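(* Let $R$ be a ring and let ${}_RC$ be a finitely presented left $R$-module, with local dual $C^+$. The following statements are equivalent. (1) $C$ is endofinite. (2) $C$ is $\Sigma$-pure-injective, and $C^+$ is $C$-Mittag-Leffler. (3) $C$ is $\Sigma$-pure-injective, and all cyclic $\mathrm{End}_R(C^+)$-submodules of $C^+$ are finite matrix subgroups of $C^+$.
   Context: For a left $R$-module $C$ let $S$ be its endomorphism ring acting on the right, so that $C$ is an $R$-$S$-bimodule; the local dual of $C$ is the right $R$-module $C^+=\mathrm{Hom}_S(C,V)$, where $V$ is an injective cogenerator of $\mathrm{Mod}\text{-}S$. A module is endofinite if it has finite length as a module over its endomorphism ring. A module is $\Sigma$-pure-injective if every direct sum of copies of it is pure-injective. A right $R$-module $M$ is $C$-Mittag-Leffler if for every set $I$ the canonical map $M\otimes_RC^I\to(M\otimes_RC)^I$ is injective. A finite matrix subgroup of a right $R$-module $B$ is a subgroup of the form $\{f(a)\mid f\in\mathrm{Hom}_R(A,B)\}$ with $A$ a finitely presented right $R$-module and $a\in A$. *)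

theory Defs
  imports "HOL-Algebra.Free_Abelian_Groups" "HOL-Algebra.Generated_Groups" "HOL-Algebra.Module"
begin

text \<open>
  Modules over a not necessarily commutative ring. The library locale \<open>module\<close> requires a
  commutative ring, but its record type and the locale \<open>submodule\<close> do not, so these are reused.
  The record components \<open>mult\<close> and \<open>one\<close> of a module are irrelevant.
\<close>

locale left_module = ring R + M?: abelian_group M
  for R :: "('r, 'd) ring_scheme" (structure) and M :: "('r, 'm) module" (structure) +
  assumes lsmult_closed: "\<lbrakk>r \<in> carrier R; x \<in> carrier M\<rbrakk> \<Longrightarrow> r \<odot>\<^bsub>M\<^esub> x \<in> carrier M"
    and lsmult_l_distr: "\<lbrakk>r \<in> carrier R; s \<in> carrier R; x \<in> carrier M\<rbrakk> \<Longrightarrow>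
      (r \<oplus>\<^bsub>R\<^esub> s) \<odot>\<^bsub>M\<^esub> x = r \<odot>\<^bsub>M\<^esub> x \<oplus>\<^bsub>M\<^esub> s \<odot>\<^bsub>M\<^esub> x"
    and lsmult_r_distr: "\<lbrakk>r \<in> carrier R; x \<in> carrier M; y \<in> carrier M\<rbrakk> \<Longrightarrow>
      r \<odot>\<^bsub>M\<^esub> (x \<oplus>\<^bsub>M\<^esub> y) = r \<odot>\<^bsub>M\<^esub> x \<oplus>\<^bsub>M\<^esub> r \<odot>\<^bsub>M\<^esub> y"
    and lsmult_assoc: "\<lbrakk>r \<in> carrier R; s \<in> carrier R; x \<in> carrier M\<rbrakk> \<Longrightarrow>
      (r \<otimes>\<^bsub>R\<^esub> s) \<odot>\<^bsub>M\<^esub> x = r \<odot>\<^bsub>M\<^esub> (s \<odot>\<^bsub>M\<^esub> x)"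
    and lsmult_one: "x \<in> carrier M \<Longrightarrow> \<one>\<^bsub>R\<^esub> \<odot>\<^bsub>M\<^esub> x = x"

definition opp :: "('r, 'd) ring_scheme \<Rightarrow> ('r, 'd) ring_scheme" where
  "opp R = R\<lparr>mult := \<lambda>x y. y \<otimes>\<^bsub>R\<^esub> x\<rparr>"

text \<open>
  Right \<open>R\<close>-modules are left modules over the opposite ring: in a right module,
  \<open>r \<odot>\<^bsub>M\<^esub> x\<close> is the element written \<open>x r\<close> in the literature. A notion defined below for
  left modules is applied to right modules by replacing \<open>R\<close> by \<open>opp R\<close>.
\<close>

abbreviation right_module :: "('r, 'd) ring_scheme \<Rightarrow> ('r, 'm) module \<Rightarrow> bool" where
  "right_module R M \<equiv> left_module (opp R) M"

text \<open>Homomorphisms are extensional, so that equality of homomorphisms is equality in HOL.\<close>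

definition mod_hom ::
  "('r, 'd) ring_scheme \<Rightarrow> ('r, 'm) module \<Rightarrow> ('r, 'n) module \<Rightarrow> ('m \<Rightarrow> 'n) set" where
  "mod_hom R M N = {f \<in> carrier M \<rightarrow>\<^sub>E carrier N.
     (\<forall>x\<in>carrier M. \<forall>y\<in>carrier M. f (x \<oplus>\<^bsub>M\<^esub> y) = f x \<oplus>\<^bsub>N\<^esub> f y) \<and>
     (\<forall>r\<in>carrier R. \<forall>x\<in>carrier M. f (r \<odot>\<^bsub>M\<^esub> x) = r \<odot>\<^bsub>N\<^esub> f x)}"

definition mod_span :: "('r, 'd) ring_scheme \<Rightarrow> ('r, 'm) module \<Rightarrow> 'm set \<Rightarrow> 'm set" where
  "mod_span R M X = \<Inter>{N. submodule N R M \<and> X \<subseteq> N}"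

definition cyclic_submodule :: "('r, 'd) ring_scheme \<Rightarrow> ('r, 'm) module \<Rightarrow> 'm set \<Rightarrow> bool" where
  "cyclic_submodule R M N \<longleftrightarrow> (\<exists>x\<in>carrier M. N = mod_span R M {x})"

definition product_module :: "'i set \<Rightarrow> ('i \<Rightarrow> ('r, 'm) module) \<Rightarrow> ('r, 'i \<Rightarrow> 'm) module" where
  "product_module I M = \<lparr>carrier = (\<Pi>\<^sub>E i\<in>I. carrier (M i)), mult = undefined, one = undefined,
     zero = (\<lambda>i\<in>I. \<zero>\<^bsub>M i\<^esub>), add = (\<lambda>x y. \<lambda>i\<in>I. x i \<oplus>\<^bsub>M i\<^esub> y i),
     smult = (\<lambda>r x. \<lambda>i\<in>I. r \<odot>\<^bsub>M i\<^esub> x i)\<rparr>"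

definition direct_sum_module :: "'i set \<Rightarrow> ('i \<Rightarrow> ('r, 'm) module) \<Rightarrow> ('r, 'i \<Rightarrow> 'm) module" where
  "direct_sum_module I M = (product_module I M)
     \<lparr>carrier := {x \<in> (\<Pi>\<^sub>E i\<in>I. carrier (M i)). finite {i \<in> I. x i \<noteq> \<zero>\<^bsub>M i\<^esub>}}\<rparr>"

definition regular_module :: "('r, 'd) ring_scheme \<Rightarrow> ('r, 'r) module" where
  "regular_module R = \<lparr>carrier = carrier R, mult = undefined, one = undefined,
     zero = \<zero>\<^bsub>R\<^esub>, add = add R, smult = mult R\<rparr>"

text \<open>\<open>M\<close> is the image of some \<open>R\<^sup>n\<close> under a homomorphism with finitely generated kernel.\<close>

definition finitely_presented :: "('r, 'd) ring_scheme \<Rightarrow> ('r, 'm) module \<Rightarrow> bool" where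
  "finitely_presented R M \<longleftrightarrow>
     (\<exists>n::nat. let F = product_module {..<n} (\<lambda>_. regular_module R) in
        \<exists>p\<in>mod_hom R F M. p ` carrier F = carrier M \<and>
          (\<exists>X. finite X \<and> X \<subseteq> carrier F \<and> mod_span R F X = {x \<in> carrier F. p x = \<zero>\<^bsub>M\<^esub>}))"

text \<open>Existence of a composition series.\<close>

definition finite_length :: "('r, 'd) ring_scheme \<Rightarrow> ('r, 'm) module \<Rightarrow> bool" where
  "finite_length R M \<longleftrightarrow>
     (\<exists>(n::nat) N. N 0 = {\<zero>\<^bsub>M\<^esub>} \<and> N n = carrier M \<and> (\<forall>k\<le>n. submodule (N k) R M) \<and>
        (\<forall>k<n. N k \<subset> N (Suc k) \<and> \<not> (\<exists>L. submodule L R M \<and> N k \<subset> L \<and> L \<subset> N (Suc k))))"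

text \<open>
  The endomorphism ring with composition \<open>(f g) x = f (g x)\<close> as multiplication, and \<open>M\<close> as a left
  module over it.
\<close>

definition End_ring :: "('r, 'd) ring_scheme \<Rightarrow> ('r, 'm) module \<Rightarrow> ('m \<Rightarrow> 'm) ring" where
  "End_ring R M = \<lparr>carrier = mod_hom R M M, mult = compose (carrier M), one = (\<lambda>x\<in>carrier M. x),
     zero = (\<lambda>x\<in>carrier M. \<zero>\<^bsub>M\<^esub>), add = (\<lambda>f g. \<lambda>x\<in>carrier M. f x \<oplus>\<^bsub>M\<^esub> g x)\<rparr>"

definition End_module :: "('r, 'm) module \<Rightarrow> ('m \<Rightarrow> 'm, 'm) module" where
  "End_module M = \<lparr>carrier = carrier M, mult = undefined, one = undefined,
     zero = \<zero>\<^bsub>M\<^esub>, add = add M, smult = (\<lambda>f x. f x)\<rparr>"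

definition endofinite :: "('r, 'd) ring_scheme \<Rightarrow> ('r, 'm) module \<Rightarrow> bool" where
  "endofinite R M \<longleftrightarrow> finite_length (End_ring R M) (End_module M)"

text \<open>
  The endomorphism ring acting on the right, i.e. \<open>c (f g) = (c f) g\<close>. With this multiplication
  \<open>End_module C\<close> is a right module over \<open>right_End R C\<close>.
\<close>

definition right_End :: "('r, 'd) ring_scheme \<Rightarrow> ('r, 'c) module \<Rightarrow> ('c \<Rightarrow> 'c) ring" where
  "right_End R C = opp (End_ring R C)"

text \<open>
  The right \<open>R\<close>-module \<open>Hom\<^sub>S(C, V)\<close>, where \<open>S = right_End R C\<close> and \<open>V\<close> is a right \<open>S\<close>-module; the
  action is \<open>(f r) c = f (r c)\<close>.
\<close>

definition local_dual ::
  "('r, 'd) ring_scheme \<Rightarrow> ('r, 'c) module \<Rightarrow> ('c \<Rightarrow> 'c, 'v) module \<Rightarrow> ('r, 'c \<Rightarrow> 'v) module" where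
  "local_dual R C V =
     \<lparr>carrier = mod_hom (opp (right_End R C)) (End_module C) V, mult = undefined, one = undefined,
      zero = (\<lambda>c\<in>carrier C. \<zero>\<^bsub>V\<^esub>), add = (\<lambda>f g. \<lambda>c\<in>carrier C. f c \<oplus>\<^bsub>V\<^esub> g c),
      smult = (\<lambda>r f. \<lambda>c\<in>carrier C. f (r \<odot>\<^bsub>C\<^esub> c))\<rparr>"

text \<open>Tensor product of a right module \<open>M\<close> and a left module \<open>N\<close>.\<close>

definition tensor_relations ::
  "('r, 'd) ring_scheme \<Rightarrow> ('r, 'm) module \<Rightarrow> ('r, 'n) module \<Rightarrow> ('m \<times> 'n \<Rightarrow>\<^sub>0 int) set" where
  "tensor_relations R M N = generate (free_Abelian_group (carrier M \<times> carrier N))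
     ({frag_of (x \<oplus>\<^bsub>M\<^esub> x', y) - frag_of (x, y) - frag_of (x', y) | x x' y.
         x \<in> carrier M \<and> x' \<in> carrier M \<and> y \<in> carrier N} \<union>
      {frag_of (x, y \<oplus>\<^bsub>N\<^esub> y') - frag_of (x, y) - frag_of (x, y') | x y y'.
         x \<in> carrier M \<and> y \<in> carrier N \<and> y' \<in> carrier N} \<union>
      {frag_of (r \<odot>\<^bsub>M\<^esub> x, y) - frag_of (x, r \<odot>\<^bsub>N\<^esub> y) | r x y.
         r \<in> carrier R \<and> x \<in> carrier M \<and> y \<in> carrier N})"

definition tensor_product ::
  "('r, 'd) ring_scheme \<Rightarrow> ('r, 'm) module \<Rightarrow> ('r, 'n) module \<Rightarrow> ('m \<times> 'n \<Rightarrow>\<^sub>0 int) set monoid" where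
  "tensor_product R M N =
     free_Abelian_group (carrier M \<times> carrier N) Mod tensor_relations R M N"

definition tensor_class ::
  "('r, 'd) ring_scheme \<Rightarrow> ('r, 'm) module \<Rightarrow> ('r, 'n) module \<Rightarrow>
   ('m \<times> 'n \<Rightarrow>\<^sub>0 int) \<Rightarrow> ('m \<times> 'n \<Rightarrow>\<^sub>0 int) set" where
  "tensor_class R M N z =
     tensor_relations R M N #>\<^bsub>free_Abelian_group (carrier M \<times> carrier N)\<^esub> z"

text \<open>
  For a homomorphism \<open>f : N \<rightarrow> N'\<close>, the map \<open>M \<otimes> f : M \<otimes> N \<rightarrow> M \<otimes> N'\<close> determined by
  \<open>x \<otimes> y \<mapsto> x \<otimes> f y\<close>. All representatives of a coset \<open>Z\<close> have the same image.
\<close>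

definition tensor_map ::
  "('r, 'd) ring_scheme \<Rightarrow> ('r, 'm) module \<Rightarrow> ('r, 'p) module \<Rightarrow> ('n \<Rightarrow> 'p) \<Rightarrow>
   ('m \<times> 'n \<Rightarrow>\<^sub>0 int) set \<Rightarrow> ('m \<times> 'p \<Rightarrow>\<^sub>0 int) set" where
  "tensor_map R M N' f Z =
     the_elem ((\<lambda>z. tensor_class R M N' (frag_extend (\<lambda>(x, y). frag_of (x, f y)) z)) ` Z)"

text \<open>
  The canonical map \<open>M \<otimes> C\<^sup>I \<rightarrow> (M \<otimes> C)\<^sup>I\<close>; its \<open>i\<close>-th component is induced by the \<open>i\<close>-th projection.
\<close>

definition tensor_power_map ::
  "('r, 'd) ring_scheme \<Rightarrow> ('r, 'm) module \<Rightarrow> ('r, 'c) module \<Rightarrow> 'i set \<Rightarrow>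
   ('m \<times> ('i \<Rightarrow> 'c) \<Rightarrow>\<^sub>0 int) set \<Rightarrow> 'i \<Rightarrow> ('m \<times> 'c \<Rightarrow>\<^sub>0 int) set" where
  "tensor_power_map R M C I Z = (\<lambda>i\<in>I. tensor_map R M C (\<lambda>x. x i) Z)"

text \<open>
  The remaining notions quantify over all sets or over all modules. HOL cannot quantify over types
  inside a formula, so they take a type \<open>'u\<close> as a parameter, which plays the role of a universe:
  test modules have carriers in \<open>'u\<close> and index sets are sets over \<open>'u\<close>.
  Once \<open>'u\<close> is large enough relative to the given data, the notions no longer depend on \<open>'u\<close>:
  \<^item> injectivity is tested on right ideals of \<open>S\<close> (Baer), the cogenerator property on simple modules;
  \<^item> purity and finite matrix subgroups only involve finitely presented modules;
  \<^item> for the Mittag-Leffler condition it suffices to consider as \<open>I\<close> the sets of tuples \<open>c \<in> C\<^sup>n\<close>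
    with \<open>\<Sum>\<^sub>k m\<^sub>k \<otimes> c\<^sub>k = 0\<close>, where \<open>m \<in> M\<^sup>n\<close>;
  \<^item> \<open>\<Sigma>\<close>-pure-injectivity of \<open>C\<close> follows from a splitting of \<open>C\<^sup>(\<^sup>\<nat>\<^sup>) \<subseteq> C\<^sup>\<nat>\<close>.
\<close>

definition large_universe ::
  "'u itself \<Rightarrow> ('r, 'd) ring_scheme \<Rightarrow> ('r, 'c) module \<Rightarrow> bool" where
  "large_universe U R C \<longleftrightarrow>
     infinite (UNIV :: 'u set) \<and>
     carrier R \<lesssim> (UNIV :: 'u set) \<and>
     carrier (End_ring R C) \<lesssim> (UNIV :: 'u set) \<and>
     ((UNIV :: nat set) \<rightarrow>\<^sub>E carrier C) \<lesssim> (UNIV :: 'u set)"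

text \<open>Such types exist for all data, so \<open>large_universe\<close> imposes no restriction on \<open>R\<close> and \<open>C\<close>.\<close>

lemma large_universe_exists:
  "large_universe TYPE(nat + 'r + ('c \<Rightarrow> 'c) + (nat \<Rightarrow> 'c)) R (C :: ('r, 'c) module)"
proof -
  have le: "A \<lesssim> (UNIV :: 'y set)" if "inj f" for A :: "'x set" and f :: "'x \<Rightarrow> 'y"
    unfolding lepoll_def by (rule exI[of _ f]) (simp add: inj_on_subset[OF that])
  have "inj (\<lambda>x. Inr (Inl x) :: nat + 'r + ('c \<Rightarrow> 'c) + (nat \<Rightarrow> 'c))"
    "inj (\<lambda>x. Inr (Inr (Inl x)) :: nat + 'r + ('c \<Rightarrow> 'c) + (nat \<Rightarrow> 'c))"
    "inj (\<lambda>x. Inr (Inr (Inr x)) :: nat + 'r + ('c \<Rightarrow> 'c) + (nat \<Rightarrow> 'c))"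
    by (auto intro!: injI)
  note this[THEN le]
  then show ?thesis
    unfolding large_universe_def by (intro conjI) simp_all
qed

definition injective_module ::
  "'u itself \<Rightarrow> ('r, 'd) ring_scheme \<Rightarrow> ('r, 'm) module \<Rightarrow> bool" where
  "injective_module U R V \<longleftrightarrow>
     (\<forall>(A :: ('r, 'u) module) (B :: ('r, 'u) module). \<forall>i\<in>mod_hom R A B. \<forall>g\<in>mod_hom R A V.
        left_module R A \<and> left_module R B \<and> inj_on i (carrier A) \<longrightarrow>
        (\<exists>h\<in>mod_hom R B V. \<forall>a\<in>carrier A. h (i a) = g a))"

definition cogenerator ::
  "'u itself \<Rightarrow> ('r, 'd) ring_scheme \<Rightarrow> ('r, 'm) module \<Rightarrow> bool" where
  "cogenerator U R V \<longleftrightarrow>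
     (\<forall>(A :: ('r, 'u) module) (B :: ('r, 'u) module). \<forall>f\<in>mod_hom R A B. \<forall>g\<in>mod_hom R A B.
        left_module R A \<and> left_module R B \<and> f \<noteq> g \<longrightarrow>
        (\<exists>h\<in>mod_hom R B V. \<exists>a\<in>carrier A. h (f a) \<noteq> h (g a)))"

definition pure_mono ::
  "'u itself \<Rightarrow> ('r, 'd) ring_scheme \<Rightarrow> ('r, 'm) module \<Rightarrow> ('r, 'n) module \<Rightarrow> ('m \<Rightarrow> 'n) \<Rightarrow> bool" where
  "pure_mono U R A B i \<longleftrightarrow>
     i \<in> mod_hom R A B \<and> inj_on i (carrier A) \<and>
     (\<forall>X :: ('r, 'u) module. right_module R X \<longrightarrow>
        inj_on (tensor_map R X B i) (carrier (tensor_product R X A)))"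

definition pure_injective ::
  "'u itself \<Rightarrow> ('r, 'd) ring_scheme \<Rightarrow> ('r, 'm) module \<Rightarrow> bool" where
  "pure_injective U R M \<longleftrightarrow>
     (\<forall>(A :: ('r, 'u) module) (B :: ('r, 'u) module) i. \<forall>g\<in>mod_hom R A M.
        left_module R A \<and> left_module R B \<and> pure_mono U R A B i \<longrightarrow>
        (\<exists>h\<in>mod_hom R B M. \<forall>a\<in>carrier A. h (i a) = g a))"

definition sigma_pure_injective ::
  "'u itself \<Rightarrow> ('r, 'd) ring_scheme \<Rightarrow> ('r, 'm) module \<Rightarrow> bool" where
  "sigma_pure_injective U R M \<longleftrightarrow>
     (\<forall>I :: 'u set. pure_injective U R (direct_sum_module I (\<lambda>_. M)))"

text \<open>The right \<open>R\<close>-module \<open>M\<close> is \<open>C\<close>-Mittag-Leffler.\<close>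

definition mittag_leffler ::
  "'u itself \<Rightarrow> ('r, 'd) ring_scheme \<Rightarrow> ('r, 'c) module \<Rightarrow> ('r, 'm) module \<Rightarrow> bool" where
  "mittag_leffler U R C M \<longleftrightarrow>
     (\<forall>I :: 'u set. inj_on (tensor_power_map R M C I)
        (carrier (tensor_product R M (product_module I (\<lambda>_. C)))))"

text \<open>\<open>G\<close> is a finite matrix subgroup of the right \<open>R\<close>-module \<open>B\<close>.\<close>

definition finite_matrix_subgroup ::
  "'u itself \<Rightarrow> ('r, 'd) ring_scheme \<Rightarrow> ('r, 'b) module \<Rightarrow> 'b set \<Rightarrow> bool" where
  "finite_matrix_subgroup U R B G \<longleftrightarrow>
     (\<exists>A :: ('r, 'u) module. right_module R A \<and> finitely_presented (opp R) A \<and>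
        (\<exists>a\<in>carrier A. G = {f a | f. f \<in> mod_hom (opp R) A B}))"

end

theory Submission
  imports Defs
begin

text \<open>
  Call a subgroup of \<open>C\<close> stable if all homomorphisms \<open>C\<^sup>I \<rightarrow> C\<close> preserve it. If \<open>C\<close> is
  \<open>\<Sigma>\<close>-pure-injective, then the inclusion \<open>C\<^sup>(\<^sup>\<nat>\<^sup>) \<subseteq> C\<^sup>\<nat>\<close> splits, and this yields the descending chain
  condition on stable \<open>S\<close>-submodules of \<open>C\<close>. Since \<open>C\<close> is finitely presented, the evaluation map
  \<open>C\<^sup>+ \<otimes> C \<rightarrow> V\<close> is injective. Therefore the kernel of every \<open>f \<in> C\<^sup>+\<close> is stable if \<open>C\<^sup>+\<close> is
  \<open>C\<close>-Mittag-Leffler. It is also stable if \<open>End(C\<^sup>+) f\<close> is a finite matrix subgroup, because it is then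
  defined by linear equations in \<open>C\<close>. As \<open>V\<close> cogenerates, every \<open>S\<close>-submodule of \<open>C\<close> is an intersection
  of such kernels, so \<open>C\<close> is artinian over \<open>S\<close>. A finite generating set of \<open>C\<close> over \<open>R\<close> has zero annihilator
  in \<open>S\<close>, and a theorem of Hopkins and Levitzki shows that \<open>C\<close> has finite length.

  Conversely, let \<open>C\<close> be endofinite. The descending chain condition on \<open>S\<close>-submodules makes finitely
  solvable systems of linear equations over \<open>C\<^sup>(\<^sup>I\<^sup>)\<close> solvable, which gives \<open>\<Sigma>\<close>-pure-injectivity. The ascending
  chain condition on \<open>S\<close>-submodules of \<open>C\<^sup>n\<close> shows that all right modules are \<open>C\<close>-Mittag-Leffler. Finally,
  \<open>End(C\<^sup>+) f\<close> consists of the \<open>g \<in> C\<^sup>+\<close> that vanish on the finitely generated \<open>S\<close>-module \<open>Ker f\<close>.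
\<close>

section \<open>Modules over noncommutative rings\<close>

text \<open>Conditions (2) and (3) speak about one f in C+ at a time, while the chain condition
  concerns all S-submodules of C. Stability bridges this gap because, unlike being a finite matrix
  subgroup, it passes to arbitrary intersections. The evaluation map is injective because, for
  finitely presented C and injective V, the group C+ \<otimes> C is Hom_S(Hom_R(C, C), V) = Hom_S(S,
  V) = V. Only elementary tensors are needed, and for them this becomes a calculation with
  generators and relations of C. S itself is not known to be artinian. It inherits the descending
  chain condition from C, because a finite family with zero annihilator embeds it into C^n. A
  recurring obstacle is that injectivity, purity and the cogenerator property are tested only by
  modules whose carriers are sets over \<open>'u\<close>. Test modules are therefore made as
  quotients of modules that embed into \<open>'u\<close>. V need not embed there, so endomorphisms
  of V have to be extended one element at a time, with tests on left ideals of S only.\<close>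

lemma left_moduleI:
  fixes R (structure) and M (structure)
  assumes "ring R"
    and add_closed: "\<And>x y. \<lbrakk>x \<in> carrier M; y \<in> carrier M\<rbrakk> \<Longrightarrow> x \<oplus>\<^bsub>M\<^esub> y \<in> carrier M"
    and zero_closed: "\<zero>\<^bsub>M\<^esub> \<in> carrier M"
    and add_assoc: "\<And>x y z. \<lbrakk>x \<in> carrier M; y \<in> carrier M; z \<in> carrier M\<rbrakk> \<Longrightarrow>
      (x \<oplus>\<^bsub>M\<^esub> y) \<oplus>\<^bsub>M\<^esub> z = x \<oplus>\<^bsub>M\<^esub> (y \<oplus>\<^bsub>M\<^esub> z)"
    and add_comm: "\<And>x y. \<lbrakk>x \<in> carrier M; y \<in> carrier M\<rbrakk> \<Longrightarrow> x \<oplus>\<^bsub>M\<^esub> y = y \<oplus>\<^bsub>M\<^esub> x"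
    and zero_add: "\<And>x. x \<in> carrier M \<Longrightarrow> \<zero>\<^bsub>M\<^esub> \<oplus>\<^bsub>M\<^esub> x = x"
    and smult_closed: "\<And>r x. \<lbrakk>r \<in> carrier R; x \<in> carrier M\<rbrakk> \<Longrightarrow> r \<odot>\<^bsub>M\<^esub> x \<in> carrier M"
    and smult_zero: "\<And>x. x \<in> carrier M \<Longrightarrow> \<zero>\<^bsub>R\<^esub> \<odot>\<^bsub>M\<^esub> x = \<zero>\<^bsub>M\<^esub>"
    and l_distr: "\<And>r s x. \<lbrakk>r \<in> carrier R; s \<in> carrier R; x \<in> carrier M\<rbrakk> \<Longrightarrow>
      (r \<oplus>\<^bsub>R\<^esub> s) \<odot>\<^bsub>M\<^esub> x = r \<odot>\<^bsub>M\<^esub> x \<oplus>\<^bsub>M\<^esub> s \<odot>\<^bsub>M\<^esub> x"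
    and r_distr: "\<And>r x y. \<lbrakk>r \<in> carrier R; x \<in> carrier M; y \<in> carrier M\<rbrakk> \<Longrightarrow>
      r \<odot>\<^bsub>M\<^esub> (x \<oplus>\<^bsub>M\<^esub> y) = r \<odot>\<^bsub>M\<^esub> x \<oplus>\<^bsub>M\<^esub> r \<odot>\<^bsub>M\<^esub> y"
    and assoc: "\<And>r s x. \<lbrakk>r \<in> carrier R; s \<in> carrier R; x \<in> carrier M\<rbrakk> \<Longrightarrow>
      (r \<otimes>\<^bsub>R\<^esub> s) \<odot>\<^bsub>M\<^esub> x = r \<odot>\<^bsub>M\<^esub> (s \<odot>\<^bsub>M\<^esub> x)"
    and one: "\<And>x. x \<in> carrier M \<Longrightarrow> \<one>\<^bsub>R\<^esub> \<odot>\<^bsub>M\<^esub> x = x"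
  shows "left_module R M"
proof -
  interpret R: ring R by fact
  have "abelian_group M"
  proof (rule abelian_groupI)
    \<comment> \<open>The negative of x is (-1) x. To this end the premises contain 0 x = 0 in place
      of the existence of negatives.\<close>
    fix x assume x: "x \<in> carrier M"
    have "(\<ominus>\<^bsub>R\<^esub> \<one>\<^bsub>R\<^esub>) \<odot>\<^bsub>M\<^esub> x \<oplus>\<^bsub>M\<^esub> x = (\<ominus>\<^bsub>R\<^esub> \<one>\<^bsub>R\<^esub> \<oplus>\<^bsub>R\<^esub> \<one>\<^bsub>R\<^esub>) \<odot>\<^bsub>M\<^esub> x"
      using x by (simp add: l_distr one)
    also have "\<dots> = \<zero>\<^bsub>M\<^esub>"
      using x by (simp add: R.l_neg smult_zero)
    finally show "\<exists>y\<in>carrier M. y \<oplus>\<^bsub>M\<^esub> x = \<zero>\<^bsub>M\<^esub>"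
      using x smult_closed by blast
  qed (use assms in auto)
  then show ?thesis
    using assms by (intro left_module.intro left_module_axioms.intro) auto
qed

definition submodule_sum :: "('r, 'm) module \<Rightarrow> 'm set \<Rightarrow> 'm set \<Rightarrow> 'm set" where
  "submodule_sum M A B = {a \<oplus>\<^bsub>M\<^esub> b | a b. a \<in> A \<and> b \<in> B}"

lemma mod_homI:
  assumes "f \<in> carrier M \<rightarrow>\<^sub>E carrier N"
    and "\<And>x y. \<lbrakk>x \<in> carrier M; y \<in> carrier M\<rbrakk> \<Longrightarrow> f (x \<oplus>\<^bsub>M\<^esub> y) = f x \<oplus>\<^bsub>N\<^esub> f y"
    and "\<And>r x. \<lbrakk>r \<in> carrier R; x \<in> carrier M\<rbrakk> \<Longrightarrow> f (r \<odot>\<^bsub>M\<^esub> x) = r \<odot>\<^bsub>N\<^esub> f x"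
  shows "f \<in> mod_hom R M N"
  using assms by (simp add: mod_hom_def)

lemma hom_closed: "\<lbrakk>f \<in> mod_hom R M N; x \<in> carrier M\<rbrakk> \<Longrightarrow> f x \<in> carrier N"
  by (auto simp: mod_hom_def)

lemma hom_add: "\<lbrakk>f \<in> mod_hom R M N; x \<in> carrier M; y \<in> carrier M\<rbrakk> \<Longrightarrow> f (x \<oplus>\<^bsub>M\<^esub> y) = f x \<oplus>\<^bsub>N\<^esub> f y"
  by (auto simp: mod_hom_def)

lemma hom_smult: "\<lbrakk>f \<in> mod_hom R M N; r \<in> carrier R; x \<in> carrier M\<rbrakk> \<Longrightarrow> f (r \<odot>\<^bsub>M\<^esub> x) = r \<odot>\<^bsub>N\<^esub> f x"
  by (auto simp: mod_hom_def)

lemma hom_PiE: "f \<in> mod_hom R M N \<Longrightarrow> f \<in> carrier M \<rightarrow>\<^sub>E carrier N"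
  by (auto simp: mod_hom_def)

lemma hom_eqI:
  assumes "f \<in> mod_hom R M N" "g \<in> mod_hom R M N" "\<And>x. x \<in> carrier M \<Longrightarrow> f x = g x"
  shows "f = g"
  by (rule PiE_ext[OF hom_PiE[OF assms(1)] hom_PiE[OF assms(2)]]) (fact assms(3))

context left_module
begin

lemma smult_zero_left [simp]:
  assumes "x \<in> carrier M"
  shows "\<zero>\<^bsub>R\<^esub> \<odot>\<^bsub>M\<^esub> x = \<zero>\<^bsub>M\<^esub>"
proof -
  have "\<zero>\<^bsub>R\<^esub> \<odot>\<^bsub>M\<^esub> x \<oplus>\<^bsub>M\<^esub> \<zero>\<^bsub>R\<^esub> \<odot>\<^bsub>M\<^esub> x = \<zero>\<^bsub>R\<^esub> \<odot>\<^bsub>M\<^esub> x"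
    using assms lsmult_l_distr[of "\<zero>\<^bsub>R\<^esub>" "\<zero>\<^bsub>R\<^esub>" x] by simp
  moreover have "\<zero>\<^bsub>R\<^esub> \<odot>\<^bsub>M\<^esub> x \<in> carrier M"
    using assms by (intro lsmult_closed) auto
  ultimately show ?thesis by simp
qed

lemma smult_zero_right [simp]:
  assumes "r \<in> carrier R"
  shows "r \<odot>\<^bsub>M\<^esub> \<zero>\<^bsub>M\<^esub> = \<zero>\<^bsub>M\<^esub>"
proof -
  have "r \<odot>\<^bsub>M\<^esub> \<zero>\<^bsub>M\<^esub> \<oplus>\<^bsub>M\<^esub> r \<odot>\<^bsub>M\<^esub> \<zero>\<^bsub>M\<^esub> = r \<odot>\<^bsub>M\<^esub> \<zero>\<^bsub>M\<^esub>"
    using assms lsmult_r_distr[of r "\<zero>\<^bsub>M\<^esub>" "\<zero>\<^bsub>M\<^esub>"] by simp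
  moreover have "r \<odot>\<^bsub>M\<^esub> \<zero>\<^bsub>M\<^esub> \<in> carrier M"
    using assms by (intro lsmult_closed) auto
  ultimately show ?thesis by simp
qed

lemma smult_minus_left:
  assumes "r \<in> carrier R" "x \<in> carrier M"
  shows "(\<ominus>\<^bsub>R\<^esub> r) \<odot>\<^bsub>M\<^esub> x = \<ominus>\<^bsub>M\<^esub> (r \<odot>\<^bsub>M\<^esub> x)"
proof (rule M.minus_equality[symmetric])
  show "(\<ominus>\<^bsub>R\<^esub> r) \<odot>\<^bsub>M\<^esub> x \<oplus>\<^bsub>M\<^esub> r \<odot>\<^bsub>M\<^esub> x = \<zero>\<^bsub>M\<^esub>"
    using assms by (simp flip: lsmult_l_distr add: abelian_group.l_neg[OF ring.axioms(1)[OF ring_axioms]])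
qed (use assms in \<open>auto intro: lsmult_closed\<close>)

lemma smult_minus_right:
  assumes "r \<in> carrier R" "x \<in> carrier M"
  shows "r \<odot>\<^bsub>M\<^esub> (\<ominus>\<^bsub>M\<^esub> x) = \<ominus>\<^bsub>M\<^esub> (r \<odot>\<^bsub>M\<^esub> x)"
proof (rule M.minus_equality[symmetric])
  show "r \<odot>\<^bsub>M\<^esub> (\<ominus>\<^bsub>M\<^esub> x) \<oplus>\<^bsub>M\<^esub> r \<odot>\<^bsub>M\<^esub> x = \<zero>\<^bsub>M\<^esub>"
    using assms by (simp flip: lsmult_r_distr add: M.l_neg)
qed (use assms in \<open>auto intro: lsmult_closed\<close>)

lemma minus_one_smult: "x \<in> carrier M \<Longrightarrow> (\<ominus>\<^bsub>R\<^esub> \<one>\<^bsub>R\<^esub>) \<odot>\<^bsub>M\<^esub> x = \<ominus>\<^bsub>M\<^esub> x"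
  by (simp add: smult_minus_left lsmult_one)

lemma minus_eq_zero_iff [simp]:
  assumes "x \<in> carrier M" "y \<in> carrier M"
  shows "x \<ominus>\<^bsub>M\<^esub> y = \<zero>\<^bsub>M\<^esub> \<longleftrightarrow> x = y"
proof
  assume "x \<ominus>\<^bsub>M\<^esub> y = \<zero>\<^bsub>M\<^esub>"
  then have "\<ominus>\<^bsub>M\<^esub> (\<ominus>\<^bsub>M\<^esub> y) = x"
    using assms by (intro M.minus_equality) (auto simp: a_minus_def)
  then show "x = y" using assms by simp
qed (use assms in \<open>simp add: a_minus_def M.r_neg\<close>)

lemma minus_self [simp]: "x \<in> carrier M \<Longrightarrow> x \<ominus>\<^bsub>M\<^esub> x = \<zero>\<^bsub>M\<^esub>"
  by simp

lemma minus_add_minus: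
  assumes "x \<in> carrier M" "y \<in> carrier M" "z \<in> carrier M"
  shows "(x \<ominus>\<^bsub>M\<^esub> y) \<oplus>\<^bsub>M\<^esub> (y \<ominus>\<^bsub>M\<^esub> z) = x \<ominus>\<^bsub>M\<^esub> z"
  using assms by (simp add: a_minus_def M.a_assoc M.r_neg1)

lemma a_inv_minus:
  assumes "x \<in> carrier M" "y \<in> carrier M"
  shows "\<ominus>\<^bsub>M\<^esub> (x \<ominus>\<^bsub>M\<^esub> y) = y \<ominus>\<^bsub>M\<^esub> x"
  using assms by (simp add: a_minus_def M.minus_add M.a_comm)

lemma add_minus_cancel:
  assumes "x \<in> carrier M" "y \<in> carrier M"
  shows "(x \<oplus>\<^bsub>M\<^esub> y) \<ominus>\<^bsub>M\<^esub> y = x" "(x \<oplus>\<^bsub>M\<^esub> y) \<ominus>\<^bsub>M\<^esub> x = y"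
    "(x \<ominus>\<^bsub>M\<^esub> y) \<oplus>\<^bsub>M\<^esub> y = x"
proof -
  have *: "(x \<oplus>\<^bsub>M\<^esub> y) \<ominus>\<^bsub>M\<^esub> y = x" if "x \<in> carrier M" "y \<in> carrier M" for x y
    using that by (simp add: a_minus_def M.a_assoc M.r_neg)
  then show "(x \<oplus>\<^bsub>M\<^esub> y) \<ominus>\<^bsub>M\<^esub> y = x" using assms by blast
  show "(x \<oplus>\<^bsub>M\<^esub> y) \<ominus>\<^bsub>M\<^esub> x = y"
    using assms *[of y x] by (simp add: M.a_comm)
qed (use assms in \<open>simp_all add: a_minus_def M.a_assoc M.l_neg\<close>)

lemma submoduleI:
  assumes "N \<subseteq> carrier M" "\<zero>\<^bsub>M\<^esub> \<in> N" "\<And>x y. \<lbrakk>x \<in> N; y \<in> N\<rbrakk> \<Longrightarrow> x \<oplus>\<^bsub>M\<^esub> y \<in> N"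
    "\<And>r x. \<lbrakk>r \<in> carrier R; x \<in> N\<rbrakk> \<Longrightarrow> r \<odot>\<^bsub>M\<^esub> x \<in> N"
  shows "submodule N R M"
proof -
  have "\<ominus>\<^bsub>M\<^esub> x \<in> N" if "x \<in> N" for x
    using that assms(4)[of "\<ominus>\<^bsub>R\<^esub> \<one>\<^bsub>R\<^esub>" x] assms(1) minus_one_smult by auto
  then have "subgroup N (add_monoid M)"
    using assms(1-3) by (intro M.add.subgroupI) (auto simp: a_inv_def)
  then show ?thesis
    using assms(4) by (simp add: submodule_def submodule_axioms_def)
qed

lemma submodule_carrier: "submodule (carrier M) R M"
  by (rule submoduleI) (auto intro: lsmult_closed)

lemma submodule_zero: "submodule {\<zero>\<^bsub>M\<^esub>} R M"
  by (rule submoduleI) auto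

end

lemma submodule_subset: "submodule N R M \<Longrightarrow> N \<subseteq> carrier M"
  using subgroup.subset[of N "add_monoid M"] by (auto simp: submodule_def)

lemma submodule_in_carrier: "\<lbrakk>submodule N R M; x \<in> N\<rbrakk> \<Longrightarrow> x \<in> carrier M"
  using submodule_subset by blast

lemma submodule_zero_closed: "submodule N R M \<Longrightarrow> \<zero>\<^bsub>M\<^esub> \<in> N"
  using subgroup.one_closed[of N "add_monoid M"] by (auto simp: submodule_def)

lemma submodule_add_closed: "\<lbrakk>submodule N R M; x \<in> N; y \<in> N\<rbrakk> \<Longrightarrow> x \<oplus>\<^bsub>M\<^esub> y \<in> N"
  using subgroup.m_closed[of N "add_monoid M"] by (auto simp: submodule_def)

lemma submodule_a_inv_closed: "\<lbrakk>submodule N R M; x \<in> N\<rbrakk> \<Longrightarrow> \<ominus>\<^bsub>M\<^esub> x \<in> N"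
  using subgroup.m_inv_closed[of N "add_monoid M"] by (auto simp: submodule_def a_inv_def)

lemma submodule_minus_closed: "\<lbrakk>submodule N R M; x \<in> N; y \<in> N\<rbrakk> \<Longrightarrow> x \<ominus>\<^bsub>M\<^esub> y \<in> N"
  by (simp add: a_minus_def submodule_add_closed submodule_a_inv_closed)

lemma submodule_smult_closed: "\<lbrakk>submodule N R M; r \<in> carrier R; x \<in> N\<rbrakk> \<Longrightarrow> r \<odot>\<^bsub>M\<^esub> x \<in> N"
  by (auto simp: submodule_def submodule_axioms_def)

lemmas submodule_closed = submodule_zero_closed submodule_add_closed submodule_a_inv_closed
  submodule_minus_closed submodule_smult_closed

context left_module
begin

lemma submodule_Inter:
  assumes "\<F> \<noteq> {}" "\<And>N. N \<in> \<F> \<Longrightarrow> submodule N R M"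
  shows "submodule (\<Inter>\<F>) R M"
  by (rule submoduleI) (use assms in \<open>auto dest: submodule_subset intro: submodule_closed\<close>)

lemma submodule_Int: "\<lbrakk>submodule A R M; submodule B R M\<rbrakk> \<Longrightarrow> submodule (A \<inter> B) R M"
  using submodule_Inter[of "{A, B}"] by auto

lemma submodule_chain_Union:
  assumes "\<F> \<noteq> {}" "\<And>N. N \<in> \<F> \<Longrightarrow> submodule N R M"
    and "\<And>A B. \<lbrakk>A \<in> \<F>; B \<in> \<F>\<rbrakk> \<Longrightarrow> A \<subseteq> B \<or> B \<subseteq> A"
  shows "submodule (\<Union>\<F>) R M"
proof (rule submoduleI)
  fix x y assume "x \<in> \<Union>\<F>" "y \<in> \<Union>\<F>"
  then obtain A B where AB: "x \<in> A" "y \<in> B" "A \<in> \<F>" "B \<in> \<F>" by auto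
  with assms(3) have "\<exists>D\<in>\<F>. x \<in> D \<and> y \<in> D" by blast
  then show "x \<oplus>\<^bsub>M\<^esub> y \<in> \<Union>\<F>"
    using assms(2) submodule_add_closed by fast
qed (use assms(1,2) in \<open>auto dest: submodule_subset intro: submodule_closed\<close>)

lemma mod_span_submodule: "X \<subseteq> carrier M \<Longrightarrow> submodule (mod_span R M X) R M"
  unfolding mod_span_def using submodule_carrier by (intro submodule_Inter) auto

lemma mod_span_incl: "X \<subseteq> mod_span R M X"
  unfolding mod_span_def by auto

lemma mod_span_least: "\<lbrakk>submodule N R M; X \<subseteq> N\<rbrakk> \<Longrightarrow> mod_span R M X \<subseteq> N"
  unfolding mod_span_def by auto

lemma submodule_left_module:
  assumes "submodule N R M"
  shows "left_module R (M\<lparr>carrier := N\<rparr>)"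
proof -
  note sub = submodule_in_carrier[OF assms]
  show ?thesis
    by (rule left_moduleI)
      (use assms sub in \<open>auto simp: ring_axioms M.a_assoc M.a_comm M.a_lcomm lsmult_l_distr lsmult_r_distr
        lsmult_assoc lsmult_one intro: submodule_closed\<close>)
qed

lemma submodule_submodule_sum:
  assumes A: "submodule A R M" and B: "submodule B R M"
  shows "submodule (submodule_sum M A B) R M"
proof -
  note sub = submodule_in_carrier[OF A] submodule_in_carrier[OF B]
  have mem: "x \<in> submodule_sum M A B \<longleftrightarrow> (\<exists>a\<in>A. \<exists>b\<in>B. x = a \<oplus>\<^bsub>M\<^esub> b)" for x
    by (auto simp: submodule_sum_def)
  show ?thesis
  proof (rule submoduleI)
    show "\<zero>\<^bsub>M\<^esub> \<in> submodule_sum M A B"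
      unfolding mem by (rule bexI[OF _ submodule_zero_closed[OF A]], rule bexI[OF _ submodule_zero_closed[OF B]]) simp
  next
    fix x y assume "x \<in> submodule_sum M A B" "y \<in> submodule_sum M A B"
    then obtain a b a' b' where *: "a \<in> A" "b \<in> B" "a' \<in> A" "b' \<in> B" "x = a \<oplus>\<^bsub>M\<^esub> b" "y = a' \<oplus>\<^bsub>M\<^esub> b'"
      unfolding mem by blast
    then have "x \<oplus>\<^bsub>M\<^esub> y = (a \<oplus>\<^bsub>M\<^esub> a') \<oplus>\<^bsub>M\<^esub> (b \<oplus>\<^bsub>M\<^esub> b')"
      using sub by (simp add: M.a_ac)
    then show "x \<oplus>\<^bsub>M\<^esub> y \<in> submodule_sum M A B"
      unfolding mem using * A B submodule_add_closed by metis
  next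
    fix r x assume r: "r \<in> carrier R" "x \<in> submodule_sum M A B"
    then obtain a b where *: "a \<in> A" "b \<in> B" "x = a \<oplus>\<^bsub>M\<^esub> b" unfolding mem by blast
    then have "r \<odot>\<^bsub>M\<^esub> x = r \<odot>\<^bsub>M\<^esub> a \<oplus>\<^bsub>M\<^esub> r \<odot>\<^bsub>M\<^esub> b"
      using sub r by (simp add: lsmult_r_distr)
    then show "r \<odot>\<^bsub>M\<^esub> x \<in> submodule_sum M A B"
      unfolding mem using * A B r submodule_smult_closed by metis
  qed (auto simp: mem sub)
qed

lemma submodule_sum_mem: "x \<in> submodule_sum M A B \<longleftrightarrow> (\<exists>a\<in>A. \<exists>b\<in>B. x = a \<oplus>\<^bsub>M\<^esub> b)"
  by (auto simp: submodule_sum_def)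

lemma submodule_sum_left:
  assumes A: "submodule A R M" and B: "submodule B R M"
  shows "A \<subseteq> submodule_sum M A B"
proof
  fix x assume "x \<in> A"
  then show "x \<in> submodule_sum M A B"
    unfolding submodule_sum_mem using submodule_in_carrier[OF A] submodule_zero_closed[OF B]
    by (metis M.r_zero)
qed

lemma submodule_sum_right:
  assumes A: "submodule A R M" and B: "submodule B R M"
  shows "B \<subseteq> submodule_sum M A B"
proof
  fix x assume "x \<in> B"
  then show "x \<in> submodule_sum M A B"
    unfolding submodule_sum_mem using submodule_in_carrier[OF B] submodule_zero_closed[OF A]
    by (metis M.l_zero)
qed

lemma submodule_sum_least: "\<lbrakk>submodule D R M; A \<subseteq> D; B \<subseteq> D\<rbrakk> \<Longrightarrow> submodule_sum M A B \<subseteq> D"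
  unfolding submodule_sum_def by (auto intro: submodule_add_closed)

end

lemma hom_zero:
  assumes "left_module R M" "left_module R N" "f \<in> mod_hom R M N"
  shows "f \<zero>\<^bsub>M\<^esub> = \<zero>\<^bsub>N\<^esub>"
proof -
  interpret M: left_module R M by fact
  interpret N: left_module R N by fact
  have "f (\<zero>\<^bsub>R\<^esub> \<odot>\<^bsub>M\<^esub> \<zero>\<^bsub>M\<^esub>) = \<zero>\<^bsub>R\<^esub> \<odot>\<^bsub>N\<^esub> f \<zero>\<^bsub>M\<^esub>"
    by (rule hom_smult[OF assms(3)]) auto
  then show ?thesis using hom_closed[OF assms(3)] by simp
qed

lemma hom_a_inv:
  assumes "left_module R M" "left_module R N" "f \<in> mod_hom R M N" "x \<in> carrier M"
  shows "f (\<ominus>\<^bsub>M\<^esub> x) = \<ominus>\<^bsub>N\<^esub> f x"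
proof -
  interpret M: left_module R M by fact
  interpret N: left_module R N by fact
  have "f ((\<ominus>\<^bsub>R\<^esub> \<one>\<^bsub>R\<^esub>) \<odot>\<^bsub>M\<^esub> x) = (\<ominus>\<^bsub>R\<^esub> \<one>\<^bsub>R\<^esub>) \<odot>\<^bsub>N\<^esub> f x"
    by (rule hom_smult[OF assms(3)]) (use assms in auto)
  then show ?thesis using hom_closed[OF assms(3,4)] assms(4) by (simp add: M.minus_one_smult N.minus_one_smult)
qed

lemma hom_minus:
  assumes "left_module R M" "left_module R N" "f \<in> mod_hom R M N" "x \<in> carrier M" "y \<in> carrier M"
  shows "f (x \<ominus>\<^bsub>M\<^esub> y) = f x \<ominus>\<^bsub>N\<^esub> f y"
proof -
  interpret M: left_module R M by fact
  show ?thesis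
    using assms by (simp add: a_minus_def hom_add hom_a_inv)
qed

lemma hom_compose:
  assumes f: "f \<in> mod_hom R M N" and g: "g \<in> mod_hom R N P" and M: "left_module R M"
  shows "(\<lambda>x\<in>carrier M. g (f x)) \<in> mod_hom R M P"
proof -
  interpret M: left_module R M by fact
  show ?thesis
    by (rule mod_homI)
      (auto simp: hom_add[OF f] hom_smult[OF f] hom_add[OF g] hom_smult[OF g] hom_closed[OF f] hom_closed[OF g] M.lsmult_closed)
qed

lemma hom_image_submodule:
  assumes M: "left_module R M" and N: "left_module R N" and f: "f \<in> mod_hom R M N"
    and A: "submodule A R M"
  shows "submodule (f ` A) R N"
proof -
  interpret M: left_module R M by fact
  interpret N: left_module R N by fact
  note sub = submodule_in_carrier[OF A]
  show ?thesis
  proof (rule N.submoduleI)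
    show "f ` A \<subseteq> carrier N" using f sub hom_closed by fast
    show "\<zero>\<^bsub>N\<^esub> \<in> f ` A" using hom_zero[OF M N f] submodule_zero_closed[OF A] by (metis imageI)
  next
    fix x y assume "x \<in> f ` A" "y \<in> f ` A"
    then obtain a b where "a \<in> A" "b \<in> A" "x = f a" "y = f b" by auto
    then show "x \<oplus>\<^bsub>N\<^esub> y \<in> f ` A"
      using hom_add[OF f sub sub] submodule_add_closed[OF A] by (metis imageI)
  next
    fix r x assume "r \<in> carrier R" "x \<in> f ` A"
    then obtain a where "a \<in> A" "r \<in> carrier R" "x = f a" by auto
    then show "r \<odot>\<^bsub>N\<^esub> x \<in> f ` A"
      using hom_smult[OF f _ sub] submodule_smult_closed[OF A] by (metis imageI)
  qed
qed

lemma hom_vimage_submodule: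
  assumes M: "left_module R M" and N: "left_module R N" and f: "f \<in> mod_hom R M N"
    and B: "submodule B R N"
  shows "submodule {x \<in> carrier M. f x \<in> B} R M"
proof -
  interpret M: left_module R M by fact
  interpret N: left_module R N by fact
  show ?thesis
    by (rule M.submoduleI)
      (use B in \<open>auto simp: hom_add[OF f] hom_smult[OF f] hom_zero[OF M N f] M.lsmult_closed intro: submodule_closed\<close>)
qed

lemma regular_left_module:
  assumes "ring R"
  shows "left_module R (regular_module R)"
proof -
  interpret ring R by fact
  show ?thesis
    by (rule left_moduleI)
      (auto simp: regular_module_def ring_axioms a_ac l_distr r_distr m_assoc)
qed

lemma opp_simps [simp]: "carrier (opp R) = carrier R" "\<zero>\<^bsub>opp R\<^esub> = \<zero>\<^bsub>R\<^esub>" "\<one>\<^bsub>opp R\<^esub> = \<one>\<^bsub>R\<^esub>"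
  "x \<oplus>\<^bsub>opp R\<^esub> y = x \<oplus>\<^bsub>R\<^esub> y" "x \<otimes>\<^bsub>opp R\<^esub> y = y \<otimes>\<^bsub>R\<^esub> x"
  by (simp_all add: opp_def)

lemma opp_opp [simp]: "opp (opp R) = R"
  by (simp add: opp_def)

lemma ring_opp:
  assumes "ring R"
  shows "ring (opp R)"
proof -
  interpret ring R by fact
  have "abelian_group (opp R)"
    by (rule abelian_groupI) (auto simp: a_ac intro: bexI[of _ "\<ominus>\<^bsub>R\<^esub> _"] l_neg)
  moreover have "monoid (opp R)"
    by unfold_locales (auto simp: m_assoc)
  ultimately show ?thesis
    by (intro ringI) (auto simp: l_distr r_distr abelian_group_def)
qed

text \<open>Source of all test modules: a quotient of a module whose carrier embeds into
  \<open>'u\<close> has a copy with elements in \<open>'u\<close>, namely the codes of chosen coset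
  representatives. With K = 0 it copies B itself.\<close>

lemma quotient_in_universe:
  fixes B :: "('r, 'b) module"
  assumes B: "left_module R B" and K: "submodule K R B" and le: "carrier B \<lesssim> (UNIV :: 'u set)"
  obtains A :: "('r, 'u) module" and p where "left_module R A" "p \<in> mod_hom R B A"
    "p ` carrier B = carrier A"
    "\<And>x y. \<lbrakk>x \<in> carrier B; y \<in> carrier B\<rbrakk> \<Longrightarrow> p x = p y \<longleftrightarrow> x \<ominus>\<^bsub>B\<^esub> y \<in> K"
proof -
  interpret B: left_module R B by fact
  obtain e :: "'b \<Rightarrow> 'u" where e: "inj_on e (carrier B)"
    using le by (auto simp: lepoll_def)
  define rep where "rep x = (SOME y. y \<in> carrier B \<and> x \<ominus>\<^bsub>B\<^esub> y \<in> K)" for x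
  have rep: "rep x \<in> carrier B \<and> x \<ominus>\<^bsub>B\<^esub> rep x \<in> K" if "x \<in> carrier B" for x
    unfolding rep_def
    by (rule someI[of _ x]) (use that K in \<open>simp add: submodule_zero_closed\<close>)
  have rep_eq: "rep x = rep y \<longleftrightarrow> x \<ominus>\<^bsub>B\<^esub> y \<in> K" if x: "x \<in> carrier B" and y: "y \<in> carrier B" for x y
  proof
    assume eq: "rep x = rep y"
    have "(x \<ominus>\<^bsub>B\<^esub> rep x) \<oplus>\<^bsub>B\<^esub> \<ominus>\<^bsub>B\<^esub> (y \<ominus>\<^bsub>B\<^esub> rep y) = x \<ominus>\<^bsub>B\<^esub> y"
      using x y rep[OF x] rep[OF y] by (simp add: eq B.a_inv_minus B.minus_add_minus)
    then show "x \<ominus>\<^bsub>B\<^esub> y \<in> K" using rep[OF x] rep[OF y] K submodule_closed by metis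
  next
    \<comment> \<open>Congruent elements satisfy the same predicate, so the choice operator returns
      the same representative for both.\<close>
    assume xy: "x \<ominus>\<^bsub>B\<^esub> y \<in> K"
    have "x \<ominus>\<^bsub>B\<^esub> z \<in> K \<longleftrightarrow> y \<ominus>\<^bsub>B\<^esub> z \<in> K" if z: "z \<in> carrier B" for z
    proof -
      have "x \<ominus>\<^bsub>B\<^esub> z = (x \<ominus>\<^bsub>B\<^esub> y) \<oplus>\<^bsub>B\<^esub> (y \<ominus>\<^bsub>B\<^esub> z)"
        "y \<ominus>\<^bsub>B\<^esub> z = \<ominus>\<^bsub>B\<^esub> (x \<ominus>\<^bsub>B\<^esub> y) \<oplus>\<^bsub>B\<^esub> (x \<ominus>\<^bsub>B\<^esub> z)"
        using x y z by (simp_all add: B.minus_add_minus B.a_inv_minus)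
      then show ?thesis using xy K submodule_closed by metis
    qed
    then show "rep x = rep y" unfolding rep_def by metis
  qed
  define p where "p = (\<lambda>x\<in>carrier B. e (rep x))"
  have p_eq: "p x = p y \<longleftrightarrow> x \<ominus>\<^bsub>B\<^esub> y \<in> K" if "x \<in> carrier B" "y \<in> carrier B" for x y
    using that rep rep_eq[OF that] inj_on_eq_iff[OF e] by (simp add: p_def)
  \<comment> \<open>A section of p, through which addition and scalar action are transported to the
    codes.\<close>
  define \<sigma> where "\<sigma> = inv_into (carrier B) p"
  define A :: "('r, 'u) module" where "A = \<lparr>carrier = p ` carrier B, mult = undefined, one = undefined,
     zero = p \<zero>\<^bsub>B\<^esub>, add = (\<lambda>a b. p (\<sigma> a \<oplus>\<^bsub>B\<^esub> \<sigma> b)), smult = (\<lambda>r a. p (r \<odot>\<^bsub>B\<^esub> \<sigma> a))\<rparr>"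
  have s: "\<sigma> (p x) \<in> carrier B" "\<sigma> (p x) \<ominus>\<^bsub>B\<^esub> x \<in> K" if "x \<in> carrier B" for x
  proof -
    show c: "\<sigma> (p x) \<in> carrier B" using that by (simp add: \<sigma>_def inv_into_into)
    have "p (\<sigma> (p x)) = p x" using that by (simp add: \<sigma>_def f_inv_into_f)
    then show "\<sigma> (p x) \<ominus>\<^bsub>B\<^esub> x \<in> K" using p_eq that c by simp
  qed
  have add: "p x \<oplus>\<^bsub>A\<^esub> p y = p (x \<oplus>\<^bsub>B\<^esub> y)" if x: "x \<in> carrier B" and y: "y \<in> carrier B" for x y
  proof -
    have "(\<sigma> (p x) \<oplus>\<^bsub>B\<^esub> \<sigma> (p y)) \<ominus>\<^bsub>B\<^esub> (x \<oplus>\<^bsub>B\<^esub> y) = (\<sigma> (p x) \<ominus>\<^bsub>B\<^esub> x) \<oplus>\<^bsub>B\<^esub> (\<sigma> (p y) \<ominus>\<^bsub>B\<^esub> y)"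
      using x y s by (simp add: a_minus_def B.minus_add B.a_ac)
    then have "\<dots> \<in> K" "(\<sigma> (p x) \<oplus>\<^bsub>B\<^esub> \<sigma> (p y)) \<ominus>\<^bsub>B\<^esub> (x \<oplus>\<^bsub>B\<^esub> y) \<in> K"
      using s x y K submodule_closed by metis+
    then show ?thesis using x y s by (simp add: A_def p_eq)
  qed
  have smult: "r \<odot>\<^bsub>A\<^esub> p x = p (r \<odot>\<^bsub>B\<^esub> x)" if x: "x \<in> carrier B" and r: "r \<in> carrier R" for x r
  proof -
    have "r \<odot>\<^bsub>B\<^esub> \<sigma> (p x) \<ominus>\<^bsub>B\<^esub> r \<odot>\<^bsub>B\<^esub> x = r \<odot>\<^bsub>B\<^esub> (\<sigma> (p x) \<ominus>\<^bsub>B\<^esub> x)"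
      using x s r by (simp add: a_minus_def B.lsmult_r_distr B.smult_minus_right)
    then have "r \<odot>\<^bsub>B\<^esub> \<sigma> (p x) \<ominus>\<^bsub>B\<^esub> r \<odot>\<^bsub>B\<^esub> x \<in> K"
      using s x r K submodule_closed by metis
    then show ?thesis using x s r by (simp add: A_def p_eq B.lsmult_closed)
  qed
  have car: "carrier A = p ` carrier B" and zero: "\<zero>\<^bsub>A\<^esub> = p \<zero>\<^bsub>B\<^esub>" by (simp_all add: A_def)
  have "left_module R A"
    by (rule left_moduleI)
      (auto simp: car zero add smult B.ring_axioms B.lsmult_closed B.lsmult_l_distr B.lsmult_r_distr
         B.lsmult_assoc B.lsmult_one B.a_ac)
  moreover have "p \<in> mod_hom R B A"
    by (rule mod_homI) (simp_all add: car add smult, simp add: p_def)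
  ultimately show thesis using that car p_eq by blast
qed

section \<open>Chain conditions\<close>

text \<open>The condition is imposed on the submodules of the fixed module M that lie in A, so that
  passing to submodules does not change the module record.\<close>

definition noetherian :: "('r, 'd) ring_scheme \<Rightarrow> ('r, 'm) module \<Rightarrow> 'm set \<Rightarrow> bool" where
  "noetherian R M A \<longleftrightarrow> (\<forall>f :: nat \<Rightarrow> 'm set.
     (\<forall>k. submodule (f k) R M \<and> f k \<subseteq> A \<and> f k \<subseteq> f (Suc k)) \<longrightarrow> (\<exists>n. \<forall>k\<ge>n. f k = f n))"

definition artinian :: "('r, 'd) ring_scheme \<Rightarrow> ('r, 'm) module \<Rightarrow> 'm set \<Rightarrow> bool" where
  "artinian R M A \<longleftrightarrow> (\<forall>f :: nat \<Rightarrow> 'm set.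
     (\<forall>k. submodule (f k) R M \<and> f k \<subseteq> A \<and> f (Suc k) \<subseteq> f k) \<longrightarrow> (\<exists>n. \<forall>k\<ge>n. f k = f n))"

lemma noetherianD:
  assumes "noetherian R M A" "\<And>k::nat. submodule (f k) R M" "\<And>k. f k \<subseteq> A" "\<And>k. f k \<subseteq> f (Suc k)"
  shows "\<exists>n. \<forall>k\<ge>n. f k = f n"
  using assms by (simp add: noetherian_def)

lemma artinianD:
  assumes "artinian R M A" "\<And>k::nat. submodule (f k) R M" "\<And>k. f k \<subseteq> A" "\<And>k. f (Suc k) \<subseteq> f k"
  shows "\<exists>n. \<forall>k\<ge>n. f k = f n"
  using assms by (simp add: artinian_def)

text \<open>For submodules A and B this means that B / A is simple.\<close>

definition covers :: "('r, 'd) ring_scheme \<Rightarrow> ('r, 'm) module \<Rightarrow> 'm set \<Rightarrow> 'm set \<Rightarrow> bool" where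
  "covers R M A B \<longleftrightarrow> A \<subset> B \<and> \<not> (\<exists>L. submodule L R M \<and> A \<subset> L \<and> L \<subset> B)"

lemma stationary_conj:
  assumes "\<exists>n. \<forall>k\<ge>n. f k = f n" "\<exists>n. \<forall>k\<ge>n. g k = g n"
  shows "\<exists>n :: nat. \<forall>k\<ge>n. f k = f n \<and> g k = g n"
proof -
  obtain m n where *: "\<And>k. k \<ge> m \<Longrightarrow> f k = f m" "\<And>k. k \<ge> n \<Longrightarrow> g k = g n"
    using assms by blast
  have "f k = f (max m n) \<and> g k = g (max m n)" if "k \<ge> max m n" for k
    using that *(1)[of k] *(1)[of "max m n"] *(2)[of k] *(2)[of "max m n"] by simp
  then show ?thesis by blast
qed

lemma stationary_all:
  fixes f :: "nat \<Rightarrow> nat \<Rightarrow> 'a"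
  assumes "\<And>i. i < m \<Longrightarrow> \<exists>n. \<forall>k\<ge>n. f i k = f i n"
  shows "\<exists>n. \<forall>i<m. \<forall>k\<ge>n. f i k = f i n"
  using assms
proof (induction m)
  case (Suc m)
  then obtain n1 n2 where *: "\<forall>i<m. \<forall>k\<ge>n1. f i k = f i n1" "\<forall>k\<ge>n2. f m k = f m n2"
    by (metis less_Suc_eq)
  then have "f i k = f i (max n1 n2)" if "i < Suc m" "k \<ge> max n1 n2" for i k
    using that by (metis less_Suc_eq max.bounded_iff order_refl)
  then show ?case by blast
qed simp

context left_module
begin

lemma noetherian_mono: "\<lbrakk>noetherian R M B; A \<subseteq> B\<rbrakk> \<Longrightarrow> noetherian R M A"
  unfolding noetherian_def by (blast intro: subset_trans)

lemma noetherian_maximal: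
  assumes "noetherian R M A" "\<F> \<noteq> {}" "\<And>X. X \<in> \<F> \<Longrightarrow> submodule X R M \<and> X \<subseteq> A"
  shows "\<exists>X\<in>\<F>. \<forall>Y\<in>\<F>. X \<subseteq> Y \<longrightarrow> Y = X"
proof (rule ccontr)
  assume "\<not> ?thesis"
  then have step: "\<exists>Y. Y \<in> \<F> \<and> X \<subset> Y" if "X \<in> \<F>" for X
    using that by blast
  have "\<exists>f. \<forall>k::nat. f k \<in> \<F> \<and> f k \<subset> f (Suc k)"
    by (rule dependent_nat_choice) (use assms(2) step in auto)
  then obtain f where f: "\<And>k::nat. f k \<in> \<F>" "\<And>k. f k \<subset> f (Suc k)"
    by blast
  have "\<exists>n. \<forall>k\<ge>n. f k = f n"
    using assms(3)[OF f(1)] psubset_imp_subset[OF f(2)] by (intro noetherianD[OF assms(1)]) auto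
  then obtain n where "\<forall>k\<ge>n. f k = f n" ..
  from this[rule_format, of "Suc n"] have "f (Suc n) = f n" by (simp only: le_SucI[OF order_refl])
  then show False using f(2) by blast
qed

lemma artinian_minimal:
  assumes "artinian R M A" "\<F> \<noteq> {}" "\<And>X. X \<in> \<F> \<Longrightarrow> submodule X R M \<and> X \<subseteq> A"
  shows "\<exists>X\<in>\<F>. \<forall>Y\<in>\<F>. Y \<subseteq> X \<longrightarrow> Y = X"
proof (rule ccontr)
  assume "\<not> ?thesis"
  then have step: "\<exists>Y. Y \<in> \<F> \<and> Y \<subset> X" if "X \<in> \<F>" for X
    using that by blast
  have "\<exists>f. \<forall>k::nat. f k \<in> \<F> \<and> f (Suc k) \<subset> f k"
    by (rule dependent_nat_choice) (use assms(2) step in auto)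
  then obtain f where f: "\<And>k::nat. f k \<in> \<F>" "\<And>k. f (Suc k) \<subset> f k"
    by blast
  have "\<exists>n. \<forall>k\<ge>n. f k = f n"
    using assms(3)[OF f(1)] psubset_imp_subset[OF f(2)] by (intro artinianD[OF assms(1)]) auto
  then obtain n where "\<forall>k\<ge>n. f k = f n" ..
  from this[rule_format, of "Suc n"] have "f (Suc n) = f n" by (simp only: le_SucI[OF order_refl])
  then show False using f(2) by blast
qed

text \<open>A form of the modular law. The pair of intersection and sum with D replaces the pair of
  a submodule of D and a submodule of M / D.\<close>

lemma modular_eq:
  assumes A: "submodule A R M" and B: "submodule B R M" and D: "submodule D R M"
    and "A \<subseteq> B" "A \<inter> D = B \<inter> D" "submodule_sum M A D = submodule_sum M B D"
  shows "A = B"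
proof
  show "B \<subseteq> A"
  proof
    fix b assume b: "b \<in> B"
    then have "b \<in> submodule_sum M A D"
      using submodule_sum_left[OF B D] assms(6) by auto
    then obtain a d where ad: "a \<in> A" "d \<in> D" "b = a \<oplus>\<^bsub>M\<^esub> d"
      unfolding submodule_sum_mem by blast
    note c = submodule_in_carrier[OF A ad(1)] submodule_in_carrier[OF D ad(2)] submodule_in_carrier[OF B b]
    have "d = b \<ominus>\<^bsub>M\<^esub> a" using ad c by (simp add: add_minus_cancel)
    moreover have "b \<ominus>\<^bsub>M\<^esub> a \<in> B"
      using b ad(1) assms(4) by (intro submodule_minus_closed[OF B]) auto
    ultimately have "d \<in> B" by (rule ssubst)
    then have "d \<in> A" using ad assms(5) by auto
    then show "b \<in> A" using ad submodule_add_closed[OF A] by simp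
  qed
qed fact

lemma submodule_sum_mono: "\<lbrakk>A \<subseteq> A'; B \<subseteq> B'\<rbrakk> \<Longrightarrow> submodule_sum M A B \<subseteq> submodule_sum M A' B'"
  unfolding submodule_sum_def by blast

text \<open>By \<open>modular_eq\<close> a chain is stationary as soon as its intersections with A
  and its sums with A are. The sums represent the induced chain modulo A, so no quotient module is
  formed.\<close>

lemma noetherian_extension:
  assumes A: "submodule A R M" and "noetherian R M A"
    and *: "\<And>f :: nat \<Rightarrow> 'm set. \<forall>k. submodule (f k) R M \<and> f k \<subseteq> B \<and> f k \<subseteq> f (Suc k) \<Longrightarrow>
      \<exists>n. \<forall>k\<ge>n. submodule_sum M (f k) A = submodule_sum M (f n) A"
  shows "noetherian R M B"
  unfolding noetherian_def
proof (intro allI impI)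
  fix f :: "nat \<Rightarrow> 'm set"
  assume f: "\<forall>k. submodule (f k) R M \<and> f k \<subseteq> B \<and> f k \<subseteq> f (Suc k)"
  have "\<exists>n. \<forall>k\<ge>n. f k \<inter> A = f n \<inter> A"
    by (rule noetherianD[OF assms(2)]) (use f A submodule_Int in auto)
  from stationary_conj[OF this *[OF f]] obtain n where
    n: "\<forall>k\<ge>n. f k \<inter> A = f n \<inter> A \<and> submodule_sum M (f k) A = submodule_sum M (f n) A" ..
  have sub: "submodule (f k) R M" for k using f by blast
  have mono: "f n \<subseteq> f k" if "k \<ge> n" for k
    using f by (intro lift_Suc_mono_le[of f, OF _ that]) blast
  have "f n = f k" if "k \<ge> n" for k
    by (rule modular_eq[OF sub sub A mono[OF that]]) (use n that in metis)+
  then have "f k = f n" if "k \<ge> n" for k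
    using that by metis
  then show "\<exists>n. \<forall>k\<ge>n. f k = f n" by blast
qed

lemma noetherian_sum:
  assumes A: "submodule A R M" "noetherian R M A" and B: "submodule B R M" "noetherian R M B"
  shows "noetherian R M (submodule_sum M A B)"
proof (rule noetherian_extension[OF A])
  fix f :: "nat \<Rightarrow> 'm set"
  assume f: "\<forall>k. submodule (f k) R M \<and> f k \<subseteq> submodule_sum M A B \<and> f k \<subseteq> f (Suc k)"
  \<comment> \<open>By the modular law g k + A = f k + A, since f k lies in A + B. So a chain inside
    B controls the sums.\<close>
  define g where "g k = submodule_sum M (f k) A \<inter> B" for k
  have g: "submodule (g k) R M \<and> g k \<subseteq> B \<and> g k \<subseteq> g (Suc k)" for k
    using f A B submodule_sum_mono[of "f k" "f (Suc k)" A A]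
    by (auto simp: g_def intro!: submodule_Int submodule_submodule_sum)
  then have "\<exists>n. \<forall>k\<ge>n. g k = g n" by (intro noetherianD[OF B(2)]) auto
  then obtain n where n: "\<forall>k\<ge>n. g k = g n" ..
  have eq: "submodule_sum M (f k) A = submodule_sum M (g k) A" for k
  proof
    show "submodule_sum M (g k) A \<subseteq> submodule_sum M (f k) A"
      using f A submodule_sum_right by (intro submodule_sum_least submodule_submodule_sum) (auto simp: g_def)
    show "submodule_sum M (f k) A \<subseteq> submodule_sum M (g k) A"
    proof (intro submodule_sum_least)
      show "f k \<subseteq> submodule_sum M (g k) A"
      proof
        fix x assume x: "x \<in> f k"
        then obtain a b where ab: "a \<in> A" "b \<in> B" "x = a \<oplus>\<^bsub>M\<^esub> b"
          using f submodule_sum_mem by blast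
        note c = submodule_in_carrier[OF A(1) ab(1)] submodule_in_carrier[OF B(1) ab(2)]
        then have b: "b = x \<oplus>\<^bsub>M\<^esub> \<ominus>\<^bsub>M\<^esub> a" using ab add_minus_cancel(2)[of a b] by (simp add: a_minus_def)
        then have "b \<in> g k"
          unfolding g_def using x ab submodule_a_inv_closed[OF A(1)] submodule_sum_mem by blast
        then show "x \<in> submodule_sum M (g k) A"
          using ab c M.a_comm[of a b] submodule_sum_mem by blast
      qed
    qed (use f A g submodule_sum_right submodule_submodule_sum in auto)
  qed
  show "\<exists>n. \<forall>k\<ge>n. submodule_sum M (f k) A = submodule_sum M (f n) A"
  proof (intro exI allI impI)
    fix k assume "n \<le> k"
    then have "g k = g n" using n by blast
    then show "submodule_sum M (f k) A = submodule_sum M (f n) A" by (simp only: eq)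
  qed
qed

lemma noetherian_covers:
  assumes A: "submodule A R M" "noetherian R M A" and B: "submodule B R M" and cov: "covers R M A B"
  shows "noetherian R M B"
proof (rule noetherian_extension[OF A])
  fix f :: "nat \<Rightarrow> 'm set"
  assume f: "\<forall>k. submodule (f k) R M \<and> f k \<subseteq> B \<and> f k \<subseteq> f (Suc k)"
  \<comment> \<open>Nothing lies strictly between A and B, so the chain of sums can only jump
    once.\<close>
  have AB: "submodule_sum M (f k) A = A \<or> submodule_sum M (f k) A = B" for k
    using cov f A B submodule_sum_right[of "f k" A] submodule_submodule_sum[of "f k" A]
      submodule_sum_least[of B "f k" A] unfolding covers_def by blast
  have mono: "submodule_sum M (f k) A \<subseteq> submodule_sum M (f l) A" if "k \<le> l" for k l
    using that f lift_Suc_mono_le[of f, OF _ that] by (intro submodule_sum_mono) auto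
  show "\<exists>n. \<forall>k\<ge>n. submodule_sum M (f k) A = submodule_sum M (f n) A"
  proof (cases "\<exists>n. submodule_sum M (f n) A = B")
    case True
    then obtain n where "submodule_sum M (f n) A = B" by blast
    then show ?thesis using AB mono cov unfolding covers_def by (metis psubsetE subset_antisym)
  next
    case False
    then show ?thesis using AB by metis
  qed
qed

lemma artinian_covers:
  assumes A: "submodule A R M" "artinian R M A" and B: "submodule B R M" and cov: "covers R M A B"
  shows "artinian R M B"
  unfolding artinian_def
proof (intro allI impI)
  fix f :: "nat \<Rightarrow> 'm set"
  assume f: "\<forall>k. submodule (f k) R M \<and> f k \<subseteq> B \<and> f (Suc k) \<subseteq> f k"
  have "\<exists>n. \<forall>k\<ge>n. f k \<inter> A = f n \<inter> A"
    by (rule artinianD[OF A(2)]) (use f A submodule_Int in auto)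
  moreover
  have AB: "submodule_sum M (f k) A = A \<or> submodule_sum M (f k) A = B" for k
    using cov f A B submodule_sum_right[of "f k" A] submodule_submodule_sum[of "f k" A]
      submodule_sum_least[of B "f k" A] unfolding covers_def by blast
  have anti: "f l \<subseteq> f k" if "k \<le> l" for k l
    using that f lift_Suc_antimono_le[of f, OF _ that] by auto
  have mono: "submodule_sum M (f l) A \<subseteq> submodule_sum M (f k) A" if "k \<le> l" for k l
    using anti[OF that] by (intro submodule_sum_mono) auto
  have "\<exists>n. \<forall>k\<ge>n. submodule_sum M (f k) A = submodule_sum M (f n) A"
  proof (cases "\<exists>n. submodule_sum M (f n) A = A")
    case True
    then obtain n where "submodule_sum M (f n) A = A" by blast
    then show ?thesis using AB mono cov unfolding covers_def by (metis psubsetE subset_antisym)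
  next
    case False
    then show ?thesis using AB by metis
  qed
  ultimately have "\<exists>n. \<forall>k\<ge>n. f k \<inter> A = f n \<inter> A \<and> submodule_sum M (f k) A = submodule_sum M (f n) A"
    by (rule stationary_conj)
  then obtain n where
    n: "\<forall>k\<ge>n. f k \<inter> A = f n \<inter> A \<and> submodule_sum M (f k) A = submodule_sum M (f n) A" ..
  have sub: "submodule (f k) R M" for k using f by blast
  have "f k = f n" if "k \<ge> n" for k
    by (rule modular_eq[OF sub sub A(1) anti[OF that]]) (use n that in blast)+
  then show "\<exists>n. \<forall>k\<ge>n. f k = f n" by blast
qed

lemma finite_length_imp_chain_conditions:
  assumes "finite_length R M"
  shows "noetherian R M (carrier M)" "artinian R M (carrier M)"
proof -
  obtain n N where N: "N 0 = {\<zero>\<^bsub>M\<^esub>}" "N n = carrier M" "\<And>k. k \<le> n \<Longrightarrow> submodule (N k) R M"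
    "\<And>k. k < n \<Longrightarrow> covers R M (N k) (N (Suc k))"
    using assms unfolding finite_length_def covers_def by metis
  \<comment> \<open>Q stands for the inclusion between successive members, so that one fact starts
    the induction for both chain conditions.\<close>
  have z: "\<exists>n. \<forall>k\<ge>n. f k = f n" if "\<forall>k. submodule (f k) R M \<and> f k \<subseteq> {\<zero>\<^bsub>M\<^esub>} \<and> Q k" for f :: "nat \<Rightarrow> 'm set" and Q
  proof -
    have "f k = {\<zero>\<^bsub>M\<^esub>}" for k
      using that submodule_zero_closed[of "f k" R M] by blast
    then show ?thesis by simp
  qed
  have "noetherian R M (N k) \<and> artinian R M (N k)" if "k \<le> n" for k
    using that
  proof (induction k)
    case 0
    show ?case unfolding noetherian_def artinian_def N(1) using z by simp
  next
    case (Suc k)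
    have k: "k \<le> n" "Suc k \<le> n" "k < n" using Suc(2) by auto
    have "noetherian R M (N k)" "artinian R M (N k)" using Suc(1)[OF k(1)] by auto
    then show ?case
      by (intro conjI noetherian_covers[OF N(3)[OF k(1)] _ N(3)[OF k(2)] N(4)[OF k(3)]]
          artinian_covers[OF N(3)[OF k(1)] _ N(3)[OF k(2)] N(4)[OF k(3)]])
  qed
  from this[of n] show "noetherian R M (carrier M)" "artinian R M (carrier M)" using N(2) by auto
qed

lemma chain_conditions_imp_finite_length:
  assumes noeth: "noetherian R M (carrier M)" and art: "artinian R M (carrier M)"
  shows "finite_length R M"
proof -
  \<comment> \<open>The descending chain condition yields a minimal submodule above a proper one.
    The ascending one then makes the tower of these steps reach \<open>carrier M\<close>.\<close>
  have "\<exists>B. submodule B R M \<and> (if A = carrier M then B = A else covers R M A B)"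
    if A: "submodule A R M" for A
  proof (cases "A = carrier M")
    case False
    have "carrier M \<in> {B. submodule B R M \<and> A \<subset> B}"
      using False A submodule_carrier submodule_subset by auto
    moreover have "X \<subseteq> carrier M" if "submodule X R M" for X
      using submodule_subset[OF that] .
    ultimately have "\<exists>X\<in>{B. submodule B R M \<and> A \<subset> B}. \<forall>Y\<in>{B. submodule B R M \<and> A \<subset> B}. Y \<subseteq> X \<longrightarrow> Y = X"
      by (intro artinian_minimal[OF art]) auto
    then obtain B where "submodule B R M" "A \<subset> B" "\<forall>Y. submodule Y R M \<and> A \<subset> Y \<longrightarrow> Y \<subseteq> B \<longrightarrow> Y = B"
      by auto
    then show ?thesis using False unfolding covers_def by auto
  qed (use A in auto)
  note step = this
  have "\<exists>f. \<forall>k::nat. (submodule (f k) R M \<and> (k = 0 \<longrightarrow> f k = {\<zero>\<^bsub>M\<^esub>})) \<and>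
      (if f k = carrier M then f (Suc k) = f k else covers R M (f k) (f (Suc k)))"
    by (rule dependent_nat_choice) (use submodule_zero step in auto)
  then obtain f where f: "\<And>k::nat. submodule (f k) R M" "f 0 = {\<zero>\<^bsub>M\<^esub>}"
    "\<And>k. if f k = carrier M then f (Suc k) = f k else covers R M (f k) (f (Suc k))"
    by blast
  have "f k \<subseteq> f (Suc k)" for k using f(3)[of k] unfolding covers_def by (auto split: if_splits)
  then have "\<exists>m. \<forall>k\<ge>m. f k = f m"
    by (intro noetherianD[OF noeth] f submodule_subset[OF f(1)]) auto
  then obtain m where "\<forall>k\<ge>m. f k = f m" ..
  from this[rule_format, of "Suc m"] have "f (Suc m) = f m" by (simp only: le_SucI[OF order_refl])
  then have "f m = carrier M" using f(3)[of m] unfolding covers_def by (auto split: if_splits)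
  \<comment> \<open>The tower is constant after reaching \<open>carrier M\<close>, so a composition
    series has to stop at the first such index.\<close>
  define n where "n = (LEAST n. f n = carrier M)"
  have n: "f n = carrier M"
    unfolding n_def by (rule LeastI) fact
  have "f k \<noteq> carrier M" if "k < n" for k
    using not_less_Least[of k "\<lambda>n. f n = carrier M"] that unfolding n_def by blast
  then have "covers R M (f k) (f (Suc k))" if "k < n" for k
    using f(3)[of k] that by simp
  then show ?thesis
    unfolding finite_length_def using f(1,2) n unfolding covers_def
    by (intro exI[of _ n] exI[of _ f] conjI) auto
qed


lemma submodule_smult_image:
  assumes I: "submodule I R (regular_module R)" and x: "x \<in> carrier M"
  shows "submodule ((\<lambda>r. r \<odot>\<^bsub>M\<^esub> x) ` I) R M"
proof -
  have c: "r \<in> carrier R" if "r \<in> I" for r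
    using submodule_in_carrier[OF I that] by (simp add: regular_module_def)
  show ?thesis
  proof (rule submoduleI)
    show "\<zero>\<^bsub>M\<^esub> \<in> (\<lambda>r. r \<odot>\<^bsub>M\<^esub> x) ` I"
      using submodule_zero_closed[OF I] x by (force simp: regular_module_def)
  next
    fix y z assume "y \<in> (\<lambda>r. r \<odot>\<^bsub>M\<^esub> x) ` I" "z \<in> (\<lambda>r. r \<odot>\<^bsub>M\<^esub> x) ` I"
    then obtain r s where rs: "r \<in> I" "s \<in> I" "y = r \<odot>\<^bsub>M\<^esub> x" "z = s \<odot>\<^bsub>M\<^esub> x" by auto
    then have "y \<oplus>\<^bsub>M\<^esub> z = (r \<oplus>\<^bsub>R\<^esub> s) \<odot>\<^bsub>M\<^esub> x" using c x by (simp add: lsmult_l_distr)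
    then show "y \<oplus>\<^bsub>M\<^esub> z \<in> (\<lambda>r. r \<odot>\<^bsub>M\<^esub> x) ` I"
      using submodule_add_closed[OF I rs(1,2)] by (simp add: regular_module_def)
  next
    fix r y assume r: "r \<in> carrier R" and "y \<in> (\<lambda>r. r \<odot>\<^bsub>M\<^esub> x) ` I"
    then obtain s where s: "s \<in> I" "y = s \<odot>\<^bsub>M\<^esub> x" by auto
    then have "r \<odot>\<^bsub>M\<^esub> y = (r \<otimes>\<^bsub>R\<^esub> s) \<odot>\<^bsub>M\<^esub> x" using c x r by (simp add: lsmult_assoc)
    then show "r \<odot>\<^bsub>M\<^esub> y \<in> (\<lambda>r. r \<odot>\<^bsub>M\<^esub> x) ` I"
      using submodule_smult_closed[OF I r s(1)] by (simp add: regular_module_def)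
  qed (use c x in \<open>auto intro: lsmult_closed\<close>)
qed

lemma submodule_restrict_coefficients:
  assumes A: "submodule A R M" and x: "x \<in> carrier M" and I: "submodule I R (regular_module R)"
  shows "submodule {r \<in> I. r \<odot>\<^bsub>M\<^esub> x \<in> A} R (regular_module R)"
proof -
  interpret reg: left_module R "regular_module R" by (rule regular_left_module[OF ring_axioms])
  have c: "r \<in> carrier R" if "r \<in> I" for r
    using submodule_in_carrier[OF I that] by (simp add: regular_module_def)
  note cl = submodule_closed[OF A] submodule_closed[OF I, unfolded regular_module_def, simplified]
  show ?thesis
    by (rule reg.submoduleI)
      (use x c cl in \<open>auto simp: regular_module_def lsmult_l_distr lsmult_assoc\<close>)
qed

end

text \<open>The graded pieces of \<open>K\<close> for the filtration by the common kernels of \<open>e 0, \<dots>, e (i - 1)\<close>.\<close>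

definition filtration_piece :: "('p, 'x) module \<Rightarrow> ('m, 'y) module \<Rightarrow> (nat \<Rightarrow> 'x \<Rightarrow> 'y) \<Rightarrow> nat \<Rightarrow> 'x set \<Rightarrow> 'y set" where
  "filtration_piece P M e i K = e i ` {k \<in> K. \<forall>l<i. e l k = \<zero>\<^bsub>M\<^esub>}"

lemma filtration_piece_mono: "K \<subseteq> K' \<Longrightarrow> filtration_piece P M e i K \<subseteq> filtration_piece P M e i K'"
  unfolding filtration_piece_def by auto

lemma filtration_piece_submodule:
  assumes P: "left_module R P" and M: "left_module R M"
    and e: "\<And>l. l \<le> i \<Longrightarrow> e l \<in> mod_hom R P M" and K: "submodule K R P"
  shows "submodule (filtration_piece P M e i K) R M"
proof -
  interpret P: left_module R P by fact
  interpret M: left_module R M by fact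
  have c: "k \<in> carrier P" if "k \<in> K" for k using submodule_in_carrier[OF K that] .
  have "submodule {k \<in> K. \<forall>l<i. e l k = \<zero>\<^bsub>M\<^esub>} R P"
  proof (rule P.submoduleI)
    fix x y assume xy: "x \<in> {k \<in> K. \<forall>l<i. e l k = \<zero>\<^bsub>M\<^esub>}" "y \<in> {k \<in> K. \<forall>l<i. e l k = \<zero>\<^bsub>M\<^esub>}"
    then have "e l (x \<oplus>\<^bsub>P\<^esub> y) = \<zero>\<^bsub>M\<^esub>" if "l < i" for l
      using that hom_add[OF e[of l], of x y] c by simp
    then show "x \<oplus>\<^bsub>P\<^esub> y \<in> {k \<in> K. \<forall>l<i. e l k = \<zero>\<^bsub>M\<^esub>}"
      using xy K by (simp add: submodule_closed)
  next
    fix r x assume rx: "r \<in> carrier R" "x \<in> {k \<in> K. \<forall>l<i. e l k = \<zero>\<^bsub>M\<^esub>}"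
    then have "e l (r \<odot>\<^bsub>P\<^esub> x) = \<zero>\<^bsub>M\<^esub>" if "l < i" for l
      using that hom_smult[OF e[of l], of r x] c by simp
    then show "r \<odot>\<^bsub>P\<^esub> x \<in> {k \<in> K. \<forall>l<i. e l k = \<zero>\<^bsub>M\<^esub>}"
      using rx K by (simp add: submodule_closed)
  qed (use c K hom_zero[OF P M e] in \<open>auto intro: submodule_closed\<close>)
  then show ?thesis
    unfolding filtration_piece_def by (rule hom_image_submodule[OF P M e[OF order_refl]])
qed

text \<open>Approximate s in K' by t in K. If e l (s - t) = 0 for all l < i, then e i (s - t) lies
  in the i-th piece of K', hence of K, and equals e i u for some u in K that is killed by the
  earlier maps. Then t + u is a better approximation. After n steps the error is killed by all maps
  and lies in K.\<close>

lemma filtration_pieces_eq: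
  assumes P: "left_module R P" and M: "left_module R M"
    and e: "\<And>i. i < n \<Longrightarrow> e i \<in> mod_hom R P M"
    and K: "submodule K R P" and K': "submodule K' R P" and le: "K \<subseteq> K'"
    and ker: "\<And>k. \<lbrakk>k \<in> K'; \<And>i. i < n \<Longrightarrow> e i k = \<zero>\<^bsub>M\<^esub>\<rbrakk> \<Longrightarrow> k \<in> K"
    and eq: "\<And>i. i < n \<Longrightarrow> filtration_piece P M e i K = filtration_piece P M e i K'"
  shows "K = K'"
proof
  interpret P: left_module R P by fact
  interpret M: left_module R M by fact
  show "K' \<subseteq> K"
  proof
    fix s assume s: "s \<in> K'"
    have "\<exists>t\<in>K. \<forall>l<i. e l (s \<ominus>\<^bsub>P\<^esub> t) = \<zero>\<^bsub>M\<^esub>" if "i \<le> n" for i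
      using that
    proof (induction i)
      case 0
      then show ?case using submodule_zero_closed[OF K] by auto
    next
      case (Suc i)
      then obtain t where t: "t \<in> K" "\<forall>l<i. e l (s \<ominus>\<^bsub>P\<^esub> t) = \<zero>\<^bsub>M\<^esub>" by auto
      then have "s \<ominus>\<^bsub>P\<^esub> t \<in> {k \<in> K'. \<forall>l<i. e l k = \<zero>\<^bsub>M\<^esub>}"
        using s le submodule_minus_closed[OF K'] by auto
      then have "e i (s \<ominus>\<^bsub>P\<^esub> t) \<in> filtration_piece P M e i K"
        using eq[of i] Suc(2) by (auto simp: filtration_piece_def)
      then obtain u where u: "u \<in> K" "\<forall>l<i. e l u = \<zero>\<^bsub>M\<^esub>" "e i (s \<ominus>\<^bsub>P\<^esub> t) = e i u"
        by (auto simp: filtration_piece_def)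
      have c: "s \<in> carrier P" "t \<in> carrier P" "u \<in> carrier P"
        using s t u submodule_in_carrier[OF K] submodule_in_carrier[OF K'] by auto
      have dec: "s \<ominus>\<^bsub>P\<^esub> (t \<oplus>\<^bsub>P\<^esub> u) = (s \<ominus>\<^bsub>P\<^esub> t) \<ominus>\<^bsub>P\<^esub> u"
        using c by (simp add: a_minus_def P.minus_add P.a_assoc)
      have "e l (s \<ominus>\<^bsub>P\<^esub> (t \<oplus>\<^bsub>P\<^esub> u)) = \<zero>\<^bsub>M\<^esub>" if l: "l < Suc i" for l
      proof -
        have el: "e l \<in> mod_hom R P M" using e l Suc(2) by simp
        have "e l (s \<ominus>\<^bsub>P\<^esub> (t \<oplus>\<^bsub>P\<^esub> u)) = e l (s \<ominus>\<^bsub>P\<^esub> t) \<ominus>\<^bsub>M\<^esub> e l u"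
          unfolding dec using c by (intro hom_minus[OF P M el]) auto
        moreover have "e l (s \<ominus>\<^bsub>P\<^esub> t) = e l u" using l t u less_Suc_eq by metis
        ultimately show ?thesis using hom_closed[OF el c(3)] by simp
      qed
      then show ?case using submodule_add_closed[OF K t(1) u(1)] by blast
    qed
    from this[of n] obtain t where t: "t \<in> K" "\<forall>l<n. e l (s \<ominus>\<^bsub>P\<^esub> t) = \<zero>\<^bsub>M\<^esub>" by auto
    then have "s \<ominus>\<^bsub>P\<^esub> t \<in> K"
      using s le submodule_minus_closed[OF K'] by (intro ker) auto
    then have "(s \<ominus>\<^bsub>P\<^esub> t) \<oplus>\<^bsub>P\<^esub> t \<in> K" using t submodule_add_closed[OF K] by blast
    then show "s \<in> K"
      using s t submodule_in_carrier[OF K] submodule_in_carrier[OF K'] by (simp add: P.add_minus_cancel)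
  qed
qed fact

text \<open>The maps e i embed P into M^n up to elements that belong to every f l, so a chain in P
  is controlled by n chains in M. The disjunction allows one proof for ascending and descending
  chains.\<close>

lemma filtration_stationary:
  assumes P: "left_module R P" and M: "left_module R M"
    and e: "\<And>i. i < n \<Longrightarrow> e i \<in> mod_hom R P M"
    and f: "\<And>k::nat. submodule (f k) R P" and mono: "(\<forall>k. f k \<subseteq> f (Suc k)) \<or> (\<forall>k. f (Suc k) \<subseteq> f k)"
    and ker: "\<And>k l x. \<lbrakk>x \<in> f k; \<And>i. i < n \<Longrightarrow> e i x = \<zero>\<^bsub>M\<^esub>\<rbrakk> \<Longrightarrow> x \<in> f l"
    and stat: "\<And>i. i < n \<Longrightarrow> \<exists>m. \<forall>k\<ge>m. filtration_piece P M e i (f k) = filtration_piece P M e i (f m)"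
  shows "\<exists>m. \<forall>k\<ge>m. f k = f m"
proof -
  have "\<exists>m. \<forall>i<n. \<forall>k\<ge>m. filtration_piece P M e i (f k) = filtration_piece P M e i (f m)"
    by (rule stationary_all) (rule stat)
  then obtain m where m: "\<forall>i<n. \<forall>k\<ge>m. filtration_piece P M e i (f k) = filtration_piece P M e i (f m)" ..
  have "f k = f m" if k: "k \<ge> m" for k
  proof -
    have "f m \<subseteq> f k \<or> f k \<subseteq> f m"
      using mono lift_Suc_mono_le[of f, OF _ k] lift_Suc_antimono_le[of f, OF _ k] by blast
    moreover have "f m = f k" if "f m \<subseteq> f k"
      by (rule filtration_pieces_eq[OF P M e f f that ker]) (use m k in auto)
    moreover have "f k = f m" if "f k \<subseteq> f m"
      by (rule filtration_pieces_eq[OF P M e f f that ker]) (use m k in auto)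
    ultimately show ?thesis by blast
  qed
  then show ?thesis by blast
qed

section \<open>The theorem of Hopkins and Levitzki\<close>

context left_module
begin

lemma submodule_Union_chain:
  assumes "\<C> \<noteq> {}" "subset.chain \<A> \<C>" "\<And>N. N \<in> \<A> \<Longrightarrow> submodule N R M"
  shows "submodule (\<Union>\<C>) R M"
proof (rule submodule_chain_Union[OF assms(1)])
  show "A \<subseteq> B \<or> B \<subseteq> A" if "A \<in> \<C>" "B \<in> \<C>" for A B
    using assms(2) that unfolding subset_chain_def by blast
  show "submodule N R M" if "N \<in> \<C>" for N
    using assms(2) that unfolding subset_chain_def by (intro assms(3)) blast
qed

definition orbit_map :: "'m \<Rightarrow> 'r \<Rightarrow> 'm" where
  "orbit_map x = (\<lambda>r\<in>carrier R. r \<odot>\<^bsub>M\<^esub> x)"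

lemma orbit_map_hom:
  assumes "x \<in> carrier M"
  shows "orbit_map x \<in> mod_hom R (regular_module R) M"
  by (rule mod_homI)
    (use assms in \<open>auto simp: orbit_map_def regular_module_def lsmult_l_distr lsmult_assoc lsmult_closed\<close>)

lemma left_ideal_subset: "submodule I R (regular_module R) \<Longrightarrow> I \<subseteq> carrier R"
  using submodule_subset[of I R "regular_module R"] by (simp add: regular_module_def)

text \<open>The map that sends r to the tuple of all r x_i embeds R, as a left module, into
  M^n.\<close>

lemma artinian_left_ideals:
  fixes n :: nat
  assumes art: "artinian R M (carrier M)" and x: "\<And>i. i < n \<Longrightarrow> x i \<in> carrier M"
    and faithful: "\<And>r. \<lbrakk>r \<in> carrier R; \<And>i. i < n \<Longrightarrow> r \<odot>\<^bsub>M\<^esub> x i = \<zero>\<^bsub>M\<^esub>\<rbrakk> \<Longrightarrow> r = \<zero>\<^bsub>R\<^esub>"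
  shows "artinian R (regular_module R) (carrier R)"
  unfolding artinian_def
proof (intro allI impI)
  fix f :: "nat \<Rightarrow> 'r set"
  assume f: "\<forall>k. submodule (f k) R (regular_module R) \<and> f k \<subseteq> carrier R \<and> f (Suc k) \<subseteq> f k"
  note reg = regular_left_module[OF ring_axioms]
  have M: "left_module R M" by (rule left_module_axioms)
  have e: "orbit_map (x i) \<in> mod_hom R (regular_module R) M" if "i < n" for i
    by (rule orbit_map_hom) (use that x in auto)
  have sub: "submodule (f k) R (regular_module R)" for k using f by blast
  have z: "\<zero>\<^bsub>R\<^esub> \<in> f k" for k
    using submodule_zero_closed[OF sub[of k]] by (simp add: regular_module_def)
  show "\<exists>n. \<forall>k\<ge>n. f k = f n"
  proof (rule filtration_stationary[OF reg M e sub])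
    show "(\<forall>k. f k \<subseteq> f (Suc k)) \<or> (\<forall>k. f (Suc k) \<subseteq> f k)" using f by blast
  next
    fix k l r
    assume r: "r \<in> f k" "\<And>i. i < n \<Longrightarrow> orbit_map (x i) r = \<zero>\<^bsub>M\<^esub>"
    then have "r \<in> carrier R" using f by blast
    then have "r = \<zero>\<^bsub>R\<^esub>" using r by (intro faithful) (auto simp: orbit_map_def)
    then show "r \<in> f l" using z by simp
  next
    fix i assume i: "i < n"
    have piece: "submodule (filtration_piece (regular_module R) M (\<lambda>i. orbit_map (x i)) i (f k)) R M" for k
      by (rule filtration_piece_submodule[OF reg M _ sub]) (use i e in auto)
    show "\<exists>m. \<forall>k\<ge>m. filtration_piece (regular_module R) M (\<lambda>i. orbit_map (x i)) i (f k)
        = filtration_piece (regular_module R) M (\<lambda>i. orbit_map (x i)) i (f m)"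
      by (rule artinianD[OF art piece submodule_subset[OF piece]])
        (use f in \<open>auto intro!: filtration_piece_mono\<close>)
  qed
qed

text \<open>
  The theorem of Hopkins and Levitzki. Let \<open>B\<close> be a minimal submodule that is not noetherian. Then
  \<open>B\<close> is neither cyclic nor the sum of two proper submodules. The annihilator \<open>P\<close> of \<open>B\<close> is the
  annihilator of a finite subset, so left ideals above \<open>P\<close> satisfy the ascending chain condition.
  Hence there are left ideals \<open>L\<close> and \<open>I\<close> with \<open>I / L\<close> simple, \<open>L B \<noteq> B\<close> and \<open>I B = B\<close>. Now
  \<open>B / L B\<close> is a sum of simple modules \<open>I x\<close> and therefore a sum of two proper submodules.
\<close>

theorem artinian_imp_noetherian:
  fixes n :: nat
  assumes art: "artinian R M (carrier M)" and x: "\<And>i. i < n \<Longrightarrow> x i \<in> carrier M"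
    and faithful: "\<And>r. \<lbrakk>r \<in> carrier R; \<And>i. i < n \<Longrightarrow> r \<odot>\<^bsub>M\<^esub> x i = \<zero>\<^bsub>M\<^esub>\<rbrakk> \<Longrightarrow> r = \<zero>\<^bsub>R\<^esub>"
  shows "noetherian R M (carrier M)"
proof (rule ccontr)
  assume bad: "\<not> noetherian R M (carrier M)"
  let ?reg = "regular_module R"
  note reg = regular_left_module[OF ring_axioms]
  interpret reg: left_module R ?reg by (rule reg)
  have M: "left_module R M" by (rule left_module_axioms)
  have regs: "carrier ?reg = carrier R" "\<zero>\<^bsub>?reg\<^esub> = \<zero>\<^bsub>R\<^esub>" by (simp_all add: regular_module_def)
  have artR: "artinian R ?reg (carrier R)"
    by (rule artinian_left_ideals[OF art x faithful])
  have "\<exists>B\<in>{B. submodule B R M \<and> \<not> noetherian R M B}. \<forall>Y\<in>{B. submodule B R M \<and> \<not> noetherian R M B}.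
      Y \<subseteq> B \<longrightarrow> Y = B"
    by (rule artinian_minimal[OF art]) (use bad submodule_carrier in \<open>auto dest: submodule_subset\<close>)
  then obtain B where B: "submodule B R M" "\<not> noetherian R M B"
    and min': "\<forall>Y\<in>{B. submodule B R M \<and> \<not> noetherian R M B}. Y \<subseteq> B \<longrightarrow> Y = B"
    by auto
  have min: "noetherian R M Y" if "submodule Y R M" "Y \<subset> B" for Y
    using min'[rule_format, of Y] that by blast
  have Bc: "y \<in> carrier M" if "y \<in> B" for y using submodule_in_carrier[OF B(1) that] .
  \<comment> \<open>Proper submodules of B are noetherian by minimality, so the sum of two of them
    is noetherian, and B is not.\<close>
  have hollow: "submodule_sum M Y Z \<noteq> B"
    if "submodule Y R M" "submodule Z R M" "Y \<subset> B" "Z \<subset> B" for Y Z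
    using noetherian_sum[OF that(1) min[OF that(1,3)] that(2) min[OF that(2,4)]] B(2) by metis
  have sum_proper: "submodule_sum M Y Z \<subset> B"
    if "submodule Y R M" "submodule Z R M" "Y \<subset> B" "Z \<subset> B" for Y Z
    using hollow[OF that] submodule_sum_least[OF B(1), of Y Z] that by blast
  \<comment> \<open>B has no maximal proper submodule N: N would be noetherian and B / N simple, so
    B would be noetherian.\<close>
  have nocov: "\<not> covers R M Y B" if "submodule Y R M" for Y
    using noetherian_covers[OF that _ B(1)] B(2) min[OF that] unfolding covers_def by blast
  have z_proper: "{\<zero>\<^bsub>M\<^esub>} \<subset> B"
  proof -
    have "noetherian R M {\<zero>\<^bsub>M\<^esub>}"
    proof (unfold noetherian_def, intro allI impI)
      fix f :: "nat \<Rightarrow> 'm set"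
      assume "\<forall>k. submodule (f k) R M \<and> f k \<subseteq> {\<zero>\<^bsub>M\<^esub>} \<and> f k \<subseteq> f (Suc k)"
      then have "f k = {\<zero>\<^bsub>M\<^esub>}" for k using submodule_zero_closed[of "f k" R M] by blast
      then show "\<exists>n. \<forall>k\<ge>n. f k = f n" by simp
    qed
    then have "B \<noteq> {\<zero>\<^bsub>M\<^esub>}" using B(2) by auto
    then show ?thesis using submodule_zero_closed[OF B(1)] by blast
  qed
  have carR: "submodule (carrier R) R ?reg" using reg.submodule_carrier by (simp add: regs)
  have orb_sub: "submodule ((\<lambda>r. r \<odot>\<^bsub>M\<^esub> y) ` I) R M" if "y \<in> B" "submodule I R ?reg" for y I
    using submodule_smult_image[OF that(2) Bc[OF that(1)]] .
  have orb_le: "(\<lambda>r. r \<odot>\<^bsub>M\<^esub> y) ` I \<subseteq> B" if "y \<in> B" "I \<subseteq> carrier R" for y I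
    using that submodule_smult_closed[OF B(1)] by auto
  \<comment> \<open>If y generated B, then Zorn's lemma would give a submodule maximal among those
    that avoid y, and this would be a maximal proper submodule of B.\<close>
  have cyc: "(\<lambda>r. r \<odot>\<^bsub>M\<^esub> y) ` carrier R \<subset> B" if y: "y \<in> B" for y
  proof -
    have "(\<lambda>r. r \<odot>\<^bsub>M\<^esub> y) ` carrier R \<noteq> B"
    proof
      assume eq: "(\<lambda>r. r \<odot>\<^bsub>M\<^esub> y) ` carrier R = B"
      have gen: "N = B" if N: "submodule N R M" "N \<subseteq> B" "y \<in> N" for N
        using N eq submodule_smult_closed[OF N(1)] by auto
      let ?\<F> = "{N. submodule N R M \<and> N \<subseteq> B \<and> y \<notin> N}"
      have "y \<noteq> \<zero>\<^bsub>M\<^esub>"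
        using gen[OF submodule_zero] z_proper by auto
      have "\<exists>N\<in>?\<F>. \<forall>X\<in>?\<F>. N \<subseteq> X \<longrightarrow> X = N"
      proof (rule subset_Zorn_nonempty)
        show "?\<F> \<noteq> {}" using \<open>y \<noteq> \<zero>\<^bsub>M\<^esub>\<close> submodule_zero z_proper by blast
        fix \<C> assume C: "\<C> \<noteq> {}" "subset.chain ?\<F> \<C>"
        then have "submodule (\<Union>\<C>) R M"
          by (rule submodule_Union_chain) simp
        then show "\<Union>\<C> \<in> ?\<F>" using C unfolding subset_chain_def by auto
      qed
      then obtain N where "N \<in> ?\<F>" and max': "\<forall>X\<in>?\<F>. N \<subseteq> X \<longrightarrow> X = N" ..
      then have N: "submodule N R M" "N \<subseteq> B" "y \<notin> N" by auto
      have max: "X = N" if "submodule X R M" "X \<subseteq> B" "y \<notin> X" "N \<subseteq> X" for X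
        using max'[rule_format, of X] that by simp
      have "covers R M N B"
        unfolding covers_def
      proof (intro conjI notI)
        show "N \<subset> B" using N y by blast
        assume "\<exists>L. submodule L R M \<and> N \<subset> L \<and> L \<subset> B"
        then obtain L where L: "submodule L R M" "N \<subset> L" "L \<subset> B" by blast
        then have "y \<notin> L" using gen[OF L(1)] by blast
        then show False using max[OF L(1)] L by blast
      qed
      then show False using nocov[OF N(1)] by blast
    qed
    then show ?thesis using orb_le[OF y] by blast
  qed
  have cyc_noeth: "noetherian R M ((\<lambda>r. r \<odot>\<^bsub>M\<^esub> y) ` carrier R)" if "y \<in> B" for y
    by (rule min[OF orb_sub[OF that carR] cyc[OF that]])
  define ann where "ann F = {r \<in> carrier R. \<forall>y\<in>F. r \<odot>\<^bsub>M\<^esub> y = \<zero>\<^bsub>M\<^esub>}" for F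
  have ann_sub: "submodule (ann F) R ?reg" if F: "F \<subseteq> B" for F
  proof -
    have "y \<in> carrier M" if "y \<in> F" for y using Bc F that by blast
    then show ?thesis
      by (intro reg.submoduleI) (auto simp: ann_def regular_module_def lsmult_l_distr lsmult_assoc)
  qed
  let ?\<A> = "{ann F | F. finite F \<and> F \<subseteq> B}"
  have "\<exists>P\<in>?\<A>. \<forall>Y\<in>?\<A>. Y \<subseteq> P \<longrightarrow> Y = P"
    by (rule reg.artinian_minimal[OF artR]) (use ann_sub in \<open>auto simp: ann_def\<close>)
  then obtain P where P: "P \<in> ?\<A>" "\<forall>Y\<in>?\<A>. Y \<subseteq> P \<longrightarrow> Y = P" ..
  from P(1) obtain F where F: "finite F" "F \<subseteq> B" "P = ann F" by blast
  have Fmin: "\<forall>Y\<in>?\<A>. Y \<subseteq> ann F \<longrightarrow> Y = ann F" using P(2) unfolding F(3) .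
  \<comment> \<open>The annihilator of F is minimal among those of finite subsets, so adding any y
    to F does not change it.\<close>
  have annF: "r \<odot>\<^bsub>M\<^esub> y = \<zero>\<^bsub>M\<^esub>" if "r \<in> ann F" "y \<in> B" for r y
  proof -
    have "ann (insert y F) \<in> ?\<A>" using F that by blast
    moreover have "ann (insert y F) \<subseteq> ann F" by (auto simp: ann_def)
    ultimately have "ann (insert y F) = ann F" using Fmin by blast
    then show ?thesis using that by (auto simp: ann_def)
  qed
  obtain xs where xs: "set xs = F" using F finite_list by blast
  \<comment> \<open>R / ann F embeds into the product of the cyclic modules R y with y in F, and
    these are noetherian as proper submodules of B.\<close>
  have accR: "\<exists>m. \<forall>k\<ge>m. f k = f m"
    if f: "\<And>k. submodule (f k) R ?reg" "\<And>k. ann F \<subseteq> f k" "\<And>k. f k \<subseteq> f (Suc k)"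
    for f :: "nat \<Rightarrow> 'r set"
  proof -
    have xsB: "xs ! i \<in> B" if "i < length xs" for i using that xs F by auto
    have e: "orbit_map (xs ! i) \<in> mod_hom R ?reg M" if "i < length xs" for i
      by (rule orbit_map_hom) (use Bc xsB that in auto)
    have fc: "f k \<subseteq> carrier R" for k by (rule left_ideal_subset) (rule f)
    show ?thesis
    proof (rule filtration_stationary[OF reg M e f(1)])
      show "(\<forall>k. f k \<subseteq> f (Suc k)) \<or> (\<forall>k. f (Suc k) \<subseteq> f k)" using f by blast
    next
      fix k l r
      assume r: "r \<in> f k" "\<And>i. i < length xs \<Longrightarrow> orbit_map (xs ! i) r = \<zero>\<^bsub>M\<^esub>"
      then have "r \<in> carrier R" using fc by blast
      then have "r \<in> ann F" using r by (auto simp: ann_def xs[symmetric] in_set_conv_nth orbit_map_def)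
      then show "r \<in> f l" using f by blast
    next
      fix i assume i: "i < length xs"
      have piece: "submodule (filtration_piece ?reg M (\<lambda>i. orbit_map (xs ! i)) i (f k)) R M" for k
        by (rule filtration_piece_submodule[OF reg M _ f(1)]) (use i e in auto)
      show "\<exists>m. \<forall>k\<ge>m. filtration_piece ?reg M (\<lambda>i. orbit_map (xs ! i)) i (f k)
          = filtration_piece ?reg M (\<lambda>i. orbit_map (xs ! i)) i (f m)"
      proof (rule noetherianD[OF cyc_noeth[OF xsB[OF i]] piece])
        fix k
        show "filtration_piece ?reg M (\<lambda>i. orbit_map (xs ! i)) i (f k) \<subseteq> (\<lambda>r. r \<odot>\<^bsub>M\<^esub> (xs ! i)) ` carrier R"
          using fc[of k] by (auto simp: filtration_piece_def orbit_map_def)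
        show "filtration_piece ?reg M (\<lambda>i. orbit_map (xs ! i)) i (f k)
            \<subseteq> filtration_piece ?reg M (\<lambda>i. orbit_map (xs ! i)) i (f (Suc k))"
          by (rule filtration_piece_mono) (rule f(3))
      qed
    qed
  qed
  define IB where "IB I = mod_span R M {r \<odot>\<^bsub>M\<^esub> y | r y. r \<in> I \<and> y \<in> B}" for I
  have IB_sub: "submodule (IB I) R M" if "I \<subseteq> carrier R" for I
    unfolding IB_def using that Bc by (intro mod_span_submodule) (auto intro: lsmult_closed)
  have IB_incl: "r \<odot>\<^bsub>M\<^esub> y \<in> IB I" if "r \<in> I" "y \<in> B" for r y I
    unfolding IB_def using that by (intro subsetD[OF mod_span_incl]) auto
  have IB_least: "IB I \<subseteq> N" if "submodule N R M" "\<And>r y. \<lbrakk>r \<in> I; y \<in> B\<rbrakk> \<Longrightarrow> r \<odot>\<^bsub>M\<^esub> y \<in> N" for I N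
    unfolding IB_def using that by (intro mod_span_least) auto
  have IB_B: "IB I \<subseteq> B" if "I \<subseteq> carrier R" for I
    using that submodule_smult_closed[OF B(1)] by (intro IB_least B(1)) auto
  let ?\<L> = "{L. submodule L R ?reg \<and> ann F \<subseteq> L \<and> IB L \<noteq> B}"
  define \<L> where "\<L> = ?\<L>"
  \<comment> \<open>Maximality is taken from \<open>accR\<close> and not from Zorn's lemma: for a
    union of a chain of ideals L the product with B may be B although no single L B is. The family
    is nonempty because \<open>ann F\<close> kills B.\<close>
  have "\<exists>L\<in>\<L>. \<forall>Y\<in>\<L>. L \<subseteq> Y \<longrightarrow> Y = L"
  proof (rule ccontr)
    assume no: "\<not> ?thesis"
    then have step: "\<exists>Y. Y \<in> \<L> \<and> L \<subset> Y" if "L \<in> \<L>" for L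
      using that by blast
    have "IB (ann F) \<subseteq> {\<zero>\<^bsub>M\<^esub>}" using annF by (intro IB_least submodule_zero) auto
    then have "ann F \<in> \<L>" unfolding \<L>_def using z_proper ann_sub[OF F(2)] by auto
    then have "\<exists>f. \<forall>k::nat. f k \<in> \<L> \<and> f k \<subset> f (Suc k)"
      using step by (intro dependent_nat_choice) auto
    then obtain f where f: "\<And>k::nat. f k \<in> \<L>" "\<And>k. f k \<subset> f (Suc k)" by blast
    have "submodule (f k) R ?reg" "ann F \<subseteq> f k" for k
      using f(1)[of k] by (simp_all add: \<L>_def)
    then have "\<exists>m. \<forall>k\<ge>m. f k = f m"
      by (intro accR psubset_imp_subset[OF f(2)])
    then obtain m where "\<forall>k\<ge>m. f k = f m" ..
    from this[rule_format, of "Suc m"] have "f (Suc m) = f m" by (simp only: le_SucI[OF order_refl])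
    then show False using f(2) by blast
  qed
  then obtain L where "L \<in> \<L>" and Lmax': "\<forall>Y\<in>\<L>. L \<subseteq> Y \<longrightarrow> Y = L" ..
  then have L: "submodule L R ?reg" "ann F \<subseteq> L" "IB L \<noteq> B" by (auto simp: \<L>_def)
  have Lmax: "Y = L" if "submodule Y R ?reg" "ann F \<subseteq> Y" "IB Y \<noteq> B" "L \<subseteq> Y" for Y
    using Lmax'[rule_format, of Y] that by (simp add: \<L>_def)
  have Lc: "L \<subseteq> carrier R" by (rule left_ideal_subset) (rule L)
  have "IB (carrier R) = B"
  proof
    show "B \<subseteq> IB (carrier R)"
      using IB_incl[of "\<one>\<^bsub>R\<^esub>" "carrier R"] Bc lsmult_one by force
  qed (rule IB_B, simp)
  then have "L \<noteq> carrier R" using L by auto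
  let ?\<I> = "{I. submodule I R ?reg \<and> L \<subset> I}"
  have "\<exists>I\<in>?\<I>. \<forall>Y\<in>?\<I>. Y \<subseteq> I \<longrightarrow> Y = I"
    by (rule reg.artinian_minimal[OF artR])
      (use carR \<open>L \<noteq> carrier R\<close> Lc left_ideal_subset in \<open>auto simp: psubset_eq\<close>)
  then obtain I where "I \<in> ?\<I>" and Imin': "\<forall>Y\<in>?\<I>. Y \<subseteq> I \<longrightarrow> Y = I" ..
  then have I: "submodule I R ?reg" "L \<subset> I" by auto
  have Imin: "Y = I" if "submodule Y R ?reg" "L \<subset> Y" "Y \<subseteq> I" for Y
    using Imin'[rule_format, of Y] that by simp
  have Ic: "I \<subseteq> carrier R" by (rule left_ideal_subset) (rule I)
  \<comment> \<open>I is properly larger than L, which is maximal among the ideals above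
    \<open>ann F\<close> whose product with B is proper.\<close>
  have IBI: "IB I = B"
    using Lmax[OF I(1)] I L by blast
  define N0 where "N0 = IB L"
  have N0: "submodule N0 R M" "N0 \<subset> B"
    using IB_sub[OF Lc] IB_B[OF Lc] L(3) by (auto simp: N0_def)
  \<comment> \<open>Modulo N0 = L B the map r -> r y from I kills L, so T y / N0 is a quotient of
    the simple module I / L.\<close>
  define T where "T y = submodule_sum M ((\<lambda>r. r \<odot>\<^bsub>M\<^esub> y) ` I) N0" for y
  have T_sub: "submodule (T y) R M" if "y \<in> B" for y
    unfolding T_def by (rule submodule_submodule_sum[OF orb_sub[OF that I(1)] N0(1)])
  have T_B: "T y \<subset> B" if "y \<in> B" for y
    unfolding T_def using cyc[OF that] Ic by (intro sum_proper orb_sub that I N0) blast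
  have T_incl: "N0 \<subseteq> T y" "(\<lambda>r. r \<odot>\<^bsub>M\<^esub> y) ` I \<subseteq> T y" if "y \<in> B" for y
    unfolding T_def using submodule_sum_right[OF orb_sub[OF that I(1)] N0(1)]
      submodule_sum_left[OF orb_sub[OF that I(1)] N0(1)] by auto
  have T_simple: "Y \<subseteq> N0 \<or> (\<lambda>r. r \<odot>\<^bsub>M\<^esub> y) ` I \<subseteq> Y"
    if y: "y \<in> B" and Y: "submodule Y R M" "N0 \<subseteq> Y" "Y \<subseteq> T y" for Y y
  proof -
    let ?J = "{r \<in> I. r \<odot>\<^bsub>M\<^esub> y \<in> Y}"
    have J: "submodule ?J R ?reg"
      by (rule submodule_restrict_coefficients[OF Y(1) Bc[OF y] I(1)])
    have "L \<subseteq> ?J" using I IB_incl[OF _ y, of _ L] Y by (auto simp: N0_def)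
    then consider "?J = L" | "?J = I" using Imin[OF J] by blast
    then show ?thesis
    proof cases
      case 1
      have "w \<in> N0" if w: "w \<in> Y" for w
      proof -
        obtain r z where rz: "r \<in> I" "z \<in> N0" "w = r \<odot>\<^bsub>M\<^esub> y \<oplus>\<^bsub>M\<^esub> z"
          using w Y unfolding T_def submodule_sum_def by blast
        have c: "r \<odot>\<^bsub>M\<^esub> y \<in> carrier M" "z \<in> carrier M"
          using rz Ic Bc[OF y] submodule_in_carrier[OF N0(1)] lsmult_closed by auto
        have "w \<ominus>\<^bsub>M\<^esub> z \<in> Y" using w rz(2) Y(2) by (intro submodule_minus_closed[OF Y(1)]) auto
        then have "r \<odot>\<^bsub>M\<^esub> y \<in> Y" using rz c add_minus_cancel(1) by simp
        then have "r \<in> L" using rz 1 by blast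
        then have "r \<odot>\<^bsub>M\<^esub> y \<in> N0" using IB_incl[OF _ y] by (simp add: N0_def)
        then show ?thesis using rz submodule_add_closed[OF N0(1)] by simp
      qed
      then show ?thesis by blast
    qed blast
  qed
  have "\<exists>y\<in>B. \<not> (\<lambda>r. r \<odot>\<^bsub>M\<^esub> y) ` I \<subseteq> N0"
  proof (rule ccontr)
    assume "\<not> ?thesis"
    then have "IB I \<subseteq> N0" by (intro IB_least N0) blast
    then show False using IBI N0 by blast
  qed
  then obtain y0 where y0: "y0 \<in> B" "\<not> (\<lambda>r. r \<odot>\<^bsub>M\<^esub> y0) ` I \<subseteq> N0" by blast
  \<comment> \<open>N is meant to be a complement of T y0 modulo N0. Since B is not a sum of two
    proper submodules, N + T y0 is proper. Then some I y lies outside of it, and N + T y is a larger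
    candidate, against maximality.\<close>
  let ?\<N> = "{N. submodule N R M \<and> N0 \<subseteq> N \<and> N \<subseteq> B \<and> N \<inter> T y0 \<subseteq> N0}"
  have "\<exists>N\<in>?\<N>. \<forall>X\<in>?\<N>. N \<subseteq> X \<longrightarrow> X = N"
  proof (rule subset_Zorn_nonempty)
    show "?\<N> \<noteq> {}" using N0 by blast
    fix \<C> assume C: "\<C> \<noteq> {}" "subset.chain ?\<N> \<C>"
    then have sub: "submodule (\<Union>\<C>) R M"
      by (rule submodule_Union_chain) simp
    have CN: "N0 \<subseteq> X \<and> X \<subseteq> B \<and> X \<inter> T y0 \<subseteq> N0" if "X \<in> \<C>" for X
      using subsetD[OF subset.chain_def[THEN iffD1, OF C(2), THEN conjunct1] that] by simp
    obtain X0 where "X0 \<in> \<C>" using C(1) by blast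
    with CN[of X0] have "N0 \<subseteq> \<Union>\<C>" by blast
    moreover have "\<Union>\<C> \<subseteq> B" "\<Union>\<C> \<inter> T y0 \<subseteq> N0" using CN by auto
    ultimately show "\<Union>\<C> \<in> ?\<N>" using sub by simp
  qed
  then obtain N where "N \<in> ?\<N>" and Nmax': "\<forall>X\<in>?\<N>. N \<subseteq> X \<longrightarrow> X = N" ..
  then have N: "submodule N R M" "N0 \<subseteq> N" "N \<subseteq> B" "N \<inter> T y0 \<subseteq> N0" by auto
  have Nmax: "X = N" if "submodule X R M" "N0 \<subseteq> X" "X \<subseteq> B" "X \<inter> T y0 \<subseteq> N0" "N \<subseteq> X" for X
    using Nmax'[rule_format, of X] that by simp
  have NT: "submodule (submodule_sum M N (T y0)) R M"
    by (rule submodule_submodule_sum[OF N(1) T_sub[OF y0(1)]])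
  have NTl: "N \<subseteq> submodule_sum M N (T y0)" and NTr: "T y0 \<subseteq> submodule_sum M N (T y0)"
    using submodule_sum_left[OF N(1) T_sub[OF y0(1)]] submodule_sum_right[OF N(1) T_sub[OF y0(1)]] by auto
  have "N \<noteq> B" using N(4) T_B[OF y0(1)] T_incl[OF y0(1)] y0(2) by blast
  then have "submodule_sum M N (T y0) \<subset> B"
    using N T_B y0 T_sub by (intro sum_proper) auto
  have "\<exists>y\<in>B. \<not> (\<lambda>r. r \<odot>\<^bsub>M\<^esub> y) ` I \<subseteq> submodule_sum M N (T y0)"
  proof (rule ccontr)
    assume "\<not> ?thesis"
    then have "IB I \<subseteq> submodule_sum M N (T y0)" by (intro IB_least NT) blast
    then show False using IBI \<open>submodule_sum M N (T y0) \<subset> B\<close> by blast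
  qed
  then obtain y where y: "y \<in> B" "\<not> (\<lambda>r. r \<odot>\<^bsub>M\<^esub> y) ` I \<subseteq> submodule_sum M N (T y0)" by blast
  \<comment> \<open>T y / N0 is simple and T y is not contained in N + T y0, so the two meet only in
    N0.\<close>
  have int: "T y \<inter> submodule_sum M N (T y0) \<subseteq> N0"
    using T_simple[OF y(1) submodule_Int[OF T_sub[OF y(1)] NT]] y T_incl[OF y(1)] N NTl by blast
  define X where "X = submodule_sum M N (T y)"
  have X: "submodule X R M" "N \<subseteq> X" "T y \<subseteq> X"
    unfolding X_def using submodule_submodule_sum[OF N(1) T_sub[OF y(1)]]
      submodule_sum_left[OF N(1) T_sub[OF y(1)]] submodule_sum_right[OF N(1) T_sub[OF y(1)]] by auto
  have "X \<inter> T y0 \<subseteq> N0"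
  proof
    fix t assume t: "t \<in> X \<inter> T y0"
    then obtain a b where ab: "a \<in> N" "b \<in> T y" "t = a \<oplus>\<^bsub>M\<^esub> b"
      unfolding X_def submodule_sum_def by blast
    have c: "a \<in> carrier M" "b \<in> carrier M"
      using ab submodule_in_carrier[OF N(1)] submodule_in_carrier[OF T_sub[OF y(1)]] by auto
    have "t \<ominus>\<^bsub>M\<^esub> a \<in> submodule_sum M N (T y0)"
      using t ab NTl NTr by (intro submodule_minus_closed[OF NT]) auto
    then have "b \<in> N0" using ab c int by (auto simp: add_minus_cancel)
    then have "t \<in> N" using ab N submodule_add_closed[OF N(1)] by auto
    then show "t \<in> N0" using t N by blast
  qed
  moreover have "X \<subseteq> B"
    unfolding X_def using N T_B[OF y(1)] by (intro submodule_sum_least B) auto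
  ultimately have "X = N" using X N by (intro Nmax) auto
  then show False using X y T_incl[OF y(1)] NTl by blast
qed

end

section \<open>Tensor products\<close>

text \<open>The homomorphism of free groups that \<open>tensor_map\<close> applies to
  representatives.\<close>

definition frag_map :: "('n \<Rightarrow> 'p) \<Rightarrow> ('m \<times> 'n \<Rightarrow>\<^sub>0 int) \<Rightarrow> ('m \<times> 'p \<Rightarrow>\<^sub>0 int)" where
  "frag_map f = frag_extend (\<lambda>(x, y). frag_of (x, f y))"

lemma frag_map_simps [simp]:
  "frag_map f 0 = 0" "frag_map f (a + b) = frag_map f a + frag_map f b"
  "frag_map f (a - b) = frag_map f a - frag_map f b" "frag_map f (- a) = - frag_map f a"
  "frag_map f (frag_of (x, y)) = frag_of (x, f y)"
  by (simp_all add: frag_map_def frag_extend_add frag_extend_diff frag_extend_minus)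

lemma keys_frag_add: "\<lbrakk>Poly_Mapping.keys a \<subseteq> X; Poly_Mapping.keys b \<subseteq> X\<rbrakk> \<Longrightarrow> Poly_Mapping.keys (a + b) \<subseteq> X"
  using keys_add[of a b] by blast

lemma keys_frag_diff: "\<lbrakk>Poly_Mapping.keys a \<subseteq> X; Poly_Mapping.keys b \<subseteq> X\<rbrakk> \<Longrightarrow> Poly_Mapping.keys (a - b) \<subseteq> X"
  using keys_diff[of a b] by blast

lemma keys_frag_of_diff [simp]:
  "\<lbrakk>a \<in> X; b \<in> X\<rbrakk> \<Longrightarrow> Poly_Mapping.keys (frag_of a - frag_of b) \<subseteq> X"
  "\<lbrakk>a \<in> X; b \<in> X; c \<in> X\<rbrakk> \<Longrightarrow> Poly_Mapping.keys (frag_of a - frag_of b - frag_of c) \<subseteq> X"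
  by (intro keys_frag_diff; simp)+

lemma keys_frag_map:
  assumes "Poly_Mapping.keys z \<subseteq> X \<times> Y" "f \<in> Y \<rightarrow> Z"
  shows "Poly_Mapping.keys (frag_map f z) \<subseteq> X \<times> Z"
  using assms(1)
proof (rule free_Abelian_group_induct)
  fix a assume "a \<in> X \<times> Y"
  then show "Poly_Mapping.keys (frag_map f (frag_of a)) \<subseteq> X \<times> Z"
    using assms(2) by (cases a) auto
qed (auto intro: keys_frag_diff simp: keys_frag_diff)

context
  fixes R :: "('r, 'd) ring_scheme" and M :: "('r, 'm) module" and N :: "('r, 'n) module"
  assumes M: "right_module R M" and N: "left_module R N"
begin

interpretation M: left_module "opp R" M by (rule M)
interpretation N: left_module R N by (rule N)

abbreviation (input) Rel where "Rel \<equiv> tensor_relations R M N"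
abbreviation (input) Free where "Free \<equiv> free_Abelian_group (carrier M \<times> carrier N)"

lemma M_smult_closed: "\<lbrakk>r \<in> carrier R; x \<in> carrier M\<rbrakk> \<Longrightarrow> r \<odot>\<^bsub>M\<^esub> x \<in> carrier M"
  using M.lsmult_closed by simp

text \<open>The bounds on the keys are carried through the induction, because a homomorphism on the
  free group is only controlled on its carrier.\<close>

lemma tensor_relations_induct [consumes 1, case_names zero left right balanced add uminus]:
  assumes "z \<in> Rel" and "P 0"
    and "\<And>x x' y. \<lbrakk>x \<in> carrier M; x' \<in> carrier M; y \<in> carrier N\<rbrakk> \<Longrightarrow>
      P (frag_of (x \<oplus>\<^bsub>M\<^esub> x', y) - frag_of (x, y) - frag_of (x', y))"
    and "\<And>x y y'. \<lbrakk>x \<in> carrier M; y \<in> carrier N; y' \<in> carrier N\<rbrakk> \<Longrightarrow>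
      P (frag_of (x, y \<oplus>\<^bsub>N\<^esub> y') - frag_of (x, y) - frag_of (x, y'))"
    and "\<And>r x y. \<lbrakk>r \<in> carrier R; x \<in> carrier M; y \<in> carrier N\<rbrakk> \<Longrightarrow>
      P (frag_of (r \<odot>\<^bsub>M\<^esub> x, y) - frag_of (x, r \<odot>\<^bsub>N\<^esub> y))"
    and add: "\<And>z w. \<lbrakk>Poly_Mapping.keys z \<subseteq> carrier M \<times> carrier N; Poly_Mapping.keys w \<subseteq> carrier M \<times> carrier N;
      P z; P w\<rbrakk> \<Longrightarrow> P (z + w)"
    and uminus: "\<And>z. \<lbrakk>Poly_Mapping.keys z \<subseteq> carrier M \<times> carrier N; P z\<rbrakk> \<Longrightarrow> P (- z)"
  shows "P z"
proof -
  let ?G = "{frag_of (x \<oplus>\<^bsub>M\<^esub> x', y) - frag_of (x, y) - frag_of (x', y) | x x' y.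
         x \<in> carrier M \<and> x' \<in> carrier M \<and> y \<in> carrier N} \<union>
      {frag_of (x, y \<oplus>\<^bsub>N\<^esub> y') - frag_of (x, y) - frag_of (x, y') | x y y'.
         x \<in> carrier M \<and> y \<in> carrier N \<and> y' \<in> carrier N} \<union>
      {frag_of (r \<odot>\<^bsub>M\<^esub> x, y) - frag_of (x, r \<odot>\<^bsub>N\<^esub> y) | r x y.
         r \<in> carrier R \<and> x \<in> carrier M \<and> y \<in> carrier N}"
  have G: "Poly_Mapping.keys g \<subseteq> carrier M \<times> carrier N \<and> P g" if "g \<in> ?G" for g
    using that
  proof (elim UnE CollectE exE conjE)
  qed (simp_all add: assms(3-5) M_smult_closed N.lsmult_closed)
  have "Poly_Mapping.keys z \<subseteq> carrier M \<times> carrier N \<and> P z"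
    using assms(1) unfolding tensor_relations_def
  proof (induction z rule: generate.induct)
    case one
    show ?case using assms(2) by simp
  next
    case (incl h)
    then show ?case by (rule G)
  next
    case (inv h)
    then show ?case using G[OF inv] uminus by simp
  next
    case (eng h1 h2)
    then show ?case by (simp add: add keys_frag_add)
  qed
  then show ?thesis ..
qed

lemma tensor_relations_keys:
  assumes "z \<in> Rel"
  shows "Poly_Mapping.keys z \<subseteq> carrier M \<times> carrier N"
  using assms
  by (induction z rule: tensor_relations_induct)
    (simp_all add: M_smult_closed N.lsmult_closed keys_frag_add)

lemma tensor_left:
  "\<lbrakk>x \<in> carrier M; x' \<in> carrier M; y \<in> carrier N\<rbrakk> \<Longrightarrow>
    frag_of (x \<oplus>\<^bsub>M\<^esub> x', y) - frag_of (x, y) - frag_of (x', y) \<in> Rel"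
  unfolding tensor_relations_def by (rule generate.incl) blast

lemma tensor_right:
  "\<lbrakk>x \<in> carrier M; y \<in> carrier N; y' \<in> carrier N\<rbrakk> \<Longrightarrow>
    frag_of (x, y \<oplus>\<^bsub>N\<^esub> y') - frag_of (x, y) - frag_of (x, y') \<in> Rel"
  unfolding tensor_relations_def by (rule generate.incl) blast

lemma tensor_balanced:
  "\<lbrakk>r \<in> carrier R; x \<in> carrier M; y \<in> carrier N\<rbrakk> \<Longrightarrow>
    frag_of (r \<odot>\<^bsub>M\<^esub> x, y) - frag_of (x, r \<odot>\<^bsub>N\<^esub> y) \<in> Rel"
  unfolding tensor_relations_def by (rule generate.incl) blast

lemma tensor_subgroup: "subgroup Rel Free"
  unfolding tensor_relations_def
proof (rule group.generate_is_subgroup[OF group_free_Abelian_group], rule subsetI)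
  fix g assume "g \<in> {frag_of (x \<oplus>\<^bsub>M\<^esub> x', y) - frag_of (x, y) - frag_of (x', y) | x x' y.
         x \<in> carrier M \<and> x' \<in> carrier M \<and> y \<in> carrier N} \<union>
      {frag_of (x, y \<oplus>\<^bsub>N\<^esub> y') - frag_of (x, y) - frag_of (x, y') | x y y'.
         x \<in> carrier M \<and> y \<in> carrier N \<and> y' \<in> carrier N} \<union>
      {frag_of (r \<odot>\<^bsub>M\<^esub> x, y) - frag_of (x, r \<odot>\<^bsub>N\<^esub> y) | r x y.
         r \<in> carrier R \<and> x \<in> carrier M \<and> y \<in> carrier N}"
  then have "g \<in> Rel"
    unfolding tensor_relations_def by (rule generate.incl)
  then show "g \<in> carrier Free" using tensor_relations_keys by simp
qed

lemma tensor_zero: "0 \<in> Rel"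
  using subgroup.one_closed[OF tensor_subgroup] by simp

lemma tensor_add: "\<lbrakk>z \<in> Rel; w \<in> Rel\<rbrakk> \<Longrightarrow> z + w \<in> Rel"
  using subgroup.m_closed[OF tensor_subgroup, of z w] by simp

lemma tensor_uminus:
  assumes "z \<in> Rel"
  shows "- z \<in> Rel"
  using subgroup.m_inv_closed[OF tensor_subgroup assms] tensor_relations_keys[OF assms] by simp

lemma tensor_diff: "\<lbrakk>z \<in> Rel; w \<in> Rel\<rbrakk> \<Longrightarrow> z - w \<in> Rel"
  using tensor_add[of z "- w"] tensor_uminus[of w] by simp

lemma tensor_add_cancel: "z \<in> Rel \<Longrightarrow> z + w \<in> Rel \<longleftrightarrow> w \<in> Rel"
  using tensor_add[of z w] tensor_diff[of "z + w" z] by auto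

text \<open>The form in which tensors are compared: a calculation passes from one representative to
  a congruent one.\<close>

lemma tensor_diff_cancel: "z - w \<in> Rel \<Longrightarrow> z \<in> Rel \<longleftrightarrow> w \<in> Rel"
  using tensor_add[of "z - w" w] tensor_diff[of z "z - w"] by auto

lemma tensor_zero_right:
  assumes "x \<in> carrier M"
  shows "frag_of (x, \<zero>\<^bsub>N\<^esub>) \<in> Rel"
  using tensor_uminus[OF tensor_right[OF assms N.M.zero_closed N.M.zero_closed]] by simp

lemma tensor_inverse_right:
  assumes "x \<in> carrier M" "y \<in> carrier N"
  shows "frag_of (x, y) + frag_of (x, \<ominus>\<^bsub>N\<^esub> y) \<in> Rel"
proof -
  have "frag_of (x, \<zero>\<^bsub>N\<^esub>) - frag_of (x, y) - frag_of (x, \<ominus>\<^bsub>N\<^esub> y) \<in> Rel"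
    using tensor_right[OF assms(1,2), of "\<ominus>\<^bsub>N\<^esub> y"] assms by (simp add: N.M.r_neg)
  from tensor_diff[OF tensor_zero_right[OF assms(1)] this] show ?thesis by (simp add: add.commute)
qed

lemma mem_tensor_class: "v \<in> tensor_class R M N u \<longleftrightarrow> v - u \<in> Rel"
  unfolding tensor_class_def r_coset_def
  by (auto simp: algebra_simps) (metis add.commute diff_add_cancel)

lemma tensor_class_eq:
  assumes z: "Poly_Mapping.keys z \<subseteq> carrier M \<times> carrier N" and w: "Poly_Mapping.keys w \<subseteq> carrier M \<times> carrier N"
  shows "tensor_class R M N z = tensor_class R M N w \<longleftrightarrow> z - w \<in> Rel"
proof -
  note mem = mem_tensor_class
  show ?thesis
  proof
    assume "tensor_class R M N z = tensor_class R M N w"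
    moreover have "z \<in> tensor_class R M N z" using mem tensor_zero by simp
    ultimately show "z - w \<in> Rel" using mem by simp
  next
    assume "z - w \<in> Rel"
    then have "v - z \<in> Rel \<longleftrightarrow> v - w \<in> Rel" for v
      using tensor_add_cancel[of "z - w" "v - z"] by simp
    then show "tensor_class R M N z = tensor_class R M N w" using mem by blast
  qed
qed

lemma tensor_product_carrier:
  "carrier (tensor_product R M N) =
    tensor_class R M N ` {z. Poly_Mapping.keys z \<subseteq> carrier M \<times> carrier N}"
  unfolding tensor_product_def FactGroup_def RCOSETS_def tensor_class_def by auto

text \<open>A plain list without coefficients suffices, because a minus sign can be absorbed into
  the second factor of an elementary tensor.\<close>

lemma tensor_representation:
  assumes "Poly_Mapping.keys z \<subseteq> carrier M \<times> carrier N"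
  shows "\<exists>xs. set xs \<subseteq> carrier M \<times> carrier N \<and> z - sum_list (map frag_of xs) \<in> Rel"
  using assms
proof (induction z rule: free_Abelian_group_induct[consumes 1, case_names 1 2 3])
  case 1
  show ?case by (rule exI[of _ "[]"]) (simp add: tensor_zero)
next
  case (2 z w)
  then obtain xs ys where xs: "set xs \<subseteq> carrier M \<times> carrier N" "z - sum_list (map frag_of xs) \<in> Rel"
    and ys: "set ys \<subseteq> carrier M \<times> carrier N" "w - sum_list (map frag_of ys) \<in> Rel" by blast
  define ys' where "ys' = map (\<lambda>(x, y). (x, \<ominus>\<^bsub>N\<^esub> y)) ys"
  have ys': "set ys' \<subseteq> carrier M \<times> carrier N \<and> sum_list (map frag_of ys) + sum_list (map frag_of ys') \<in> Rel"
    using ys(1) unfolding ys'_def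
  proof (induction ys)
    case (Cons p ys)
    obtain x y where p: "p = (x, y)" by fastforce
    let ?s = "sum_list (map frag_of ys)" and ?s' = "sum_list (map frag_of (map (\<lambda>(x, y). (x, \<ominus>\<^bsub>N\<^esub> y)) ys))"
    have "?s + ?s' \<in> Rel" "frag_of (x, y) + frag_of (x, \<ominus>\<^bsub>N\<^esub> y) \<in> Rel"
      using Cons p tensor_inverse_right by auto
    from tensor_add[OF this] show ?case using Cons p by (auto simp: algebra_simps)
  qed (simp add: tensor_zero)
  have "(z - sum_list (map frag_of xs)) - (w - sum_list (map frag_of ys))
      - (sum_list (map frag_of ys) + sum_list (map frag_of ys')) \<in> Rel"
    by (rule tensor_diff[OF tensor_diff[OF xs(2) ys(2)] conjunct2[OF ys']])
  then show ?case using xs ys' by (intro exI[of _ "xs @ ys'"]) (auto simp: algebra_simps)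
next
  case (3 a)
  then show ?case by (intro exI[of _ "[a]"]) (auto simp: tensor_zero)
qed

text \<open>The relations are only required modulo \<open>H\<close>, so that no quotient group has to be formed.\<close>

lemma tensor_universal:
  fixes G (structure)
  assumes G: "comm_group G"
    and b: "\<And>x y. \<lbrakk>x \<in> carrier M; y \<in> carrier N\<rbrakk> \<Longrightarrow> b x y \<in> carrier G" and H: "subgroup H G"
    and left: "\<And>x x' y. \<lbrakk>x \<in> carrier M; x' \<in> carrier M; y \<in> carrier N\<rbrakk> \<Longrightarrow>
      b (x \<oplus>\<^bsub>M\<^esub> x') y \<otimes> inv (b x y) \<otimes> inv (b x' y) \<in> H"
    and right: "\<And>x y y'. \<lbrakk>x \<in> carrier M; y \<in> carrier N; y' \<in> carrier N\<rbrakk> \<Longrightarrow>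
      b x (y \<oplus>\<^bsub>N\<^esub> y') \<otimes> inv (b x y) \<otimes> inv (b x y') \<in> H"
    and balanced: "\<And>r x y. \<lbrakk>r \<in> carrier R; x \<in> carrier M; y \<in> carrier N\<rbrakk> \<Longrightarrow>
      b (r \<odot>\<^bsub>M\<^esub> x) y \<otimes> inv (b x (r \<odot>\<^bsub>N\<^esub> y)) \<in> H"
  obtains h where "h \<in> hom Free G"
    "\<And>x y. \<lbrakk>x \<in> carrier M; y \<in> carrier N\<rbrakk> \<Longrightarrow> h (frag_of (x, y)) = b x y"
    "\<And>z. z \<in> Rel \<Longrightarrow> h z \<in> H"
proof -
  interpret G: comm_group G by (rule G)
  obtain h where h: "h \<in> hom Free G" "\<And>p. p \<in> carrier M \<times> carrier N \<Longrightarrow> h (frag_of p) = (\<lambda>(x, y). b x y) p"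
    by (rule G.free_Abelian_group_universal[of "\<lambda>(x, y). b x y" "carrier M \<times> carrier N"]) (use b in auto)
  interpret h: group_hom Free G h
    by (simp add: group_hom_def group_hom_axioms_def h(1) G.is_group)
  have hb: "h (frag_of (x, y)) = b x y" if "x \<in> carrier M" "y \<in> carrier N" for x y
    using h(2)[of "(x, y)"] that by simp
  have hminus: "h (- z) = inv (h z)" if "Poly_Mapping.keys z \<subseteq> carrier M \<times> carrier N" for z
    using h.hom_inv[of z] that by simp
  have hadd: "h (z + w) = h z \<otimes> h w"
    if "Poly_Mapping.keys z \<subseteq> carrier M \<times> carrier N" "Poly_Mapping.keys w \<subseteq> carrier M \<times> carrier N" for z w
    using h.hom_mult[of z w] that by simp
  have hdiff: "h (z - w) = h z \<otimes> inv (h w)"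
    if "Poly_Mapping.keys z \<subseteq> carrier M \<times> carrier N" "Poly_Mapping.keys w \<subseteq> carrier M \<times> carrier N" for z w
    using hadd[of z "- w"] hminus[of w] that by simp
  have "h z \<in> H" if "z \<in> Rel" for z
    using that
  proof (induction z rule: tensor_relations_induct)
    case zero
    then show ?case using h.hom_one subgroup.one_closed[OF H] by simp
  next
    case (left x x' y)
    then show ?case using assms(4)[of x x' y] by (simp add: hdiff hb keys_frag_diff)
  next
    case (right x y y')
    then show ?case using assms(5)[of x y y'] by (simp add: hdiff hb keys_frag_diff)
  next
    case (balanced r x y)
    then show ?case using assms(6)[of r x y] by (simp add: hdiff hb M_smult_closed N.lsmult_closed)
  next
    case (add z w)
    then show ?case using subgroup.m_closed[OF H] by (simp add: hadd)
  next
    case (uminus z)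
    then show ?case using subgroup.m_inv_closed[OF H] by (simp add: hminus)
  qed
  then show thesis using that h(1) hb by blast
qed

end

lemma tensor_map_relations:
  assumes M: "right_module R M" and N: "left_module R N" and N': "left_module R N'"
    and f: "f \<in> mod_hom R N N'" and z: "z \<in> tensor_relations R M N"
  shows "frag_map f z \<in> tensor_relations R M N'"
  using z
proof (induction z rule: tensor_relations_induct[OF M N, consumes 1,
    case_names zero left right balanced add uminus])
  case zero
  then show ?case by (simp add: tensor_zero[OF M N'])
next
  case (left x x' y)
  then show ?case using tensor_left[OF M N'] hom_closed[OF f] by simp
next
  case (right x y y')
  then show ?case using tensor_right[OF M N'] hom_closed[OF f] by (simp add: hom_add[OF f])
next
  case (balanced r x y)
  then show ?case using tensor_balanced[OF M N'] hom_closed[OF f] by (simp add: hom_smult[OF f])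
next
  case (add z w)
  then show ?case by (simp add: tensor_add[OF M N'])
next
  case (uminus z)
  then show ?case by (simp add: tensor_uminus[OF M N'])
qed

text \<open>All representatives of a coset have the same image class, so the set to which
  \<open>tensor_map\<close> applies \<open>the_elem\<close> is a singleton.\<close>

lemma tensor_map_class:
  assumes M: "right_module R M" and N: "left_module R N" and N': "left_module R N'"
    and f: "f \<in> mod_hom R N N'" and z: "Poly_Mapping.keys z \<subseteq> carrier M \<times> carrier N"
  shows "tensor_map R M N' f (tensor_class R M N z) = tensor_class R M N' (frag_map f z)"
proof -
  have "f \<in> carrier N \<rightarrow> carrier N'" using hom_closed[OF f] by auto
  note fk = keys_frag_map[OF _ this]
  have eq: "tensor_class R M N' (frag_map f w) = tensor_class R M N' (frag_map f z)"
    if w: "w \<in> tensor_class R M N z" for w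
  proof -
    have wz: "w - z \<in> tensor_relations R M N" using w mem_tensor_class[OF M N] by blast
    then have "Poly_Mapping.keys (w - z + z) \<subseteq> carrier M \<times> carrier N"
      using tensor_relations_keys[OF M N] z by (intro keys_frag_add) auto
    then have "Poly_Mapping.keys w \<subseteq> carrier M \<times> carrier N" by simp
    moreover have "frag_map f w - frag_map f z \<in> tensor_relations R M N'"
      using tensor_map_relations[OF M N N' f wz] by simp
    ultimately show ?thesis
      using z by (simp add: tensor_class_eq[OF M N'] fk)
  qed
  have "z \<in> tensor_class R M N z"
    using mem_tensor_class[OF M N] tensor_zero[OF M N] by simp
  then have "(\<lambda>_. tensor_class R M N' (frag_map f z)) ` tensor_class R M N z
      = {tensor_class R M N' (frag_map f z)}" by (rule image_constant)
  moreover have "(\<lambda>w. tensor_class R M N' (frag_map f w)) ` tensor_class R M N z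
      = (\<lambda>_. tensor_class R M N' (frag_map f z)) ` tensor_class R M N z"
    by (rule image_cong[OF refl]) (rule eq)
  ultimately have "(\<lambda>w. tensor_class R M N' (frag_map f w)) ` tensor_class R M N z
      = {tensor_class R M N' (frag_map f z)}" by (simp only:)
  then show ?thesis unfolding tensor_map_def frag_map_def by simp
qed

text \<open>Purity is used in this form: a homomorphism is injective iff its kernel is trivial, and
  the kernel is described by representatives instead of cosets.\<close>

lemma inj_on_tensor_map_iff:
  assumes M: "right_module R M" and N: "left_module R N" and N': "left_module R N'"
    and f: "f \<in> mod_hom R N N'"
  shows "inj_on (tensor_map R M N' f) (carrier (tensor_product R M N)) \<longleftrightarrow>
    (\<forall>z. Poly_Mapping.keys z \<subseteq> carrier M \<times> carrier N \<longrightarrow> frag_map f z \<in> tensor_relations R M N' \<longrightarrow>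
      z \<in> tensor_relations R M N)" (is "?L \<longleftrightarrow> ?R")
proof -
  have "f \<in> carrier N \<rightarrow> carrier N'" using hom_closed[OF f] by auto
  note fk = keys_frag_map[OF _ this]
  show ?thesis
  proof
    assume L: ?L
    show ?R
    proof (intro allI impI)
      fix z assume z: "Poly_Mapping.keys z \<subseteq> carrier M \<times> carrier N" "frag_map f z \<in> tensor_relations R M N'"
      have "tensor_map R M N' f (tensor_class R M N z) = tensor_map R M N' f (tensor_class R M N 0)"
        using z by (simp add: tensor_map_class[OF M N N' f] tensor_class_eq[OF M N'] fk)
      then have "tensor_class R M N z = tensor_class R M N 0"
        using z by (intro inj_onD[OF L]) (auto simp: tensor_product_carrier[OF M N])
      then show "z \<in> tensor_relations R M N" using tensor_class_eq[OF M N z(1), of 0] by simp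
    qed
  next
    assume R: ?R
    show ?L
    proof (rule inj_onI, unfold tensor_product_carrier[OF M N], elim imageE CollectE)
      fix Z W z w
      assume eq: "tensor_map R M N' f Z = tensor_map R M N' f W" "Z = tensor_class R M N z" "W = tensor_class R M N w"
        and zw: "Poly_Mapping.keys z \<subseteq> carrier M \<times> carrier N" "Poly_Mapping.keys w \<subseteq> carrier M \<times> carrier N"
      then have "frag_map f z - frag_map f w \<in> tensor_relations R M N'"
        by (simp add: tensor_map_class[OF M N N' f] tensor_class_eq[OF M N'] fk)
      then have "z - w \<in> tensor_relations R M N" using R zw keys_frag_diff[OF zw] by simp
      then show "Z = W" using eq zw by (simp add: tensor_class_eq[OF M N])
    qed
  qed
qed

lemma restrict_ext_eq_iff: "restrict f I = restrict g I \<longleftrightarrow> (\<forall>i\<in>I. f i = g i)"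
  by (auto simp: fun_eq_iff restrict_def)

lemma inj_on_tensor_power_map_iff:
  fixes M :: "('r, 'm) module" and C :: "('r, 'c) module" and I :: "'i set"
  assumes M: "right_module R M" and C: "left_module R C" and CI: "left_module R (product_module I (\<lambda>_. C))"
    and proj: "\<And>i. i \<in> I \<Longrightarrow> (\<lambda>x\<in>carrier (product_module I (\<lambda>_. C)). x i) \<in> mod_hom R (product_module I (\<lambda>_. C)) C"
  shows "inj_on (tensor_power_map R M C I) (carrier (tensor_product R M (product_module I (\<lambda>_. C)))) \<longleftrightarrow>
    (\<forall>z. Poly_Mapping.keys z \<subseteq> carrier M \<times> carrier (product_module I (\<lambda>_. C)) \<longrightarrow>
      (\<forall>i\<in>I. frag_map (\<lambda>x. x i) z \<in> tensor_relations R M C) \<longrightarrow>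
      z \<in> tensor_relations R M (product_module I (\<lambda>_. C)))" (is "?L \<longleftrightarrow> ?R")
proof -
  let ?P = "product_module I (\<lambda>_. C)"
  \<comment> \<open>The bare projection is not extensional and hence not in \<open>mod_hom\<close>.
    On the elements that occur in z it agrees with the restricted projection.\<close>
  have fr: "frag_map (\<lambda>x\<in>carrier ?P. x i) z = frag_map (\<lambda>x. x i) z"
    if "Poly_Mapping.keys z \<subseteq> carrier M \<times> carrier ?P" for z :: "'m \<times> ('i \<Rightarrow> 'c) \<Rightarrow>\<^sub>0 int" and i
    using that unfolding frag_map_def by (intro frag_extend_eq) auto
  have tm: "tensor_map R M C (\<lambda>x. x i) Z = tensor_map R M C (\<lambda>x\<in>carrier ?P. x i) Z"
    if Z: "Z = tensor_class R M ?P z" and z: "Poly_Mapping.keys z \<subseteq> carrier M \<times> carrier ?P" for Z z i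
  proof -
    have "Poly_Mapping.keys w \<subseteq> carrier M \<times> carrier ?P" if "w \<in> Z" for w
    proof -
      have "w - z \<in> tensor_relations R M ?P" using that Z mem_tensor_class[OF M CI] by blast
      then have "Poly_Mapping.keys (w - z + z) \<subseteq> carrier M \<times> carrier ?P"
        using tensor_relations_keys[OF M CI] z by (intro keys_frag_add) auto
      then show ?thesis by simp
    qed
    then have "(\<lambda>z. tensor_class R M C (frag_map (\<lambda>x. x i) z)) ` Z
        = (\<lambda>z. tensor_class R M C (frag_map (\<lambda>x\<in>carrier ?P. x i) z)) ` Z"
      using fr by (intro image_cong refl) metis
    then show ?thesis unfolding tensor_map_def frag_map_def by simp
  qed
  have cl: "tensor_map R M C (\<lambda>x. x i) (tensor_class R M ?P z) = tensor_class R M C (frag_map (\<lambda>x. x i) z)"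
    if "Poly_Mapping.keys z \<subseteq> carrier M \<times> carrier ?P" "i \<in> I" for z i
    using tm[OF refl that(1)] tensor_map_class[OF M CI C proj[OF that(2)] that(1)] fr[OF that(1)] by simp
  have fk: "Poly_Mapping.keys (frag_map (\<lambda>x. x i) z) \<subseteq> carrier M \<times> carrier C"
    if "Poly_Mapping.keys z \<subseteq> carrier M \<times> carrier ?P" "i \<in> I" for z :: "'m \<times> ('i \<Rightarrow> 'c) \<Rightarrow>\<^sub>0 int" and i
    by (rule keys_frag_map[OF that(1)]) (use that in \<open>auto simp: product_module_def\<close>)
  have eqI: "tensor_power_map R M C I (tensor_class R M ?P z) = tensor_power_map R M C I (tensor_class R M ?P w)
      \<longleftrightarrow> (\<forall>i\<in>I. frag_map (\<lambda>x. x i) (z - w) \<in> tensor_relations R M C)"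
    if z: "Poly_Mapping.keys z \<subseteq> carrier M \<times> carrier ?P" and w: "Poly_Mapping.keys w \<subseteq> carrier M \<times> carrier ?P" for z w
  proof -
    have "tensor_power_map R M C I (tensor_class R M ?P z) = tensor_power_map R M C I (tensor_class R M ?P w)
      \<longleftrightarrow> (\<forall>i\<in>I. tensor_class R M C (frag_map (\<lambda>x. x i) z) = tensor_class R M C (frag_map (\<lambda>x. x i) w))"
      unfolding tensor_power_map_def
      by (subst restrict_ext_eq_iff) (use cl z w in simp)
    then show ?thesis using fk z w by (simp add: tensor_class_eq[OF M C])
  qed
  show ?thesis
  proof
    assume L: ?L
    show ?R
    proof (intro allI impI)
      fix z assume z: "Poly_Mapping.keys z \<subseteq> carrier M \<times> carrier ?P" "\<forall>i\<in>I. frag_map (\<lambda>x. x i) z \<in> tensor_relations R M C"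
      have "tensor_class R M ?P z = tensor_class R M ?P 0"
        using z eqI[OF z(1), of 0] by (intro inj_onD[OF L]) (auto simp: tensor_product_carrier[OF M CI])
      then show "z \<in> tensor_relations R M ?P" using tensor_class_eq[OF M CI z(1), of 0] by simp
    qed
  next
    assume R: ?R
    show ?L
    proof (rule inj_onI, unfold tensor_product_carrier[OF M CI], elim imageE CollectE)
      fix Z W z w
      assume eq: "tensor_power_map R M C I Z = tensor_power_map R M C I W" "Z = tensor_class R M ?P z" "W = tensor_class R M ?P w"
        and zw: "Poly_Mapping.keys z \<subseteq> carrier M \<times> carrier ?P" "Poly_Mapping.keys w \<subseteq> carrier M \<times> carrier ?P"
      then have "z - w \<in> tensor_relations R M ?P"
        using R keys_frag_diff[OF zw] eqI[OF zw] by simp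
      then show "Z = W" using eq zw by (simp add: tensor_class_eq[OF M CI])
    qed
  qed
qed

section \<open>Products, endomorphism rings and injective cogenerators\<close>

lemma product_carrier: "carrier (product_module I M) = (\<Pi>\<^sub>E i\<in>I. carrier (M i))"
  by (simp add: product_module_def)

lemma product_apply [simp]:
  "i \<in> I \<Longrightarrow> (x \<oplus>\<^bsub>product_module I M\<^esub> y) i = x i \<oplus>\<^bsub>M i\<^esub> y i"
  "i \<in> I \<Longrightarrow> (r \<odot>\<^bsub>product_module I M\<^esub> x) i = r \<odot>\<^bsub>M i\<^esub> x i"
  "i \<in> I \<Longrightarrow> \<zero>\<^bsub>product_module I M\<^esub> i = \<zero>\<^bsub>M i\<^esub>"
  by (simp_all add: product_module_def)

lemma product_in_carrier: "\<lbrakk>x \<in> carrier (product_module I M); i \<in> I\<rbrakk> \<Longrightarrow> x i \<in> carrier (M i)"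
  by (auto simp: product_carrier)

lemma product_ext:
  assumes "x \<in> carrier (product_module I M)" "y \<in> carrier (product_module I M)" "\<And>i. i \<in> I \<Longrightarrow> x i = y i"
  shows "x = y"
  using assms by (auto simp: product_carrier intro: PiE_ext)

lemma product_left_module:
  assumes R: "ring R" and M: "\<And>i. i \<in> I \<Longrightarrow> left_module R (M i)"
  shows "left_module R (product_module I M)"
proof -
  interpret R: ring R by (rule R)
  have ag: "abelian_group (M i)" if "i \<in> I" for i
    using M[OF that] by (simp add: left_module_def)
  note ax = left_module.lsmult_closed[OF M] left_module.lsmult_l_distr[OF M] left_module.lsmult_r_distr[OF M]
    left_module.lsmult_assoc[OF M] left_module.lsmult_one[OF M] left_module.smult_zero_left[OF M]
  note am = abelian_group.axioms(1)[OF ag]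
  note ab = abelian_monoid.a_closed[OF am] abelian_monoid.zero_closed[OF am]
    abelian_monoid.a_assoc[OF am] 
    abelian_monoid.l_zero[OF am] abelian_monoid.r_zero[OF am]
  show ?thesis
  proof (rule left_moduleI[OF R])
    fix x y assume "x \<in> carrier (product_module I M)" "y \<in> carrier (product_module I M)"
    then show "x \<oplus>\<^bsub>product_module I M\<^esub> y = y \<oplus>\<^bsub>product_module I M\<^esub> x"
      by (auto simp: product_module_def intro!: restrict_ext abelian_monoid.a_comm[OF am])
  qed (auto simp: product_module_def ax ab fun_eq_iff restrict_def PiE_def extensional_def Pi_def)
qed

lemma product_a_inv [simp]:
  assumes R: "ring R" and M: "\<And>i. i \<in> I \<Longrightarrow> left_module R (M i)"
    and x: "x \<in> carrier (product_module I M)" and i: "i \<in> I"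
  shows "(\<ominus>\<^bsub>product_module I M\<^esub> x) i = \<ominus>\<^bsub>M i\<^esub> x i"
proof -
  interpret P: left_module R "product_module I M" by (rule product_left_module[OF R M])
  interpret Mi: left_module R "M i" by (rule M[OF i])
  have "((\<ominus>\<^bsub>R\<^esub> \<one>\<^bsub>R\<^esub>) \<odot>\<^bsub>product_module I M\<^esub> x) i = (\<ominus>\<^bsub>R\<^esub> \<one>\<^bsub>R\<^esub>) \<odot>\<^bsub>M i\<^esub> x i"
    using i by simp
  then show ?thesis
    using P.minus_one_smult[OF x] Mi.minus_one_smult[OF product_in_carrier[OF x i]] by simp
qed

lemma proj_hom:
  assumes R: "ring R" and M: "\<And>i. i \<in> I \<Longrightarrow> left_module R (M i)" and i: "i \<in> I"
  shows "(\<lambda>x\<in>carrier (product_module I M). x i) \<in> mod_hom R (product_module I M) (M i)"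
proof -
  interpret P: left_module R "product_module I M" by (rule product_left_module[OF R M])
  show ?thesis
    by (rule mod_homI) (use i in \<open>auto simp: product_in_carrier P.lsmult_closed\<close>)
qed

lemma tuple_hom:
  assumes P: "left_module R P" and f: "\<And>i. i \<in> I \<Longrightarrow> f i \<in> mod_hom R P (M i)"
  shows "(\<lambda>x\<in>carrier P. \<lambda>i\<in>I. f i x) \<in> mod_hom R P (product_module I M)"
proof -
  interpret P: left_module R P by (rule P)
  show ?thesis
  proof (rule mod_homI)
    fix x y assume "x \<in> carrier P" "y \<in> carrier P"
    then show "(\<lambda>x\<in>carrier P. \<lambda>i\<in>I. f i x) (x \<oplus>\<^bsub>P\<^esub> y) =
        (\<lambda>x\<in>carrier P. \<lambda>i\<in>I. f i x) x \<oplus>\<^bsub>product_module I M\<^esub> (\<lambda>x\<in>carrier P. \<lambda>i\<in>I. f i x) y"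
      by (auto simp: product_module_def hom_add[OF f] intro!: restrict_ext)
  next
    fix r x assume "r \<in> carrier R" "x \<in> carrier P"
    then show "(\<lambda>x\<in>carrier P. \<lambda>i\<in>I. f i x) (r \<odot>\<^bsub>P\<^esub> x) =
        r \<odot>\<^bsub>product_module I M\<^esub> (\<lambda>x\<in>carrier P. \<lambda>i\<in>I. f i x) x"
      by (auto simp: product_module_def hom_smult[OF f] P.lsmult_closed intro!: restrict_ext)
  qed (auto simp: product_carrier hom_closed[OF f])
qed

lemma direct_sum_submodule:
  assumes R: "ring R" and M: "\<And>i. i \<in> I \<Longrightarrow> left_module R (M i)"
  shows "submodule (carrier (direct_sum_module I M)) R (product_module I M)"
proof -
  interpret P: left_module R "product_module I M" by (rule product_left_module[OF R M])
  have car: "x \<in> carrier (direct_sum_module I M) \<longleftrightarrow>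
      x \<in> carrier (product_module I M) \<and> finite {i \<in> I. x i \<noteq> \<zero>\<^bsub>M i\<^esub>}" for x
    by (auto simp: direct_sum_module_def product_carrier)
  have z: "\<zero>\<^bsub>M i\<^esub> \<oplus>\<^bsub>M i\<^esub> \<zero>\<^bsub>M i\<^esub> = \<zero>\<^bsub>M i\<^esub>" if i: "i \<in> I" for i
  proof -
    interpret Mi: left_module R "M i" by (rule M[OF i])
    show ?thesis by simp
  qed
  show ?thesis
  proof (rule P.submoduleI)
    fix x y assume xy: "x \<in> carrier (direct_sum_module I M)" "y \<in> carrier (direct_sum_module I M)"
    have "{i \<in> I. (x \<oplus>\<^bsub>product_module I M\<^esub> y) i \<noteq> \<zero>\<^bsub>M i\<^esub>} \<subseteq> {i \<in> I. x i \<noteq> \<zero>\<^bsub>M i\<^esub>} \<union> {i \<in> I. y i \<noteq> \<zero>\<^bsub>M i\<^esub>}"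
      using z by auto
    with xy show "x \<oplus>\<^bsub>product_module I M\<^esub> y \<in> carrier (direct_sum_module I M)"
      unfolding car by (auto intro: finite_subset)
  next
    fix r x assume rx: "r \<in> carrier R" "x \<in> carrier (direct_sum_module I M)"
    have "{i \<in> I. (r \<odot>\<^bsub>product_module I M\<^esub> x) i \<noteq> \<zero>\<^bsub>M i\<^esub>} \<subseteq> {i \<in> I. x i \<noteq> \<zero>\<^bsub>M i\<^esub>}"
      using rx left_module.smult_zero_right[OF M] by auto
    with rx show "r \<odot>\<^bsub>product_module I M\<^esub> x \<in> carrier (direct_sum_module I M)"
      unfolding car by (auto intro: finite_subset P.lsmult_closed)
  next
    show "carrier (direct_sum_module I M) \<subseteq> carrier (product_module I M)" using car by blast
    show "\<zero>\<^bsub>product_module I M\<^esub> \<in> carrier (direct_sum_module I M)"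
      unfolding car by (auto intro: finite_subset[of _ "{}"])
  qed
qed

lemma direct_sum_alt: "direct_sum_module I M = (product_module I M)\<lparr>carrier := carrier (direct_sum_module I M)\<rparr>"
  by (simp add: direct_sum_module_def)

lemma direct_sum_apply [simp]:
  "\<zero>\<^bsub>direct_sum_module I M\<^esub> = \<zero>\<^bsub>product_module I M\<^esub>"
  "x \<oplus>\<^bsub>direct_sum_module I M\<^esub> y = x \<oplus>\<^bsub>product_module I M\<^esub> y"
  "r \<odot>\<^bsub>direct_sum_module I M\<^esub> x = r \<odot>\<^bsub>product_module I M\<^esub> x"
  by (simp_all add: direct_sum_module_def)

lemma direct_sum_carrier: "x \<in> carrier (direct_sum_module I M) \<longleftrightarrow>
    x \<in> carrier (product_module I M) \<and> finite {i \<in> I. x i \<noteq> \<zero>\<^bsub>M i\<^esub>}"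
  by (auto simp: direct_sum_module_def product_carrier)

lemma direct_sum_left_module:
  assumes R: "ring R" and M: "\<And>i. i \<in> I \<Longrightarrow> left_module R (M i)"
  shows "left_module R (direct_sum_module I M)"
  by (subst direct_sum_alt)
    (rule left_module.submodule_left_module[OF product_left_module[OF R M] direct_sum_submodule[OF R M]])

section \<open>Endomorphism rings and their natural modules\<close>

lemma End_ring_simps [simp]:
  "carrier (End_ring R M) = mod_hom R M M"
  "\<lbrakk>x \<in> carrier M\<rbrakk> \<Longrightarrow> (f \<otimes>\<^bsub>End_ring R M\<^esub> g) x = f (g x)"
  "\<lbrakk>x \<in> carrier M\<rbrakk> \<Longrightarrow> (f \<oplus>\<^bsub>End_ring R M\<^esub> g) x = f x \<oplus>\<^bsub>M\<^esub> g x"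
  "\<lbrakk>x \<in> carrier M\<rbrakk> \<Longrightarrow> \<one>\<^bsub>End_ring R M\<^esub> x = x"
  "\<lbrakk>x \<in> carrier M\<rbrakk> \<Longrightarrow> \<zero>\<^bsub>End_ring R M\<^esub> x = \<zero>\<^bsub>M\<^esub>"
  by (simp_all add: End_ring_def compose_def)

lemma End_module_simps [simp]:
  "carrier (End_module M) = carrier M" "\<zero>\<^bsub>End_module M\<^esub> = \<zero>\<^bsub>M\<^esub>"
  "x \<oplus>\<^bsub>End_module M\<^esub> y = x \<oplus>\<^bsub>M\<^esub> y" "f \<odot>\<^bsub>End_module M\<^esub> x = f x"
  by (simp_all add: End_module_def)

lemma End_ring_closed:
  assumes M: "left_module R M"
  shows "\<lbrakk>f \<in> mod_hom R M M; g \<in> mod_hom R M M\<rbrakk> \<Longrightarrow> f \<oplus>\<^bsub>End_ring R M\<^esub> g \<in> mod_hom R M M"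
    "\<lbrakk>f \<in> mod_hom R M M; g \<in> mod_hom R M M\<rbrakk> \<Longrightarrow> f \<otimes>\<^bsub>End_ring R M\<^esub> g \<in> mod_hom R M M"
    "\<one>\<^bsub>End_ring R M\<^esub> \<in> mod_hom R M M" "\<zero>\<^bsub>End_ring R M\<^esub> \<in> mod_hom R M M"
    "f \<in> mod_hom R M M \<Longrightarrow> (\<lambda>x\<in>carrier M. \<ominus>\<^bsub>M\<^esub> f x) \<in> mod_hom R M M"
proof -
  interpret M: left_module R M by (rule M)
  show "f \<oplus>\<^bsub>End_ring R M\<^esub> g \<in> mod_hom R M M" if f: "f \<in> mod_hom R M M" and g: "g \<in> mod_hom R M M"
    by (rule mod_homI) (simp_all add: End_ring_def hom_closed[OF f] hom_closed[OF g] hom_add[OF f] hom_add[OF g]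
        hom_smult[OF f] hom_smult[OF g] M.lsmult_closed M.lsmult_r_distr M.M.a_ac)
  show "f \<otimes>\<^bsub>End_ring R M\<^esub> g \<in> mod_hom R M M" if f: "f \<in> mod_hom R M M" and g: "g \<in> mod_hom R M M"
    by (rule mod_homI) (simp_all add: End_ring_def compose_def hom_closed[OF f] hom_closed[OF g] hom_add[OF f] hom_add[OF g]
        hom_smult[OF f] hom_smult[OF g] M.lsmult_closed)
  show "(\<lambda>x\<in>carrier M. \<ominus>\<^bsub>M\<^esub> f x) \<in> mod_hom R M M" if f: "f \<in> mod_hom R M M"
    by (rule mod_homI) (simp_all add: hom_closed[OF f] hom_add[OF f] hom_smult[OF f] M.lsmult_closed
        M.M.minus_add M.smult_minus_right M.M.a_comm)
qed (simp_all add: End_ring_def mod_hom_def left_module.lsmult_closed[OF M] abelian_monoid.zero_closed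
    abelian_monoid.a_closed left_module.smult_zero_right[OF M] abelian_group.axioms(1)[OF left_module.axioms(2)[OF M]]
    abelian_monoid.l_zero)

lemma ring_End_ring:
  assumes M: "left_module R M"
  shows "ring (End_ring R M)"
proof -
  interpret M: left_module R M by (rule M)
  note cl = End_ring_closed[OF M]
  have ext: "f = g" if "f \<in> mod_hom R M M" "g \<in> mod_hom R M M" "\<And>x. x \<in> carrier M \<Longrightarrow> f x = g x" for f g
    using that by (rule hom_eqI)
  have hc: "f x \<in> carrier M" if "f \<in> mod_hom R M M" "x \<in> carrier M" for f x
    using that by (rule hom_closed)
  have "abelian_group (End_ring R M)"
  proof (rule abelian_groupI)
    fix f assume f: "f \<in> carrier (End_ring R M)"
    show "\<exists>g\<in>carrier (End_ring R M). g \<oplus>\<^bsub>End_ring R M\<^esub> f = \<zero>\<^bsub>End_ring R M\<^esub>"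
      using f by (intro bexI[of _ "\<lambda>x\<in>carrier M. \<ominus>\<^bsub>M\<^esub> f x"]) (auto intro!: ext cl simp: hc M.M.l_neg)
  qed (auto intro!: ext cl simp: hc M.M.a_ac)
  moreover have "monoid (End_ring R M)"
    by (rule monoidI) (auto intro!: ext cl simp: hc)
  ultimately show ?thesis
    by (intro ringI) (auto intro!: ext cl simp: hc hom_add)
qed

lemma End_module_left_module:
  assumes M: "left_module R M"
  shows "left_module (End_ring R M) (End_module M)"
proof -
  interpret M: left_module R M by (rule M)
  show ?thesis
    by (rule left_moduleI[OF ring_End_ring[OF M]])
      (simp_all add: M.M.a_ac hom_closed[where M = M and N = M] hom_add[where M = M and N = M])
qed

section \<open>Factorisation of homomorphisms, injective modules and cogenerators\<close>

lemma hom_factor: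
  assumes P: "left_module R P" and p: "p \<in> mod_hom R P A" "p ` carrier P = carrier A"
    and f: "f \<in> mod_hom R P N"
    and ker: "\<And>x y. \<lbrakk>x \<in> carrier P; y \<in> carrier P; p x = p y\<rbrakk> \<Longrightarrow> f x = f y"
  shows "\<exists>h\<in>mod_hom R A N. \<forall>x\<in>carrier P. h (p x) = f x"
proof -
  interpret P: left_module R P by (rule P)
  define h where "h = (\<lambda>a\<in>carrier A. f (inv_into (carrier P) p a))"
  have hp: "h (p x) = f x" if x: "x \<in> carrier P" for x
  proof -
    have "p x \<in> p ` carrier P" using x by blast
    then have "f (inv_into (carrier P) p (p x)) = f x"
      using x by (intro ker) (auto simp: inv_into_into f_inv_into_f)
    then show ?thesis using x hom_closed[OF p(1)] by (simp add: h_def)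
  qed
  have ex: "\<exists>x\<in>carrier P. a = p x" if "a \<in> carrier A" for a using that p(2) by blast
  have "h \<in> mod_hom R A N"
  proof (rule mod_homI)
    show "h \<in> carrier A \<rightarrow>\<^sub>E carrier N"
      unfolding h_def using p(2) hom_closed[OF f] inv_into_into[of _ p "carrier P"] by auto
  next
    fix a b assume "a \<in> carrier A" "b \<in> carrier A"
    then obtain x y where xy: "x \<in> carrier P" "y \<in> carrier P" "a = p x" "b = p y" using ex by blast
    then have "h (a \<oplus>\<^bsub>A\<^esub> b) = h (p (x \<oplus>\<^bsub>P\<^esub> y))" by (simp add: hom_add[OF p(1)])
    then show "h (a \<oplus>\<^bsub>A\<^esub> b) = h a \<oplus>\<^bsub>N\<^esub> h b" using xy by (simp add: hp hom_add[OF f])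
  next
    fix r a assume r: "r \<in> carrier R" "a \<in> carrier A"
    then obtain x where x: "x \<in> carrier P" "a = p x" using ex by blast
    then have "h (r \<odot>\<^bsub>A\<^esub> a) = h (p (r \<odot>\<^bsub>P\<^esub> x))" using r by (simp add: hom_smult[OF p(1)])
    then show "h (r \<odot>\<^bsub>A\<^esub> a) = r \<odot>\<^bsub>N\<^esub> h a" using x r by (simp add: hp hom_smult[OF f] P.lsmult_closed)
  qed
  then show ?thesis using hp by blast
qed

lemma hom_ker_submodule:
  assumes "left_module R M" "left_module R N" "f \<in> mod_hom R M N"
  shows "submodule {x \<in> carrier M. f x = \<zero>\<^bsub>N\<^esub>} R M"
  using hom_vimage_submodule[OF assms left_module.submodule_zero[OF assms(2)]] by simp

lemma hom_eq_iff:
  assumes M: "left_module R M" and N: "left_module R N" and f: "f \<in> mod_hom R M N"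
    and x: "x \<in> carrier M" "y \<in> carrier M"
  shows "f x = f y \<longleftrightarrow> f (x \<ominus>\<^bsub>M\<^esub> y) = \<zero>\<^bsub>N\<^esub>"
  using left_module.minus_eq_zero_iff[OF N hom_closed[OF f x(1)] hom_closed[OF f x(2)]] hom_minus[OF M N f x]
  by simp

text \<open>Injectivity of V for modules of any type that embed into \<open>'u\<close>. The map
  \<rho> need not be injective: f descends to P / Ker \<rho>, and a copy of this quotient embeds
  into a copy of Q.\<close>

lemma injective_factor:
  fixes U :: "'u itself"
  assumes inj: "injective_module U R V" and V: "left_module R V"
    and P: "left_module R P" "carrier P \<lesssim> (UNIV :: 'u set)"
    and Q: "left_module R Q" "carrier Q \<lesssim> (UNIV :: 'u set)"
    and \<rho>: "\<rho> \<in> mod_hom R P Q" and f: "f \<in> mod_hom R P V"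
    and ker: "\<And>x. \<lbrakk>x \<in> carrier P; \<rho> x = \<zero>\<^bsub>Q\<^esub>\<rbrakk> \<Longrightarrow> f x = \<zero>\<^bsub>V\<^esub>"
  shows "\<exists>g\<in>mod_hom R Q V. \<forall>x\<in>carrier P. g (\<rho> x) = f x"
proof -
  interpret P: left_module R P by (rule P)
  interpret Q: left_module R Q by (rule Q)
  obtain A :: "('a, 'u) module" and p where A: "left_module R A" "p \<in> mod_hom R P A" "p ` carrier P = carrier A"
    and pe: "\<And>x y. \<lbrakk>x \<in> carrier P; y \<in> carrier P\<rbrakk> \<Longrightarrow> p x = p y \<longleftrightarrow> x \<ominus>\<^bsub>P\<^esub> y \<in> {x \<in> carrier P. \<rho> x = \<zero>\<^bsub>Q\<^esub>}"
    by (rule quotient_in_universe[OF P(1) hom_ker_submodule[OF P(1) Q(1) \<rho>] P(2)]) (rule that)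
  obtain B :: "('a, 'u) module" and q where B: "left_module R B" "q \<in> mod_hom R Q B" "q ` carrier Q = carrier B"
    and qe: "\<And>x y. \<lbrakk>x \<in> carrier Q; y \<in> carrier Q\<rbrakk> \<Longrightarrow> q x = q y \<longleftrightarrow> x \<ominus>\<^bsub>Q\<^esub> y \<in> {\<zero>\<^bsub>Q\<^esub>}"
    by (rule quotient_in_universe[OF Q(1) Q.submodule_zero Q(2)]) (rule that)
  have pe': "p x = p y \<longleftrightarrow> \<rho> x = \<rho> y" if "x \<in> carrier P" "y \<in> carrier P" for x y
    using pe[OF that] hom_eq_iff[OF P(1) Q(1) \<rho> that] that by simp
  have qe': "q x = q y \<longleftrightarrow> x = y" if "x \<in> carrier Q" "y \<in> carrier Q" for x y
    using qe[OF that] that by simp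
  have fe: "f x = f y" if "x \<in> carrier P" "y \<in> carrier P" "p x = p y" for x y
    using that ker[of "x \<ominus>\<^bsub>P\<^esub> y"] pe[OF that(1,2)] hom_eq_iff[OF P(1) V f that(1,2)] by simp
  obtain g where g: "g \<in> mod_hom R A V" "\<And>x. x \<in> carrier P \<Longrightarrow> g (p x) = f x"
    using hom_factor[OF P(1) A(2,3) f fe] by blast
  have "(\<lambda>x\<in>carrier P. q (\<rho> x)) \<in> mod_hom R P B"
    by (rule hom_compose[OF \<rho> B(2) P(1)])
  from hom_factor[OF P(1) A(2,3) this] obtain i
    where i: "i \<in> mod_hom R A B" "\<And>x. x \<in> carrier P \<Longrightarrow> i (p x) = q (\<rho> x)"
    using pe' by auto
  have "inj_on i (carrier A)"
  proof (rule inj_onI)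
    fix a b assume ab: "a \<in> carrier A" "b \<in> carrier A" "i a = i b"
    then obtain x y where xy: "x \<in> carrier P" "y \<in> carrier P" "a = p x" "b = p y" using A(3) by blast
    then have "\<rho> x = \<rho> y" using ab i(2) qe'[of "\<rho> x" "\<rho> y"] hom_closed[OF \<rho>] by simp
    then show "a = b" using xy pe' by simp
  qed
  then have "\<exists>h\<in>mod_hom R B V. \<forall>a\<in>carrier A. h (i a) = g a"
    using inj[unfolded injective_module_def, rule_format, OF i(1) g(1)] A(1) B(1) by blast
  then obtain h where h: "h \<in> mod_hom R B V" "\<And>a. a \<in> carrier A \<Longrightarrow> h (i a) = g a"
    by blast
  have "(\<lambda>x\<in>carrier Q. h (q x)) \<in> mod_hom R Q V"
    by (rule hom_compose[OF B(2) h(1) Q(1)])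
  moreover have "(\<lambda>x\<in>carrier Q. h (q x)) (\<rho> x) = f x" if "x \<in> carrier P" for x
    using that h(2)[of "p x"] i(2)[OF that] g(2)[OF that] hom_closed[OF \<rho>] hom_closed[OF A(2)] by simp
  ultimately show ?thesis by blast
qed

text \<open>Compare the map r -> r c + X from R to C / X with the zero map. A homomorphism h from C
  / X to V that tells them apart satisfies r h(c + X) \<noteq> 0 for some r, so it does not vanish
  at c + X.\<close>

lemma cogenerator_separates:
  fixes U :: "'u itself"
  assumes cog: "cogenerator U R V" and V: "left_module R V" and C: "left_module R C"
    and le: "carrier R \<lesssim> (UNIV :: 'u set)" "carrier C \<lesssim> (UNIV :: 'u set)"
    and X: "submodule X R C" and c: "c \<in> carrier C" "c \<notin> X"
  shows "\<exists>f\<in>mod_hom R C V. (\<forall>x\<in>X. f x = \<zero>\<^bsub>V\<^esub>) \<and> f c \<noteq> \<zero>\<^bsub>V\<^esub>"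
proof -
  interpret C: left_module R C by (rule C)
  interpret V: left_module R V by (rule V)
  let ?reg = "regular_module R"
  note reg = regular_left_module[OF C.ring_axioms]
  interpret reg: left_module R ?reg by (rule reg)
  have regc: "carrier ?reg = carrier R" by (simp add: regular_module_def)
  obtain A :: "('a, 'u) module" and p where A: "left_module R A" "p \<in> mod_hom R ?reg A" "p ` carrier ?reg = carrier A"
    and pe: "\<And>x y. \<lbrakk>x \<in> carrier ?reg; y \<in> carrier ?reg\<rbrakk> \<Longrightarrow> p x = p y \<longleftrightarrow> x \<ominus>\<^bsub>?reg\<^esub> y \<in> {\<zero>\<^bsub>?reg\<^esub>}"
    by (rule quotient_in_universe[OF reg reg.submodule_zero le(1)[folded regc]]) (rule that)
  obtain B :: "('a, 'u) module" and q where B: "left_module R B" "q \<in> mod_hom R C B" "q ` carrier C = carrier B"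
    and qe: "\<And>x y. \<lbrakk>x \<in> carrier C; y \<in> carrier C\<rbrakk> \<Longrightarrow> q x = q y \<longleftrightarrow> x \<ominus>\<^bsub>C\<^esub> y \<in> X"
    by (rule quotient_in_universe[OF C X le(2)]) (rule that)
  interpret B: left_module R B by (rule B)
  have orb: "C.orbit_map c \<in> mod_hom R ?reg C" by (rule C.orbit_map_hom[OF c(1)])
  have qo: "(\<lambda>r\<in>carrier ?reg. q (C.orbit_map c r)) \<in> mod_hom R ?reg B"
    by (rule hom_compose[OF orb B(2) reg])
  have pinj: "x = y" if "x \<in> carrier ?reg" "y \<in> carrier ?reg" "p x = p y" for x y
    using pe[OF that(1,2)] that by simp
  have "\<exists>f\<in>mod_hom R A B. \<forall>r\<in>carrier ?reg. f (p r) = (\<lambda>r\<in>carrier ?reg. q (C.orbit_map c r)) r"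
    by (rule hom_factor[OF reg A(2,3) qo]) (drule (2) pinj, simp)
  then obtain f where f: "f \<in> mod_hom R A B" "\<And>r. r \<in> carrier ?reg \<Longrightarrow> f (p r) = q (C.orbit_map c r)"
    by auto
  define z where "z = (\<lambda>a\<in>carrier A. \<zero>\<^bsub>B\<^esub>)"
  interpret A: left_module R A by (rule A)
  have z: "z \<in> mod_hom R A B"
    by (rule mod_homI) (auto simp: z_def A.lsmult_closed)
  have q0: "q x = \<zero>\<^bsub>B\<^esub> \<longleftrightarrow> x \<in> X" if "x \<in> carrier C" for x
    using qe[OF that C.M.zero_closed] hom_zero[OF C B(1,2)] that C.add_minus_cancel(3)[OF that C.M.zero_closed]
    by simp
  have one: "\<one>\<^bsub>R\<^esub> \<in> carrier ?reg" by (simp add: regc)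
  have "C.orbit_map c \<one>\<^bsub>R\<^esub> = c" using c by (simp add: C.orbit_map_def C.lsmult_one)
  then have "f (p \<one>\<^bsub>R\<^esub>) \<noteq> z (p \<one>\<^bsub>R\<^esub>)"
    using f(2)[OF one] q0[OF c(1)] c(2) hom_closed[OF A(2) one] by (simp add: z_def)
  then have "f \<noteq> z" by metis
  then have "\<exists>h\<in>mod_hom R B V. \<exists>a\<in>carrier A. h (f a) \<noteq> h (z a)"
    using cog[unfolded cogenerator_def, rule_format, OF f(1) z] A(1) B(1) by blast
  then obtain h a where h: "h \<in> mod_hom R B V" "a \<in> carrier A" "h (f a) \<noteq> h (z a)"
    by blast
  then obtain r where r: "r \<in> carrier R" "a = p r" using A(3) regc by auto
  have cr: "r \<odot>\<^bsub>C\<^esub> c \<in> carrier C" using r c by (simp add: C.lsmult_closed)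
  have "h (f a) = h (q (r \<odot>\<^bsub>C\<^esub> c))" using r f(2)[of r] regc by (simp add: C.orbit_map_def)
  also have "\<dots> = r \<odot>\<^bsub>V\<^esub> h (q c)"
    using r c by (simp add: hom_smult[OF B(2)] hom_smult[OF h(1)] hom_closed[OF B(2)])
  finally have "r \<odot>\<^bsub>V\<^esub> h (q c) \<noteq> \<zero>\<^bsub>V\<^esub>"
    using h(2,3) hom_zero[OF B(1) V h(1)] by (simp add: z_def)
  then have "h (q c) \<noteq> \<zero>\<^bsub>V\<^esub>" using r(1) by auto
  moreover have "h (q x) = \<zero>\<^bsub>V\<^esub>" if "x \<in> X" for x
    using q0[of x] that submodule_in_carrier[OF X that] hom_zero[OF B(1) V h(1)] by simp
  moreover have "(\<lambda>x\<in>carrier C. h (q x)) \<in> mod_hom R C V"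
    by (rule hom_compose[OF B(2) h(1) C])
  ultimately show ?thesis
    using c(1) submodule_in_carrier[OF X] by (intro bexI[of _ "\<lambda>x\<in>carrier C. h (q x)"]) auto
qed

text \<open>Finite tuples are coded as lists, and an infinite set has as many lists as
  elements.\<close>

lemma lepoll_finite_power:
  assumes "A \<lesssim> (UNIV :: 'u set)" "infinite (UNIV :: 'u set)"
  shows "({..<n::nat} \<rightarrow>\<^sub>E A) \<lesssim> (UNIV :: 'u set)"
proof -
  have "({..<n} \<rightarrow>\<^sub>E A) \<lesssim> {xs :: 'u list. set xs \<subseteq> UNIV}"
  proof -
    obtain e :: "'a \<Rightarrow> 'u" where e: "inj_on e A" using assms(1) by (auto simp: lepoll_def)
    have "inj_on (\<lambda>f. map (\<lambda>i. e (f i)) [0..<n]) ({..<n} \<rightarrow>\<^sub>E A)"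
    proof (rule inj_onI)
      fix f g assume f: "f \<in> {..<n} \<rightarrow>\<^sub>E A" and g: "g \<in> {..<n} \<rightarrow>\<^sub>E A"
        and eq: "map (\<lambda>i. e (f i)) [0..<n] = map (\<lambda>i. e (g i)) [0..<n]"
      show "f = g"
      proof (rule PiE_ext[OF f g])
        fix i assume i: "i \<in> {..<n}"
        then have "e (f i) = e (g i)" using eq by simp
        then show "f i = g i" using e f g i by (auto simp: inj_on_def)
      qed
    qed
    then show ?thesis by (auto simp: lepoll_def)
  qed
  also have "{xs :: 'u list. set xs \<subseteq> UNIV} = lists UNIV" by auto
  also have "lists (UNIV :: 'u set) \<lesssim> (UNIV :: 'u set)"
    using card_of_lists_infinite[OF assms(2)]
    by (metis eqpoll_iff_card_of_ordIso eqpoll_imp_lepoll)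
  finally show ?thesis .
qed

section \<open>Stable subgroups\<close>

lemma frag_map_comp: "frag_map g (frag_map f z) = frag_map (\<lambda>x. g (f x)) z"
  by (rule frag_induction[of z UNIV "\<lambda>z. frag_map g (frag_map f z) = frag_map (\<lambda>x. g (f x)) z"]) auto

lemma frag_map_cong:
  assumes "\<And>x y. (x, y) \<in> Poly_Mapping.keys z \<Longrightarrow> f y = g y"
  shows "frag_map f z = frag_map g z"
  unfolding frag_map_def by (rule frag_extend_eq) (use assms in auto)

lemma frag_map_ident:
  assumes "\<And>x y. (x, y) \<in> Poly_Mapping.keys z \<Longrightarrow> f y = y"
  shows "frag_map f z = z"
proof -
  have "frag_map f z = frag_extend frag_of z"
    unfolding frag_map_def by (rule frag_extend_eq) (use assms in auto)
  then show ?thesis using frag_expansion[of z] by simp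
qed

lemma End_module_a_inv [simp]: "\<ominus>\<^bsub>End_module M\<^esub> x = \<ominus>\<^bsub>M\<^esub> x"
  by (simp add: a_inv_def m_inv_def End_module_def)

text \<open>
  Finite matrix subgroups are stable, and this is the only property of them that is used to derive
  the descending chain condition.
\<close>

definition stable ::
  "'u itself \<Rightarrow> ('r, 'd) ring_scheme \<Rightarrow> ('r, 'c) module \<Rightarrow> 'c set \<Rightarrow> bool" where
  "stable U R C X \<longleftrightarrow> (\<forall>I :: 'u set. \<forall>u\<in>mod_hom R (product_module I (\<lambda>_. C)) C.
     \<forall>c\<in>carrier (product_module I (\<lambda>_. C)). (\<forall>i\<in>I. c i \<in> X) \<longrightarrow> u c \<in> X)"

text \<open>This closure property carries stability from the kernels of elements of C+ to all
  S-submodules of C.\<close>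

lemma stable_Inter:
  assumes "\<And>X. X \<in> \<X> \<Longrightarrow> stable U R C X"
  shows "stable U R C (\<Inter>\<X>)"
  using assms unfolding stable_def by blast

text \<open>The truncation fixes every family supported in J. So any finitely many elements of the
  direct sum are fixed by one homomorphism from the product to the direct sum, which is the local
  splitting behind purity.\<close>

lemma direct_sum_truncation:
  assumes R: "ring R" and C: "left_module R C" and J: "finite J"
  shows "(\<lambda>x\<in>carrier (product_module I (\<lambda>_. C)). \<lambda>i\<in>I. if i \<in> J then x i else \<zero>\<^bsub>C\<^esub>)
    \<in> mod_hom R (product_module I (\<lambda>_. C)) (direct_sum_module I (\<lambda>_. C))"
proof -
  interpret C: left_module R C by (rule C)
  interpret P: left_module R "product_module I (\<lambda>_. C)" by (rule product_left_module[OF R C])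
  note pc = product_in_carrier[where M = "\<lambda>_. C"]
  show ?thesis
  proof (rule mod_homI)
    show "(\<lambda>x\<in>carrier (product_module I (\<lambda>_. C)). \<lambda>i\<in>I. if i \<in> J then x i else \<zero>\<^bsub>C\<^esub>)
        \<in> carrier (product_module I (\<lambda>_. C)) \<rightarrow>\<^sub>E carrier (direct_sum_module I (\<lambda>_. C))"
    proof (intro restrict_PiE_iff[THEN iffD2] ballI)
      fix x assume x: "x \<in> carrier (product_module I (\<lambda>_. C))"
      have "{i \<in> I. (\<lambda>i\<in>I. if i \<in> J then x i else \<zero>\<^bsub>C\<^esub>) i \<noteq> \<zero>\<^bsub>C\<^esub>} \<subseteq> J" by auto
      then show "(\<lambda>i\<in>I. if i \<in> J then x i else \<zero>\<^bsub>C\<^esub>) \<in> carrier (direct_sum_module I (\<lambda>_. C))"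
        using x J pc[OF x] by (auto simp: direct_sum_carrier product_carrier intro: finite_subset)
    qed
  next
    fix x y assume "x \<in> carrier (product_module I (\<lambda>_. C))" "y \<in> carrier (product_module I (\<lambda>_. C))"
    then show "(\<lambda>x\<in>carrier (product_module I (\<lambda>_. C)). \<lambda>i\<in>I. if i \<in> J then x i else \<zero>\<^bsub>C\<^esub>) (x \<oplus>\<^bsub>product_module I (\<lambda>_. C)\<^esub> y)
      = (\<lambda>x\<in>carrier (product_module I (\<lambda>_. C)). \<lambda>i\<in>I. if i \<in> J then x i else \<zero>\<^bsub>C\<^esub>) x
        \<oplus>\<^bsub>direct_sum_module I (\<lambda>_. C)\<^esub> (\<lambda>x\<in>carrier (product_module I (\<lambda>_. C)). \<lambda>i\<in>I. if i \<in> J then x i else \<zero>\<^bsub>C\<^esub>) y"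
      by (auto simp: product_module_def intro!: restrict_ext)
  next
    fix r x assume rx: "r \<in> carrier R" "x \<in> carrier (product_module I (\<lambda>_. C))"
    have sm: "r \<odot>\<^bsub>product_module I (\<lambda>_. C)\<^esub> y = (\<lambda>i\<in>I. r \<odot>\<^bsub>C\<^esub> y i)" for y
      by (simp add: product_module_def)
    from rx show "(\<lambda>x\<in>carrier (product_module I (\<lambda>_. C)). \<lambda>i\<in>I. if i \<in> J then x i else \<zero>\<^bsub>C\<^esub>) (r \<odot>\<^bsub>product_module I (\<lambda>_. C)\<^esub> x)
      = r \<odot>\<^bsub>direct_sum_module I (\<lambda>_. C)\<^esub> (\<lambda>x\<in>carrier (product_module I (\<lambda>_. C)). \<lambda>i\<in>I. if i \<in> J then x i else \<zero>\<^bsub>C\<^esub>) x"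
      using P.lsmult_closed[OF rx] by (auto simp: sm intro!: restrict_ext)
  qed
qed

lemma direct_sum_inclusion_hom:
  assumes R: "ring R" and C: "left_module R C"
  shows "(\<lambda>x\<in>carrier (direct_sum_module I (\<lambda>_. C)). x) \<in> mod_hom R (direct_sum_module I (\<lambda>_. C)) (product_module I (\<lambda>_. C))"
proof -
  interpret D: left_module R "direct_sum_module I (\<lambda>_. C)" by (rule direct_sum_left_module[OF R C])
  show ?thesis
    using D.M.a_closed D.lsmult_closed by (intro mod_homI) (auto simp: direct_sum_carrier)
qed

text \<open>The inclusion \<open>C\<^sup>(\<^sup>I\<^sup>) \<subseteq> C\<^sup>I\<close> is pure since it splits locally.\<close>

lemma direct_sum_retraction:
  fixes U :: "'u itself" and I :: "'u set" and C :: "('r, 'c) module"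
  assumes R: "ring R" and C: "left_module R C"
    and le: "carrier (product_module I (\<lambda>_. C)) \<lesssim> (UNIV :: 'u set)"
    and pinj: "pure_injective U R (direct_sum_module I (\<lambda>_. C))"
  shows "\<exists>r\<in>mod_hom R (product_module I (\<lambda>_. C)) (direct_sum_module I (\<lambda>_. C)).
    \<forall>x\<in>carrier (direct_sum_module I (\<lambda>_. C)). r x = x"
proof -
  let ?P = "product_module I (\<lambda>_. C)" and ?D = "direct_sum_module I (\<lambda>_. C)"
  have P: "left_module R ?P" by (rule product_left_module[OF R C])
  have D: "left_module R ?D" by (rule direct_sum_left_module[OF R C])
  interpret P: left_module R ?P by (rule P)
  interpret D: left_module R ?D by (rule D)
  have DP: "carrier ?D \<subseteq> carrier ?P" by (auto simp: direct_sum_carrier)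
  have leD: "carrier ?D \<lesssim> (UNIV :: 'u set)"
    using subset_imp_lepoll[OF DP] le lepoll_trans by blast
  obtain A :: "('r, 'u) module" and a where A: "left_module R A" "a \<in> mod_hom R ?D A" "a ` carrier ?D = carrier A"
    and ae: "\<And>x y. \<lbrakk>x \<in> carrier ?D; y \<in> carrier ?D\<rbrakk> \<Longrightarrow> a x = a y \<longleftrightarrow> x \<ominus>\<^bsub>?D\<^esub> y \<in> {\<zero>\<^bsub>?D\<^esub>}"
    by (rule quotient_in_universe[OF D D.submodule_zero leD]) (rule that)
  obtain B :: "('r, 'u) module" and b where B: "left_module R B" "b \<in> mod_hom R ?P B" "b ` carrier ?P = carrier B"
    and be: "\<And>x y. \<lbrakk>x \<in> carrier ?P; y \<in> carrier ?P\<rbrakk> \<Longrightarrow> b x = b y \<longleftrightarrow> x \<ominus>\<^bsub>?P\<^esub> y \<in> {\<zero>\<^bsub>?P\<^esub>}"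
    by (rule quotient_in_universe[OF P P.submodule_zero le]) (rule that)
  have ainj: "x = y" if "x \<in> carrier ?D" "y \<in> carrier ?D" "a x = a y" for x y
    using ae[OF that(1,2)] that D.minus_eq_zero_iff[OF that(1,2)] by simp
  have binj: "x = y" if "x \<in> carrier ?P" "y \<in> carrier ?P" "b x = b y" for x y
    using be[OF that(1,2)] that P.minus_eq_zero_iff[OF that(1,2)] by simp
  have "(\<lambda>x\<in>carrier ?D. b ((\<lambda>x\<in>carrier ?D. x) x)) \<in> mod_hom R ?D B"
    by (rule hom_compose[OF direct_sum_inclusion_hom[OF R C] B(2) D])
  then have "\<exists>i\<in>mod_hom R A B. \<forall>x\<in>carrier ?D. i (a x) = (\<lambda>x\<in>carrier ?D. b ((\<lambda>x\<in>carrier ?D. x) x)) x"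
    by (rule hom_factor[OF D A(2,3)]) (drule (2) ainj, simp)
  then obtain i where i: "i \<in> mod_hom R A B" "\<And>x. x \<in> carrier ?D \<Longrightarrow> i (a x) = b x" by auto
  have "(\<lambda>x\<in>carrier ?D. x) \<in> mod_hom R ?D ?D"
    using D.M.a_closed D.lsmult_closed by (intro mod_homI) auto
  then have "\<exists>g\<in>mod_hom R A ?D. \<forall>x\<in>carrier ?D. g (a x) = (\<lambda>x\<in>carrier ?D. x) x"
    by (rule hom_factor[OF D A(2,3)]) (drule (2) ainj, simp)
  then obtain g where g: "g \<in> mod_hom R A ?D" "\<And>x. x \<in> carrier ?D \<Longrightarrow> g (a x) = x" by auto
  have ex: "\<exists>x\<in>carrier ?D. \<alpha> = a x" if "\<alpha> \<in> carrier A" for \<alpha> using A(3) that by blast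
  have "pure_mono U R A B i"
    unfolding pure_mono_def
  proof (intro conjI allI impI)
    show "inj_on i (carrier A)"
    proof (rule inj_onI)
      fix \<alpha> \<beta> assume ab: "\<alpha> \<in> carrier A" "\<beta> \<in> carrier A" "i \<alpha> = i \<beta>"
      obtain x where "x \<in> carrier ?D" "\<alpha> = a x" using ex[OF ab(1)] ..
      moreover obtain y where "y \<in> carrier ?D" "\<beta> = a y" using ex[OF ab(2)] ..
      ultimately have xy: "x \<in> carrier ?D" "y \<in> carrier ?D" "\<alpha> = a x" "\<beta> = a y" by simp_all
      then have "b x = b y" using ab i by simp
      then show "\<alpha> = \<beta>" using xy binj[of x y] DP by auto
    qed
  next
    fix X :: "('r, 'u) module" assume X: "right_module R X"
    show "inj_on (tensor_map R X B i) (carrier (tensor_product R X A))"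
      unfolding inj_on_tensor_map_iff[OF X A(1) B(1) i(1)]
    proof (intro allI impI)
      fix z assume z: "Poly_Mapping.keys z \<subseteq> carrier X \<times> carrier A" "frag_map i z \<in> tensor_relations R X B"
      \<comment> \<open>The union of the supports of all elements of the direct sum that occur in z.
        Truncation to J fixes each of them and is therefore a left inverse of the inclusion as far
        as z is concerned.\<close>
      define J where "J = (\<Union>(x, \<alpha>)\<in>Poly_Mapping.keys z. {j \<in> I. g \<alpha> j \<noteq> \<zero>\<^bsub>C\<^esub>})"
      have J: "finite J"
        unfolding J_def using z(1) hom_closed[OF g(1)] by (intro finite_UN_I) (auto simp: direct_sum_carrier)
      let ?t = "\<lambda>x\<in>carrier ?P. \<lambda>i\<in>I. if i \<in> J then x i else \<zero>\<^bsub>C\<^esub>"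
      have t: "?t \<in> mod_hom R ?P ?D" by (rule direct_sum_truncation[OF R C J])
      have "(\<lambda>x\<in>carrier ?P. a (?t x)) \<in> mod_hom R ?P A" by (rule hom_compose[OF t A(2) P])
      then have "\<exists>h\<in>mod_hom R B A. \<forall>x\<in>carrier ?P. h (b x) = (\<lambda>x\<in>carrier ?P. a (?t x)) x"
        by (rule hom_factor[OF P B(2,3)]) (drule (2) binj, simp)
      then obtain h where h: "h \<in> mod_hom R B A" "\<And>x. x \<in> carrier ?P \<Longrightarrow> h (b x) = a (?t x)" by auto
      have "h (i \<alpha>) = \<alpha>" if "(x, \<alpha>) \<in> Poly_Mapping.keys z" for x \<alpha>
      proof -
        have "\<alpha> \<in> carrier A" using subsetD[OF z(1) that] by simp
        from ex[OF this] obtain d where d: "d \<in> carrier ?D" "\<alpha> = a d" ..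
        have dP: "d \<in> carrier ?P" by (rule subsetD[OF DP d(1)])
        have "g \<alpha> = d" using d g(2) by simp
        then have "{j \<in> I. d j \<noteq> \<zero>\<^bsub>C\<^esub>} \<subseteq> J"
          unfolding J_def by (intro subsetI UN_I[OF that]) simp
        then have dj: "d j = \<zero>\<^bsub>C\<^esub>" if "j \<in> I" "j \<notin> J" for j using that by blast
        have tP: "?t d \<in> carrier ?P" using hom_closed[OF t dP] unfolding direct_sum_carrier by (rule conjunct1)
        have "?t d = d"
          by (rule product_ext[OF tP dP]) (use dP dj in simp)
        then show ?thesis using d i(2) h(2)[OF dP] by simp
      qed
      then have "frag_map h (frag_map i z) = z" unfolding frag_map_comp by (rule frag_map_ident)
      then show "z \<in> tensor_relations R X A"
        using tensor_map_relations[OF X B(1) A(1) h(1) z(2)] by simp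
    qed
  qed (fact i(1))
  then have "\<exists>h\<in>mod_hom R B ?D. \<forall>\<alpha>\<in>carrier A. h (i \<alpha>) = g \<alpha>"
    using pinj[unfolded pure_injective_def, rule_format, OF g(1)] A(1) B(1) by blast
  then obtain h where h: "h \<in> mod_hom R B ?D" "\<And>\<alpha>. \<alpha> \<in> carrier A \<Longrightarrow> h (i \<alpha>) = g \<alpha>" by blast
  have "(\<lambda>x\<in>carrier ?P. h (b x)) \<in> mod_hom R ?P ?D" by (rule hom_compose[OF B(2) h(1) P])
  moreover have "(\<lambda>x\<in>carrier ?P. h (b x)) x = x" if x: "x \<in> carrier ?D" for x
    using x DP h(2)[OF hom_closed[OF A(2) x]] i(2)[OF x] g(2)[OF x] by auto
  ultimately show ?thesis by blast
qed

text \<open>Choose x_k in f k, outside of f (k + 1) if possible. A retraction of the product onto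
  the direct sum sends the sequence of all x_k to a sequence of finite support. For large k, its
  k-th component is a homomorphism from the product to C that kills this sequence, and stability
  forces x_k into f (k + 1).\<close>

lemma sigma_pure_injective_stable_chain:
  fixes U :: "'u itself" and C :: "('r, 'c) module" and f :: "nat \<Rightarrow> 'c set"
  assumes C: "left_module R C" and inf: "infinite (UNIV :: 'u set)"
    and le: "((UNIV :: nat set) \<rightarrow>\<^sub>E carrier C) \<lesssim> (UNIV :: 'u set)"
    and spi: "sigma_pure_injective U R C"
    and f: "\<And>k. f k \<subseteq> carrier C" "\<And>k. \<zero>\<^bsub>C\<^esub> \<in> f k" "\<And>k x. x \<in> f k \<Longrightarrow> \<ominus>\<^bsub>C\<^esub> x \<in> f k"
      "\<And>k. stable U R C (f k)" "\<And>k. f (Suc k) \<subseteq> f k"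
  shows "\<exists>n. \<forall>k\<ge>n. f k = f n"
proof -
  interpret C: left_module R C by (rule C)
  have R: "ring R" by (rule C.ring_axioms)
  obtain e :: "nat \<Rightarrow> 'u" where e: "inj e"
    using inf infinite_le_lepoll[of "UNIV :: 'u set"] by (auto simp: lepoll_def)
  \<comment> \<open>Index sets are sets over \<open>'u\<close>, so the natural numbers are replaced
    by a copy.\<close>
  define I where "I = range e"
  let ?P = "product_module I (\<lambda>_. C)" and ?D = "direct_sum_module I (\<lambda>_. C)"
  have "inj_on (\<lambda>x. \<lambda>k\<in>UNIV. x (e k)) (carrier ?P)"
  proof (rule inj_onI)
    fix x y assume x: "x \<in> carrier ?P" and y: "y \<in> carrier ?P"
      and eq: "(\<lambda>k\<in>UNIV. x (e k)) = (\<lambda>k\<in>UNIV. y (e k))"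
    show "x = y"
    proof (rule product_ext[OF x y])
      fix i assume "i \<in> I"
      then obtain k where "i = e k" by (auto simp: I_def)
      then show "x i = y i" using fun_cong[OF eq, of k] by simp
    qed
  qed
  then have "carrier ?P \<lesssim> ((UNIV :: nat set) \<rightarrow>\<^sub>E carrier C)"
    unfolding lepoll_def by (intro exI[of _ "\<lambda>x. \<lambda>k\<in>UNIV. x (e k)"]) (auto simp: product_carrier I_def)
  then have leP: "carrier ?P \<lesssim> (UNIV :: 'u set)" using le lepoll_trans by blast
  have P: "left_module R ?P" by (rule product_left_module[OF R C])
  have D: "left_module R ?D" by (rule direct_sum_left_module[OF R C])
  interpret P: left_module R ?P by (rule P)
  obtain r where r: "r \<in> mod_hom R ?P ?D" "\<And>x. x \<in> carrier ?D \<Longrightarrow> r x = x"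
    using direct_sum_retraction[OF R C leP, of U] spi unfolding sigma_pure_injective_def by blast
  \<comment> \<open>x k is a witness if the chain drops at k, and an arbitrary element
    otherwise.\<close>
  have "\<exists>x. x \<in> f k \<and> (x \<in> f (Suc k) \<longrightarrow> f k = f (Suc k))" for k
    using f(2)[of k] f(5)[of k] by blast
  then obtain x where x: "\<And>k. x k \<in> f k" "\<And>k. x k \<in> f (Suc k) \<Longrightarrow> f k = f (Suc k)" by metis
  have anti: "f l \<subseteq> f k" if "k \<le> l" for k l
    by (rule lift_Suc_antimono_le[of f, OF f(5) that])
  define c where "c = (\<lambda>i\<in>I. x (inv_into UNIV e i))"
  have ce: "c (e k) = x k" for k using e by (simp add: c_def I_def)
  have c: "c \<in> carrier ?P"
    using x(1) f(1) by (auto simp: product_carrier c_def)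
  have "finite {i \<in> I. r c i \<noteq> \<zero>\<^bsub>C\<^esub>}"
    using hom_closed[OF r(1) c] by (simp add: direct_sum_carrier)
  then have "finite (e -` {i \<in> I. r c i \<noteq> \<zero>\<^bsub>C\<^esub>})" by (rule finite_vimageI[OF _ e])
  then obtain n where n: "\<forall>k\<in>e -` {i \<in> I. r c i \<noteq> \<zero>\<^bsub>C\<^esub>}. k < n"
    unfolding finite_nat_set_iff_bounded ..
  have step: "f k = f (Suc k)" if k: "k \<ge> n" for k
  proof -
    have eI: "e k \<in> I" by (simp add: I_def)
    have rk: "r c (e k) = \<zero>\<^bsub>C\<^esub>" using n[rule_format, of k] k eI by (auto simp: not_less[symmetric])
    have hP: "r y \<in> carrier ?P" "r y \<in> carrier ?D" if "y \<in> carrier ?P" for y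
      using hom_closed[OF r(1) that] by (simp_all add: direct_sum_carrier)
    \<comment> \<open>The k-th component of the retraction; by the choice of n it vanishes at
      c.\<close>
    define u where "u = (\<lambda>x\<in>carrier ?P. r x (e k))"
    have u: "u \<in> mod_hom R ?P C"
    proof -
      note h = hom_compose[OF hom_compose[OF r(1) direct_sum_inclusion_hom[OF R C] P] proj_hom[OF R C eI] P]
      have "u = (\<lambda>x\<in>carrier ?P. (\<lambda>x\<in>carrier ?P. x (e k)) ((\<lambda>x\<in>carrier ?P. (\<lambda>x\<in>carrier ?D. x) (r x)) x))"
        unfolding u_def using hP by (intro restrict_ext) simp
      then show ?thesis using h by simp
    qed
    \<comment> \<open>Split c behind position k. The first part has finite support, so the
      retraction fixes it and u takes the value x k there. All entries of the second part lie in f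
      (k + 1), so u sends it into f (k + 1).\<close>
    define c' where "c' = (\<lambda>i\<in>I. if i \<in> e ` {..k} then c i else \<zero>\<^bsub>C\<^esub>)"
    define c'' where "c'' = (\<lambda>i\<in>I. if i \<in> e ` {..k} then \<zero>\<^bsub>C\<^esub> else c i)"
    have cc: "c' \<in> carrier ?P" "c'' \<in> carrier ?P"
      using product_in_carrier[OF c] by (auto simp: c'_def c''_def product_carrier)
    have dec: "c = c' \<oplus>\<^bsub>?P\<^esub> c''"
      using product_in_carrier[OF c] by (intro product_ext[OF c P.M.a_closed[OF cc]]) (simp add: c'_def c''_def)
    have "{i \<in> I. c' i \<noteq> \<zero>\<^bsub>C\<^esub>} \<subseteq> e ` {..k}" by (auto simp: c'_def)
    then have "c' \<in> carrier ?D" using cc by (auto simp: direct_sum_carrier intro: finite_subset)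
    then have "u c' = x k" using r(2)[of c'] cc eI ce by (simp add: u_def c'_def)
    moreover have "u c = u c' \<oplus>\<^bsub>C\<^esub> u c''" unfolding dec by (rule hom_add[OF u cc])
    moreover have "u c = \<zero>\<^bsub>C\<^esub>" using rk c by (simp add: u_def)
    moreover have xc: "x k \<in> carrier C" "u c'' \<in> carrier C" using x(1) f(1) hom_closed[OF u cc(2)] by auto
    ultimately have "x k = \<ominus>\<^bsub>C\<^esub> u c''" using C.M.minus_equality[of "x k" "u c''"] by simp
    moreover have "u c'' \<in> f (Suc k)"
    proof -
      have "\<forall>i\<in>I. c'' i \<in> f (Suc k)"
      proof
        fix i assume "i \<in> I"
        then obtain l where l: "i = e l" by (auto simp: I_def)
        show "c'' i \<in> f (Suc k)"
        proof (cases "l \<le> k")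
          case True
          then show ?thesis using l f(2) by (simp add: c''_def I_def)
        next
          case False
          then have "e l \<notin> e ` {..k}" using e by (auto simp: inj_def)
          moreover have "x l \<in> f (Suc k)" using x(1)[of l] anti[of "Suc k" l] False by auto
          ultimately show ?thesis using l ce by (simp add: c''_def I_def)
        qed
      qed
      then show ?thesis using f(4)[of "Suc k"] u cc(2) unfolding stable_def by blast
    qed
    ultimately have "x k \<in> f (Suc k)" using f(3) by simp
    then show ?thesis by (rule x(2))
  qed
  have "f k = f n" if "k \<ge> n" for k
    using that
  proof (induction k rule: dec_induct)
    case (step m)
    then show ?case using \<open>\<And>k. k \<ge> n \<Longrightarrow> f k = f (Suc k)\<close>[of m] by simp
  qed simp
  then show ?thesis by blast
qed

section \<open>Finite sums and finite presentations\<close>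

text \<open>The recursion equations carry no closure conditions. Hence sums in a product are
  evaluated componentwise, and sums in \<open>End_module C\<close> agree with sums in
  \<open>C\<close>, without side conditions.\<close>

primrec nsum :: "('a, 'b) ring_scheme \<Rightarrow> nat \<Rightarrow> (nat \<Rightarrow> 'a) \<Rightarrow> 'a" where
  "nsum M 0 v = \<zero>\<^bsub>M\<^esub>"
| "nsum M (Suc n) v = nsum M n v \<oplus>\<^bsub>M\<^esub> v n"

lemma nsum_cong: "(\<And>k. k < n \<Longrightarrow> v k = w k) \<Longrightarrow> nsum M n v = nsum M n w"
  by (induction n) auto

context left_module
begin

lemma nsum_closed: "(\<And>k. k < n \<Longrightarrow> v k \<in> carrier M) \<Longrightarrow> nsum M n v \<in> carrier M"
  by (induction n) auto

lemma nsum_zero: "(\<And>k. k < n \<Longrightarrow> v k = \<zero>\<^bsub>M\<^esub>) \<Longrightarrow> nsum M n v = \<zero>\<^bsub>M\<^esub>"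
  by (induction n) auto

lemma add_add_swap:
  assumes "a \<in> carrier M" "b \<in> carrier M" "c \<in> carrier M" "d \<in> carrier M"
  shows "(a \<oplus>\<^bsub>M\<^esub> b) \<oplus>\<^bsub>M\<^esub> (c \<oplus>\<^bsub>M\<^esub> d) = (a \<oplus>\<^bsub>M\<^esub> c) \<oplus>\<^bsub>M\<^esub> (b \<oplus>\<^bsub>M\<^esub> d)"
  using assms by (simp add: M.a_ac)

lemma nsum_add:
  assumes "\<And>k. k < n \<Longrightarrow> v k \<in> carrier M" "\<And>k. k < n \<Longrightarrow> w k \<in> carrier M"
  shows "nsum M n (\<lambda>k. v k \<oplus>\<^bsub>M\<^esub> w k) = nsum M n v \<oplus>\<^bsub>M\<^esub> nsum M n w"
  using assms
proof (induction n)
  case (Suc n)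
  then show ?case by (simp add: add_add_swap nsum_closed)
qed simp

lemma nsum_smult:
  assumes "\<And>k. k < n \<Longrightarrow> v k \<in> carrier M" "r \<in> carrier R"
  shows "r \<odot>\<^bsub>M\<^esub> nsum M n v = nsum M n (\<lambda>k. r \<odot>\<^bsub>M\<^esub> v k)"
  using assms by (induction n) (auto simp: lsmult_r_distr nsum_closed)

lemma nsum_swap:
  assumes "\<And>j k. \<lbrakk>j < m; k < n\<rbrakk> \<Longrightarrow> v j k \<in> carrier M"
  shows "nsum M m (\<lambda>j. nsum M n (v j)) = nsum M n (\<lambda>k. nsum M m (\<lambda>j. v j k))"
  using assms
proof (induction m)
  case 0
  show ?case by (simp add: nsum_zero)
next
  case (Suc m)
  then show ?case by (simp add: nsum_add nsum_closed)
qed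

end

lemma hom_nsum:
  assumes M: "left_module R M" and N: "left_module R N" and f: "f \<in> mod_hom R M N"
    and v: "\<And>k. k < n \<Longrightarrow> v k \<in> carrier M"
  shows "f (nsum M n v) = nsum N n (\<lambda>k. f (v k))"
  using v
proof (induction n)
  case 0
  show ?case by (simp add: hom_zero[OF M N f])
next
  case (Suc n)
  then show ?case by (simp add: hom_add[OF f] left_module.nsum_closed[OF M])
qed

text \<open>The j-th coordinate embedding of N into N^n.\<close>

definition ins :: "('r, 'm) module \<Rightarrow> nat \<Rightarrow> nat \<Rightarrow> 'm \<Rightarrow> nat \<Rightarrow> 'm" where
  "ins N n j y = (\<lambda>i\<in>{..<n}. if i = j then y else \<zero>\<^bsub>N\<^esub>)"

lemma ins_carrier:
  assumes N: "left_module R N" and y: "y \<in> carrier N"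
  shows "ins N n j y \<in> carrier (product_module {..<n} (\<lambda>_. N))"
proof -
  interpret N: left_module R N by (rule N)
  show ?thesis using y by (simp add: ins_def product_carrier)
qed

lemma ins_hom:
  assumes N: "left_module R N"
  shows "(\<lambda>y\<in>carrier N. ins N n j y) \<in> mod_hom R N (product_module {..<n} (\<lambda>_. N))"
proof -
  interpret N: left_module R N by (rule N)
  show ?thesis
  proof (rule mod_homI)
    fix x y assume "x \<in> carrier N" "y \<in> carrier N"
    then show "(\<lambda>y\<in>carrier N. ins N n j y) (x \<oplus>\<^bsub>N\<^esub> y) =
        (\<lambda>y\<in>carrier N. ins N n j y) x \<oplus>\<^bsub>product_module {..<n} (\<lambda>_. N)\<^esub> (\<lambda>y\<in>carrier N. ins N n j y) y"
      by (auto simp: ins_def product_module_def intro!: restrict_ext)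
  next
    fix r x assume "r \<in> carrier R" "x \<in> carrier N"
    then show "(\<lambda>y\<in>carrier N. ins N n j y) (r \<odot>\<^bsub>N\<^esub> x) =
        r \<odot>\<^bsub>product_module {..<n} (\<lambda>_. N)\<^esub> (\<lambda>y\<in>carrier N. ins N n j y) x"
      by (auto simp: ins_def product_module_def N.lsmult_closed intro!: restrict_ext)
  qed (simp add: ins_carrier[OF N])
qed

lemma product_decomposition:
  assumes N: "left_module R N" and z: "z \<in> carrier (product_module {..<n} (\<lambda>_. N))"
  shows "nsum (product_module {..<n} (\<lambda>_. N)) n (\<lambda>j. ins N n j (z j)) = z"
proof -
  interpret N: left_module R N by (rule N)
  let ?P = "product_module {..<n} (\<lambda>_. N)"
  interpret P: left_module R ?P by (rule product_left_module[OF N.ring_axioms N])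
  have zc: "z j \<in> carrier N" if "j < n" for j using product_in_carrier[OF z] that by simp
  have "nsum ?P m (\<lambda>j. ins N n j (z j)) = (\<lambda>i\<in>{..<n}. if i < m then z i else \<zero>\<^bsub>N\<^esub>)" if "m \<le> n" for m
    using that
  proof (induction m)
    case 0
    then show ?case by (simp add: product_module_def)
  next
    case (Suc m)
    then show ?case
      using zc by (auto simp: ins_def product_module_def less_Suc_eq intro!: restrict_ext)
  qed
  then have "nsum ?P n (\<lambda>j. ins N n j (z j)) = (\<lambda>i\<in>{..<n}. if i < n then z i else \<zero>\<^bsub>N\<^esub>)" by simp
  also have "\<dots> = z"
    by (rule product_ext[OF _ z]) (use zc in \<open>auto simp: product_carrier\<close>)
  finally show ?thesis .
qed

lemma hom_product_expand:
  assumes N: "left_module R N" and V: "left_module R V"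
    and g: "g \<in> mod_hom R (product_module {..<n} (\<lambda>_. N)) V"
    and z: "z \<in> carrier (product_module {..<n} (\<lambda>_. N))"
  shows "g z = nsum V n (\<lambda>j. g (ins N n j (z j)))"
proof -
  interpret N: left_module R N by (rule N)
  have P: "left_module R (product_module {..<n} (\<lambda>_. N))" by (rule product_left_module[OF N.ring_axioms N])
  have c: "ins N n k (z k) \<in> carrier (product_module {..<n} (\<lambda>_. N))" if "k < n" for k
    by (rule ins_carrier[OF N]) (use that product_in_carrier[OF z] in simp)
  have "g (nsum (product_module {..<n} (\<lambda>_. N)) n (\<lambda>j. ins N n j (z j))) = nsum V n (\<lambda>j. g (ins N n j (z j)))"
    by (rule hom_nsum[OF P V g c])
  then show ?thesis by (simp add: product_decomposition[OF N z])
qed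

lemma regular_simps [simp]: "carrier (regular_module R) = carrier R" "x \<oplus>\<^bsub>regular_module R\<^esub> y = x \<oplus>\<^bsub>R\<^esub> y"
  "r \<odot>\<^bsub>regular_module R\<^esub> x = r \<otimes>\<^bsub>R\<^esub> x" "\<zero>\<^bsub>regular_module R\<^esub> = \<zero>\<^bsub>R\<^esub>"
  by (simp_all add: regular_module_def)

abbreviation free_module :: "('r, 'd) ring_scheme \<Rightarrow> nat \<Rightarrow> ('r, nat \<Rightarrow> 'r) module" where
  "free_module R n \<equiv> product_module {..<n} (\<lambda>_. regular_module R)"

lemma free_left_module: "ring R \<Longrightarrow> left_module R (free_module R n)"
  by (rule product_left_module) (auto intro: regular_left_module)

lemma hom_free_expand:
  assumes R: "ring R" and A: "left_module R A" and p: "p \<in> mod_hom R (free_module R n) A"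
    and t: "t \<in> carrier (free_module R n)"
  shows "p t = nsum A n (\<lambda>k. t k \<odot>\<^bsub>A\<^esub> p (ins (regular_module R) n k \<one>\<^bsub>R\<^esub>))"
proof -
  interpret ring R by (rule R)
  note reg = regular_left_module[OF R]
  have "p (ins (regular_module R) n k (t k)) = t k \<odot>\<^bsub>A\<^esub> p (ins (regular_module R) n k \<one>\<^bsub>R\<^esub>)" if k: "k < n" for k
  proof -
    have tk: "t k \<in> carrier R" using product_in_carrier[OF t, of k] k by simp
    have "ins (regular_module R) n k (t k) = t k \<odot>\<^bsub>free_module R n\<^esub> ins (regular_module R) n k \<one>\<^bsub>R\<^esub>"
      using tk by (auto simp: ins_def product_module_def intro!: restrict_ext)
    then show ?thesis
      using tk by (simp add: hom_smult[OF p] ins_carrier[OF reg])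
  qed
  then show ?thesis
    unfolding hom_product_expand[OF reg A p t] by (rule nsum_cong)
qed

lemma free_hom:
  assumes N: "left_module R N" and v: "\<And>k. k < n \<Longrightarrow> v k \<in> carrier N"
  shows "(\<lambda>t\<in>carrier (free_module R n). nsum N n (\<lambda>k. t k \<odot>\<^bsub>N\<^esub> v k)) \<in> mod_hom R (free_module R n) N"
proof -
  interpret N: left_module R N by (rule N)
  interpret F: left_module R "free_module R n" by (rule free_left_module[OF N.ring_axioms])
  have tc: "t k \<in> carrier R" if "t \<in> carrier (free_module R n)" "k < n" for t k
    using product_in_carrier[OF that(1), of k] that(2) by simp
  have vc: "t k \<odot>\<^bsub>N\<^esub> v k \<in> carrier N" if "t \<in> carrier (free_module R n)" "k < n" for t k
    using tc[OF that] v[OF that(2)] by (rule N.lsmult_closed)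
  show ?thesis
  proof (rule mod_homI)
    fix t s assume t: "t \<in> carrier (free_module R n)" and s: "s \<in> carrier (free_module R n)"
    have "nsum N n (\<lambda>k. (t \<oplus>\<^bsub>free_module R n\<^esub> s) k \<odot>\<^bsub>N\<^esub> v k) = nsum N n (\<lambda>k. t k \<odot>\<^bsub>N\<^esub> v k \<oplus>\<^bsub>N\<^esub> s k \<odot>\<^bsub>N\<^esub> v k)"
      by (rule nsum_cong) (simp add: N.lsmult_l_distr tc[OF t] tc[OF s] v)
    also have "\<dots> = nsum N n (\<lambda>k. t k \<odot>\<^bsub>N\<^esub> v k) \<oplus>\<^bsub>N\<^esub> nsum N n (\<lambda>k. s k \<odot>\<^bsub>N\<^esub> v k)"
      by (rule N.nsum_add) (simp_all add: vc t s)
    finally show "(\<lambda>t\<in>carrier (free_module R n). nsum N n (\<lambda>k. t k \<odot>\<^bsub>N\<^esub> v k)) (t \<oplus>\<^bsub>free_module R n\<^esub> s) =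
      (\<lambda>t\<in>carrier (free_module R n). nsum N n (\<lambda>k. t k \<odot>\<^bsub>N\<^esub> v k)) t
      \<oplus>\<^bsub>N\<^esub> (\<lambda>t\<in>carrier (free_module R n). nsum N n (\<lambda>k. t k \<odot>\<^bsub>N\<^esub> v k)) s"
      using t s by simp
  next
    fix r t assume r: "r \<in> carrier R" and t: "t \<in> carrier (free_module R n)"
    have "nsum N n (\<lambda>k. (r \<odot>\<^bsub>free_module R n\<^esub> t) k \<odot>\<^bsub>N\<^esub> v k) = nsum N n (\<lambda>k. r \<odot>\<^bsub>N\<^esub> (t k \<odot>\<^bsub>N\<^esub> v k))"
      by (rule nsum_cong) (simp add: N.lsmult_assoc r tc[OF t] v)
    also have "\<dots> = r \<odot>\<^bsub>N\<^esub> nsum N n (\<lambda>k. t k \<odot>\<^bsub>N\<^esub> v k)"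
      by (rule N.nsum_smult[symmetric]) (simp_all add: vc t r)
    finally show "(\<lambda>t\<in>carrier (free_module R n). nsum N n (\<lambda>k. t k \<odot>\<^bsub>N\<^esub> v k)) (r \<odot>\<^bsub>free_module R n\<^esub> t) =
      r \<odot>\<^bsub>N\<^esub> (\<lambda>t\<in>carrier (free_module R n). nsum N n (\<lambda>k. t k \<odot>\<^bsub>N\<^esub> v k)) t"
      using r t by (simp add: F.lsmult_closed)
  qed (auto intro!: N.nsum_closed vc)
qed

text \<open>The universal property of a presentation: homomorphisms from A to N correspond to the
  solutions v of the relations in N.\<close>

lemma presentation_hom:
  assumes A: "left_module R A" and N: "left_module R N"
    and p: "p \<in> mod_hom R (free_module R n) A" "p ` carrier (free_module R n) = carrier A"
    and X: "X \<subseteq> carrier (free_module R n)" "mod_span R (free_module R n) X = {x \<in> carrier (free_module R n). p x = \<zero>\<^bsub>A\<^esub>}"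
    and v: "\<And>k. k < n \<Longrightarrow> v k \<in> carrier N" and rel: "\<And>x. x \<in> X \<Longrightarrow> nsum N n (\<lambda>k. x k \<odot>\<^bsub>N\<^esub> v k) = \<zero>\<^bsub>N\<^esub>"
  shows "\<exists>h\<in>mod_hom R A N. \<forall>t\<in>carrier (free_module R n). h (p t) = nsum N n (\<lambda>k. t k \<odot>\<^bsub>N\<^esub> v k)"
proof -
  interpret A: left_module R A by (rule A)
  have F: "left_module R (free_module R n)" by (rule free_left_module[OF A.ring_axioms])
  interpret F: left_module R "free_module R n" by (rule F)
  let ?f = "\<lambda>t\<in>carrier (free_module R n). nsum N n (\<lambda>k. t k \<odot>\<^bsub>N\<^esub> v k)"
  have f: "?f \<in> mod_hom R (free_module R n) N" by (rule free_hom[OF N v])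
  have "mod_span R (free_module R n) X \<subseteq> {x \<in> carrier (free_module R n). ?f x = \<zero>\<^bsub>N\<^esub>}"
    by (rule F.mod_span_least[OF hom_ker_submodule[OF F N f]]) (use X(1) rel in auto)
  then have ker: "?f x = \<zero>\<^bsub>N\<^esub>" if "x \<in> carrier (free_module R n)" "p x = \<zero>\<^bsub>A\<^esub>" for x
    using that unfolding X(2) by auto
  have "\<exists>h\<in>mod_hom R A N. \<forall>t\<in>carrier (free_module R n). h (p t) = ?f t"
  proof (rule hom_factor[OF F p f])
    fix x y assume xy: "x \<in> carrier (free_module R n)" "y \<in> carrier (free_module R n)" "p x = p y"
    then have "p (x \<ominus>\<^bsub>free_module R n\<^esub> y) = \<zero>\<^bsub>A\<^esub>" using hom_eq_iff[OF F A p(1) xy(1,2)] by simp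
    then have "?f (x \<ominus>\<^bsub>free_module R n\<^esub> y) = \<zero>\<^bsub>N\<^esub>"
      using xy(1,2) by (intro ker) auto
    then show "?f x = ?f y" using hom_eq_iff[OF F N f xy(1,2)] by simp
  qed
  then show ?thesis by auto
qed

lemma tensor_nsum_right:
  assumes M: "right_module R M" and N: "left_module R N" and x: "x \<in> carrier M"
    and v: "\<And>k. k < n \<Longrightarrow> v k \<in> carrier N"
  shows "frag_of (x, nsum N n v) - (\<Sum>k<n. frag_of (x, v k)) \<in> tensor_relations R M N"
  using v
proof (induction n)
  case 0
  then show ?case by (simp add: tensor_zero_right[OF M N x])
next
  case (Suc n)
  then have "frag_of (x, nsum N n v \<oplus>\<^bsub>N\<^esub> v n) - frag_of (x, nsum N n v) - frag_of (x, v n) \<in> tensor_relations R M N"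
    by (intro tensor_right[OF M N x] left_module.nsum_closed[OF N]) auto
  from tensor_add[OF M N this Suc(1)] Suc(2) show ?case by (simp add: algebra_simps)
qed

lemma tensor_nsum_left:
  assumes M: "right_module R M" and N: "left_module R N" and y: "y \<in> carrier N"
    and v: "\<And>k. k < n \<Longrightarrow> v k \<in> carrier M"
  shows "frag_of (nsum M n v, y) - (\<Sum>k<n. frag_of (v k, y)) \<in> tensor_relations R M N"
  using v
proof (induction n)
  case 0
  interpret M: left_module "opp R" M by (rule M)
  show ?case using tensor_uminus[OF M N tensor_left[OF M N M.M.zero_closed M.M.zero_closed y]] by simp
next
  case (Suc n)
  then have "frag_of (nsum M n v \<oplus>\<^bsub>M\<^esub> v n, y) - frag_of (nsum M n v, y) - frag_of (v n, y) \<in> tensor_relations R M N"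
    by (intro tensor_left[OF M N _ _ y] left_module.nsum_closed[OF M]) auto
  from tensor_add[OF M N this Suc(1)] Suc(2) show ?case by (simp add: algebra_simps)
qed

lemma tensor_sum:
  assumes M: "right_module R M" and N: "left_module R N"
    and "\<And>i. i \<in> I \<Longrightarrow> z i \<in> tensor_relations R M N"
  shows "sum z I \<in> tensor_relations R M N"
  using assms(3) by (induction I rule: infinite_finite_induct) (auto simp: tensor_zero[OF M N] tensor_add[OF M N])

section \<open>The local dual\<close>

lemma (in left_module) add_minus_both:
  assumes "x \<in> carrier M" "y \<in> carrier M"
  shows "(x \<oplus>\<^bsub>M\<^esub> y) \<oplus>\<^bsub>M\<^esub> \<ominus>\<^bsub>M\<^esub> x \<oplus>\<^bsub>M\<^esub> \<ominus>\<^bsub>M\<^esub> y = \<zero>\<^bsub>M\<^esub>"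
proof -
  have "(x \<oplus>\<^bsub>M\<^esub> y) \<oplus>\<^bsub>M\<^esub> \<ominus>\<^bsub>M\<^esub> x \<oplus>\<^bsub>M\<^esub> \<ominus>\<^bsub>M\<^esub> y = (x \<oplus>\<^bsub>M\<^esub> y) \<oplus>\<^bsub>M\<^esub> \<ominus>\<^bsub>M\<^esub> (x \<oplus>\<^bsub>M\<^esub> y)"
    using assms by (simp add: M.minus_add M.a_assoc)
  then show ?thesis using assms by (simp add: M.r_neg)
qed

lemma hom_ident:
  assumes M: "left_module R M"
  shows "(\<lambda>x\<in>carrier M. x) \<in> mod_hom R M M"
proof -
  interpret left_module R M by (rule M)
  show ?thesis by (rule mod_homI) (auto simp: lsmult_closed)
qed

lemma nsum_End_module [simp]: "nsum (End_module C) n v = nsum C n v"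
  by (induction n) auto

text \<open>The opposite of \<open>right_End R C\<close> is \<open>End_ring R C\<close>. The right
  module V of the theorem is thus a left module over \<open>End_ring R C\<close>, and all work over
  S is done with left modules.\<close>

locale dual_setup =
  fixes U :: "'u itself" and R :: "('r, 'd) ring_scheme" and C :: "('r, 'c) module"
    and V :: "('c \<Rightarrow> 'c, 'v) module"
  assumes large: "large_universe U R C"
    and C_module: "left_module R C"
    and C_fp: "finitely_presented R C"
    and V_module: "left_module (End_ring R C) V"
    and V_injective: "injective_module U (End_ring R C) V"
    and V_cogenerator: "cogenerator U (End_ring R C) V"
begin

sublocale C: left_module R C by (rule C_module)

abbreviation S where "S \<equiv> End_ring R C"
abbreviation Cm where "Cm \<equiv> End_module C"
abbreviation Cp where "Cp \<equiv> local_dual R C V"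

sublocale V: left_module S V by (rule V_module)

lemma Cm_module: "left_module S Cm"
  by (rule End_module_left_module[OF C_module])

sublocale Cm: left_module S Cm by (rule Cm_module)

lemma universe_infinite: "infinite (UNIV :: 'u set)"
  and R_le: "carrier R \<lesssim> (UNIV :: 'u set)"
  and S_le: "carrier S \<lesssim> (UNIV :: 'u set)"
  and power_le: "((UNIV :: nat set) \<rightarrow>\<^sub>E carrier C) \<lesssim> (UNIV :: 'u set)"
  using large unfolding large_universe_def by blast+

lemma C_le: "carrier C \<lesssim> (UNIV :: 'u set)"
proof -
  have "carrier C \<lesssim> ((UNIV :: nat set) \<rightarrow>\<^sub>E carrier C)"
    unfolding lepoll_def
  proof (intro exI conjI)
    show "inj_on (\<lambda>c. \<lambda>k\<in>(UNIV :: nat set). c) (carrier C)"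
    proof (rule inj_onI)
      fix c d assume "(\<lambda>k\<in>UNIV. c) = (\<lambda>k\<in>(UNIV :: nat set). d)"
      from fun_cong[OF this, of 0] show "c = d" by simp
    qed
  qed auto
  then show ?thesis using power_le lepoll_trans by blast
qed

lemma Cm_power_le: "carrier (product_module {..<n::nat} (\<lambda>_. Cm)) \<lesssim> (UNIV :: 'u set)"
  using lepoll_finite_power[OF C_le universe_infinite, of n] by (simp add: product_carrier)

lemma Cm_power_module: "left_module S (product_module I (\<lambda>_. Cm))"
  by (rule product_left_module[OF V.ring_axioms Cm_module])

lemma Cp_carrier: "carrier Cp = mod_hom S Cm V"
  by (simp add: local_dual_def right_End_def)

lemma Cp_apply [simp]:
  "c \<in> carrier C \<Longrightarrow> (f \<oplus>\<^bsub>Cp\<^esub> g) c = f c \<oplus>\<^bsub>V\<^esub> g c"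
  "c \<in> carrier C \<Longrightarrow> (r \<odot>\<^bsub>Cp\<^esub> f) c = f (r \<odot>\<^bsub>C\<^esub> c)"
  "c \<in> carrier C \<Longrightarrow> \<zero>\<^bsub>Cp\<^esub> c = \<zero>\<^bsub>V\<^esub>"
  by (simp_all add: local_dual_def)

lemma Cp_hom:
  assumes "f \<in> carrier Cp"
  shows "x \<in> carrier C \<Longrightarrow> f x \<in> carrier V"
    "\<lbrakk>x \<in> carrier C; y \<in> carrier C\<rbrakk> \<Longrightarrow> f (x \<oplus>\<^bsub>C\<^esub> y) = f x \<oplus>\<^bsub>V\<^esub> f y"
    "\<lbrakk>s \<in> mod_hom R C C; x \<in> carrier C\<rbrakk> \<Longrightarrow> f (s x) = s \<odot>\<^bsub>V\<^esub> f x"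
    "f \<zero>\<^bsub>C\<^esub> = \<zero>\<^bsub>V\<^esub>"
    "x \<in> carrier C \<Longrightarrow> f (\<ominus>\<^bsub>C\<^esub> x) = \<ominus>\<^bsub>V\<^esub> f x"
proof -
  have f: "f \<in> mod_hom S Cm V" using assms by (simp add: Cp_carrier)
  show "x \<in> carrier C \<Longrightarrow> f x \<in> carrier V" using hom_closed[OF f] by simp
  show "\<lbrakk>x \<in> carrier C; y \<in> carrier C\<rbrakk> \<Longrightarrow> f (x \<oplus>\<^bsub>C\<^esub> y) = f x \<oplus>\<^bsub>V\<^esub> f y" using hom_add[OF f] by simp
  show "\<lbrakk>s \<in> mod_hom R C C; x \<in> carrier C\<rbrakk> \<Longrightarrow> f (s x) = s \<odot>\<^bsub>V\<^esub> f x" using hom_smult[OF f] by simp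
  show "f \<zero>\<^bsub>C\<^esub> = \<zero>\<^bsub>V\<^esub>" using hom_zero[OF Cm_module V_module f] by simp
  show "x \<in> carrier C \<Longrightarrow> f (\<ominus>\<^bsub>C\<^esub> x) = \<ominus>\<^bsub>V\<^esub> f x" using hom_a_inv[OF Cm_module V_module f] by simp
qed

lemma Cp_nsum:
  assumes "f \<in> carrier Cp" "\<And>k. k < n \<Longrightarrow> v k \<in> carrier C"
  shows "f (nsum C n v) = nsum V n (\<lambda>k. f (v k))"
  using hom_nsum[OF Cm_module V_module, of f n v] assms by (simp add: Cp_carrier)

lemma Cp_ext: "\<lbrakk>f \<in> carrier Cp; g \<in> carrier Cp; \<And>c. c \<in> carrier C \<Longrightarrow> f c = g c\<rbrakk> \<Longrightarrow> f = g"
  unfolding Cp_carrier by (erule (1) hom_eqI) simp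

lemma Cp_module: "right_module R Cp"
proof -
  have cI: "f \<in> carrier Cp"
    if "f \<in> carrier C \<rightarrow>\<^sub>E carrier V" "\<And>x y. \<lbrakk>x \<in> carrier C; y \<in> carrier C\<rbrakk> \<Longrightarrow> f (x \<oplus>\<^bsub>C\<^esub> y) = f x \<oplus>\<^bsub>V\<^esub> f y"
      "\<And>s x. \<lbrakk>s \<in> mod_hom R C C; x \<in> carrier C\<rbrakk> \<Longrightarrow> f (s x) = s \<odot>\<^bsub>V\<^esub> f x" for f
    unfolding Cp_carrier by (rule mod_homI) (use that in auto)
  have add: "f \<oplus>\<^bsub>Cp\<^esub> g \<in> carrier Cp" if f: "f \<in> carrier Cp" and g: "g \<in> carrier Cp" for f g
  proof (rule cI)
    show "f \<oplus>\<^bsub>Cp\<^esub> g \<in> carrier C \<rightarrow>\<^sub>E carrier V"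
      using Cp_hom(1)[OF f] Cp_hom(1)[OF g] by (simp add: local_dual_def)
  qed (simp_all add: Cp_hom[OF f] Cp_hom[OF g] V.add_add_swap V.lsmult_r_distr hom_closed[where M = C and N = C])
  have smult: "r \<odot>\<^bsub>Cp\<^esub> f \<in> carrier Cp" if r: "r \<in> carrier R" and f: "f \<in> carrier Cp" for r f
  proof (rule cI)
    show "r \<odot>\<^bsub>Cp\<^esub> f \<in> carrier C \<rightarrow>\<^sub>E carrier V"
      using Cp_hom(1)[OF f] r by (simp add: local_dual_def C.lsmult_closed)
  next
    fix s x assume s: "s \<in> mod_hom R C C" and x: "x \<in> carrier C"
    then show "(r \<odot>\<^bsub>Cp\<^esub> f) (s x) = s \<odot>\<^bsub>V\<^esub> (r \<odot>\<^bsub>Cp\<^esub> f) x"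
      using r Cp_hom(3)[OF f s, of "r \<odot>\<^bsub>C\<^esub> x"] by (simp add: hom_closed[OF s] hom_smult[OF s] C.lsmult_closed)
  qed (simp_all add: Cp_hom[OF f] C.lsmult_r_distr C.lsmult_closed r)
  have zero: "\<zero>\<^bsub>Cp\<^esub> \<in> carrier Cp"
    by (rule cI) (simp_all add: hom_closed[where M = C and N = C], simp add: local_dual_def)
  note cl = add smult zero
  show ?thesis
  proof (rule left_moduleI)
    show "ring (opp R)" by (rule ring_opp[OF C.ring_axioms])
  qed (auto intro!: Cp_ext cl simp: cl Cp_hom C.lsmult_closed C.lsmult_l_distr C.lsmult_assoc C.lsmult_one V.M.a_ac)
qed

sublocale Cp: left_module "opp R" Cp by (rule Cp_module)

lemma Cp_smult_closed: "\<lbrakk>r \<in> carrier R; f \<in> carrier Cp\<rbrakk> \<Longrightarrow> r \<odot>\<^bsub>Cp\<^esub> f \<in> carrier Cp"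
  using Cp.lsmult_closed by simp

lemma Cp_nsum_apply: "c \<in> carrier C \<Longrightarrow> nsum Cp n w c = nsum V n (\<lambda>k. w k c)"
  by (induction n) auto

text \<open>The actions of R and S on C commute, so the rows of a matrix over R act S-linearly on
  C^n.\<close>

lemma lincomb_hom:
  assumes a: "\<And>k. k < n \<Longrightarrow> a k \<in> carrier R"
  shows "(\<lambda>x\<in>carrier (product_module {..<n} (\<lambda>_. Cm)). nsum C n (\<lambda>k. a k \<odot>\<^bsub>C\<^esub> x k))
    \<in> mod_hom S (product_module {..<n} (\<lambda>_. Cm)) Cm"
proof -
  let ?P = "product_module {..<n} (\<lambda>_. Cm)"
  interpret P: left_module S ?P by (rule Cm_power_module)
  have xc: "x k \<in> carrier C" if "x \<in> carrier ?P" "k < n" for x k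
    using product_in_carrier[OF that(1), of k] that(2) by simp
  have ax: "a k \<odot>\<^bsub>C\<^esub> x k \<in> carrier C" if "x \<in> carrier ?P" "k < n" for x k
    using xc[OF that] a[OF that(2)] by (rule C.lsmult_closed[rotated])
  show ?thesis
  proof (rule mod_homI)
    fix x y assume x: "x \<in> carrier ?P" and y: "y \<in> carrier ?P"
    have "nsum C n (\<lambda>k. a k \<odot>\<^bsub>C\<^esub> (x \<oplus>\<^bsub>?P\<^esub> y) k) = nsum C n (\<lambda>k. a k \<odot>\<^bsub>C\<^esub> x k \<oplus>\<^bsub>C\<^esub> a k \<odot>\<^bsub>C\<^esub> y k)"
      by (rule nsum_cong) (simp add: C.lsmult_r_distr a xc x y)
    also have "\<dots> = nsum C n (\<lambda>k. a k \<odot>\<^bsub>C\<^esub> x k) \<oplus>\<^bsub>C\<^esub> nsum C n (\<lambda>k. a k \<odot>\<^bsub>C\<^esub> y k)"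
      by (rule C.nsum_add) (simp_all add: ax x y)
    finally show "(\<lambda>x\<in>carrier ?P. nsum C n (\<lambda>k. a k \<odot>\<^bsub>C\<^esub> x k)) (x \<oplus>\<^bsub>?P\<^esub> y)
      = (\<lambda>x\<in>carrier ?P. nsum C n (\<lambda>k. a k \<odot>\<^bsub>C\<^esub> x k)) x \<oplus>\<^bsub>Cm\<^esub> (\<lambda>x\<in>carrier ?P. nsum C n (\<lambda>k. a k \<odot>\<^bsub>C\<^esub> x k)) y"
      using x y by simp
  next
    fix s x assume s: "s \<in> carrier S" and x: "x \<in> carrier ?P"
    have s': "s \<in> mod_hom R C C" using s by simp
    have "nsum C n (\<lambda>k. a k \<odot>\<^bsub>C\<^esub> (s \<odot>\<^bsub>?P\<^esub> x) k) = nsum C n (\<lambda>k. s (a k \<odot>\<^bsub>C\<^esub> x k))"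
      by (rule nsum_cong) (simp add: hom_smult[OF s'] a xc x)
    also have "\<dots> = s (nsum C n (\<lambda>k. a k \<odot>\<^bsub>C\<^esub> x k))"
      by (rule hom_nsum[OF C_module C_module s', symmetric]) (simp add: ax x)
    finally show "(\<lambda>x\<in>carrier ?P. nsum C n (\<lambda>k. a k \<odot>\<^bsub>C\<^esub> x k)) (s \<odot>\<^bsub>?P\<^esub> x)
      = s \<odot>\<^bsub>Cm\<^esub> (\<lambda>x\<in>carrier ?P. nsum C n (\<lambda>k. a k \<odot>\<^bsub>C\<^esub> x k)) x"
      using s x P.lsmult_closed[OF s x] by simp
  qed (auto intro!: C.nsum_closed ax)
qed

lemma ins_comp_Cp:
  assumes g: "g \<in> mod_hom S (product_module {..<n} (\<lambda>_. Cm)) V"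
  shows "(\<lambda>y\<in>carrier C. g (ins Cm n j y)) \<in> carrier Cp"
proof -
  have "(\<lambda>y\<in>carrier Cm. g ((\<lambda>y\<in>carrier Cm. ins Cm n j y) y)) \<in> mod_hom S Cm V"
    by (rule hom_compose[OF ins_hom[OF Cm_module] g Cm_module])
  moreover have "(\<lambda>y\<in>carrier Cm. g ((\<lambda>y\<in>carrier Cm. ins Cm n j y) y)) = (\<lambda>y\<in>carrier C. g (ins Cm n j y))"
    by (auto intro!: restrict_ext)
  ultimately show ?thesis by (simp add: Cp_carrier)
qed

section \<open>Presentations of C and the evaluation map\<close>

lemma presentation:
  obtains n p X where "p \<in> mod_hom R (free_module R n) C" "p ` carrier (free_module R n) = carrier C"
    "finite X" "X \<subseteq> carrier (free_module R n)"
    "mod_span R (free_module R n) X = {x \<in> carrier (free_module R n). p x = \<zero>\<^bsub>C\<^esub>}"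
  using C_fp unfolding finitely_presented_def Let_def by blast

text \<open>
  As \<open>V\<close> is injective, a homomorphism on \<open>C\<^sup>l\<close> that vanishes on the kernel of the matrix
  \<open>a : C\<^sup>l \<rightarrow> C\<^sup>n\<close> factors through \<open>a\<close>.
\<close>

lemma dual_factor:
  assumes a: "\<And>k i. \<lbrakk>k < n; i < l\<rbrakk> \<Longrightarrow> a k i \<in> carrier R"
    and \<phi>: "\<phi> \<in> mod_hom S (product_module {..<l} (\<lambda>_. Cm)) V"
    and ker: "\<And>z. \<lbrakk>z \<in> carrier (product_module {..<l} (\<lambda>_. Cm));
      \<And>k. k < n \<Longrightarrow> nsum C l (\<lambda>i. a k i \<odot>\<^bsub>C\<^esub> z i) = \<zero>\<^bsub>C\<^esub>\<rbrakk> \<Longrightarrow> \<phi> z = \<zero>\<^bsub>V\<^esub>"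
  shows "\<exists>G. (\<forall>k. G k \<in> carrier Cp) \<and>
    (\<forall>i<l. \<forall>y\<in>carrier C. nsum Cp n (\<lambda>k. a k i \<odot>\<^bsub>Cp\<^esub> G k) y = \<phi> (ins Cm l i y))"
proof -
  let ?P = "product_module {..<l} (\<lambda>_. Cm)" and ?Q = "product_module {..<n} (\<lambda>_. Cm)"
  have P: "left_module S ?P" and Q: "left_module S ?Q" by (rule Cm_power_module)+
  define L where "L k = (\<lambda>x\<in>carrier ?P. nsum C l (\<lambda>i. a k i \<odot>\<^bsub>C\<^esub> x i))" for k
  have L: "L k \<in> mod_hom S ?P Cm" if "k < n" for k
    unfolding L_def by (rule lincomb_hom) (rule a[OF that])
  have Lins: "L k (ins Cm l i y) = a k i \<odot>\<^bsub>C\<^esub> y" if k: "k < n" and i: "i < l" and y: "y \<in> carrier C" for k i y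
  proof -
    have "nsum C q (\<lambda>j. a k j \<odot>\<^bsub>C\<^esub> ins Cm l i y j) = (if i < q then a k i \<odot>\<^bsub>C\<^esub> y else \<zero>\<^bsub>C\<^esub>)" if "q \<le> l" for q
      using that
    proof (induction q)
      case (Suc q)
      then show ?case using y a[OF k, of q] C.lsmult_closed[OF a[OF k i] y] by (auto simp: ins_def less_Suc_eq)
    qed simp
    then show ?thesis using ins_carrier[OF Cm_module, of y l i] y i by (simp add: L_def)
  qed
  define \<Phi> where "\<Phi> = (\<lambda>x\<in>carrier ?P. \<lambda>k\<in>{..<n}. L k x)"
  have \<Phi>: "\<Phi> \<in> mod_hom S ?P ?Q"
    unfolding \<Phi>_def by (rule tuple_hom[OF P L]) simp
  have "\<exists>g\<in>mod_hom S ?Q V. \<forall>x\<in>carrier ?P. g (\<Phi> x) = \<phi> x"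
  proof (rule injective_factor[OF V_injective V_module P Cm_power_le Q Cm_power_le \<Phi> \<phi>])
    fix x assume x: "x \<in> carrier ?P" and \<Phi>0: "\<Phi> x = \<zero>\<^bsub>?Q\<^esub>"
    show "\<phi> x = \<zero>\<^bsub>V\<^esub>"
    proof (rule ker[OF x])
      show "nsum C l (\<lambda>i. a k i \<odot>\<^bsub>C\<^esub> x i) = \<zero>\<^bsub>C\<^esub>" if "k < n" for k
        using fun_cong[OF \<Phi>0, of k] that x by (simp add: \<Phi>_def L_def)
    qed
  qed
  then obtain g where g: "g \<in> mod_hom S ?Q V" "\<And>x. x \<in> carrier ?P \<Longrightarrow> g (\<Phi> x) = \<phi> x" by blast
  \<comment> \<open>The components of g as a homomorphism on C^n; each is an element of C+.\<close>
  define G where "G k = (\<lambda>y\<in>carrier C. g (ins Cm n k y))" for k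
  have Gc: "G k \<in> carrier Cp" for k unfolding G_def by (rule ins_comp_Cp[OF g(1)])
  have "nsum Cp n (\<lambda>k. a k i \<odot>\<^bsub>Cp\<^esub> G k) y = \<phi> (ins Cm l i y)" if i: "i < l" and y: "y \<in> carrier C" for i y
  proof -
    have iP: "ins Cm l i y \<in> carrier ?P" by (rule ins_carrier[OF Cm_module]) (simp add: y)
    have \<Phi>c: "\<Phi> (ins Cm l i y) \<in> carrier ?Q" by (rule hom_closed[OF \<Phi> iP])
    have "\<phi> (ins Cm l i y) = g (\<Phi> (ins Cm l i y))" using g(2)[OF iP] by simp
    also have "\<dots> = nsum V n (\<lambda>k. g (ins Cm n k (\<Phi> (ins Cm l i y) k)))"
      by (rule hom_product_expand[OF Cm_module V_module g(1) \<Phi>c])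
    also have "\<dots> = nsum V n (\<lambda>k. (a k i \<odot>\<^bsub>Cp\<^esub> G k) y)"
      by (rule nsum_cong) (use iP y a[OF _ i] Lins[OF _ i y] in \<open>simp add: \<Phi>_def G_def C.lsmult_closed\<close>)
    also have "\<dots> = nsum Cp n (\<lambda>k. a k i \<odot>\<^bsub>Cp\<^esub> G k) y" using y by (simp add: Cp_nsum_apply)
    finally show ?thesis ..
  qed
  with Gc show ?thesis by (intro exI[of _ G]) simp
qed

text \<open>
  The relations \<open>\<rho>\<close> of \<open>C\<close> with respect to generators \<open>b\<close>. The solutions of \<open>\<rho>\<close> in \<open>C\<^sup>n\<close> are the images of
  \<open>b\<close> under \<open>S\<close>. Hence if \<open>f (\<Sum> t\<^sub>k b\<^sub>k) = 0\<close>, then \<open>(f t\<^sub>k)\<^sub>k\<close> vanishes on them.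
\<close>

definition presenting :: "nat \<Rightarrow> nat \<Rightarrow> (nat \<Rightarrow> nat \<Rightarrow> 'r) \<Rightarrow> (nat \<Rightarrow> 'c) \<Rightarrow> bool" where
  "presenting n m \<rho> b \<longleftrightarrow> (\<forall>j<m. \<forall>k<n. \<rho> j k \<in> carrier R) \<and> (\<forall>k. b k \<in> carrier C) \<and>
    (\<forall>c\<in>carrier C. \<exists>t. (\<forall>k<n. t k \<in> carrier R) \<and> c = nsum C n (\<lambda>k. t k \<odot>\<^bsub>C\<^esub> b k)) \<and>
    (\<forall>j<m. nsum C n (\<lambda>k. \<rho> j k \<odot>\<^bsub>C\<^esub> b k) = \<zero>\<^bsub>C\<^esub>) \<and>
    (\<forall>f\<in>carrier Cp. \<forall>t. (\<forall>k<n. t k \<in> carrier R) \<longrightarrow> f (nsum C n (\<lambda>k. t k \<odot>\<^bsub>C\<^esub> b k)) = \<zero>\<^bsub>V\<^esub> \<longrightarrow>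
      (\<exists>G. (\<forall>j. G j \<in> carrier Cp) \<and> (\<forall>k<n. t k \<odot>\<^bsub>Cp\<^esub> f = nsum Cp m (\<lambda>j. \<rho> j k \<odot>\<^bsub>Cp\<^esub> G j))))"

lemma presentingD:
  assumes "presenting n m \<rho> b"
  shows "\<lbrakk>j < m; k < n\<rbrakk> \<Longrightarrow> \<rho> j k \<in> carrier R" "b k \<in> carrier C"
    "c \<in> carrier C \<Longrightarrow> \<exists>t. (\<forall>k<n. t k \<in> carrier R) \<and> c = nsum C n (\<lambda>k. t k \<odot>\<^bsub>C\<^esub> b k)"
    "j < m \<Longrightarrow> nsum C n (\<lambda>k. \<rho> j k \<odot>\<^bsub>C\<^esub> b k) = \<zero>\<^bsub>C\<^esub>"
    "\<lbrakk>f \<in> carrier Cp; \<forall>k<n. t k \<in> carrier R; f (nsum C n (\<lambda>k. t k \<odot>\<^bsub>C\<^esub> b k)) = \<zero>\<^bsub>V\<^esub>\<rbrakk> \<Longrightarrow>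
      \<exists>G. (\<forall>j. G j \<in> carrier Cp) \<and> (\<forall>k<n. t k \<odot>\<^bsub>Cp\<^esub> f = nsum Cp m (\<lambda>j. \<rho> j k \<odot>\<^bsub>Cp\<^esub> G j))"
proof -
  note p = assms[unfolded presenting_def]
  note p1 = p[THEN conjunct1] and p2 = p[THEN conjunct2, THEN conjunct1]
    and p3 = p[THEN conjunct2, THEN conjunct2, THEN conjunct1]
    and p4 = p[THEN conjunct2, THEN conjunct2, THEN conjunct2, THEN conjunct1]
    and p5 = p[THEN conjunct2, THEN conjunct2, THEN conjunct2, THEN conjunct2]
  show "\<lbrakk>j < m; k < n\<rbrakk> \<Longrightarrow> \<rho> j k \<in> carrier R" using p1 by simp
  show "b k \<in> carrier C" using p2 by simp
  show "c \<in> carrier C \<Longrightarrow> \<exists>t. (\<forall>k<n. t k \<in> carrier R) \<and> c = nsum C n (\<lambda>k. t k \<odot>\<^bsub>C\<^esub> b k)"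
    by (rule p3[rule_format])
  show "j < m \<Longrightarrow> nsum C n (\<lambda>k. \<rho> j k \<odot>\<^bsub>C\<^esub> b k) = \<zero>\<^bsub>C\<^esub>" by (rule p4[rule_format])
  show "\<lbrakk>f \<in> carrier Cp; \<forall>k<n. t k \<in> carrier R; f (nsum C n (\<lambda>k. t k \<odot>\<^bsub>C\<^esub> b k)) = \<zero>\<^bsub>V\<^esub>\<rbrakk> \<Longrightarrow>
      \<exists>G. (\<forall>j. G j \<in> carrier Cp) \<and> (\<forall>k<n. t k \<odot>\<^bsub>Cp\<^esub> f = nsum Cp m (\<lambda>j. \<rho> j k \<odot>\<^bsub>Cp\<^esub> G j))"
    using p5 by simp
qed

lemma presenting_exists: "\<exists>n m \<rho> b. presenting n m \<rho> b"
proof -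
  obtain n p X where p: "p \<in> mod_hom R (free_module R n) C" "p ` carrier (free_module R n) = carrier C"
    and X: "finite X" "X \<subseteq> carrier (free_module R n)"
      "mod_span R (free_module R n) X = {x \<in> carrier (free_module R n). p x = \<zero>\<^bsub>C\<^esub>}"
    by (rule presentation)
  let ?F = "free_module R n"
  have F: "left_module R ?F" by (rule free_left_module[OF C.ring_axioms])
  interpret F: left_module R ?F by (rule F)
  obtain xs where xs: "set xs = X" using finite_list[OF X(1)] by blast
  define m where "m = length xs"
  define \<rho> where "\<rho> j k = (xs ! j) k" for j k
  have xsF: "xs ! j \<in> carrier ?F" if "j < m" for j using that xs X(2) by (auto simp: m_def)
  have \<rho>c: "\<rho> j k \<in> carrier R" if "j < m" "k < n" for j k
    using product_in_carrier[OF xsF[OF that(1)], of k] that(2) by (simp add: \<rho>_def)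
  define b where "b k = p (ins (regular_module R) n k \<one>\<^bsub>R\<^esub>)" for k
  have bc: "b k \<in> carrier C" for k
    unfolding b_def by (rule hom_closed[OF p(1)], rule ins_carrier[OF regular_left_module[OF C.ring_axioms]]) simp
  have pe: "p u = nsum C n (\<lambda>k. u k \<odot>\<^bsub>C\<^esub> b k)" if "u \<in> carrier ?F" for u
    unfolding b_def by (rule hom_free_expand[OF C.ring_axioms C_module p(1) that])
  have gen: "\<exists>t. (\<forall>k<n. t k \<in> carrier R) \<and> c = nsum C n (\<lambda>k. t k \<odot>\<^bsub>C\<^esub> b k)" if "c \<in> carrier C" for c
  proof -
    have "c \<in> p ` carrier ?F" unfolding p(2) by (rule that)
    then obtain t where t: "t \<in> carrier ?F" "c = p t" by blast
    have "t k \<in> carrier R" if "k < n" for k using product_in_carrier[OF t(1), of k] that by simp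
    then show ?thesis using t(2) pe[OF t(1)] by blast
  qed
  have rel: "nsum C n (\<lambda>k. \<rho> j k \<odot>\<^bsub>C\<^esub> b k) = \<zero>\<^bsub>C\<^esub>" if j: "j < m" for j
  proof -
    have "xs ! j \<in> mod_span R ?F X" using subsetD[OF F.mod_span_incl, of "xs ! j" X] j xs by (auto simp: m_def)
    then have "p (xs ! j) = \<zero>\<^bsub>C\<^esub>" unfolding X(3) by simp
    then show ?thesis using pe[OF xsF[OF j]] by (simp add: \<rho>_def)
  qed
  have sys: "\<exists>G. (\<forall>j. G j \<in> carrier Cp) \<and> (\<forall>k<n. t k \<odot>\<^bsub>Cp\<^esub> f = nsum Cp m (\<lambda>j. \<rho> j k \<odot>\<^bsub>Cp\<^esub> G j))"
    if f: "f \<in> carrier Cp" and tc: "\<And>k. k < n \<Longrightarrow> t k \<in> carrier R" and ft: "f (nsum C n (\<lambda>k. t k \<odot>\<^bsub>C\<^esub> b k)) = \<zero>\<^bsub>V\<^esub>"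
    for f t
  proof -
    let ?P = "product_module {..<n} (\<lambda>_. Cm)"
    have P: "left_module S ?P" by (rule Cm_power_module)
    have fh: "f \<in> mod_hom S Cm V" using f by (simp add: Cp_carrier)
    define Lt where "Lt = (\<lambda>x\<in>carrier ?P. nsum C n (\<lambda>k. t k \<odot>\<^bsub>C\<^esub> x k))"
    have Lt: "Lt \<in> mod_hom S ?P Cm" unfolding Lt_def by (rule lincomb_hom) (rule tc)
    define \<phi> where "\<phi> = (\<lambda>x\<in>carrier ?P. f (Lt x))"
    have \<phi>: "\<phi> \<in> mod_hom S ?P V"
      unfolding \<phi>_def by (rule hom_compose[OF Lt fh P])
    have ker: "\<phi> x = \<zero>\<^bsub>V\<^esub>"
      if x: "x \<in> carrier ?P" and rel0: "\<And>j. j < m \<Longrightarrow> nsum C n (\<lambda>k. \<rho> j k \<odot>\<^bsub>C\<^esub> x k) = \<zero>\<^bsub>C\<^esub>" for x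
    proof -
      have xc: "x k \<in> carrier C" if "k < n" for k using product_in_carrier[OF x, of k] that by simp
      have "\<exists>h\<in>mod_hom R C C. \<forall>u\<in>carrier ?F. h (p u) = nsum C n (\<lambda>k. u k \<odot>\<^bsub>C\<^esub> x k)"
      proof (rule presentation_hom[OF C_module C_module p X(2,3) xc])
        fix y assume "y \<in> X"
        then obtain j where "j < m" "y = xs ! j" using xs by (auto simp: m_def in_set_conv_nth)
        then show "nsum C n (\<lambda>k. y k \<odot>\<^bsub>C\<^esub> x k) = \<zero>\<^bsub>C\<^esub>" using rel0 by (simp add: \<rho>_def)
      qed
      then obtain h where h: "h \<in> mod_hom R C C" "\<forall>u\<in>carrier ?F. h (p u) = nsum C n (\<lambda>k. u k \<odot>\<^bsub>C\<^esub> x k)" ..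
      define u where "u = (\<lambda>k\<in>{..<n}. t k)"
      have u: "u \<in> carrier ?F" using tc by (simp add: u_def product_carrier)
      have ut: "nsum C n (\<lambda>k. u k \<odot>\<^bsub>C\<^esub> y k) = nsum C n (\<lambda>k. t k \<odot>\<^bsub>C\<^esub> y k)" for y
        by (rule nsum_cong) (simp add: u_def)
      have pu: "p u = nsum C n (\<lambda>k. t k \<odot>\<^bsub>C\<^esub> b k)" using pe[OF u] ut by simp
      have "\<phi> x = f (h (p u))" using h(2) u x ut by (simp add: \<phi>_def Lt_def)
      also have "\<dots> = h \<odot>\<^bsub>V\<^esub> f (p u)" by (rule Cp_hom(3)[OF f h(1) hom_closed[OF p(1) u]])
      also have "\<dots> = \<zero>\<^bsub>V\<^esub>" using h(1) ft pu by simp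
      finally show ?thesis .
    qed
    \<comment> \<open>\<phi> kills all solutions of the relations, so it factors through the
      relation matrix, and the components of the second factor are the G j.\<close>
    have "\<exists>G. (\<forall>j. G j \<in> carrier Cp) \<and>
        (\<forall>k<n. \<forall>y\<in>carrier C. nsum Cp m (\<lambda>j. \<rho> j k \<odot>\<^bsub>Cp\<^esub> G j) y = \<phi> (ins Cm n k y))"
      by (rule dual_factor[where a = \<rho>, OF \<rho>c \<phi> ker])
    then obtain G where G': "\<forall>j. G j \<in> carrier Cp"
      "\<forall>k<n. \<forall>y\<in>carrier C. nsum Cp m (\<lambda>j. \<rho> j k \<odot>\<^bsub>Cp\<^esub> G j) y = \<phi> (ins Cm n k y)"
      by blast
    have G: "G j \<in> carrier Cp" "\<And>k y. \<lbrakk>k < n; y \<in> carrier C\<rbrakk> \<Longrightarrow> nsum Cp m (\<lambda>j. \<rho> j k \<odot>\<^bsub>Cp\<^esub> G j) y = \<phi> (ins Cm n k y)" for j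
      using G' by simp_all
    have "t k \<odot>\<^bsub>Cp\<^esub> f = nsum Cp m (\<lambda>j. \<rho> j k \<odot>\<^bsub>Cp\<^esub> G j)" if k: "k < n" for k
    proof (rule Cp_ext)
      show "t k \<odot>\<^bsub>Cp\<^esub> f \<in> carrier Cp" by (rule Cp_smult_closed[OF tc[OF k] f])
      show "nsum Cp m (\<lambda>j. \<rho> j k \<odot>\<^bsub>Cp\<^esub> G j) \<in> carrier Cp"
        by (rule Cp.nsum_closed, rule Cp_smult_closed[OF \<rho>c[OF _ k] G(1)])
      fix y assume y: "y \<in> carrier C"
      have iP: "ins Cm n k y \<in> carrier ?P" by (rule ins_carrier[OF Cm_module]) (simp add: y)
      have "nsum C q (\<lambda>i. t i \<odot>\<^bsub>C\<^esub> ins Cm n k y i) = (if k < q then t k \<odot>\<^bsub>C\<^esub> y else \<zero>\<^bsub>C\<^esub>)" if "q \<le> n" for q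
        using that
      proof (induction q)
        case (Suc q)
        then show ?case using y tc[of q] C.lsmult_closed[OF tc[OF k] y] by (auto simp: ins_def less_Suc_eq)
      qed simp
      then have "\<phi> (ins Cm n k y) = f (t k \<odot>\<^bsub>C\<^esub> y)" using iP k by (simp add: \<phi>_def Lt_def)
      then show "(t k \<odot>\<^bsub>Cp\<^esub> f) y = nsum Cp m (\<lambda>j. \<rho> j k \<odot>\<^bsub>Cp\<^esub> G j) y" using y G(2)[OF k y] by simp
    qed
    then show ?thesis using G(1) by blast
  qed
  have "presenting n m \<rho> b"
    unfolding presenting_def
  proof (intro conjI allI impI ballI)
    fix f t assume "f \<in> carrier Cp" "\<forall>k<n. t k \<in> carrier R" "f (nsum C n (\<lambda>k. t k \<odot>\<^bsub>C\<^esub> b k)) = \<zero>\<^bsub>V\<^esub>"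
    then show "\<exists>G. (\<forall>j. G j \<in> carrier Cp) \<and> (\<forall>k<n. t k \<odot>\<^bsub>Cp\<^esub> f = nsum Cp m (\<lambda>j. \<rho> j k \<odot>\<^bsub>Cp\<^esub> G j))"
      by (intro sys) simp_all
  qed (rule \<rho>c bc gen rel; assumption)+
  then show ?thesis by blast
qed

text \<open>As \<open>C\<close> is finitely presented, the evaluation map \<open>C\<^sup>+ \<otimes> C \<rightarrow> V\<close> is injective.\<close>

lemma evaluation_injective:
  assumes f: "f \<in> carrier Cp" and c: "c \<in> carrier C" and fc: "f c = \<zero>\<^bsub>V\<^esub>"
  shows "frag_of (f, c) \<in> tensor_relations R Cp C"
proof -
  obtain n m \<rho> b where pres: "presenting n m \<rho> b" using presenting_exists by blast
  note \<rho>c = presentingD(1)[OF pres] and bc = presentingD(2)[OF pres] and rel = presentingD(4)[OF pres]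
  obtain t where t: "\<forall>k<n. t k \<in> carrier R" and ct: "c = nsum C n (\<lambda>k. t k \<odot>\<^bsub>C\<^esub> b k)"
    using presentingD(3)[OF pres c] by blast
  then have tc: "t k \<in> carrier R" if "k < n" for k using that by blast
  obtain G where G: "\<forall>j. G j \<in> carrier Cp" "\<forall>k<n. t k \<odot>\<^bsub>Cp\<^esub> f = nsum Cp m (\<lambda>j. \<rho> j k \<odot>\<^bsub>Cp\<^esub> G j)"
    using presentingD(5)[OF pres f t fc[unfolded ct]] by blast
  have Gc: "G j \<in> carrier Cp" for j using G(1) ..
  have ft: "t k \<odot>\<^bsub>Cp\<^esub> f = nsum Cp m (\<lambda>j. \<rho> j k \<odot>\<^bsub>Cp\<^esub> G j)" if "k < n" for k using G(2) that by blast
  have rG: "\<rho> j k \<odot>\<^bsub>Cp\<^esub> G j \<in> carrier Cp" if "j < m" "k < n" for j k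
    by (rule Cp_smult_closed[OF \<rho>c[OF that] Gc])
  let ?T = "tensor_relations R Cp C"
  note tens = Cp_module C_module
  \<comment> \<open>The calculation is carried out from its end: f \<otimes> c is the sum of the t_k
    f \<otimes> b_k, which is the sum of the \<rho>_jk G_j \<otimes> b_k, and moving \<rho>_jk to
    the right produces the relations of C.\<close>
  have "(\<Sum>k<n. frag_of (G j, \<rho> j k \<odot>\<^bsub>C\<^esub> b k)) \<in> ?T" if j: "j < m" for j
  proof -
    have d: "frag_of (G j, nsum C n (\<lambda>k. \<rho> j k \<odot>\<^bsub>C\<^esub> b k)) - (\<Sum>k<n. frag_of (G j, \<rho> j k \<odot>\<^bsub>C\<^esub> b k)) \<in> ?T"
      by (rule tensor_nsum_right[OF tens Gc]) (simp add: C.lsmult_closed \<rho>c j bc)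
    have "frag_of (G j, nsum C n (\<lambda>k. \<rho> j k \<odot>\<^bsub>C\<^esub> b k)) \<in> ?T"
      unfolding rel[OF j] by (rule tensor_zero_right[OF tens Gc])
    then show ?thesis using tensor_diff_cancel[OF tens d] by simp
  qed
  then have "(\<Sum>j<m. \<Sum>k<n. frag_of (G j, \<rho> j k \<odot>\<^bsub>C\<^esub> b k)) \<in> ?T"
    by - (rule tensor_sum[OF tens], simp)
  then have s1: "(\<Sum>k<n. \<Sum>j<m. frag_of (G j, \<rho> j k \<odot>\<^bsub>C\<^esub> b k)) \<in> ?T"
    by (subst sum.swap)
  have d2: "(\<Sum>k<n. \<Sum>j<m. frag_of (\<rho> j k \<odot>\<^bsub>Cp\<^esub> G j, b k) - frag_of (G j, \<rho> j k \<odot>\<^bsub>C\<^esub> b k)) \<in> ?T"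
    by (intro tensor_sum[OF tens] tensor_balanced[OF tens] Gc bc) (auto simp: \<rho>c)
  have s2: "(\<Sum>k<n. \<Sum>j<m. frag_of (\<rho> j k \<odot>\<^bsub>Cp\<^esub> G j, b k)) \<in> ?T"
    using tensor_diff_cancel[OF tens d2[unfolded sum_subtractf]] s1 by blast
  have d3: "(\<Sum>k<n. frag_of (t k \<odot>\<^bsub>Cp\<^esub> f, b k) - (\<Sum>j<m. frag_of (\<rho> j k \<odot>\<^bsub>Cp\<^esub> G j, b k))) \<in> ?T"
  proof (rule tensor_sum[OF tens])
    fix k assume "k \<in> {..<n}"
    then have k: "k < n" by simp
    show "frag_of (t k \<odot>\<^bsub>Cp\<^esub> f, b k) - (\<Sum>j<m. frag_of (\<rho> j k \<odot>\<^bsub>Cp\<^esub> G j, b k)) \<in> ?T"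
      unfolding ft[OF k] by (rule tensor_nsum_left[OF tens bc]) (rule rG[OF _ k])
  qed
  have s3: "(\<Sum>k<n. frag_of (t k \<odot>\<^bsub>Cp\<^esub> f, b k)) \<in> ?T"
    using tensor_diff_cancel[OF tens d3[unfolded sum_subtractf]] s2 by blast
  have d4: "(\<Sum>k<n. frag_of (t k \<odot>\<^bsub>Cp\<^esub> f, b k) - frag_of (f, t k \<odot>\<^bsub>C\<^esub> b k)) \<in> ?T"
    by (intro tensor_sum[OF tens] tensor_balanced[OF tens] f bc) (auto simp: tc)
  have s4: "(\<Sum>k<n. frag_of (f, t k \<odot>\<^bsub>C\<^esub> b k)) \<in> ?T"
    using tensor_diff_cancel[OF tens d4[unfolded sum_subtractf]] s3 by blast
  have d5: "frag_of (f, nsum C n (\<lambda>k. t k \<odot>\<^bsub>C\<^esub> b k)) - (\<Sum>k<n. frag_of (f, t k \<odot>\<^bsub>C\<^esub> b k)) \<in> ?T"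
    by (rule tensor_nsum_right[OF tens f]) (simp add: C.lsmult_closed tc bc)
  then show ?thesis
    using tensor_diff_cancel[OF tens d5] s4 unfolding ct by blast
qed

text \<open>The map (g, y) -> \<alpha> g y is balanced and factors through C+ \<otimes> C. For the
  identity this is the converse of \<open>evaluation_injective\<close>; in general the two lemmas
  together show that \<alpha> f vanishes wherever f does.\<close>

lemma evaluation_vanishes:
  assumes \<alpha>: "\<alpha> \<in> mod_hom (opp R) Cp Cp" and f: "f \<in> carrier Cp" and c: "c \<in> carrier C"
    and rel: "frag_of (f, c) \<in> tensor_relations R Cp C"
  shows "\<alpha> f c = \<zero>\<^bsub>V\<^esub>"
proof -
  have \<alpha>c: "\<alpha> g \<in> carrier Cp" if "g \<in> carrier Cp" for g by (rule hom_closed[OF \<alpha> that])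
  have grp: "comm_group (add_monoid V)" by (rule V.M.a_comm_group)
  have sub: "subgroup {\<zero>\<^bsub>V\<^esub>} (add_monoid V)"
    using V.submodule_zero by (simp add: submodule_def)
  obtain h where h: "h \<in> hom (free_Abelian_group (carrier Cp \<times> carrier C)) (add_monoid V)"
    "\<And>x y. \<lbrakk>x \<in> carrier Cp; y \<in> carrier C\<rbrakk> \<Longrightarrow> h (frag_of (x, y)) = \<alpha> x y"
    "\<And>z. z \<in> tensor_relations R Cp C \<Longrightarrow> h z \<in> {\<zero>\<^bsub>V\<^esub>}"
  proof (rule tensor_universal[OF Cp_module C_module grp _ sub, of "\<lambda>x y. \<alpha> x y"])
    fix x x' y assume "x \<in> carrier Cp" "x' \<in> carrier Cp" "y \<in> carrier C"
    then show "\<alpha> (x \<oplus>\<^bsub>Cp\<^esub> x') y \<otimes>\<^bsub>add_monoid V\<^esub> inv\<^bsub>add_monoid V\<^esub> (\<alpha> x y) \<otimes>\<^bsub>add_monoid V\<^esub> inv\<^bsub>add_monoid V\<^esub> (\<alpha> x' y) \<in> {\<zero>\<^bsub>V\<^esub>}"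
      by (simp add: a_inv_def[symmetric] hom_add[OF \<alpha>] V.add_minus_both Cp_hom \<alpha>c)
  next
    fix x y y' assume "x \<in> carrier Cp" "y \<in> carrier C" "y' \<in> carrier C"
    then show "\<alpha> x (y \<oplus>\<^bsub>C\<^esub> y') \<otimes>\<^bsub>add_monoid V\<^esub> inv\<^bsub>add_monoid V\<^esub> (\<alpha> x y) \<otimes>\<^bsub>add_monoid V\<^esub> inv\<^bsub>add_monoid V\<^esub> (\<alpha> x y') \<in> {\<zero>\<^bsub>V\<^esub>}"
      by (simp add: a_inv_def[symmetric] V.add_minus_both Cp_hom \<alpha>c)
  next
    fix r x y assume rxy: "r \<in> carrier R" "x \<in> carrier Cp" "y \<in> carrier C"
    then have "\<alpha> (r \<odot>\<^bsub>Cp\<^esub> x) y = \<alpha> x (r \<odot>\<^bsub>C\<^esub> y)" using hom_smult[OF \<alpha>, of r x] by simp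
    then show "\<alpha> (r \<odot>\<^bsub>Cp\<^esub> x) y \<otimes>\<^bsub>add_monoid V\<^esub> inv\<^bsub>add_monoid V\<^esub> (\<alpha> x (r \<odot>\<^bsub>C\<^esub> y)) \<in> {\<zero>\<^bsub>V\<^esub>}"
      using rxy by (simp add: a_inv_def[symmetric] V.M.r_neg Cp_hom \<alpha>c C.lsmult_closed)
  qed (auto simp: Cp_hom \<alpha>c)
  show ?thesis using h(2)[OF f c] h(3)[OF rel] by simp
qed

text \<open>If all c_i lie in Ker f, then the components of f \<otimes> c are zero, hence so is f
  \<otimes> c in C+ \<otimes> C^I. Applying u to the second factor and evaluating gives f (u c) =
  0.\<close>

lemma mittag_leffler_imp_stable:
  assumes ml: "mittag_leffler U R C Cp" and f: "f \<in> carrier Cp"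
  shows "stable U R C {x \<in> carrier C. f x = \<zero>\<^bsub>V\<^esub>}"
  unfolding stable_def
proof (intro allI ballI impI)
  fix I :: "'u set" and u c
  assume u: "u \<in> mod_hom R (product_module I (\<lambda>_. C)) C" and c: "c \<in> carrier (product_module I (\<lambda>_. C))"
    and ci: "\<forall>i\<in>I. c i \<in> {x \<in> carrier C. f x = \<zero>\<^bsub>V\<^esub>}"
  have CI: "left_module R (product_module I (\<lambda>_. C))" by (rule product_left_module[OF C.ring_axioms C_module])
  have "\<forall>i\<in>I. frag_map (\<lambda>x. x i) (frag_of (f, c)) \<in> tensor_relations R Cp C"
    using evaluation_injective[OF f] ci by simp
  then have "frag_of (f, c) \<in> tensor_relations R Cp (product_module I (\<lambda>_. C))"
    using ml[unfolded mittag_leffler_def, rule_format, of I] f c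
      inj_on_tensor_power_map_iff[OF Cp_module C_module CI proj_hom[OF C.ring_axioms C_module]] by simp
  from tensor_map_relations[OF Cp_module CI C_module u this]
  have "frag_of (f, u c) \<in> tensor_relations R Cp C" by simp
  from evaluation_vanishes[OF hom_ident[OF Cp_module] f hom_closed[OF u c] this]
  show "u c \<in> {x \<in> carrier C. f x = \<zero>\<^bsub>V\<^esub>}" using f hom_closed[OF u c] by simp
qed

lemma stable_kernels_imp_endofinite:
  assumes spi: "sigma_pure_injective U R C"
    and st: "\<And>f. f \<in> carrier Cp \<Longrightarrow> stable U R C {x \<in> carrier C. f x = \<zero>\<^bsub>V\<^esub>}"
  shows "endofinite R C"
proof -
  have stX: "stable U R C X" if X: "submodule X S Cm" for X
  proof -
    define \<X> where "\<X> = {{x \<in> carrier C. f x = \<zero>\<^bsub>V\<^esub>} | f. f \<in> carrier Cp \<and> (\<forall>x\<in>X. f x = \<zero>\<^bsub>V\<^esub>)}"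
    have Xc: "X \<subseteq> carrier C" using submodule_subset[OF X] by simp
    have "\<Inter>\<X> = X"
    proof
      show "X \<subseteq> \<Inter>\<X>" using Xc by (auto simp: \<X>_def)
      show "\<Inter>\<X> \<subseteq> X"
      proof
        fix c assume c: "c \<in> \<Inter>\<X>"
        \<comment> \<open>The zero functional makes C a member of the family, which keeps the
          intersection inside C.\<close>
        have "\<zero>\<^bsub>Cp\<^esub> \<in> carrier Cp" by simp
        then have "{x \<in> carrier C. \<zero>\<^bsub>Cp\<^esub> x = \<zero>\<^bsub>V\<^esub>} \<in> \<X>" unfolding \<X>_def using Xc by fastforce
        then have cC: "c \<in> carrier C" using c by blast
        show "c \<in> X"
        proof (rule ccontr)
          assume "c \<notin> X"
          then obtain f where f: "f \<in> mod_hom S Cm V" "\<forall>x\<in>X. f x = \<zero>\<^bsub>V\<^esub>" "f c \<noteq> \<zero>\<^bsub>V\<^esub>"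
            using cogenerator_separates[OF V_cogenerator V_module Cm_module S_le _ X, of c] C_le cC by auto
          then have "{x \<in> carrier C. f x = \<zero>\<^bsub>V\<^esub>} \<in> \<X>" unfolding \<X>_def Cp_carrier by blast
          then show False using c f(3) by blast
        qed
      qed
    qed
    moreover have "stable U R C (\<Inter>\<X>)" by (rule stable_Inter) (auto simp: \<X>_def st)
    ultimately show ?thesis by simp
  qed
  have art: "artinian S Cm (carrier Cm)"
    unfolding artinian_def
  proof (intro allI impI)
    fix f :: "nat \<Rightarrow> 'c set"
    assume f: "\<forall>k. submodule (f k) S Cm \<and> f k \<subseteq> carrier Cm \<and> f (Suc k) \<subseteq> f k"
    then have sub: "submodule (f k) S Cm" for k by blast
    show "\<exists>n. \<forall>k\<ge>n. f k = f n"
      by (rule sigma_pure_injective_stable_chain[OF C_module universe_infinite power_le spi])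
        (use f stX[OF sub] submodule_zero_closed[OF sub] submodule_a_inv_closed[OF sub] in auto)
  qed
  obtain n p X where p: "p \<in> mod_hom R (free_module R n) C" "p ` carrier (free_module R n) = carrier C"
    by (rule presentation)
  have bc: "p (ins (regular_module R) n k \<one>\<^bsub>R\<^esub>) \<in> carrier C" for k
    by (rule hom_closed[OF p(1)], rule ins_carrier[OF regular_left_module[OF C.ring_axioms]]) simp
  have "noetherian S Cm (carrier Cm)"
  proof (rule Cm.artinian_imp_noetherian[OF art, of n "\<lambda>k. p (ins (regular_module R) n k \<one>\<^bsub>R\<^esub>)"])
    \<comment> \<open>Faithfulness: an R-linear map that kills generators of C is zero.\<close>
    fix s assume s: "s \<in> carrier S" and s0: "\<And>i. i < n \<Longrightarrow> s \<odot>\<^bsub>Cm\<^esub> p (ins (regular_module R) n i \<one>\<^bsub>R\<^esub>) = \<zero>\<^bsub>Cm\<^esub>"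
    have s': "s \<in> mod_hom R C C" using s by simp
    show "s = \<zero>\<^bsub>S\<^esub>"
    proof (rule hom_eqI[OF s' End_ring_closed(4)[OF C_module]])
      fix x assume x: "x \<in> carrier C"
      have "x \<in> p ` carrier (free_module R n)" unfolding p(2) by (rule x)
      then obtain t where t: "t \<in> carrier (free_module R n)" "x = p t" by blast
      have tc: "t k \<in> carrier R" if "k < n" for k using product_in_carrier[OF t(1), of k] that by simp
      have "s x = nsum C n (\<lambda>k. s (t k \<odot>\<^bsub>C\<^esub> p (ins (regular_module R) n k \<one>\<^bsub>R\<^esub>)))"
        unfolding t(2) hom_free_expand[OF C.ring_axioms C_module p(1) t(1)]
        by (rule hom_nsum[OF C_module C_module s']) (simp add: C.lsmult_closed tc bc)
      also have "\<dots> = \<zero>\<^bsub>C\<^esub>"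
        by (rule C.nsum_zero) (use s0 in \<open>simp add: hom_smult[OF s'] tc bc\<close>)
      finally show "s x = \<zero>\<^bsub>S\<^esub> x" using x by simp
    qed
  qed (simp add: bc)
  then show ?thesis
    unfolding endofinite_def by (rule Cm.chain_conditions_imp_finite_length[OF _ art])
qed

end

section \<open>Cyclic submodules of the local dual\<close>

lemma nsum_product_apply: "i \<in> I \<Longrightarrow> nsum (product_module I M) n v i = nsum (M i) n (\<lambda>k. v k i)"
  by (induction n) auto

lemma (in left_module) mod_span_singleton:
  assumes x: "x \<in> carrier M"
  shows "mod_span R M {x} = (\<lambda>r. r \<odot>\<^bsub>M\<^esub> x) ` carrier R"
proof
  have "submodule ((\<lambda>r. r \<odot>\<^bsub>M\<^esub> x) ` carrier R) R M"
    using submodule_smult_image[OF _ x] left_module.submodule_carrier[OF regular_left_module[OF ring_axioms]] by simp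
  moreover have "x \<in> (\<lambda>r. r \<odot>\<^bsub>M\<^esub> x) ` carrier R"
    using lsmult_one[OF x] by (intro image_eqI[of _ _ "\<one>\<^bsub>R\<^esub>"]) auto
  ultimately show "mod_span R M {x} \<subseteq> (\<lambda>r. r \<odot>\<^bsub>M\<^esub> x) ` carrier R"
    by (intro mod_span_least) auto
  have "submodule (mod_span R M {x}) R M" by (rule mod_span_submodule) (simp add: x)
  moreover have "x \<in> mod_span R M {x}" using mod_span_incl[of "{x}"] by simp
  ultimately show "(\<lambda>r. r \<odot>\<^bsub>M\<^esub> x) ` carrier R \<subseteq> mod_span R M {x}"
    using submodule_smult_closed by fast
qed

context dual_setup
begin

text \<open>The projection to the last of \<open>m + 1\<close> unknowns of the solutions of \<open>n\<close> linear equations.\<close>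

definition solutions :: "nat \<Rightarrow> nat \<Rightarrow> (nat \<Rightarrow> nat \<Rightarrow> 'r) \<Rightarrow> 'c set" where
  "solutions n m a = {z m | z. (\<forall>i<Suc m. z i \<in> carrier C) \<and>
     (\<forall>k<n. nsum C (Suc m) (\<lambda>i. a k i \<odot>\<^bsub>C\<^esub> z i) = \<zero>\<^bsub>C\<^esub>)}"

lemma solutions_subset: "solutions n m a \<subseteq> carrier C"
  by (auto simp: solutions_def)

text \<open>Solutions chosen for each index form one solution of the same equations in the product,
  and u maps it to a solution in C.\<close>

lemma solutions_stable:
  assumes a: "\<And>k i. \<lbrakk>k < n; i < Suc m\<rbrakk> \<Longrightarrow> a k i \<in> carrier R"
  shows "stable U R C (solutions n m a)"
  unfolding stable_def
proof (intro allI ballI impI)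
  fix I :: "'u set" and u c
  let ?P = "product_module I (\<lambda>_. C)"
  assume u: "u \<in> mod_hom R ?P C" and c: "c \<in> carrier ?P" and ci: "\<forall>i\<in>I. c i \<in> solutions n m a"
  have P: "left_module R ?P" by (rule product_left_module[OF C.ring_axioms C_module])
  interpret P: left_module R ?P by (rule P)
  have "\<forall>i\<in>I. \<exists>z. c i = z m \<and> (\<forall>j<Suc m. z j \<in> carrier C) \<and>
     (\<forall>k<n. nsum C (Suc m) (\<lambda>j. a k j \<odot>\<^bsub>C\<^esub> z j) = \<zero>\<^bsub>C\<^esub>)"
    using ci unfolding solutions_def by blast
  then obtain Z where Z: "\<forall>i\<in>I. c i = Z i m \<and> (\<forall>j<Suc m. Z i j \<in> carrier C) \<and>
     (\<forall>k<n. nsum C (Suc m) (\<lambda>j. a k j \<odot>\<^bsub>C\<^esub> Z i j) = \<zero>\<^bsub>C\<^esub>)"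
    unfolding bchoice_iff ..
  define w where "w j = (\<lambda>i\<in>I. Z i j)" for j
  have w: "w j \<in> carrier ?P" if "j < Suc m" for j using Z that by (auto simp: w_def product_carrier)
  have aw: "a k j \<odot>\<^bsub>?P\<^esub> w j \<in> carrier ?P" if "k < n" "j < Suc m" for k j
    by (rule P.lsmult_closed[OF a[OF that] w[OF that(2)]])
  have cw: "c = w m"
    by (rule product_ext[OF c w]) (use Z in \<open>auto simp: w_def\<close>)
  have "nsum C (Suc m) (\<lambda>j. a k j \<odot>\<^bsub>C\<^esub> u (w j)) = \<zero>\<^bsub>C\<^esub>" if k: "k < n" for k
  proof -
    have "nsum ?P (Suc m) (\<lambda>j. a k j \<odot>\<^bsub>?P\<^esub> w j) = \<zero>\<^bsub>?P\<^esub>"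
    proof (rule product_ext)
      show "nsum ?P (Suc m) (\<lambda>j. a k j \<odot>\<^bsub>?P\<^esub> w j) \<in> carrier ?P"
        by (rule P.nsum_closed) (rule aw[OF k])
      fix i assume i: "i \<in> I"
      have "nsum ?P (Suc m) (\<lambda>j. a k j \<odot>\<^bsub>?P\<^esub> w j) i = nsum C (Suc m) (\<lambda>j. a k j \<odot>\<^bsub>C\<^esub> Z i j)"
        unfolding nsum_product_apply[OF i] by (rule nsum_cong) (use i in \<open>simp add: w_def\<close>)
      then show "nsum ?P (Suc m) (\<lambda>j. a k j \<odot>\<^bsub>?P\<^esub> w j) i = \<zero>\<^bsub>?P\<^esub> i" using Z i k by simp
    qed (rule P.M.zero_closed)
    then have "u (nsum ?P (Suc m) (\<lambda>j. a k j \<odot>\<^bsub>?P\<^esub> w j)) = \<zero>\<^bsub>C\<^esub>" using hom_zero[OF P C_module u] by simp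
    moreover have "u (nsum ?P (Suc m) (\<lambda>j. a k j \<odot>\<^bsub>?P\<^esub> w j)) = nsum C (Suc m) (\<lambda>j. u (a k j \<odot>\<^bsub>?P\<^esub> w j))"
      by (rule hom_nsum[OF P C_module u aw[OF k]])
    moreover have "\<dots> = nsum C (Suc m) (\<lambda>j. a k j \<odot>\<^bsub>C\<^esub> u (w j))"
      by (rule nsum_cong) (rule hom_smult[OF u a[OF k] w])
    ultimately show ?thesis by (simp only:)
  qed
  moreover have "u (w j) \<in> carrier C" if "j < Suc m" for j by (rule hom_closed[OF u w[OF that]])
  ultimately show "u c \<in> solutions n m a"
    unfolding cw solutions_def by (intro CollectI exI[of _ "\<lambda>j. u (w j)"]) blast
qed

lemma solutions_submodule:
  assumes a: "\<And>k i. \<lbrakk>k < n; i < Suc m\<rbrakk> \<Longrightarrow> a k i \<in> carrier R"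
  shows "submodule (solutions n m a) S Cm"
proof (rule Cm.submoduleI)
  show "solutions n m a \<subseteq> carrier Cm" using solutions_subset by simp
  have "nsum C (Suc m) (\<lambda>i. a k i \<odot>\<^bsub>C\<^esub> \<zero>\<^bsub>C\<^esub>) = \<zero>\<^bsub>C\<^esub>" if "k < n" for k
    by (rule C.nsum_zero) (simp add: a that)
  then show "\<zero>\<^bsub>Cm\<^esub> \<in> solutions n m a"
    unfolding solutions_def by (intro CollectI exI[of _ "\<lambda>_. \<zero>\<^bsub>C\<^esub>"]) auto
next
  fix x y assume "x \<in> solutions n m a" "y \<in> solutions n m a"
  then obtain z w where x: "x = z m" and z: "\<forall>i<Suc m. z i \<in> carrier C" and ze: "\<forall>k<n. nsum C (Suc m) (\<lambda>i. a k i \<odot>\<^bsub>C\<^esub> z i) = \<zero>\<^bsub>C\<^esub>"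
    and y: "y = w m" and w: "\<forall>i<Suc m. w i \<in> carrier C" and we: "\<forall>k<n. nsum C (Suc m) (\<lambda>i. a k i \<odot>\<^bsub>C\<^esub> w i) = \<zero>\<^bsub>C\<^esub>"
    unfolding solutions_def by blast
  have "nsum C (Suc m) (\<lambda>i. a k i \<odot>\<^bsub>C\<^esub> (z i \<oplus>\<^bsub>C\<^esub> w i)) = \<zero>\<^bsub>C\<^esub>" if k: "k < n" for k
  proof -
    have "nsum C (Suc m) (\<lambda>i. a k i \<odot>\<^bsub>C\<^esub> (z i \<oplus>\<^bsub>C\<^esub> w i)) = nsum C (Suc m) (\<lambda>i. a k i \<odot>\<^bsub>C\<^esub> z i \<oplus>\<^bsub>C\<^esub> a k i \<odot>\<^bsub>C\<^esub> w i)"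
      by (rule nsum_cong) (use z w a[OF k] C.lsmult_r_distr in blast)
    also have "\<dots> = nsum C (Suc m) (\<lambda>i. a k i \<odot>\<^bsub>C\<^esub> z i) \<oplus>\<^bsub>C\<^esub> nsum C (Suc m) (\<lambda>i. a k i \<odot>\<^bsub>C\<^esub> w i)"
      by (rule C.nsum_add) (use z w a[OF k] C.lsmult_closed in blast)+
    also have "\<dots> = \<zero>\<^bsub>C\<^esub> \<oplus>\<^bsub>C\<^esub> \<zero>\<^bsub>C\<^esub>" using ze we k by (simp only:)
    finally show ?thesis by simp
  qed
  then show "x \<oplus>\<^bsub>Cm\<^esub> y \<in> solutions n m a"
    unfolding solutions_def x y using z w by (intro CollectI exI[of _ "\<lambda>i. z i \<oplus>\<^bsub>C\<^esub> w i"]) auto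
next
  fix s x assume s: "s \<in> carrier S" and "x \<in> solutions n m a"
  then obtain z where x: "x = z m" and z: "\<forall>i<Suc m. z i \<in> carrier C" and ze: "\<forall>k<n. nsum C (Suc m) (\<lambda>i. a k i \<odot>\<^bsub>C\<^esub> z i) = \<zero>\<^bsub>C\<^esub>"
    unfolding solutions_def by blast
  have s': "s \<in> mod_hom R C C" using s by simp
  have "nsum C (Suc m) (\<lambda>i. a k i \<odot>\<^bsub>C\<^esub> s (z i)) = \<zero>\<^bsub>C\<^esub>" if k: "k < n" for k
  proof -
    have "nsum C (Suc m) (\<lambda>i. a k i \<odot>\<^bsub>C\<^esub> s (z i)) = nsum C (Suc m) (\<lambda>i. s (a k i \<odot>\<^bsub>C\<^esub> z i))"
      by (rule nsum_cong) (use z a[OF k] hom_smult[OF s'] in metis)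
    also have "\<dots> = s (nsum C (Suc m) (\<lambda>i. a k i \<odot>\<^bsub>C\<^esub> z i))"
      by (rule hom_nsum[OF C_module C_module s', symmetric]) (use z a[OF k] C.lsmult_closed in blast)
    also have "\<dots> = s \<zero>\<^bsub>C\<^esub>" using ze k by (simp only:)
    finally show ?thesis using hom_zero[OF C_module C_module s'] by simp
  qed
  then show "s \<odot>\<^bsub>Cm\<^esub> x \<in> solutions n m a"
    unfolding solutions_def x using z hom_closed[OF s'] by (intro CollectI exI[of _ "\<lambda>i. s (z i)"]) auto
qed

text \<open>The functional z -> f (z m) kills every solution z, so by \<open>dual_factor\<close> it
  is a combination of the equations with coefficients G k in C+. Comparing coordinates gives zero
  for i < m and f for i = m.\<close>

lemma annihilator_of_solutions:
  assumes a: "\<And>k i. \<lbrakk>k < n; i < Suc m\<rbrakk> \<Longrightarrow> a k i \<in> carrier R"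
    and f: "f \<in> carrier Cp" and van: "\<And>x. x \<in> solutions n m a \<Longrightarrow> f x = \<zero>\<^bsub>V\<^esub>"
  shows "\<exists>G. (\<forall>k. G k \<in> carrier Cp) \<and> (\<forall>i<m. nsum Cp n (\<lambda>k. a k i \<odot>\<^bsub>Cp\<^esub> G k) = \<zero>\<^bsub>Cp\<^esub>) \<and>
    nsum Cp n (\<lambda>k. a k m \<odot>\<^bsub>Cp\<^esub> G k) = f"
proof -
  let ?P = "product_module {..<Suc m} (\<lambda>_. Cm)"
  have P: "left_module S ?P" by (rule Cm_power_module)
  have fh: "f \<in> mod_hom S Cm V" using f by (simp add: Cp_carrier)
  have pr: "(\<lambda>z\<in>carrier ?P. z m) \<in> mod_hom S ?P Cm"
    using proj_hom[OF V.ring_axioms Cm_module, of m "{..<Suc m}"] by simp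
  define \<phi> where "\<phi> = (\<lambda>z\<in>carrier ?P. f ((\<lambda>z\<in>carrier ?P. z m) z))"
  have \<phi>: "\<phi> \<in> mod_hom S ?P V" unfolding \<phi>_def by (rule hom_compose[OF pr fh P])
  have "\<exists>G. (\<forall>k. G k \<in> carrier Cp) \<and>
    (\<forall>i<Suc m. \<forall>y\<in>carrier C. nsum Cp n (\<lambda>k. a k i \<odot>\<^bsub>Cp\<^esub> G k) y = \<phi> (ins Cm (Suc m) i y))"
  proof (rule dual_factor[OF a \<phi>])
    fix z assume z: "z \<in> carrier ?P" and ze: "\<And>k. k < n \<Longrightarrow> nsum C (Suc m) (\<lambda>i. a k i \<odot>\<^bsub>C\<^esub> z i) = \<zero>\<^bsub>C\<^esub>"
    have "z i \<in> carrier C" if "i < Suc m" for i using product_in_carrier[OF z, of i] that by simp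
    then have "z m \<in> solutions n m a"
      unfolding solutions_def using ze by (intro CollectI exI[of _ z]) simp
    then show "\<phi> z = \<zero>\<^bsub>V\<^esub>" using z van by (simp add: \<phi>_def)
  qed
  then obtain G where G: "\<forall>k. G k \<in> carrier Cp"
    "\<forall>i<Suc m. \<forall>y\<in>carrier C. nsum Cp n (\<lambda>k. a k i \<odot>\<^bsub>Cp\<^esub> G k) y = \<phi> (ins Cm (Suc m) i y)" by blast
  have Gc: "nsum Cp n (\<lambda>k. a k i \<odot>\<^bsub>Cp\<^esub> G k) \<in> carrier Cp" if "i < Suc m" for i
    by (rule Cp.nsum_closed, rule Cp_smult_closed[OF a[OF _ that]]) (use G(1) in simp_all)
  have \<phi>i: "\<phi> (ins Cm (Suc m) i y) = (if i = m then f y else \<zero>\<^bsub>V\<^esub>)" if y: "y \<in> carrier C" for i y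
  proof -
    have "ins Cm (Suc m) i y \<in> carrier ?P" by (rule ins_carrier[OF Cm_module]) (simp add: y)
    then show ?thesis using Cp_hom(4)[OF f] by (simp add: \<phi>_def ins_def)
  qed
  have "nsum Cp n (\<lambda>k. a k i \<odot>\<^bsub>Cp\<^esub> G k) = \<zero>\<^bsub>Cp\<^esub>" if i: "i < m" for i
    by (rule Cp_ext[OF Gc Cp.M.zero_closed]) (use i G(2) \<phi>i in simp_all)
  moreover have "nsum Cp n (\<lambda>k. a k m \<odot>\<^bsub>Cp\<^esub> G k) = f"
    by (rule Cp_ext[OF Gc f]) (use G(2) \<phi>i in simp_all)
  ultimately show ?thesis using G(1) by blast
qed

text \<open>Apply G k to the k-th equation, add up and exchange the sums: only the summand i = m
  survives.\<close>

lemma solutions_annihilated: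
  assumes a: "\<And>k i. \<lbrakk>k < n; i < Suc m\<rbrakk> \<Longrightarrow> a k i \<in> carrier R"
    and G: "\<And>k. k < n \<Longrightarrow> G k \<in> carrier Cp"
    and rel: "\<And>i. i < m \<Longrightarrow> nsum Cp n (\<lambda>k. a k i \<odot>\<^bsub>Cp\<^esub> G k) = \<zero>\<^bsub>Cp\<^esub>"
    and x: "x \<in> solutions n m a"
  shows "nsum Cp n (\<lambda>k. a k m \<odot>\<^bsub>Cp\<^esub> G k) x = \<zero>\<^bsub>V\<^esub>"
proof -
  obtain z where xz: "x = z m" and z: "\<And>i. i < Suc m \<Longrightarrow> z i \<in> carrier C"
    and ze: "\<And>k. k < n \<Longrightarrow> nsum C (Suc m) (\<lambda>i. a k i \<odot>\<^bsub>C\<^esub> z i) = \<zero>\<^bsub>C\<^esub>"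
    using x unfolding solutions_def by blast
  have az: "a k i \<odot>\<^bsub>C\<^esub> z i \<in> carrier C" if "k < n" "i < Suc m" for k i
    by (rule C.lsmult_closed[OF a[OF that] z[OF that(2)]])
  have Gz: "G k (a k i \<odot>\<^bsub>C\<^esub> z i) \<in> carrier V" if "k < n" "i < Suc m" for k i
    by (rule Cp_hom(1)[OF G[OF that(1)] az[OF that]])
  have e: "nsum V n (\<lambda>k. G k (a k i \<odot>\<^bsub>C\<^esub> z i)) = nsum Cp n (\<lambda>k. a k i \<odot>\<^bsub>Cp\<^esub> G k) (z i)" if i: "i < Suc m" for i
    using z[OF i] by (simp add: Cp_nsum_apply)
  have "\<zero>\<^bsub>V\<^esub> = nsum V n (\<lambda>k. G k (nsum C (Suc m) (\<lambda>i. a k i \<odot>\<^bsub>C\<^esub> z i)))"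
    by (rule V.nsum_zero[symmetric]) (simp only: ze Cp_hom(4)[OF G])
  also have "\<dots> = nsum V n (\<lambda>k. nsum V (Suc m) (\<lambda>i. G k (a k i \<odot>\<^bsub>C\<^esub> z i)))"
    by (rule nsum_cong) (rule Cp_nsum[OF G az])
  also have "\<dots> = nsum V (Suc m) (\<lambda>i. nsum V n (\<lambda>k. G k (a k i \<odot>\<^bsub>C\<^esub> z i)))"
    by (rule V.nsum_swap) (rule Gz)
  also have "\<dots> = nsum V (Suc m) (\<lambda>i. nsum Cp n (\<lambda>k. a k i \<odot>\<^bsub>Cp\<^esub> G k) (z i))"
    by (rule nsum_cong) (rule e)
  also have "\<dots> = nsum Cp n (\<lambda>k. a k m \<odot>\<^bsub>Cp\<^esub> G k) (z m)"
  proof -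
    have "nsum V m (\<lambda>i. nsum Cp n (\<lambda>k. a k i \<odot>\<^bsub>Cp\<^esub> G k) (z i)) = \<zero>\<^bsub>V\<^esub>"
      by (rule V.nsum_zero) (simp add: rel z)
    moreover have "nsum Cp n (\<lambda>k. a k m \<odot>\<^bsub>Cp\<^esub> G k) (z m) \<in> carrier V"
      unfolding e[symmetric, OF lessI] by (rule V.nsum_closed) (rule Gz[OF _ lessI])
    ultimately show ?thesis by simp
  qed
  finally show ?thesis using xz by simp
qed

lemma cyclic_span:
  assumes f: "f \<in> carrier Cp"
  shows "mod_span (End_ring (opp R) Cp) (End_module Cp) {f} = {\<alpha> f | \<alpha>. \<alpha> \<in> mod_hom (opp R) Cp Cp}"
proof -
  interpret E: left_module "End_ring (opp R) Cp" "End_module Cp" by (rule End_module_left_module[OF Cp_module])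
  show ?thesis using E.mod_span_singleton[of f] f by auto
qed

text \<open>Write A by generators and relations and x in coordinates. The values h x are then
  exactly the elements of C+ that annihilate a set \<open>solutions n m a\<close>. Since V separates
  points from S-submodules, this set is Ker f, and \<open>solutions_stable\<close> applies.\<close>

lemma fms_imp_stable:
  assumes fms: "\<And>N. cyclic_submodule (End_ring (opp R) Cp) (End_module Cp) N \<Longrightarrow> finite_matrix_subgroup U R Cp N"
    and f: "f \<in> carrier Cp"
  shows "stable U R C {x \<in> carrier C. f x = \<zero>\<^bsub>V\<^esub>}"
proof -
  have "cyclic_submodule (End_ring (opp R) Cp) (End_module Cp) (mod_span (End_ring (opp R) Cp) (End_module Cp) {f})"
    unfolding cyclic_submodule_def using f by auto
  from fms[OF this] obtain A :: "('r, 'u) module" and x where A: "right_module R A" "finitely_presented (opp R) A"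
    and x: "x \<in> carrier A" and N: "{\<alpha> f | \<alpha>. \<alpha> \<in> mod_hom (opp R) Cp Cp} = {h x | h. h \<in> mod_hom (opp R) A Cp}"
    unfolding finite_matrix_subgroup_def cyclic_span[OF f] by blast
  obtain n p X where p: "p \<in> mod_hom (opp R) (free_module (opp R) n) A" "p ` carrier (free_module (opp R) n) = carrier A"
    and X: "finite X" "X \<subseteq> carrier (free_module (opp R) n)"
      "mod_span (opp R) (free_module (opp R) n) X = {x \<in> carrier (free_module (opp R) n). p x = \<zero>\<^bsub>A\<^esub>}"
    using A(2) unfolding finitely_presented_def Let_def by blast
  let ?F = "free_module (opp R) n"
  have R': "ring (opp R)" by (rule ring_opp[OF C.ring_axioms])
  have F: "left_module (opp R) ?F" by (rule free_left_module[OF R'])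
  interpret F: left_module "opp R" ?F by (rule F)
  interpret A: left_module "opp R" A by (rule A(1))
  obtain xs where xs: "set xs = X" using finite_list[OF X(1)] by blast
  define m where "m = length xs"
  have "x \<in> p ` carrier ?F" unfolding p(2) by (rule x)
  then obtain t where t: "t \<in> carrier ?F" "x = p t" by blast
  \<comment> \<open>Columns 0 to m - 1 are the relations of A, and column m consists of the
    coordinates of x, so \<open>solutions\<close> projects to the unknown that belongs to x.\<close>
  define a where "a k i = (if i < m then (xs ! i) k else t k)" for k i
  have xsF: "xs ! j \<in> carrier ?F" if "j < m" for j using that xs X(2) by (auto simp: m_def)
  have ac: "a k i \<in> carrier R" if "k < n" for k i
    using product_in_carrier[OF t(1), of k] product_in_carrier[OF xsF[of i], of k] that by (simp add: a_def)
  have p0: "p (xs ! j) = \<zero>\<^bsub>A\<^esub>" if "j < m" for j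
  proof -
    have "xs ! j \<in> mod_span (opp R) ?F X" using subsetD[OF F.mod_span_incl, of "xs ! j" X] that xs by (auto simp: m_def)
    then show ?thesis unfolding X(3) by simp
  qed
  have vanish: "h x y = \<zero>\<^bsub>V\<^esub>" if h: "h \<in> mod_hom (opp R) A Cp" and y: "y \<in> solutions n m a" for h y
  proof -
    define G where "G k = h (p (ins (regular_module (opp R)) n k \<one>\<^bsub>opp R\<^esub>))" for k
    have e: "p (ins (regular_module (opp R)) n k \<one>\<^bsub>opp R\<^esub>) \<in> carrier A" for k
      by (rule hom_closed[OF p(1)], rule ins_carrier[OF regular_left_module[OF R']]) simp
    have G: "G k \<in> carrier Cp" for k unfolding G_def by (rule hom_closed[OF h e])
    have hp: "h (p u) = nsum Cp n (\<lambda>k. u k \<odot>\<^bsub>Cp\<^esub> G k)" if u: "u \<in> carrier ?F" for u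
    proof -
      have uc: "u k \<in> carrier (opp R)" if "k < n" for k using product_in_carrier[OF u, of k] that by simp
      have "h (p u) = nsum Cp n (\<lambda>k. h (u k \<odot>\<^bsub>A\<^esub> p (ins (regular_module (opp R)) n k \<one>\<^bsub>opp R\<^esub>)))"
        unfolding hom_free_expand[OF R' A(1) p(1) u]
        by (rule hom_nsum[OF A(1) Cp_module h]) (rule A.lsmult_closed[OF uc e])
      also have "\<dots> = nsum Cp n (\<lambda>k. u k \<odot>\<^bsub>Cp\<^esub> G k)"
        unfolding G_def by (rule nsum_cong) (rule hom_smult[OF h uc e])
      finally show ?thesis .
    qed
    have "nsum Cp n (\<lambda>k. a k i \<odot>\<^bsub>Cp\<^esub> G k) = \<zero>\<^bsub>Cp\<^esub>" if i: "i < m" for i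
      using hp[OF xsF[OF i]] p0[OF i] hom_zero[OF A(1) Cp_module h] i by (simp add: a_def)
    then have "nsum Cp n (\<lambda>k. a k m \<odot>\<^bsub>Cp\<^esub> G k) y = \<zero>\<^bsub>V\<^esub>"
      using y by (intro solutions_annihilated[where a = a and n = n and m = m] ac G) simp_all
    then show ?thesis using hp[OF t(1)] t(2) by (simp add: a_def)
  qed
  have mem: "\<exists>\<alpha>\<in>mod_hom (opp R) Cp Cp. g = \<alpha> f"
    if g: "g \<in> carrier Cp" and g0: "\<And>y. y \<in> solutions n m a \<Longrightarrow> g y = \<zero>\<^bsub>V\<^esub>" for g
  proof -
    have "\<exists>G. (\<forall>k. G k \<in> carrier Cp) \<and> (\<forall>i<m. nsum Cp n (\<lambda>k. a k i \<odot>\<^bsub>Cp\<^esub> G k) = \<zero>\<^bsub>Cp\<^esub>) \<and>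
        nsum Cp n (\<lambda>k. a k m \<odot>\<^bsub>Cp\<^esub> G k) = g"
      by (rule annihilator_of_solutions[OF ac g g0])
    then obtain G
      where G: "\<forall>k. G k \<in> carrier Cp" "\<forall>i<m. nsum Cp n (\<lambda>k. a k i \<odot>\<^bsub>Cp\<^esub> G k) = \<zero>\<^bsub>Cp\<^esub>"
        "nsum Cp n (\<lambda>k. a k m \<odot>\<^bsub>Cp\<^esub> G k) = g"
      by (elim exE conjE) (rule that)
    have "\<exists>h\<in>mod_hom (opp R) A Cp. \<forall>u\<in>carrier ?F. h (p u) = nsum Cp n (\<lambda>k. u k \<odot>\<^bsub>Cp\<^esub> G k)"
    proof (rule presentation_hom[OF A(1) Cp_module p X(2,3)])
      show "G k \<in> carrier Cp" for k using G(1) ..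
      fix y assume "y \<in> X"
      then obtain j where j: "j < m" "y = xs ! j" using xs by (auto simp: m_def in_set_conv_nth)
      then show "nsum Cp n (\<lambda>k. y k \<odot>\<^bsub>Cp\<^esub> G k) = \<zero>\<^bsub>Cp\<^esub>" using G(2) by (simp add: a_def)
    qed
    then obtain h where h: "h \<in> mod_hom (opp R) A Cp" "h x = nsum Cp n (\<lambda>k. t k \<odot>\<^bsub>Cp\<^esub> G k)" using t by blast
    then have "h x = g" using G(3) by (simp add: a_def)
    then have "g \<in> {h x | h. h \<in> mod_hom (opp R) A Cp}" using h(1) by blast
    then show ?thesis unfolding N[symmetric] by blast
  qed
  have "{x \<in> carrier C. f x = \<zero>\<^bsub>V\<^esub>} = solutions n m a"
  proof
    have "f = (\<lambda>x\<in>carrier Cp. x) f" using f by simp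
    then have "f \<in> {\<alpha> f | \<alpha>. \<alpha> \<in> mod_hom (opp R) Cp Cp}" using hom_ident[OF Cp_module] by blast
    then obtain h where "h \<in> mod_hom (opp R) A Cp" "f = h x" unfolding N by blast
    then show "solutions n m a \<subseteq> {x \<in> carrier C. f x = \<zero>\<^bsub>V\<^esub>}"
      using vanish solutions_subset by blast
    show "{x \<in> carrier C. f x = \<zero>\<^bsub>V\<^esub>} \<subseteq> solutions n m a"
    proof
      fix c assume "c \<in> {x \<in> carrier C. f x = \<zero>\<^bsub>V\<^esub>}"
      then have c: "c \<in> carrier C" "f c = \<zero>\<^bsub>V\<^esub>" by auto
      show "c \<in> solutions n m a"
      proof (rule ccontr)
        \<comment> \<open>A functional g that separates c from the solutions annihilates them. So it
          has the form \<alpha> f and vanishes at c after all.\<close>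
        assume "c \<notin> solutions n m a"
        moreover have "submodule (solutions n m a) S Cm" by (rule solutions_submodule[OF ac])
        ultimately obtain g where g: "g \<in> mod_hom S Cm V" "\<forall>x\<in>solutions n m a. g x = \<zero>\<^bsub>V\<^esub>" "g c \<noteq> \<zero>\<^bsub>V\<^esub>"
          using cogenerator_separates[OF V_cogenerator V_module Cm_module S_le _ _, of "solutions n m a" c] C_le c
          by auto
        then obtain \<alpha> where "\<alpha> \<in> mod_hom (opp R) Cp Cp" "g = \<alpha> f" using mem[of g] by (auto simp: Cp_carrier)
        then have "g c = \<zero>\<^bsub>V\<^esub>" using evaluation_vanishes[OF _ f c(1) evaluation_injective[OF f c]] by simp
        then show False using g(3) by simp
      qed
    qed
  qed
  moreover have "stable U R C (solutions n m a)" by (rule solutions_stable[OF ac])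
  ultimately show ?thesis by simp
qed

end

section \<open>Endofinite modules\<close>

context left_module
begin

text \<open>A maximal submodule with property Q absorbs every cyclic submodule of K. This replaces
  an induction over a finite list of generators of K.\<close>

lemma noetherian_submodule_induct:
  assumes noeth: "noetherian R M K" and K: "submodule K R M" and zero: "Q {\<zero>\<^bsub>M\<^esub>}"
    and step: "\<And>A x. \<lbrakk>submodule A R M; A \<subseteq> K; x \<in> K; Q A\<rbrakk> \<Longrightarrow>
      Q (submodule_sum M A ((\<lambda>r. r \<odot>\<^bsub>M\<^esub> x) ` carrier R))"
  shows "Q K"
proof -
  define \<F> where "\<F> = {A. submodule A R M \<and> A \<subseteq> K \<and> Q A}"
  have "{\<zero>\<^bsub>M\<^esub>} \<in> \<F>"
    using zero submodule_zero submodule_zero_closed[OF K] by (simp add: \<F>_def)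
  then have "\<exists>A\<in>\<F>. \<forall>Y\<in>\<F>. A \<subseteq> Y \<longrightarrow> Y = A"
    by (intro noetherian_maximal[OF noeth]) (auto simp: \<F>_def)
  then obtain A where AF: "A \<in> \<F>" and max: "\<forall>Y\<in>\<F>. A \<subseteq> Y \<longrightarrow> Y = A" ..
  then have A: "submodule A R M" "A \<subseteq> K" "Q A" by (auto simp: \<F>_def)
  have "x \<in> A" if x: "x \<in> K" for x
  proof -
    have xc: "x \<in> carrier M" by (rule submodule_in_carrier[OF K x])
    let ?X = "(\<lambda>r. r \<odot>\<^bsub>M\<^esub> x) ` carrier R"
    have X: "submodule ?X R M"
      using submodule_smult_image[OF _ xc] left_module.submodule_carrier[OF regular_left_module[OF ring_axioms]] by simp
    have "?X \<subseteq> K" using submodule_smult_closed[OF K _ x] by blast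
    then have "submodule_sum M A ?X \<in> \<F>"
      unfolding \<F>_def using submodule_submodule_sum[OF A(1) X] submodule_sum_least[OF K A(2)] step[OF A(1,2) x A(3)] by simp
    then have "submodule_sum M A ?X = A" using max submodule_sum_left[OF A(1) X] by simp
    moreover have "x \<in> ?X" using lsmult_one[OF xc] by (intro image_eqI[of _ _ "\<one>\<^bsub>R\<^esub>"]) auto
    ultimately show ?thesis using submodule_sum_right[OF A(1) X] by auto
  qed
  then have "A = K" using A(2) by blast
  then show ?thesis using A(3) by simp
qed

text \<open>The coordinate projections filter the power, and the pieces form ascending chains in
  M.\<close>

lemma noetherian_power:
  fixes n :: nat
  assumes noeth: "noetherian R M (carrier M)"
  shows "noetherian R (product_module {..<n} (\<lambda>_. M)) (carrier (product_module {..<n} (\<lambda>_. M)))"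
  unfolding noetherian_def
proof (intro allI impI)
  let ?P = "product_module {..<n} (\<lambda>_. M)"
  fix f :: "nat \<Rightarrow> (nat \<Rightarrow> 'm) set"
  assume f: "\<forall>k. submodule (f k) R ?P \<and> f k \<subseteq> carrier ?P \<and> f k \<subseteq> f (Suc k)"
  have M: "left_module R M" by (rule left_module_axioms)
  have P: "left_module R ?P" by (rule product_left_module[OF ring_axioms M])
  interpret P: left_module R ?P by (rule P)
  define e where "e i = (\<lambda>x\<in>carrier ?P. x i)" for i
  have e: "e i \<in> mod_hom R ?P M" if "i < n" for i
    unfolding e_def by (rule proj_hom[OF ring_axioms M]) (simp add: that)
  have sub: "submodule (f k) R ?P" for k using f by blast
  show "\<exists>m. \<forall>k\<ge>m. f k = f m"
  proof (rule filtration_stationary[OF P M e sub])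
    show "(\<forall>k. f k \<subseteq> f (Suc k)) \<or> (\<forall>k. f (Suc k) \<subseteq> f k)" using f by blast
  next
    fix k l x assume x: "x \<in> f k" and ex: "\<And>i. i < n \<Longrightarrow> e i x = \<zero>\<^bsub>M\<^esub>"
    have xc: "x \<in> carrier ?P" by (rule submodule_in_carrier[OF sub x])
    have "x = \<zero>\<^bsub>?P\<^esub>"
      by (rule product_ext[OF xc P.M.zero_closed]) (use ex xc in \<open>simp add: e_def\<close>)
    then show "x \<in> f l" using submodule_zero_closed[OF sub[of l]] by simp
  next
    fix i assume i: "i < n"
    have piece: "submodule (filtration_piece ?P M e i (f k)) R M" for k
      by (rule filtration_piece_submodule[OF P M e sub]) (use i in simp)
    have mono: "filtration_piece ?P M e i (f k) \<subseteq> filtration_piece ?P M e i (f (Suc k))" for k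
      by (rule filtration_piece_mono) (use f in blast)
    show "\<exists>m. \<forall>k\<ge>m. filtration_piece ?P M e i (f k) = filtration_piece ?P M e i (f m)"
      by (rule noetherianD[OF noeth piece submodule_subset[OF piece]]) (rule mono)
  qed
qed

end

lemma endofinite_chain_conditions:
  assumes C: "left_module R C" and "endofinite R C"
  shows "noetherian (End_ring R C) (End_module C) (carrier C)" "artinian (End_ring R C) (End_module C) (carrier C)"
  using left_module.finite_length_imp_chain_conditions[OF End_module_left_module[OF C]] assms(2)
  unfolding endofinite_def by auto

text \<open>
  If \<open>\<Sum> m\<^sub>k \<otimes> c\<^sub>k(i) = 0\<close> for all \<open>i\<close>, then the tuples \<open>c(i)\<close> lie in the finitely generated
  \<open>S\<close>-submodule \<open>K = {d. \<Sum> m\<^sub>k \<otimes> d\<^sub>k = 0}\<close> of \<open>C\<^sup>n\<close>. A generator \<open>d\<close> and a family \<open>s\<^sub>i \<in> S\<close> give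
  \<open>\<Sum> m\<^sub>k \<otimes> (s\<^sub>i d\<^sub>k)\<^sub>i = 0\<close> by applying the homomorphism \<open>(s\<^sub>i)\<^sub>i : C \<rightarrow> C\<^sup>I\<close>.
\<close>

lemma endofinite_imp_mittag_leffler:
  fixes U :: "'u itself" and M :: "('r, 'm) module" and C :: "('r, 'c) module"
  assumes C: "left_module R C" and M: "right_module R M" and fin: "endofinite R C"
  shows "mittag_leffler U R C M"
  unfolding mittag_leffler_def
proof
  fix I :: "'u set"
  interpret C: left_module R C by (rule C)
  let ?S = "End_ring R C" and ?Cm = "End_module C" and ?CI = "product_module I (\<lambda>_. C)"
  have Cm: "left_module ?S ?Cm" by (rule End_module_left_module[OF C])
  interpret Cm: left_module ?S ?Cm by (rule Cm)
  have CI: "left_module R ?CI" by (rule product_left_module[OF C.ring_axioms C])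
  interpret CI: left_module R ?CI by (rule CI)
  have "\<forall>z. Poly_Mapping.keys z \<subseteq> carrier M \<times> carrier ?CI \<longrightarrow>
      (\<forall>i\<in>I. frag_map (\<lambda>x. x i) z \<in> tensor_relations R M C) \<longrightarrow> z \<in> tensor_relations R M ?CI"
  proof (intro allI impI)
    fix z assume z: "Poly_Mapping.keys z \<subseteq> carrier M \<times> carrier ?CI"
      and zi: "\<forall>i\<in>I. frag_map (\<lambda>x. x i) z \<in> tensor_relations R M C"
    let ?T = "tensor_relations R M C" and ?TI = "tensor_relations R M ?CI"
    obtain xs where xs: "set xs \<subseteq> carrier M \<times> carrier ?CI" "z - sum_list (map frag_of xs) \<in> ?TI"
      using tensor_representation[OF M CI z] by blast
    define n where "n = length xs"
    define m where "m k = fst (xs ! k)" for k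
    define c where "c k = snd (xs ! k)" for k
    have mc: "m k \<in> carrier M" "c k \<in> carrier ?CI" if "k < n" for k
    proof -
      have "xs ! k \<in> carrier M \<times> carrier ?CI" using that xs(1) by (auto simp: n_def)
      then show "m k \<in> carrier M" "c k \<in> carrier ?CI" by (auto simp: m_def c_def)
    qed
    have sl: "sum_list (map frag_of xs) = (\<Sum>k<n. frag_of (m k, c k))"
      by (simp add: sum_list_sum_nth n_def m_def c_def atLeast0LessThan)
    have zs: "z - (\<Sum>k<n. frag_of (m k, c k)) \<in> ?TI" using xs(2) unfolding sl .
    have fs: "frag_map g (\<Sum>k<q. frag_of (m k, h k)) = (\<Sum>k<q. frag_of (m k, g (h k)))"
      for g :: "'x \<Rightarrow> 'y" and h q
      by (induction q) auto
    let ?P = "product_module {..<n} (\<lambda>_. ?Cm)"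
    have P: "left_module ?S ?P" by (rule product_left_module[OF Cm.ring_axioms Cm])
    interpret P: left_module ?S ?P by (rule P)
    have dc: "d k \<in> carrier C" if "d \<in> carrier ?P" "k < n" for d k
      using product_in_carrier[OF that(1), of k] that(2) by simp
    define K where "K = {d \<in> carrier ?P. (\<Sum>k<n. frag_of (m k, d k)) \<in> ?T}"
    have K: "submodule K ?S ?P"
    proof (rule P.submoduleI)
      have "(\<Sum>k<n. frag_of (m k, \<zero>\<^bsub>?P\<^esub> k)) \<in> ?T"
        by (rule tensor_sum[OF M C]) (simp add: tensor_zero_right[OF M C] mc)
      then show "\<zero>\<^bsub>?P\<^esub> \<in> K" by (simp add: K_def)
    next
      fix d d' assume d: "d \<in> K" "d' \<in> K"
      then have dP: "d \<in> carrier ?P" "d' \<in> carrier ?P" by (auto simp: K_def)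
      have "(\<Sum>k<n. frag_of (m k, (d \<oplus>\<^bsub>?P\<^esub> d') k) - frag_of (m k, d k) - frag_of (m k, d' k)) \<in> ?T"
        by (rule tensor_sum[OF M C]) (simp add: tensor_right[OF M C] mc dc dP)
      then have "(\<Sum>k<n. frag_of (m k, (d \<oplus>\<^bsub>?P\<^esub> d') k)) - (\<Sum>k<n. frag_of (m k, d k)) - (\<Sum>k<n. frag_of (m k, d' k)) \<in> ?T"
        unfolding sum_subtractf .
      moreover have "(\<Sum>k<n. frag_of (m k, d k)) \<in> ?T" "(\<Sum>k<n. frag_of (m k, d' k)) \<in> ?T"
        using d by (auto simp: K_def)
      ultimately have "(\<Sum>k<n. frag_of (m k, (d \<oplus>\<^bsub>?P\<^esub> d') k)) \<in> ?T"
        using tensor_diff_cancel[OF M C] by blast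
      then show "d \<oplus>\<^bsub>?P\<^esub> d' \<in> K" using P.M.a_closed[OF dP] by (simp add: K_def)
    next
      fix s d assume s: "s \<in> carrier ?S" and d: "d \<in> K"
      then have dP: "d \<in> carrier ?P" by (simp add: K_def)
      have s': "s \<in> mod_hom R C C" using s by simp
      have "frag_map s (\<Sum>k<n. frag_of (m k, d k)) \<in> ?T"
        by (rule tensor_map_relations[OF M C C s']) (use d in \<open>simp add: K_def\<close>)
      then have "(\<Sum>k<n. frag_of (m k, s (d k))) \<in> ?T" unfolding fs .
      moreover have "(\<Sum>k<n. frag_of (m k, (s \<odot>\<^bsub>?P\<^esub> d) k)) = (\<Sum>k<n. frag_of (m k, s (d k)))"
        by (rule sum.cong) auto
      ultimately show "s \<odot>\<^bsub>?P\<^esub> d \<in> K" using P.lsmult_closed[OF s dP] by (simp add: K_def)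
    qed (auto simp: K_def)
    \<comment> \<open>The claim for all families of tuples with values in A. It is extended to K
      generator by generator, and the given tuples belong to K.\<close>
    define Q where "Q A \<longleftrightarrow> (\<forall>d. (\<forall>i\<in>I. d i \<in> A) \<longrightarrow> (\<Sum>k<n. frag_of (m k, \<lambda>i\<in>I. d i k)) \<in> ?TI)" for A
    have "noetherian ?S ?P (carrier ?P)"
      by (rule Cm.noetherian_power) (use endofinite_chain_conditions(1)[OF C fin] in simp)
    then have "noetherian ?S ?P K" by (rule P.noetherian_mono[OF _ submodule_subset[OF K]])
    then have "Q K"
    proof (rule P.noetherian_submodule_induct[OF _ K])
      show "Q {\<zero>\<^bsub>?P\<^esub>}"
        unfolding Q_def
      proof (intro allI impI)
        fix d assume d: "\<forall>i\<in>I. d i \<in> {\<zero>\<^bsub>?P\<^esub>}"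
        have "(\<lambda>i\<in>I. d i k) = \<zero>\<^bsub>?CI\<^esub>" if "k < n" for k
          using d that by (auto simp: product_module_def)
        then have "(\<Sum>k<n. frag_of (m k, \<lambda>i\<in>I. d i k)) = (\<Sum>k<n. frag_of (m k, \<zero>\<^bsub>?CI\<^esub>))"
          by (intro sum.cong) auto
        also have "\<dots> \<in> ?TI"
          by (rule tensor_sum[OF M CI]) (simp add: tensor_zero_right[OF M CI] mc)
        finally show "(\<Sum>k<n. frag_of (m k, \<lambda>i\<in>I. d i k)) \<in> ?TI" .
      qed
    next
      fix A x assume A: "submodule A ?S ?P" "A \<subseteq> K" and x: "x \<in> K" and QA: "Q A"
      have xP: "x \<in> carrier ?P" using x by (simp add: K_def)
      show "Q (submodule_sum ?P A ((\<lambda>r. r \<odot>\<^bsub>?P\<^esub> x) ` carrier ?S))"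
        unfolding Q_def
      proof (intro allI impI)
        fix d assume "\<forall>i\<in>I. d i \<in> submodule_sum ?P A ((\<lambda>r. r \<odot>\<^bsub>?P\<^esub> x) ` carrier ?S)"
        then have "\<forall>i\<in>I. \<exists>as. fst as \<in> A \<and> snd as \<in> carrier ?S \<and> d i = fst as \<oplus>\<^bsub>?P\<^esub> snd as \<odot>\<^bsub>?P\<^esub> x"
          unfolding submodule_sum_def by fastforce
        then obtain as where as: "\<forall>i\<in>I. fst (as i) \<in> A \<and> snd (as i) \<in> carrier ?S \<and> d i = fst (as i) \<oplus>\<^bsub>?P\<^esub> snd (as i) \<odot>\<^bsub>?P\<^esub> x"
          unfolding bchoice_iff ..
        define a where "a i = fst (as i)" for i
        define s where "s i = snd (as i)" for i
        have a: "a i \<in> A" and aP: "a i \<in> carrier ?P" and s: "s i \<in> mod_hom R C C"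
          and di: "d i = a i \<oplus>\<^bsub>?P\<^esub> s i \<odot>\<^bsub>?P\<^esub> x" if "i \<in> I" for i
          using as that submodule_in_carrier[OF A(1)] by (auto simp: a_def s_def)
        let ?\<sigma> = "\<lambda>y\<in>carrier C. \<lambda>i\<in>I. s i y"
        have \<sigma>: "?\<sigma> \<in> mod_hom R C ?CI" by (rule tuple_hom[OF C s])
        have t1: "(\<Sum>k<n. frag_of (m k, \<lambda>i\<in>I. a i k)) \<in> ?TI" using QA a unfolding Q_def by blast
        have "frag_map ?\<sigma> (\<Sum>k<n. frag_of (m k, x k)) \<in> ?TI"
          by (rule tensor_map_relations[OF M C CI \<sigma>]) (use x in \<open>simp add: K_def\<close>)
        then have t2: "(\<Sum>k<n. frag_of (m k, ?\<sigma> (x k))) \<in> ?TI" unfolding fs .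
        have ac: "(\<lambda>i\<in>I. a i k) \<in> carrier ?CI" if "k < n" for k
          using dc[OF aP that] by (simp add: product_carrier)
        have "(\<lambda>i\<in>I. d i k) = (\<lambda>i\<in>I. a i k) \<oplus>\<^bsub>?CI\<^esub> ?\<sigma> (x k)" if k: "k < n" for k
        proof -
          have "d i k = a i k \<oplus>\<^bsub>C\<^esub> s i (x k)" if "i \<in> I" for i
            unfolding di[OF that] using k by simp
          then show ?thesis using dc[OF xP k] by (auto simp: product_module_def intro!: restrict_ext)
        qed
        then have "(\<Sum>k<n. frag_of (m k, \<lambda>i\<in>I. d i k) - frag_of (m k, \<lambda>i\<in>I. a i k) - frag_of (m k, ?\<sigma> (x k))) \<in> ?TI"
          by (intro tensor_sum[OF M CI]) (simp only: lessThan_iff tensor_right[OF M CI] mc ac hom_closed[OF \<sigma> dc[OF xP]])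
        then have "(\<Sum>k<n. frag_of (m k, \<lambda>i\<in>I. d i k)) - (\<Sum>k<n. frag_of (m k, \<lambda>i\<in>I. a i k)) - (\<Sum>k<n. frag_of (m k, ?\<sigma> (x k))) \<in> ?TI"
          unfolding sum_subtractf .
        then show "(\<Sum>k<n. frag_of (m k, \<lambda>i\<in>I. d i k)) \<in> ?TI"
          using tensor_diff_cancel[OF M CI] t1 t2 by blast
      qed
    qed
    moreover have "(\<lambda>k\<in>{..<n}. c k i) \<in> K" if i: "i \<in> I" for i
    proof -
      have "frag_map (\<lambda>x\<in>carrier ?CI. x i) (z - (\<Sum>k<n. frag_of (m k, c k))) \<in> ?T"
        by (rule tensor_map_relations[OF M CI C proj_hom[OF C.ring_axioms C i] zs])
      moreover have "frag_map (\<lambda>x\<in>carrier ?CI. x i) z = frag_map (\<lambda>x. x i) z"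
        by (rule frag_map_cong) (use z in auto)
      moreover have "frag_map (\<lambda>x\<in>carrier ?CI. x i) (\<Sum>k<n. frag_of (m k, c k)) = (\<Sum>k<n. frag_of (m k, c k i))"
        unfolding fs by (rule sum.cong) (use mc in auto)
      ultimately have "frag_map (\<lambda>x. x i) z - (\<Sum>k<n. frag_of (m k, c k i)) \<in> ?T" by simp
      then have "(\<Sum>k<n. frag_of (m k, c k i)) \<in> ?T" using tensor_diff_cancel[OF M C] zi i by blast
      moreover have "(\<Sum>k<n. frag_of (m k, (\<lambda>k\<in>{..<n}. c k i) k)) = (\<Sum>k<n. frag_of (m k, c k i))"
        by (rule sum.cong) auto
      moreover have "(\<lambda>k\<in>{..<n}. c k i) \<in> carrier ?P"
        using product_in_carrier[OF mc(2) i] by (simp add: product_carrier)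
      ultimately show ?thesis by (simp add: K_def)
    qed
    ultimately have "(\<Sum>k<n. frag_of (m k, \<lambda>i\<in>I. (\<lambda>k\<in>{..<n}. c k i) k)) \<in> ?TI"
      unfolding Q_def by (elim allE[of _ "\<lambda>i. \<lambda>k\<in>{..<n}. c k i"]) simp
    moreover have "(\<Sum>k<n. frag_of (m k, \<lambda>i\<in>I. (\<lambda>k\<in>{..<n}. c k i) k)) = (\<Sum>k<n. frag_of (m k, c k))"
    proof (rule sum.cong[OF refl])
      fix k assume k: "k \<in> {..<n}"
      then have "(\<lambda>i\<in>I. c k i) = c k" using mc(2)[of k] by (simp add: product_carrier PiE_def extensional_restrict)
      then show "frag_of (m k, \<lambda>i\<in>I. (\<lambda>k\<in>{..<n}. c k i) k) = frag_of (m k, c k)" using k by simp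
    qed
    ultimately show "z \<in> ?TI" using tensor_diff_cancel[OF M CI zs] by simp
  qed
  then show "inj_on (tensor_power_map R M C I) (carrier (tensor_product R M ?CI))"
    using inj_on_tensor_power_map_iff[OF M C CI proj_hom[OF C.ring_axioms C]] by simp
qed

text \<open>The graph of a homomorphism from a submodule of M to N. With graphs, extension becomes
  inclusion, as Zorn's lemma requires; by linearity the last clause amounts to
  single-valuedness.\<close>

definition partial_hom :: "('r, 'd) ring_scheme \<Rightarrow> ('r, 'm) module \<Rightarrow> ('r, 'n) module \<Rightarrow> ('m \<times> 'n) set \<Rightarrow> bool" where
  "partial_hom R M N p \<longleftrightarrow> p \<subseteq> carrier M \<times> carrier N \<and> (\<zero>\<^bsub>M\<^esub>, \<zero>\<^bsub>N\<^esub>) \<in> p \<and>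
     (\<forall>x y x' y'. (x, y) \<in> p \<longrightarrow> (x', y') \<in> p \<longrightarrow> (x \<oplus>\<^bsub>M\<^esub> x', y \<oplus>\<^bsub>N\<^esub> y') \<in> p) \<and>
     (\<forall>r\<in>carrier R. \<forall>x y. (x, y) \<in> p \<longrightarrow> (r \<odot>\<^bsub>M\<^esub> x, r \<odot>\<^bsub>N\<^esub> y) \<in> p) \<and>
     (\<forall>y. (\<zero>\<^bsub>M\<^esub>, y) \<in> p \<longrightarrow> y = \<zero>\<^bsub>N\<^esub>)"

lemma partial_homD:
  assumes "partial_hom R M N p"
  shows "(x, y) \<in> p \<Longrightarrow> x \<in> carrier M" "(x, y) \<in> p \<Longrightarrow> y \<in> carrier N" "(\<zero>\<^bsub>M\<^esub>, \<zero>\<^bsub>N\<^esub>) \<in> p"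
    "\<lbrakk>(x, y) \<in> p; (x', y') \<in> p\<rbrakk> \<Longrightarrow> (x \<oplus>\<^bsub>M\<^esub> x', y \<oplus>\<^bsub>N\<^esub> y') \<in> p"
    "\<lbrakk>r \<in> carrier R; (x, y) \<in> p\<rbrakk> \<Longrightarrow> (r \<odot>\<^bsub>M\<^esub> x, r \<odot>\<^bsub>N\<^esub> y) \<in> p"
    "(\<zero>\<^bsub>M\<^esub>, y) \<in> p \<Longrightarrow> y = \<zero>\<^bsub>N\<^esub>"
  using assms unfolding partial_hom_def by auto

lemma partial_hom_unique:
  assumes M: "left_module R M" and N: "left_module R N" and p: "partial_hom R M N p"
    and xy: "(x, y) \<in> p" "(x, y') \<in> p"
  shows "y = y'"
proof -
  interpret M: left_module R M by (rule M)
  interpret N: left_module R N by (rule N)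
  note c = partial_homD(1,2)[OF p xy(1)] partial_homD(2)[OF p xy(2)]
  have "((\<ominus>\<^bsub>R\<^esub> \<one>\<^bsub>R\<^esub>) \<odot>\<^bsub>M\<^esub> x, (\<ominus>\<^bsub>R\<^esub> \<one>\<^bsub>R\<^esub>) \<odot>\<^bsub>N\<^esub> y') \<in> p"
    by (rule partial_homD(5)[OF p _ xy(2)]) simp
  from partial_homD(4)[OF p xy(1) this] have "(\<zero>\<^bsub>M\<^esub>, y \<ominus>\<^bsub>N\<^esub> y') \<in> p"
    using c by (simp add: M.minus_one_smult N.minus_one_smult a_minus_def M.M.r_neg)
  from partial_homD(6)[OF p this] show ?thesis using c by simp
qed

text \<open>
  Baer's criterion: \<open>V\<close> is only tested on left ideals, so that \<open>B\<close> need not fit into the universe.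
\<close>

lemma baer_extension:
  fixes U :: "'u itself"
  assumes inj: "injective_module U R V" and V: "left_module R V" and B: "left_module R B"
    and le: "carrier R \<lesssim> (UNIV :: 'u set)" and p0: "partial_hom R B V p0"
  shows "\<exists>\<theta>\<in>mod_hom R B V. \<forall>(b, v)\<in>p0. \<theta> b = v"
proof -
  interpret B: left_module R B by (rule B)
  interpret V: left_module R V by (rule V)
  define \<P> where "\<P> = {p. partial_hom R B V p \<and> p0 \<subseteq> p}"
  have "\<exists>p\<in>\<P>. \<forall>q\<in>\<P>. p \<subseteq> q \<longrightarrow> q = p"
  proof (rule subset_Zorn_nonempty)
    show "\<P> \<noteq> {}" using p0 by (auto simp: \<P>_def)
    fix \<C> assume C: "\<C> \<noteq> {}" "subset.chain \<P> \<C>"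
    have ph: "partial_hom R B V p" "p0 \<subseteq> p" if "p \<in> \<C>" for p
      using C(2) that unfolding subset_chain_def \<P>_def by auto
    have two: "\<exists>p\<in>\<C>. a \<in> p \<and> b \<in> p" if "a \<in> \<Union>\<C>" "b \<in> \<Union>\<C>" for a b
    proof -
      obtain p q where pq: "p \<in> \<C>" "a \<in> p" "q \<in> \<C>" "b \<in> q" using \<open>a \<in> \<Union>\<C>\<close> \<open>b \<in> \<Union>\<C>\<close> by blast
      then have "p \<subseteq> q \<or> q \<subseteq> p" using C(2) unfolding subset_chain_def by blast
      then show ?thesis using pq by blast
    qed
    obtain q where q: "q \<in> \<C>" using C(1) by blast
    have "partial_hom R B V (\<Union>\<C>)"
      unfolding partial_hom_def
    proof (intro conjI allI impI ballI)
      show "\<Union>\<C> \<subseteq> carrier B \<times> carrier V" using partial_homD(1,2)[OF ph(1)] by auto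
      show "(\<zero>\<^bsub>B\<^esub>, \<zero>\<^bsub>V\<^esub>) \<in> \<Union>\<C>" using partial_homD(3)[OF ph(1)[OF q]] q by blast
      fix x y x' y' assume "(x, y) \<in> \<Union>\<C>" "(x', y') \<in> \<Union>\<C>"
      from two[OF this] obtain p where "p \<in> \<C>" "(x, y) \<in> p" "(x', y') \<in> p" by blast
      then show "(x \<oplus>\<^bsub>B\<^esub> x', y \<oplus>\<^bsub>V\<^esub> y') \<in> \<Union>\<C>" using partial_homD(4)[OF ph(1)] by blast
    next
      fix r x y assume "r \<in> carrier R" "(x, y) \<in> \<Union>\<C>"
      then show "(r \<odot>\<^bsub>B\<^esub> x, r \<odot>\<^bsub>V\<^esub> y) \<in> \<Union>\<C>" using partial_homD(5)[OF ph(1)] by blast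
    next
      fix y assume "(\<zero>\<^bsub>B\<^esub>, y) \<in> \<Union>\<C>"
      then show "y = \<zero>\<^bsub>V\<^esub>" using partial_homD(6)[OF ph(1)] by blast
    qed
    moreover have "p0 \<subseteq> \<Union>\<C>" using ph(2)[OF q] q by blast
    ultimately show "\<Union>\<C> \<in> \<P>" by (simp add: \<P>_def)
  qed
  then obtain p where pP: "p \<in> \<P>" and max: "\<forall>q\<in>\<P>. p \<subseteq> q \<longrightarrow> q = p" ..
  then have p: "partial_hom R B V p" "p0 \<subseteq> p" by (auto simp: \<P>_def)
  note pD = partial_homD[OF p(1)]
  let ?reg = "regular_module R"
  have reg: "left_module R ?reg" by (rule regular_left_module[OF B.ring_axioms])
  interpret reg: left_module R ?reg by (rule reg)
  have total: "\<exists>y. (b, y) \<in> p" if b: "b \<in> carrier B" for b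
  proof -
    \<comment> \<open>The left ideal of scalars that move b into the domain of p. The map s -> p (s
      b) on I extends to R by injectivity, and there it is multiplication by an element y, which
      becomes the value at b.\<close>
    define I where "I = {s \<in> carrier R. \<exists>w. (s \<odot>\<^bsub>B\<^esub> b, w) \<in> p}"
    have I: "submodule I R ?reg"
    proof (rule reg.submoduleI)
      show "\<zero>\<^bsub>?reg\<^esub> \<in> I" using pD(3) b by (auto simp: I_def)
    next
      fix x y assume "x \<in> I" "y \<in> I"
      then show "x \<oplus>\<^bsub>?reg\<^esub> y \<in> I" using pD(4) b by (fastforce simp: I_def B.lsmult_l_distr)
    next
      fix r x assume "r \<in> carrier R" "x \<in> I"
      then show "r \<odot>\<^bsub>?reg\<^esub> x \<in> I" using pD(5) b by (fastforce simp: I_def B.lsmult_assoc)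
    qed (auto simp: I_def)
    let ?I = "?reg\<lparr>carrier := I\<rparr>"
    have Im: "left_module R ?I" by (rule reg.submodule_left_module[OF I])
    have IR: "I \<subseteq> carrier R" by (auto simp: I_def)
    have leI: "carrier ?I \<lesssim> (UNIV :: 'u set)"
      using subset_imp_lepoll[OF IR] le lepoll_trans by auto
    have lereg: "carrier ?reg \<lesssim> (UNIV :: 'u set)" using le by simp
    define \<phi> where "\<phi> = (\<lambda>s\<in>I. SOME w. (s \<odot>\<^bsub>B\<^esub> b, w) \<in> p)"
    have \<phi>p: "(s \<odot>\<^bsub>B\<^esub> b, \<phi> s) \<in> p" if "s \<in> I" for s
      using that someI_ex[of "\<lambda>w. (s \<odot>\<^bsub>B\<^esub> b, w) \<in> p"] by (simp add: \<phi>_def I_def)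
    have uniq: "\<phi> s = w" if "s \<in> I" "(s \<odot>\<^bsub>B\<^esub> b, w) \<in> p" for s w
      by (rule partial_hom_unique[OF B V p(1) \<phi>p[OF that(1)] that(2)])
    have \<phi>: "\<phi> \<in> mod_hom R ?I V"
    proof (rule mod_homI)
      show "\<phi> \<in> carrier ?I \<rightarrow>\<^sub>E carrier V" using pD(2)[OF \<phi>p] by (auto simp: \<phi>_def)
    next
      fix x y assume xy: "x \<in> carrier ?I" "y \<in> carrier ?I"
      then have "x \<in> carrier R" "y \<in> carrier R" "x \<oplus>\<^bsub>R\<^esub> y \<in> I"
        using IR submodule_add_closed[OF I, of x y] by auto
      then show "\<phi> (x \<oplus>\<^bsub>?I\<^esub> y) = \<phi> x \<oplus>\<^bsub>V\<^esub> \<phi> y"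
        using pD(4)[OF \<phi>p \<phi>p, of x y] xy b by (simp add: uniq B.lsmult_l_distr)
    next
      fix r x assume rx: "r \<in> carrier R" "x \<in> carrier ?I"
      then have "x \<in> carrier R" "r \<otimes>\<^bsub>R\<^esub> x \<in> I"
        using IR submodule_smult_closed[OF I, of r x] by auto
      then show "\<phi> (r \<odot>\<^bsub>?I\<^esub> x) = r \<odot>\<^bsub>V\<^esub> \<phi> x"
        using pD(5)[OF rx(1) \<phi>p, of x] rx b by (simp add: uniq B.lsmult_assoc)
    qed
    have inc: "(\<lambda>s\<in>I. s) \<in> mod_hom R ?I ?reg"
      by (rule mod_homI) (use IR submodule_add_closed[OF I] submodule_smult_closed[OF I] in auto)
    have "\<exists>g\<in>mod_hom R ?reg V. \<forall>x\<in>carrier ?I. g ((\<lambda>s\<in>I. s) x) = \<phi> x"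
    proof (rule injective_factor[OF inj V Im leI reg lereg inc \<phi>])
      fix s assume "s \<in> carrier ?I" "(\<lambda>s\<in>I. s) s = \<zero>\<^bsub>?reg\<^esub>"
      then show "\<phi> s = \<zero>\<^bsub>V\<^esub>" using uniq pD(3) b by simp
    qed
    then obtain g where g: "g \<in> mod_hom R ?reg V" "\<And>s. s \<in> I \<Longrightarrow> g s = \<phi> s" by auto
    define y where "y = g \<one>\<^bsub>R\<^esub>"
    have y: "y \<in> carrier V" unfolding y_def by (rule hom_closed[OF g(1)]) simp
    have gy: "g s = s \<odot>\<^bsub>V\<^esub> y" if "s \<in> carrier R" for s
      using hom_smult[OF g(1) that, of "\<one>\<^bsub>R\<^esub>"] that by (simp add: y_def)
    define q where "q = {(x \<oplus>\<^bsub>B\<^esub> s \<odot>\<^bsub>B\<^esub> b, w \<oplus>\<^bsub>V\<^esub> s \<odot>\<^bsub>V\<^esub> y) | x w s. (x, w) \<in> p \<and> s \<in> carrier R}"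
    have qI: "(x \<oplus>\<^bsub>B\<^esub> s \<odot>\<^bsub>B\<^esub> b, w \<oplus>\<^bsub>V\<^esub> s \<odot>\<^bsub>V\<^esub> y) \<in> q" if "(x, w) \<in> p" "s \<in> carrier R" for x w s
      using that by (auto simp: q_def)
    note cl = B.lsmult_closed V.lsmult_closed b y
    have pq: "p \<subseteq> q"
    proof
      fix a assume a: "a \<in> p"
      obtain x w where xw: "a = (x, w)" by fastforce
      show "a \<in> q"
        using qI[OF a[unfolded xw], of "\<zero>\<^bsub>R\<^esub>"] pD(1,2)[OF a[unfolded xw]] b y by (simp add: xw)
    qed
    have "partial_hom R B V q"
      unfolding partial_hom_def
    proof (intro conjI allI impI ballI)
      show "q \<subseteq> carrier B \<times> carrier V" using pD(1,2) cl by (auto simp: q_def)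
      show "(\<zero>\<^bsub>B\<^esub>, \<zero>\<^bsub>V\<^esub>) \<in> q" using pq pD(3) by blast
      fix x1 y1 x2 y2 assume "(x1, y1) \<in> q" "(x2, y2) \<in> q"
      then obtain x w s x' w' s' where e: "x1 = x \<oplus>\<^bsub>B\<^esub> s \<odot>\<^bsub>B\<^esub> b" "y1 = w \<oplus>\<^bsub>V\<^esub> s \<odot>\<^bsub>V\<^esub> y"
        "x2 = x' \<oplus>\<^bsub>B\<^esub> s' \<odot>\<^bsub>B\<^esub> b" "y2 = w' \<oplus>\<^bsub>V\<^esub> s' \<odot>\<^bsub>V\<^esub> y"
        and h: "(x, w) \<in> p" "(x', w') \<in> p" "s \<in> carrier R" "s' \<in> carrier R"
        unfolding q_def by auto
      note c = pD(1,2)[OF h(1)] pD(1,2)[OF h(2)]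
      have "x1 \<oplus>\<^bsub>B\<^esub> x2 = (x \<oplus>\<^bsub>B\<^esub> x') \<oplus>\<^bsub>B\<^esub> (s \<oplus>\<^bsub>R\<^esub> s') \<odot>\<^bsub>B\<^esub> b"
        "y1 \<oplus>\<^bsub>V\<^esub> y2 = (w \<oplus>\<^bsub>V\<^esub> w') \<oplus>\<^bsub>V\<^esub> (s \<oplus>\<^bsub>R\<^esub> s') \<odot>\<^bsub>V\<^esub> y"
        unfolding e using c h cl by (simp_all add: B.lsmult_l_distr V.lsmult_l_distr B.add_add_swap V.add_add_swap)
      then show "(x1 \<oplus>\<^bsub>B\<^esub> x2, y1 \<oplus>\<^bsub>V\<^esub> y2) \<in> q"
        using qI[OF pD(4)[OF h(1,2)], of "s \<oplus>\<^bsub>R\<^esub> s'"] h by simp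
    next
      fix r x1 y1 assume r: "r \<in> carrier R" and "(x1, y1) \<in> q"
      then obtain x w s where e: "x1 = x \<oplus>\<^bsub>B\<^esub> s \<odot>\<^bsub>B\<^esub> b" "y1 = w \<oplus>\<^bsub>V\<^esub> s \<odot>\<^bsub>V\<^esub> y"
        and h: "(x, w) \<in> p" "s \<in> carrier R"
        unfolding q_def by auto
      have "r \<odot>\<^bsub>B\<^esub> x1 = r \<odot>\<^bsub>B\<^esub> x \<oplus>\<^bsub>B\<^esub> (r \<otimes>\<^bsub>R\<^esub> s) \<odot>\<^bsub>B\<^esub> b" "r \<odot>\<^bsub>V\<^esub> y1 = r \<odot>\<^bsub>V\<^esub> w \<oplus>\<^bsub>V\<^esub> (r \<otimes>\<^bsub>R\<^esub> s) \<odot>\<^bsub>V\<^esub> y"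
        unfolding e using r pD(1,2)[OF h(1)] h cl
        by (simp_all add: B.lsmult_r_distr V.lsmult_r_distr B.lsmult_assoc V.lsmult_assoc)
      then show "(r \<odot>\<^bsub>B\<^esub> x1, r \<odot>\<^bsub>V\<^esub> y1) \<in> q"
        using qI[OF pD(5)[OF r h(1)], of "r \<otimes>\<^bsub>R\<^esub> s"] h r by simp
    next
      fix y1 assume "(\<zero>\<^bsub>B\<^esub>, y1) \<in> q"
      then obtain x w s where e: "\<zero>\<^bsub>B\<^esub> = x \<oplus>\<^bsub>B\<^esub> s \<odot>\<^bsub>B\<^esub> b" "y1 = w \<oplus>\<^bsub>V\<^esub> s \<odot>\<^bsub>V\<^esub> y"
        and h: "(x, w) \<in> p" "s \<in> carrier R"
        unfolding q_def by auto
      note c = pD(1,2)[OF h(1)]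
      \<comment> \<open>Single-valuedness: if x + s b = 0, then s b lies in the domain and s in I,
        so s y is the value -w that p has at s b.\<close>
      have sb: "s \<odot>\<^bsub>B\<^esub> b = \<ominus>\<^bsub>B\<^esub> x"
        using B.M.minus_equality[of "s \<odot>\<^bsub>B\<^esub> b" x] e(1) c h(2) cl B.M.a_comm[of x "s \<odot>\<^bsub>B\<^esub> b"] by simp
      have "((\<ominus>\<^bsub>R\<^esub> \<one>\<^bsub>R\<^esub>) \<odot>\<^bsub>B\<^esub> x, (\<ominus>\<^bsub>R\<^esub> \<one>\<^bsub>R\<^esub>) \<odot>\<^bsub>V\<^esub> w) \<in> p"
        by (rule pD(5)[OF _ h(1)]) simp
      then have m: "(s \<odot>\<^bsub>B\<^esub> b, \<ominus>\<^bsub>V\<^esub> w) \<in> p" using c by (simp add: sb B.minus_one_smult V.minus_one_smult)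
      then have sI: "s \<in> I" using h(2) by (auto simp: I_def)
      have "s \<odot>\<^bsub>V\<^esub> y = \<ominus>\<^bsub>V\<^esub> w" using uniq[OF sI m] g(2)[OF sI] gy[OF h(2)] by simp
      then show "y1 = \<zero>\<^bsub>V\<^esub>" using e(2) c by (simp add: V.M.r_neg)
    qed
    then have "q \<in> \<P>" using p(2) pq by (auto simp: \<P>_def)
    then have "q = p" using max pq by blast
    moreover have "(\<zero>\<^bsub>B\<^esub> \<oplus>\<^bsub>B\<^esub> \<one>\<^bsub>R\<^esub> \<odot>\<^bsub>B\<^esub> b, \<zero>\<^bsub>V\<^esub> \<oplus>\<^bsub>V\<^esub> \<one>\<^bsub>R\<^esub> \<odot>\<^bsub>V\<^esub> y) \<in> q"
      by (rule qI[OF pD(3)]) simp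
    ultimately show ?thesis using b y by (auto simp: B.lsmult_one V.lsmult_one)
  qed
  define \<theta> where "\<theta> = (\<lambda>b\<in>carrier B. SOME y. (b, y) \<in> p)"
  have \<theta>p: "(b, \<theta> b) \<in> p" if "b \<in> carrier B" for b
    using someI_ex[OF total[OF that]] that by (simp add: \<theta>_def)
  have uniq: "\<theta> b = y" if "(b, y) \<in> p" for b y
    by (rule partial_hom_unique[OF B V p(1) \<theta>p[OF pD(1)[OF that]] that])
  have "\<theta> \<in> mod_hom R B V"
  proof (rule mod_homI)
    show "\<theta> \<in> carrier B \<rightarrow>\<^sub>E carrier V" using pD(2)[OF \<theta>p] by (auto simp: \<theta>_def)
  next
    fix x y assume "x \<in> carrier B" "y \<in> carrier B"
    then show "\<theta> (x \<oplus>\<^bsub>B\<^esub> y) = \<theta> x \<oplus>\<^bsub>V\<^esub> \<theta> y" by (intro uniq pD(4) \<theta>p)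
  next
    fix r x assume "r \<in> carrier R" "x \<in> carrier B"
    then show "\<theta> (r \<odot>\<^bsub>B\<^esub> x) = r \<odot>\<^bsub>V\<^esub> \<theta> x" by (intro uniq pD(5) \<theta>p)
  qed
  then show ?thesis using uniq p(2) by blast
qed

section \<open>Finite sums over blocks of indices\<close>

context left_module
begin

lemma nsum_single:
  assumes "l < n" "v l \<in> carrier M" "\<And>k. \<lbrakk>k < n; k \<noteq> l\<rbrakk> \<Longrightarrow> v k = \<zero>\<^bsub>M\<^esub>"
  shows "nsum M n v = v l"
  using assms
proof (induction n)
  case (Suc n)
  show ?case
  proof (cases "l = n")
    case True
    then have "nsum M n v = \<zero>\<^bsub>M\<^esub>" using Suc by (intro nsum_zero) auto
    then show ?thesis using True Suc by simp
  next
    case False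
    then have "nsum M n v = v l" using Suc by auto
    moreover have "v n = \<zero>\<^bsub>M\<^esub>" using Suc False by auto
    ultimately show ?thesis using Suc by simp
  qed
qed simp

lemma nsum_append:
  assumes "\<And>k. k < a + b \<Longrightarrow> v k \<in> carrier M"
  shows "nsum M (a + b) v = nsum M a v \<oplus>\<^bsub>M\<^esub> nsum M b (\<lambda>k. v (a + k))"
  using assms by (induction b) (auto simp: nsum_closed M.a_assoc)

lemma nsum_mult:
  assumes "\<And>k. k < q * m \<Longrightarrow> v k \<in> carrier M"
  shows "nsum M (q * m) v = nsum M q (\<lambda>l. nsum M m (\<lambda>j. v (l * m + j)))"
  using assms
proof (induction q)
  case (Suc q)
  have "nsum M (q * m + m) v = nsum M (q * m) v \<oplus>\<^bsub>M\<^esub> nsum M m (\<lambda>k. v (q * m + k))"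
    by (rule nsum_append) (use Suc(2) in \<open>simp add: add.commute\<close>)
  moreover have "nsum M (q * m) v = nsum M q (\<lambda>l. nsum M m (\<lambda>j. v (l * m + j)))"
    by (rule Suc(1)) (use Suc(2) in simp)
  ultimately show ?case by (simp add: add.commute)
qed simp

lemma nsum_a_inv:
  assumes "\<And>k. k < n \<Longrightarrow> v k \<in> carrier M"
  shows "nsum M n (\<lambda>k. \<ominus>\<^bsub>M\<^esub> v k) = \<ominus>\<^bsub>M\<^esub> nsum M n v"
  using assms
proof (induction n)
  case 0
  have "\<ominus>\<^bsub>M\<^esub> \<zero>\<^bsub>M\<^esub> = \<zero>\<^bsub>M\<^esub>" by (rule M.minus_equality) auto
  then show ?case by (simp only: nsum.simps)
qed (simp add: nsum_closed M.minus_add)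

end

section \<open>Finite matrix subgroups of the local dual\<close>

context dual_setup
begin

text \<open>Converse to the last clause of \<open>presenting\<close>: after an exchange of sums,
  each G j is applied to a relation of C.\<close>

lemma vanishes_from_system:
  assumes pres: "presenting n m \<rho> b" and g: "g \<in> carrier Cp" and t: "\<And>k. k < n \<Longrightarrow> t k \<in> carrier R"
    and G: "\<And>j. j < m \<Longrightarrow> G j \<in> carrier Cp"
    and eq: "\<And>k. k < n \<Longrightarrow> t k \<odot>\<^bsub>Cp\<^esub> g = nsum Cp m (\<lambda>j. \<rho> j k \<odot>\<^bsub>Cp\<^esub> G j)"
  shows "g (nsum C n (\<lambda>k. t k \<odot>\<^bsub>C\<^esub> b k)) = \<zero>\<^bsub>V\<^esub>"
proof -
  note \<rho>c = presentingD(1)[OF pres] and bc = presentingD(2)[OF pres] and rel = presentingD(4)[OF pres]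
  have \<rho>b: "\<rho> j k \<odot>\<^bsub>C\<^esub> b k \<in> carrier C" if "j < m" "k < n" for j k
    by (rule C.lsmult_closed[OF \<rho>c[OF that] bc])
  have "g (nsum C n (\<lambda>k. t k \<odot>\<^bsub>C\<^esub> b k)) = nsum V n (\<lambda>k. g (t k \<odot>\<^bsub>C\<^esub> b k))"
    by (rule Cp_nsum[OF g]) (rule C.lsmult_closed[OF t bc])
  also have "\<dots> = nsum V n (\<lambda>k. nsum V m (\<lambda>j. G j (\<rho> j k \<odot>\<^bsub>C\<^esub> b k)))"
  proof (rule nsum_cong)
    fix k assume k: "k < n"
    have "g (t k \<odot>\<^bsub>C\<^esub> b k) = (t k \<odot>\<^bsub>Cp\<^esub> g) (b k)" using bc by simp
    also have "\<dots> = nsum V m (\<lambda>j. G j (\<rho> j k \<odot>\<^bsub>C\<^esub> b k))" unfolding eq[OF k] using bc by (simp add: Cp_nsum_apply)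
    finally show "g (t k \<odot>\<^bsub>C\<^esub> b k) = nsum V m (\<lambda>j. G j (\<rho> j k \<odot>\<^bsub>C\<^esub> b k))" .
  qed
  also have "\<dots> = nsum V m (\<lambda>j. nsum V n (\<lambda>k. G j (\<rho> j k \<odot>\<^bsub>C\<^esub> b k)))"
    by (rule V.nsum_swap) (rule Cp_hom(1)[OF G \<rho>b])
  also have "\<dots> = nsum V m (\<lambda>j. G j (nsum C n (\<lambda>k. \<rho> j k \<odot>\<^bsub>C\<^esub> b k)))"
    by (rule nsum_cong) (rule Cp_nsum[OF G \<rho>b, symmetric])
  also have "\<dots> = \<zero>\<^bsub>V\<^esub>"
    by (rule V.nsum_zero) (simp only: rel Cp_hom(4)[OF G])
  finally show ?thesis .
qed

text \<open>
  By \<open>presenting_exists\<close> the condition \<open>g (cs ! l) = 0\<close> says that \<open>g t\<^sub>l\<^sub>k = \<Sum>\<^sub>j G\<^sub>l\<^sub>j \<rho>\<^sub>j\<^sub>k\<close> is solvable in \<open>C\<^sup>+\<close>. The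
  module presented by these equations has generators \<open>G\<^sub>l\<^sub>j\<close>, with index \<open>l * m + j\<close>, and \<open>g\<close>, with
  index \<open>q * m\<close>.
\<close>

lemma finite_annihilator_fms:
  assumes cs: "set cs \<subseteq> carrier C"
  shows "finite_matrix_subgroup U R Cp {g \<in> carrier Cp. \<forall>c\<in>set cs. g c = \<zero>\<^bsub>V\<^esub>}"
proof -
  obtain n m \<rho> b where pres: "presenting n m \<rho> b" using presenting_exists by blast
  note \<rho>c = presentingD(1)[OF pres]
  define q where "q = length cs"
  have csc: "cs ! l \<in> carrier C" if "l < q" for l using that cs by (auto simp: q_def)
  have "\<forall>l. \<exists>t. l < q \<longrightarrow> (\<forall>k<n. t k \<in> carrier R) \<and> cs ! l = nsum C n (\<lambda>k. t k \<odot>\<^bsub>C\<^esub> b k)"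
    using presentingD(3)[OF pres csc] by blast
  then obtain t where t: "\<forall>l. l < q \<longrightarrow> (\<forall>k<n. t l k \<in> carrier R) \<and> cs ! l = nsum C n (\<lambda>k. t l k \<odot>\<^bsub>C\<^esub> b k)"
    unfolding choice_iff ..
  then have tc: "t l k \<in> carrier R" and cst: "cs ! l = nsum C n (\<lambda>k. t l k \<odot>\<^bsub>C\<^esub> b k)" if "l < q" "k < n" for l k
    using that by auto
  have cst: "cs ! l = nsum C n (\<lambda>k. t l k \<odot>\<^bsub>C\<^esub> b k)" if "l < q" for l using t that by blast
  have R': "ring (opp R)" by (rule ring_opp[OF C.ring_axioms])
  note opp_a_inv_closed = abelian_group.a_inv_closed[OF ring.axioms(1)[OF R']]
  define N where "N = Suc (q * m)"
  let ?F = "free_module (opp R) N"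
  have F: "left_module (opp R) ?F" by (rule free_left_module[OF R'])
  interpret F: left_module "opp R" ?F by (rule F)
  \<comment> \<open>w l k is the relation that sets t_lk g equal to the sum of the \<rho>_jk G_lj,
    with all terms on one side. The remainder and the quotient of an index by m recover j and
    l.\<close>
  define w where "w l k = (\<lambda>i\<in>{..<N}. if i = q * m then t l k
    else if i div m = l then \<ominus>\<^bsub>opp R\<^esub> \<rho> (i mod m) k else \<zero>\<^bsub>R\<^esub>)" for l k
  have imod: "i mod m < m" "i div m < q" if "i < q * m" for i
  proof -
    have "m \<noteq> 0" using that by (cases m) auto
    then show "i mod m < m" by simp
    show "i div m < q" using that by (simp add: less_mult_imp_div_less)
  qed
  have wF: "w l k \<in> carrier ?F" if "l < q" "k < n" for l k
  proof -
    have "\<ominus>\<^bsub>opp R\<^esub> \<rho> (i mod m) k \<in> carrier R" if "i < q * m" for i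
      using opp_a_inv_closed[of "\<rho> (i mod m) k"] \<rho>c[OF imod(1)[OF that] \<open>k < n\<close>] by simp
    then show ?thesis using tc[OF that] by (auto simp: w_def product_carrier N_def less_Suc_eq)
  qed
  define X where "X = (\<lambda>(l, k). w l k) ` ({..<q} \<times> {..<n})"
  have Xfin: "finite X" and XF: "X \<subseteq> carrier ?F" using wF by (auto simp: X_def)
  define K where "K = mod_span (opp R) ?F X"
  have K: "submodule K (opp R) ?F" unfolding K_def by (rule F.mod_span_submodule[OF XF])
  have leF: "carrier ?F \<lesssim> (UNIV :: 'u set)"
    using lepoll_finite_power[OF R_le universe_infinite, of N] by (simp add: product_carrier)
  obtain A :: "('r, 'u) module" and p where A: "left_module (opp R) A" "p \<in> mod_hom (opp R) ?F A" "p ` carrier ?F = carrier A"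
    and pe: "\<And>x y. \<lbrakk>x \<in> carrier ?F; y \<in> carrier ?F\<rbrakk> \<Longrightarrow> p x = p y \<longleftrightarrow> x \<ominus>\<^bsub>?F\<^esub> y \<in> K"
    by (rule quotient_in_universe[OF F K leF]) (rule that)
  interpret A: left_module "opp R" A by (rule A(1))
  have p0: "p x = \<zero>\<^bsub>A\<^esub> \<longleftrightarrow> x \<in> K" if "x \<in> carrier ?F" for x
    using pe[OF that F.M.zero_closed] hom_zero[OF F A(1,2)] F.add_minus_cancel(3)[OF that F.M.zero_closed] that by simp
  have XK: "mod_span (opp R) ?F X = {x \<in> carrier ?F. p x = \<zero>\<^bsub>A\<^esub>}"
    unfolding K_def[symmetric] using p0 submodule_in_carrier[OF K] by blast
  have Afp: "finitely_presented (opp R) A"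
    unfolding finitely_presented_def Let_def
    by (intro exI[of _ N] bexI[OF _ A(2)] conjI exI[of _ X] A(3) Xfin XF XK)
  define e where "e i = ins (regular_module (opp R)) N i \<one>\<^bsub>opp R\<^esub>" for i
  have eF: "e i \<in> carrier ?F" for i
    unfolding e_def by (rule ins_carrier[OF regular_left_module[OF R']]) simp
  define x where "x = p (e (q * m))"
  have x: "x \<in> carrier A" unfolding x_def by (rule hom_closed[OF A(2) eF])
  \<comment> \<open>The indices below q * m form q blocks of length m, of which only the l-th
    contributes; the last index q * m contributes the term with t.\<close>
  have eval: "nsum Cp N (\<lambda>i. w l k i \<odot>\<^bsub>Cp\<^esub> v i) =
      \<ominus>\<^bsub>Cp\<^esub> nsum Cp m (\<lambda>j. \<rho> j k \<odot>\<^bsub>Cp\<^esub> v (l * m + j)) \<oplus>\<^bsub>Cp\<^esub> t l k \<odot>\<^bsub>Cp\<^esub> v (q * m)"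
    if v: "\<And>i. i < N \<Longrightarrow> v i \<in> carrier Cp" and l: "l < q" and k: "k < n" for v l k
  proof -
    have wi: "w l k i \<in> carrier (opp R)" if "i < N" for i using product_in_carrier[OF wF[OF l k], of i] that by simp
    have wv: "w l k i \<odot>\<^bsub>Cp\<^esub> v i \<in> carrier Cp" if "i < N" for i by (rule Cp.lsmult_closed[OF wi[OF that] v[OF that]])
    have idx: "l' * m + j < q * m" if "l' < q" "j < m" for l' j
    proof -
      have "l' * m + j < Suc l' * m" using that(2) by simp
      also have "\<dots> \<le> q * m" using that(1) by (intro mult_le_mono1) simp
      finally show ?thesis .
    qed
    have inner: "nsum Cp m (\<lambda>j. w l k (l' * m + j) \<odot>\<^bsub>Cp\<^esub> v (l' * m + j)) =
        (if l' = l then \<ominus>\<^bsub>Cp\<^esub> nsum Cp m (\<lambda>j. \<rho> j k \<odot>\<^bsub>Cp\<^esub> v (l * m + j)) else \<zero>\<^bsub>Cp\<^esub>)" if l': "l' < q" for l'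
    proof (cases "l' = l")
      case True
      have "nsum Cp m (\<lambda>j. w l k (l' * m + j) \<odot>\<^bsub>Cp\<^esub> v (l' * m + j)) = nsum Cp m (\<lambda>j. \<ominus>\<^bsub>Cp\<^esub> (\<rho> j k \<odot>\<^bsub>Cp\<^esub> v (l * m + j)))"
      proof (rule nsum_cong)
        fix j assume j: "j < m"
        have "w l k (l' * m + j) = \<ominus>\<^bsub>opp R\<^esub> \<rho> j k"
          using idx[OF l' j] j True by (simp add: w_def N_def)
        moreover have "v (l * m + j) \<in> carrier Cp" using idx[OF l j] by (intro v) (simp add: N_def)
        ultimately show "w l k (l' * m + j) \<odot>\<^bsub>Cp\<^esub> v (l' * m + j) = \<ominus>\<^bsub>Cp\<^esub> (\<rho> j k \<odot>\<^bsub>Cp\<^esub> v (l * m + j))"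
          using True \<rho>c[OF j k] by (simp add: Cp.smult_minus_left)
      qed
      also have "\<dots> = \<ominus>\<^bsub>Cp\<^esub> nsum Cp m (\<lambda>j. \<rho> j k \<odot>\<^bsub>Cp\<^esub> v (l * m + j))"
        by (rule Cp.nsum_a_inv, rule Cp_smult_closed[OF \<rho>c[OF _ k] v]) (use idx[OF l] in \<open>simp_all add: N_def less_SucI\<close>)
      finally show ?thesis using True by simp
    next
      case False
      have "nsum Cp m (\<lambda>j. w l k (l' * m + j) \<odot>\<^bsub>Cp\<^esub> v (l' * m + j)) = \<zero>\<^bsub>Cp\<^esub>"
      proof (rule Cp.nsum_zero)
        fix j assume j: "j < m"
        have "w l k (l' * m + j) = \<zero>\<^bsub>opp R\<^esub>"
          using idx[OF l' j] j False by (simp add: w_def N_def)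
        moreover have "v (l' * m + j) \<in> carrier Cp" using idx[OF l' j] by (intro v) (simp add: N_def)
        ultimately show "w l k (l' * m + j) \<odot>\<^bsub>Cp\<^esub> v (l' * m + j) = \<zero>\<^bsub>Cp\<^esub>"
          using Cp.smult_zero_left by simp
      qed
      then show ?thesis using False by simp
    qed
    have sc: "nsum Cp m (\<lambda>j. \<rho> j k \<odot>\<^bsub>Cp\<^esub> v (l * m + j)) \<in> carrier Cp"
      by (rule Cp.nsum_closed, rule Cp_smult_closed[OF \<rho>c[OF _ k] v]) (use idx[OF l] in \<open>simp_all add: N_def less_SucI\<close>)
    have "nsum Cp (q * m) (\<lambda>i. w l k i \<odot>\<^bsub>Cp\<^esub> v i) = nsum Cp q (\<lambda>l'. nsum Cp m (\<lambda>j. w l k (l' * m + j) \<odot>\<^bsub>Cp\<^esub> v (l' * m + j)))"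
      by (rule Cp.nsum_mult) (rule wv, simp add: N_def)
    also have "\<dots> = nsum Cp m (\<lambda>j. w l k (l * m + j) \<odot>\<^bsub>Cp\<^esub> v (l * m + j))"
      by (rule Cp.nsum_single[OF l]) (use inner l sc in simp_all)
    also have "\<dots> = \<ominus>\<^bsub>Cp\<^esub> nsum Cp m (\<lambda>j. \<rho> j k \<odot>\<^bsub>Cp\<^esub> v (l * m + j))" using inner[OF l] by simp
    finally show ?thesis by (simp add: N_def w_def)
  qed
  have hx: "nsum Cp N (\<lambda>i. e (q * m) i \<odot>\<^bsub>Cp\<^esub> v i) = v (q * m)" if v: "\<And>i. i < N \<Longrightarrow> v i \<in> carrier Cp" for v
  proof -
    have vl: "v (q * m) \<in> carrier Cp" by (rule v) (simp add: N_def)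
    have 1: "\<one>\<^bsub>opp R\<^esub> \<odot>\<^bsub>Cp\<^esub> v (q * m) = v (q * m)" by (rule Cp.lsmult_one[OF vl])
    have "nsum Cp N (\<lambda>i. e (q * m) i \<odot>\<^bsub>Cp\<^esub> v i) = e (q * m) (q * m) \<odot>\<^bsub>Cp\<^esub> v (q * m)"
      by (rule Cp.nsum_single) (use v vl 1 Cp.smult_zero_left in \<open>auto simp: N_def e_def ins_def\<close>)
    then show ?thesis using 1 by (simp add: e_def ins_def N_def)
  qed
  have "{g \<in> carrier Cp. \<forall>c\<in>set cs. g c = \<zero>\<^bsub>V\<^esub>} = {h x | h. h \<in> mod_hom (opp R) A Cp}"
  proof
    show "{h x | h. h \<in> mod_hom (opp R) A Cp} \<subseteq> {g \<in> carrier Cp. \<forall>c\<in>set cs. g c = \<zero>\<^bsub>V\<^esub>}"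
    proof
      fix g assume "g \<in> {h x | h. h \<in> mod_hom (opp R) A Cp}"
      then obtain h where h: "h \<in> mod_hom (opp R) A Cp" "g = h x" by blast
      have gc: "g \<in> carrier Cp" unfolding h(2) by (rule hom_closed[OF h(1) x])
      define v where "v i = h (p (e i))" for i
      have v: "v i \<in> carrier Cp" for i unfolding v_def by (rule hom_closed[OF h(1) hom_closed[OF A(2) eF]])
      have hp: "h (p u) = nsum Cp N (\<lambda>i. u i \<odot>\<^bsub>Cp\<^esub> v i)" if u: "u \<in> carrier ?F" for u
      proof -
        have hpm: "(\<lambda>x\<in>carrier ?F. h (p x)) \<in> mod_hom (opp R) ?F Cp" by (rule hom_compose[OF A(2) h(1) F])
        show ?thesis
          using hom_free_expand[OF R' Cp_module hpm u] u eF unfolding v_def e_def[symmetric] by simp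
      qed
      have "g (cs ! l) = \<zero>\<^bsub>V\<^esub>" if l: "l < q" for l
        unfolding cst[OF l]
      proof (rule vanishes_from_system[OF pres gc tc[OF l] v])
        fix k assume k: "k < n"
        have "w l k \<in> K" unfolding K_def using F.mod_span_incl[of X] l k by (auto simp: X_def)
        then have "h (p (w l k)) = \<zero>\<^bsub>Cp\<^esub>" using p0[OF wF[OF l k]] hom_zero[OF A(1) Cp_module h(1)] by simp
        then have z: "\<ominus>\<^bsub>Cp\<^esub> nsum Cp m (\<lambda>j. \<rho> j k \<odot>\<^bsub>Cp\<^esub> v (l * m + j)) \<oplus>\<^bsub>Cp\<^esub> t l k \<odot>\<^bsub>Cp\<^esub> v (q * m) = \<zero>\<^bsub>Cp\<^esub>"
          using hp[OF wF[OF l k]] eval[OF v l k] by simp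
        have g: "v (q * m) = g" unfolding h(2) v_def x_def ..
        have sc: "nsum Cp m (\<lambda>j. \<rho> j k \<odot>\<^bsub>Cp\<^esub> v (l * m + j)) \<in> carrier Cp"
          by (rule Cp.nsum_closed, rule Cp_smult_closed[OF \<rho>c[OF _ k] v])
        have tg: "t l k \<odot>\<^bsub>Cp\<^esub> g \<in> carrier Cp" by (rule Cp_smult_closed[OF tc[OF l k] gc])
        have "t l k \<odot>\<^bsub>Cp\<^esub> g \<ominus>\<^bsub>Cp\<^esub> nsum Cp m (\<lambda>j. \<rho> j k \<odot>\<^bsub>Cp\<^esub> v (l * m + j)) = \<zero>\<^bsub>Cp\<^esub>"
          using z sc tg unfolding g a_minus_def by (subst Cp.M.a_comm) auto
        then show "t l k \<odot>\<^bsub>Cp\<^esub> g = nsum Cp m (\<lambda>j. \<rho> j k \<odot>\<^bsub>Cp\<^esub> v (l * m + j))"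
          using sc tg by simp
      qed
      then show "g \<in> {g \<in> carrier Cp. \<forall>c\<in>set cs. g c = \<zero>\<^bsub>V\<^esub>}"
        using gc by (auto simp: in_set_conv_nth q_def)
    qed
    show "{g \<in> carrier Cp. \<forall>c\<in>set cs. g c = \<zero>\<^bsub>V\<^esub>} \<subseteq> {h x | h. h \<in> mod_hom (opp R) A Cp}"
    proof
      fix g assume "g \<in> {g \<in> carrier Cp. \<forall>c\<in>set cs. g c = \<zero>\<^bsub>V\<^esub>}"
      then have g: "g \<in> carrier Cp" "\<And>c. c \<in> set cs \<Longrightarrow> g c = \<zero>\<^bsub>V\<^esub>" by auto
      have "\<exists>G. l < q \<longrightarrow> (\<forall>j. G j \<in> carrier Cp) \<and> (\<forall>k<n. t l k \<odot>\<^bsub>Cp\<^esub> g = nsum Cp m (\<lambda>j. \<rho> j k \<odot>\<^bsub>Cp\<^esub> G j))" for l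
      proof (cases "l < q")
        case l: True
        have "g (nsum C n (\<lambda>k. t l k \<odot>\<^bsub>C\<^esub> b k)) = \<zero>\<^bsub>V\<^esub>"
          unfolding cst[OF l, symmetric] by (rule g(2)) (use l in \<open>simp add: q_def\<close>)
        then show ?thesis using presentingD(5)[OF pres g(1), of "t l"] tc[OF l] by simp
      qed simp
      then have "\<forall>l. \<exists>G. l < q \<longrightarrow> (\<forall>j. G j \<in> carrier Cp) \<and> (\<forall>k<n. t l k \<odot>\<^bsub>Cp\<^esub> g = nsum Cp m (\<lambda>j. \<rho> j k \<odot>\<^bsub>Cp\<^esub> G j))" ..
      then obtain G where G: "\<forall>l. l < q \<longrightarrow> (\<forall>j. G l j \<in> carrier Cp) \<and> (\<forall>k<n. t l k \<odot>\<^bsub>Cp\<^esub> g = nsum Cp m (\<lambda>j. \<rho> j k \<odot>\<^bsub>Cp\<^esub> G l j))"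
        unfolding choice_iff ..
      have Gc: "G l j \<in> carrier Cp" if "l < q" for l j using G that by blast
      have Ge: "t l k \<odot>\<^bsub>Cp\<^esub> g = nsum Cp m (\<lambda>j. \<rho> j k \<odot>\<^bsub>Cp\<^esub> G l j)" if "l < q" "k < n" for l k using G that by blast
      define v where "v i = (if i = q * m then g else G (i div m) (i mod m))" for i
      have v: "v i \<in> carrier Cp" if "i < N" for i
        using that g(1) Gc[OF imod(2)] by (auto simp: v_def N_def less_Suc_eq)
      have "\<exists>h\<in>mod_hom (opp R) A Cp. \<forall>u\<in>carrier ?F. h (p u) = nsum Cp N (\<lambda>i. u i \<odot>\<^bsub>Cp\<^esub> v i)"
      proof (rule presentation_hom[OF A(1) Cp_module A(2,3) XF XK v])
        fix y assume "y \<in> X"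
        then obtain l k where lk: "l < q" "k < n" "y = w l k" by (auto simp: X_def)
        have vg: "v (q * m) = g" by (simp add: v_def)
        have "nsum Cp m (\<lambda>j. \<rho> j k \<odot>\<^bsub>Cp\<^esub> v (l * m + j)) = nsum Cp m (\<lambda>j. \<rho> j k \<odot>\<^bsub>Cp\<^esub> G l j)"
        proof (rule nsum_cong)
          fix j assume j: "j < m"
          have "l * m + j < Suc l * m" using j by simp
          also have "\<dots> \<le> q * m" using lk(1) by (intro mult_le_mono1) simp
          finally show "\<rho> j k \<odot>\<^bsub>Cp\<^esub> v (l * m + j) = \<rho> j k \<odot>\<^bsub>Cp\<^esub> G l j" using j by (simp add: v_def)
        qed
        then have e1: "nsum Cp m (\<lambda>j. \<rho> j k \<odot>\<^bsub>Cp\<^esub> v (l * m + j)) = t l k \<odot>\<^bsub>Cp\<^esub> g" using Ge[OF lk(1,2)] by simp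
        have "nsum Cp N (\<lambda>i. w l k i \<odot>\<^bsub>Cp\<^esub> v i) =
            \<ominus>\<^bsub>Cp\<^esub> nsum Cp m (\<lambda>j. \<rho> j k \<odot>\<^bsub>Cp\<^esub> v (l * m + j)) \<oplus>\<^bsub>Cp\<^esub> t l k \<odot>\<^bsub>Cp\<^esub> v (q * m)"
          by (rule eval[OF v lk(1,2)])
        then have "nsum Cp N (\<lambda>i. w l k i \<odot>\<^bsub>Cp\<^esub> v i) = \<ominus>\<^bsub>Cp\<^esub> (t l k \<odot>\<^bsub>Cp\<^esub> g) \<oplus>\<^bsub>Cp\<^esub> t l k \<odot>\<^bsub>Cp\<^esub> g"
          unfolding e1 vg .
        then show "nsum Cp N (\<lambda>i. y i \<odot>\<^bsub>Cp\<^esub> v i) = \<zero>\<^bsub>Cp\<^esub>"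
          using Cp_smult_closed[OF tc[OF lk(1,2)] g(1)] lk(3) by (simp add: Cp.M.l_neg)
      qed
      then obtain h where h: "h \<in> mod_hom (opp R) A Cp" "\<forall>u\<in>carrier ?F. h (p u) = nsum Cp N (\<lambda>i. u i \<odot>\<^bsub>Cp\<^esub> v i)" ..
      have "h x = v (q * m)" unfolding x_def using h(2) eF hx[OF v] by simp
      then have "h x = g" by (simp add: v_def)
      then show "g \<in> {h x | h. h \<in> mod_hom (opp R) A Cp}" using h(1) by blast
    qed
  qed
  then show ?thesis unfolding finite_matrix_subgroup_def using A(1) Afp x by blast
qed

text \<open>Any \<alpha> f vanishes on Ker f by evaluation. Conversely, if g vanishes on Ker f, then
  f c -> g c is well defined on the image of f and extends to an endomorphism of V; composition with
  it is an endomorphism of C+ that takes f to g. Finitely many generators of Ker f over S turn the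
  vanishing into finitely many conditions.\<close>

lemma endofinite_imp_fms:
  assumes fin: "endofinite R C" and cyc: "cyclic_submodule (End_ring (opp R) Cp) (End_module Cp) N"
  shows "finite_matrix_subgroup U R Cp N"
proof -
  obtain f where f: "f \<in> carrier Cp" and N: "N = {\<alpha> f | \<alpha>. \<alpha> \<in> mod_hom (opp R) Cp Cp}"
    using cyc cyclic_span unfolding cyclic_submodule_def by auto
  have fh: "f \<in> mod_hom S Cm V" using f by (simp add: Cp_carrier)
  define K where "K = {x \<in> carrier C. f x = \<zero>\<^bsub>V\<^esub>}"
  have K: "submodule K S Cm" using hom_ker_submodule[OF Cm_module V_module fh] by (simp add: K_def)
  define Q where "Q A \<longleftrightarrow> (\<exists>cs. set cs \<subseteq> A \<and> (\<forall>g\<in>carrier Cp. (\<forall>c\<in>set cs. g c = \<zero>\<^bsub>V\<^esub>) \<longrightarrow> (\<forall>x\<in>A. g x = \<zero>\<^bsub>V\<^esub>)))" for A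
  have "noetherian S Cm K"
    by (rule Cm.noetherian_mono[OF endofinite_chain_conditions(1)[OF C_module fin]]) (auto simp: K_def)
  then have "Q K"
  proof (rule Cm.noetherian_submodule_induct[OF _ K])
    show "Q {\<zero>\<^bsub>Cm\<^esub>}"
      unfolding Q_def by (rule exI[of _ "[]"]) (simp add: Cp_hom(4))
  next
    fix A x assume A: "submodule A S Cm" "A \<subseteq> K" and x: "x \<in> K" and "Q A"
    then obtain cs where cs: "set cs \<subseteq> A" "\<And>g y. \<lbrakk>g \<in> carrier Cp; \<forall>c\<in>set cs. g c = \<zero>\<^bsub>V\<^esub>; y \<in> A\<rbrakk> \<Longrightarrow> g y = \<zero>\<^bsub>V\<^esub>"
      unfolding Q_def by blast
    let ?X = "(\<lambda>r. r \<odot>\<^bsub>Cm\<^esub> x) ` carrier S"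
    have xc: "x \<in> carrier C" using x by (simp add: K_def)
    have X: "submodule ?X S Cm"
      by (rule Cm.submodule_smult_image)
        (use left_module.submodule_carrier[OF regular_left_module[OF V.ring_axioms]] xc in simp_all)
    have xX: "x \<in> ?X" using Cm.lsmult_one[of x] xc End_ring_closed(3)[OF C_module]
      by (intro image_eqI[of _ _ "\<one>\<^bsub>S\<^esub>"]) auto
    show "Q (submodule_sum Cm A ?X)"
      unfolding Q_def
    proof (intro exI[of _ "x # cs"] conjI ballI impI)
      show "set (x # cs) \<subseteq> submodule_sum Cm A ?X"
        using cs(1) xX Cm.submodule_sum_left[OF A(1) X] Cm.submodule_sum_right[OF A(1) X] by auto
      fix g y assume g: "g \<in> carrier Cp" "\<forall>c\<in>set (x # cs). g c = \<zero>\<^bsub>V\<^esub>" and "y \<in> submodule_sum Cm A ?X"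
      then obtain a s where as: "a \<in> A" "s \<in> mod_hom R C C" "y = a \<oplus>\<^bsub>C\<^esub> s x"
        unfolding submodule_sum_def by auto
      have "g a = \<zero>\<^bsub>V\<^esub>" by (rule cs(2)[OF g(1) _ as(1)]) (use g(2) in simp)
      moreover have "g (s x) = \<zero>\<^bsub>V\<^esub>" using Cp_hom(3)[OF g(1) as(2) xc] g(2) as(2) by simp
      moreover have "a \<in> carrier C" using submodule_in_carrier[OF A(1) as(1)] by simp
      ultimately show "g y = \<zero>\<^bsub>V\<^esub>" using as(3) Cp_hom(2)[OF g(1)] hom_closed[OF as(2) xc] by simp
    qed
  qed
  then obtain cs where cs: "set cs \<subseteq> K" "\<And>g y. \<lbrakk>g \<in> carrier Cp; \<forall>c\<in>set cs. g c = \<zero>\<^bsub>V\<^esub>; y \<in> K\<rbrakk> \<Longrightarrow> g y = \<zero>\<^bsub>V\<^esub>"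
    unfolding Q_def by blast
  have "N = {g \<in> carrier Cp. \<forall>c\<in>set cs. g c = \<zero>\<^bsub>V\<^esub>}"
  proof
    show "N \<subseteq> {g \<in> carrier Cp. \<forall>c\<in>set cs. g c = \<zero>\<^bsub>V\<^esub>}"
    proof
      fix g assume "g \<in> N"
      then obtain \<alpha> where \<alpha>: "\<alpha> \<in> mod_hom (opp R) Cp Cp" "g = \<alpha> f" unfolding N by blast
      have "g c = \<zero>\<^bsub>V\<^esub>" if "c \<in> set cs" for c
      proof -
        have c: "c \<in> carrier C" "f c = \<zero>\<^bsub>V\<^esub>" using cs(1) that by (auto simp: K_def)
        show ?thesis
          unfolding \<alpha>(2) by (rule evaluation_vanishes[OF \<alpha>(1) f c(1) evaluation_injective[OF f c]])
      qed
      then show "g \<in> {g \<in> carrier Cp. \<forall>c\<in>set cs. g c = \<zero>\<^bsub>V\<^esub>}"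
        using hom_closed[OF \<alpha>(1) f] \<alpha>(2) by simp
    qed
    show "{g \<in> carrier Cp. \<forall>c\<in>set cs. g c = \<zero>\<^bsub>V\<^esub>} \<subseteq> N"
    proof
      fix g assume "g \<in> {g \<in> carrier Cp. \<forall>c\<in>set cs. g c = \<zero>\<^bsub>V\<^esub>}"
      then have g: "g \<in> carrier Cp" and gK: "\<And>y. y \<in> K \<Longrightarrow> g y = \<zero>\<^bsub>V\<^esub>" using cs(2) by auto
      define p where "p = {(f c, g c) | c. c \<in> carrier C}"
      have "partial_hom S V V p"
        unfolding partial_hom_def
      proof (intro conjI allI impI ballI)
        show "p \<subseteq> carrier V \<times> carrier V" using Cp_hom(1)[OF f] Cp_hom(1)[OF g] by (auto simp: p_def)
        show "(\<zero>\<^bsub>V\<^esub>, \<zero>\<^bsub>V\<^esub>) \<in> p"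
          unfolding p_def by (intro CollectI exI[of _ "\<zero>\<^bsub>C\<^esub>"]) (simp add: Cp_hom(4)[OF f] Cp_hom(4)[OF g])
        fix x y x' y' assume "(x, y) \<in> p" "(x', y') \<in> p"
        then obtain c c' where "c \<in> carrier C" "c' \<in> carrier C" "x = f c" "y = g c" "x' = f c'" "y' = g c'"
          by (auto simp: p_def)
        then show "(x \<oplus>\<^bsub>V\<^esub> x', y \<oplus>\<^bsub>V\<^esub> y') \<in> p"
          unfolding p_def by (intro CollectI exI[of _ "c \<oplus>\<^bsub>C\<^esub> c'"]) (simp add: Cp_hom(2)[OF f] Cp_hom(2)[OF g])
      next
        fix s x y assume s: "s \<in> carrier S" and "(x, y) \<in> p"
        then obtain c where c: "c \<in> carrier C" "x = f c" "y = g c" by (auto simp: p_def)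
        have s': "s \<in> mod_hom R C C" using s by simp
        show "(s \<odot>\<^bsub>V\<^esub> x, s \<odot>\<^bsub>V\<^esub> y) \<in> p"
          unfolding p_def using c hom_closed[OF s' c(1)] Cp_hom(3)[OF f s' c(1)] Cp_hom(3)[OF g s' c(1)]
          by (intro CollectI exI[of _ "s c"]) simp
      next
        fix y assume "(\<zero>\<^bsub>V\<^esub>, y) \<in> p"
        then obtain c where c: "c \<in> carrier C" "\<zero>\<^bsub>V\<^esub> = f c" "y = g c" by (auto simp: p_def)
        then show "y = \<zero>\<^bsub>V\<^esub>" using gK[of c] by (simp add: K_def)
      qed
      from baer_extension[OF V_injective V_module V_module S_le this]
      obtain \<theta> where \<theta>: "\<theta> \<in> mod_hom S V V" "\<forall>(b, v)\<in>p. \<theta> b = v" ..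
      have \<theta>f: "\<theta> (f c) = g c" if "c \<in> carrier C" for c using \<theta>(2) that by (auto simp: p_def)
      define \<alpha> where "\<alpha> = (\<lambda>h\<in>carrier Cp. \<lambda>c\<in>carrier C. \<theta> (h c))"
      have \<theta>c: "(\<lambda>c\<in>carrier C. \<theta> (h c)) \<in> carrier Cp" if "h \<in> carrier Cp" for h
        using hom_compose[OF _ \<theta>(1) Cm_module, of h] that by (simp add: Cp_carrier)
      have \<alpha>: "\<alpha> \<in> mod_hom (opp R) Cp Cp"
      proof (rule mod_homI)
        show "\<alpha> \<in> carrier Cp \<rightarrow>\<^sub>E carrier Cp" using \<theta>c by (auto simp: \<alpha>_def)
      next
        fix h h' assume hh: "h \<in> carrier Cp" "h' \<in> carrier Cp"
        have s: "h \<oplus>\<^bsub>Cp\<^esub> h' \<in> carrier Cp" using hh by simp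
        show "\<alpha> (h \<oplus>\<^bsub>Cp\<^esub> h') = \<alpha> h \<oplus>\<^bsub>Cp\<^esub> \<alpha> h'"
        proof (rule Cp_ext)
          show "\<alpha> (h \<oplus>\<^bsub>Cp\<^esub> h') \<in> carrier Cp" "\<alpha> h \<oplus>\<^bsub>Cp\<^esub> \<alpha> h' \<in> carrier Cp"
            using \<theta>c hh s by (simp_all add: \<alpha>_def)
          fix c assume "c \<in> carrier C"
          then show "\<alpha> (h \<oplus>\<^bsub>Cp\<^esub> h') c = (\<alpha> h \<oplus>\<^bsub>Cp\<^esub> \<alpha> h') c"
            using hh s by (simp add: \<alpha>_def hom_add[OF \<theta>(1)] Cp_hom(1))
        qed
      next
        fix r h assume rh: "r \<in> carrier (opp R)" "h \<in> carrier Cp"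
        have s: "r \<odot>\<^bsub>Cp\<^esub> h \<in> carrier Cp" using rh by (rule Cp.lsmult_closed)
        show "\<alpha> (r \<odot>\<^bsub>Cp\<^esub> h) = r \<odot>\<^bsub>Cp\<^esub> \<alpha> h"
        proof (rule Cp_ext)
          show "\<alpha> (r \<odot>\<^bsub>Cp\<^esub> h) \<in> carrier Cp" using \<theta>c s by (simp add: \<alpha>_def)
          show "r \<odot>\<^bsub>Cp\<^esub> \<alpha> h \<in> carrier Cp" using \<theta>c rh by (intro Cp.lsmult_closed) (simp_all add: \<alpha>_def)
          fix c assume "c \<in> carrier C"
          then show "\<alpha> (r \<odot>\<^bsub>Cp\<^esub> h) c = (r \<odot>\<^bsub>Cp\<^esub> \<alpha> h) c"
            using rh s by (simp add: \<alpha>_def C.lsmult_closed)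
        qed
      qed
      have "\<alpha> f = g"
        by (rule Cp_ext[OF hom_closed[OF \<alpha> f] g]) (use f \<theta>f in \<open>simp add: \<alpha>_def\<close>)
      then show "g \<in> N" unfolding N using \<alpha> by blast
    qed
  qed
  moreover have "set cs \<subseteq> carrier C" using cs(1) by (auto simp: K_def)
  ultimately show ?thesis using finite_annihilator_fms[of cs] by simp
qed

end

section \<open>Systems of linear equations\<close>

text \<open>A list of pairs \<open>(r, b)\<close> encodes a linear equation \<open>\<Sum> r h(b) = 0\<close> in unknowns \<open>h(b)\<close>.\<close>

fun lin :: "('r, 'm) module \<Rightarrow> ('r \<times> 'b) list \<Rightarrow> ('b \<Rightarrow> 'm) \<Rightarrow> 'm" where
  "lin M [] h = \<zero>\<^bsub>M\<^esub>"
| "lin M ((r, b) # \<rho>) h = r \<odot>\<^bsub>M\<^esub> h b \<oplus>\<^bsub>M\<^esub> lin M \<rho> h"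

lemma lin_cong:
  assumes "set \<rho> \<subseteq> A \<times> X" "\<And>b. b \<in> X \<Longrightarrow> h b = h' b"
  shows "lin M \<rho> h = lin M \<rho> h'"
  using assms(1)
proof (induction \<rho>)
  case (Cons p \<rho>)
  obtain r b where "p = (r, b)" by fastforce
  then show ?case using Cons assms(2)[of b] by simp
qed simp

context left_module
begin

lemma lin_closed:
  assumes "set \<rho> \<subseteq> carrier R \<times> X" "\<And>b. b \<in> X \<Longrightarrow> h b \<in> carrier M"
  shows "lin M \<rho> h \<in> carrier M"
  using assms(1)
proof (induction \<rho>)
  case (Cons p \<rho>)
  obtain r b where "p = (r, b)" by fastforce
  then show ?case using Cons assms(2)[of b] by (simp add: lsmult_closed)
qed simp

lemma lin_zero:
  assumes "set \<rho> \<subseteq> carrier R \<times> X"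
  shows "lin M \<rho> (\<lambda>_. \<zero>\<^bsub>M\<^esub>) = \<zero>\<^bsub>M\<^esub>"
  using assms
proof (induction \<rho>)
  case (Cons p \<rho>)
  obtain r b where "p = (r, b)" by fastforce
  then show ?case using Cons by simp
qed simp

lemma lin_add:
  assumes \<rho>: "set \<rho> \<subseteq> carrier R \<times> X" and h: "\<And>b. b \<in> X \<Longrightarrow> h b \<in> carrier M" and h': "\<And>b. b \<in> X \<Longrightarrow> h' b \<in> carrier M"
  shows "lin M \<rho> (\<lambda>b. h b \<oplus>\<^bsub>M\<^esub> h' b) = lin M \<rho> h \<oplus>\<^bsub>M\<^esub> lin M \<rho> h'"
  using \<rho>
proof (induction \<rho>)
  case (Cons p \<rho>)
  obtain r b where p: "p = (r, b)" by fastforce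
  have "set \<rho> \<subseteq> carrier R \<times> X" "r \<in> carrier R" "h b \<in> carrier M" "h' b \<in> carrier M"
    using Cons(2) p h h' by auto
  then show ?case
    using Cons(1) p lin_closed[of \<rho> X h] lin_closed[of \<rho> X h'] h h'
    by (simp add: lsmult_r_distr add_add_swap lsmult_closed)
qed simp

end

lemma lin_hom:
  assumes M: "left_module R M" and N: "left_module R N" and f: "f \<in> mod_hom R M N"
    and \<rho>: "set \<rho> \<subseteq> carrier R \<times> X" and h: "\<And>b. b \<in> X \<Longrightarrow> h b \<in> carrier M"
  shows "f (lin M \<rho> h) = lin N \<rho> (\<lambda>b. f (h b))"
  using \<rho>
proof (induction \<rho>)
  case Nil
  show ?case by (simp add: hom_zero[OF M N f])
next
  case (Cons p \<rho>)
  obtain r b where p: "p = (r, b)" by fastforce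
  have *: "set \<rho> \<subseteq> carrier R \<times> X" "r \<in> carrier R" "h b \<in> carrier M" using Cons(2) p h by auto
  have "r \<odot>\<^bsub>M\<^esub> h b \<in> carrier M" by (rule left_module.lsmult_closed[OF M *(2,3)])
  then show ?case
    using Cons(1)[OF *(1)] p left_module.lin_closed[OF M *(1) h] * by (simp add: hom_add[OF f] hom_smult[OF f])
qed

lemma (in left_module) lin_a_inv:
  assumes \<rho>: "set \<rho> \<subseteq> carrier R \<times> X" and h: "\<And>b. b \<in> X \<Longrightarrow> h b \<in> carrier M"
  shows "lin M \<rho> (\<lambda>b. \<ominus>\<^bsub>M\<^esub> h b) = \<ominus>\<^bsub>M\<^esub> lin M \<rho> h"
proof (rule M.minus_equality[symmetric])
  have "lin M \<rho> (\<lambda>b. \<ominus>\<^bsub>M\<^esub> h b) \<oplus>\<^bsub>M\<^esub> lin M \<rho> h = lin M \<rho> (\<lambda>b. \<ominus>\<^bsub>M\<^esub> h b \<oplus>\<^bsub>M\<^esub> h b)"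
    by (rule lin_add[OF \<rho> _ h, symmetric]) (simp add: h)
  also have "\<dots> = lin M \<rho> (\<lambda>_. \<zero>\<^bsub>M\<^esub>)" by (rule lin_cong[OF \<rho>]) (simp add: h M.l_neg)
  finally show "lin M \<rho> (\<lambda>b. \<ominus>\<^bsub>M\<^esub> h b) \<oplus>\<^bsub>M\<^esub> lin M \<rho> h = \<zero>\<^bsub>M\<^esub>" using lin_zero[OF \<rho>] by simp
qed (use lin_closed[OF \<rho>] h in auto)

lemma lin_direct_sum_apply: "i \<in> I \<Longrightarrow> lin (direct_sum_module I (\<lambda>_. C)) \<rho> h i = lin C \<rho> (\<lambda>b. h b i)"
proof (induction \<rho>)
  case (Cons p \<rho>)
  obtain r b where "p = (r, b)" by fastforce
  then show ?case using Cons by simp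
qed simp

text \<open>
  For given values of some of the unknowns and a further unknown \<open>b\<close>, the possible
  values of \<open>b\<close> in the solutions of a finite subsystem form a coset of \<open>X\<^sup>(\<^sup>I\<^sup>)\<close> with an
  \<open>S\<close>-submodule \<open>X\<close> of \<open>C\<close>. If \<open>X\<close> is minimal, then these values work for all finite subsystems.
\<close>

lemma algebraically_compact:
  fixes C :: "('r, 'c) module" and I :: "'i set" and X :: "'b set"
  assumes C: "left_module R C" and art: "artinian (End_ring R C) (End_module C) (carrier C)"
    and \<R>: "\<And>\<rho>. \<rho> \<in> \<R> \<Longrightarrow> set \<rho> \<subseteq> carrier R \<times> X"
    and sol: "\<And>E. \<lbrakk>finite E; E \<subseteq> \<R>\<rbrakk> \<Longrightarrow> \<exists>h\<in>X \<rightarrow> carrier (direct_sum_module I (\<lambda>_. C)).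
      (\<forall>\<rho>\<in>E. lin (direct_sum_module I (\<lambda>_. C)) \<rho> h = \<zero>\<^bsub>direct_sum_module I (\<lambda>_. C)\<^esub>) \<and> (\<forall>(b, y)\<in>p0. h b = y)"
  shows "\<exists>h\<in>X \<rightarrow> carrier (direct_sum_module I (\<lambda>_. C)).
      (\<forall>\<rho>\<in>\<R>. lin (direct_sum_module I (\<lambda>_. C)) \<rho> h = \<zero>\<^bsub>direct_sum_module I (\<lambda>_. C)\<^esub>) \<and> (\<forall>(b, y)\<in>p0. h b = y)"
proof -
  note direct_sum_apply [simp del]
  let ?M = "direct_sum_module I (\<lambda>_. C)" and ?S = "End_ring R C" and ?Cm = "End_module C"
  interpret C: left_module R C by (rule C)
  have M: "left_module R ?M" by (rule direct_sum_left_module[OF C.ring_axioms C])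
  interpret M: left_module R ?M by (rule M)
  have Cm: "left_module ?S ?Cm" by (rule End_module_left_module[OF C])
  interpret Cm: left_module ?S ?Cm by (rule Cm)
  define Z where "Z E p = {h \<in> X \<rightarrow> carrier ?M. (\<forall>\<rho>\<in>E. lin ?M \<rho> h = \<zero>\<^bsub>?M\<^esub>) \<and> (\<forall>(b, y)\<in>p. h b = y)}" for E p
  define good where "good p \<longleftrightarrow> (\<forall>E. finite E \<longrightarrow> E \<subseteq> \<R> \<longrightarrow> Z E p \<noteq> {})" for p
  have ZD: "h b \<in> carrier ?M" "\<rho> \<in> E \<Longrightarrow> lin ?M \<rho> h = \<zero>\<^bsub>?M\<^esub>" "(b', y) \<in> p \<Longrightarrow> h b' = y"
    if "h \<in> Z E p" "b \<in> X" for h E p b \<rho> b' y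
    using that by (auto simp: Z_def)
  have ZI: "h \<in> Z E p" if "\<And>b. b \<in> X \<Longrightarrow> h b \<in> carrier ?M" "\<And>\<rho>. \<rho> \<in> E \<Longrightarrow> lin ?M \<rho> h = \<zero>\<^bsub>?M\<^esub>"
    "\<And>b y. (b, y) \<in> p \<Longrightarrow> h b = y" for h E p
    using that by (auto simp: Z_def)
  have goodD: "\<exists>h. h \<in> Z E p" if "good p" "finite E" "E \<subseteq> \<R>" for p E
    using that unfolding good_def by blast
  \<comment> \<open>Partial assignments that extend p0 and can be completed for each finite
    subsystem. The equations only involve unknowns in X, so p0 is cut down to X here and restored at
    the end.\<close>
  define \<P> where "\<P> = {p. p \<subseteq> X \<times> UNIV \<and> p0 \<inter> (X \<times> UNIV) \<subseteq> p \<and> good p}"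
  have fun_p: "y = y'" if p: "good p" "(b, y) \<in> p" "(b, y') \<in> p" for p b y y'
  proof -
    obtain h where "h \<in> Z {} p" using goodD[OF p(1), of "{}"] by auto
    then have h: "\<forall>(b, y)\<in>p. h b = y" by (simp add: Z_def)
    show ?thesis using bspec[OF h p(2)] bspec[OF h p(3)] by simp
  qed
  have "\<exists>p\<in>\<P>. \<forall>q\<in>\<P>. p \<subseteq> q \<longrightarrow> q = p"
  proof (rule subset_Zorn_nonempty)
    have "good (p0 \<inter> (X \<times> UNIV))"
      unfolding good_def
    proof (intro allI impI)
      fix E assume E: "finite E" "E \<subseteq> \<R>"
      obtain h where "h \<in> X \<rightarrow> carrier ?M" "(\<forall>\<rho>\<in>E. lin ?M \<rho> h = \<zero>\<^bsub>?M\<^esub>) \<and> (\<forall>(b, y)\<in>p0. h b = y)"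
        using sol[OF E] by blast
      then have "h \<in> Z E (p0 \<inter> (X \<times> UNIV))" by (auto simp: Z_def)
      then show "Z E (p0 \<inter> (X \<times> UNIV)) \<noteq> {}" by blast
    qed
    then show "\<P> \<noteq> {}" by (auto simp: \<P>_def)
    fix \<C> assume Cn: "\<C> \<noteq> {}" and Cc: "subset.chain \<P> \<C>"
    have CP: "p \<subseteq> X \<times> UNIV" "p0 \<inter> (X \<times> UNIV) \<subseteq> p" "good p" if "p \<in> \<C>" for p
    proof -
      have "p \<in> \<P>" using Cc that unfolding subset_chain_def by auto
      then show "p \<subseteq> X \<times> UNIV" "p0 \<inter> (X \<times> UNIV) \<subseteq> p" "good p" by (simp_all add: \<P>_def)
    qed
    have unique: "y = y'" if "(b, y) \<in> \<Union>\<C>" "(b, y') \<in> \<Union>\<C>" for b y y'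
    proof -
      have "finite {(b, y), (b, y')}" by (intro finite.intros)
      moreover have "{(b, y), (b, y')} \<subseteq> \<Union>\<C>" using that by blast
      ultimately obtain p where "p \<in> \<C>" "{(b, y), (b, y')} \<subseteq> p"
        by (rule finite_subset_Union_chain[OF _ _ Cn Cc])
      then show ?thesis using fun_p CP(3) by blast
    qed
    have "good (\<Union>\<C>)"
      unfolding good_def
    proof (intro allI impI)
      fix E assume E: "finite E" "E \<subseteq> \<R>"
      \<comment> \<open>Only the finitely many unknowns of E matter, and the values that the chain
        assigns to them already belong to one member of the chain.\<close>
      define W where "W = (\<Union>\<rho>\<in>E. snd ` set \<rho>)"
      have W: "finite W" using E(1) by (simp add: W_def)
      define D where "D = {(b, y) \<in> \<Union>\<C>. b \<in> W}"
      have "inj_on fst D"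
      proof (rule inj_onI)
        fix u v assume "u \<in> D" "v \<in> D" "fst u = fst v"
        then have "(fst u, snd u) \<in> \<Union>\<C>" "(fst u, snd v) \<in> \<Union>\<C>" by (auto simp: D_def)
        from unique[OF this] show "u = v" using \<open>fst u = fst v\<close> by (rule prod_eqI[rotated])
      qed
      moreover have "fst ` D \<subseteq> W" by (auto simp: D_def)
      ultimately have "finite D" using W by (meson finite_imageD finite_subset)
      moreover have "D \<subseteq> \<Union>\<C>" by (auto simp: D_def)
      ultimately obtain p where p: "p \<in> \<C>" "D \<subseteq> p" by (rule finite_subset_Union_chain[OF _ _ Cn Cc])
      obtain h where h: "h \<in> Z E p" using goodD[OF CP(3)[OF p(1)] E] ..
      define h' where "h' b = (if \<exists>y. (b, y) \<in> \<Union>\<C> then THE y. (b, y) \<in> \<Union>\<C> else h b)" for b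
      have h'U: "h' b = y" if "(b, y) \<in> \<Union>\<C>" for b y
      proof -
        have "(THE y. (b, y) \<in> \<Union>\<C>) = y" by (rule the_equality, rule that, rule unique[OF _ that])
        then show ?thesis using that by (auto simp: h'_def)
      qed
      have h'W: "h' b = h b" if "b \<in> W" for b
      proof (cases "\<exists>y. (b, y) \<in> \<Union>\<C>")
        case True
        then obtain y where y: "(b, y) \<in> \<Union>\<C>" by blast
        then have "(b, y) \<in> p" using p(2) that by (auto simp: D_def)
        then show ?thesis using h h'U[OF y] by (auto simp: Z_def)
      qed (simp add: h'_def)
      have "h' b \<in> carrier ?M" if b: "b \<in> X" for b
      proof (cases "\<exists>y. (b, y) \<in> \<Union>\<C>")
        case True
        then obtain y q where y: "(b, y) \<in> q" "q \<in> \<C>" by blast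
        obtain k where k: "k \<in> Z {} q" using goodD[OF CP(3)[OF y(2)], of "{}"] by auto
        have "h' b = k b" using h'U[of b y] y ZD(3)[OF k b y(1)] by auto
        then show ?thesis using ZD(1)[OF k b] by simp
      next
        case False
        then show ?thesis using ZD(1)[OF h b] by (simp add: h'_def)
      qed
      moreover have "lin ?M \<rho> h' = \<zero>\<^bsub>?M\<^esub>" if "\<rho> \<in> E" for \<rho>
      proof -
        have "set \<rho> \<subseteq> UNIV \<times> W" using that by (force simp: W_def)
        then have "lin ?M \<rho> h' = lin ?M \<rho> h" by (rule lin_cong) (rule h'W)
        then show ?thesis using h that by (auto simp: Z_def)
      qed
      ultimately have "h' \<in> Z E (\<Union>\<C>)" by (rule ZI[OF _ _ h'U])
      then show "Z E (\<Union>\<C>) \<noteq> {}" by blast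
    qed
    moreover have "\<Union>\<C> \<subseteq> X \<times> UNIV" using CP(1) by blast
    moreover have "p0 \<inter> (X \<times> UNIV) \<subseteq> \<Union>\<C>" using CP(2) Cn by blast
    ultimately show "\<Union>\<C> \<in> \<P>" by (simp add: \<P>_def)
  qed
  then obtain p where pP: "p \<in> \<P>" and max: "\<forall>q\<in>\<P>. p \<subseteq> q \<longrightarrow> q = p" ..
  then have p: "p \<subseteq> X \<times> UNIV" "p0 \<inter> (X \<times> UNIV) \<subseteq> p" "good p" by (auto simp: \<P>_def)
  have total: "\<exists>y. (b, y) \<in> p" if b: "b \<in> X" for b
  proof -
    \<comment> \<open>The homogeneous system over C, with zero for the unknowns already assigned; V
      E consists of the possible values at b.\<close>
    define H where "H E = {h \<in> X \<rightarrow> carrier C. (\<forall>\<rho>\<in>E. lin C \<rho> h = \<zero>\<^bsub>C\<^esub>) \<and> (\<forall>(b, y)\<in>p. h b = \<zero>\<^bsub>C\<^esub>)}" for E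
    define V where "V E = {h b | h. h \<in> H E}" for E
    have HI: "h \<in> H E" if "\<And>b. b \<in> X \<Longrightarrow> h b \<in> carrier C" "\<And>\<rho>. \<rho> \<in> E \<Longrightarrow> lin C \<rho> h = \<zero>\<^bsub>C\<^esub>"
      "\<And>b y. (b, y) \<in> p \<Longrightarrow> h b = \<zero>\<^bsub>C\<^esub>" for h E
      using that by (auto simp: H_def)
    have HD: "\<And>b. b \<in> X \<Longrightarrow> h b \<in> carrier C" "\<And>\<rho>. \<rho> \<in> E \<Longrightarrow> lin C \<rho> h = \<zero>\<^bsub>C\<^esub>"
      "\<And>b y. (b, y) \<in> p \<Longrightarrow> h b = \<zero>\<^bsub>C\<^esub>" if "h \<in> H E" for h E
      using that by (auto simp: H_def)
    have VS: "submodule (V E) ?S ?Cm" if E: "E \<subseteq> \<R>" for E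
    proof (rule Cm.submoduleI)
      show "V E \<subseteq> carrier ?Cm" using HD(1) b by (auto simp: V_def)
      have "(\<lambda>_. \<zero>\<^bsub>C\<^esub>) \<in> H E" by (rule HI) (use E C.lin_zero[OF \<R>] in auto)
      then show "\<zero>\<^bsub>?Cm\<^esub> \<in> V E" unfolding V_def by auto
    next
      fix x y assume "x \<in> V E" "y \<in> V E"
      then obtain h k where hk: "h \<in> H E" "k \<in> H E" "x = h b" "y = k b" unfolding V_def by blast
      have "(\<lambda>b. h b \<oplus>\<^bsub>C\<^esub> k b) \<in> H E"
      proof (rule HI)
        fix \<rho> assume \<rho>: "\<rho> \<in> E"
        then have "lin C \<rho> (\<lambda>b. h b \<oplus>\<^bsub>C\<^esub> k b) = lin C \<rho> h \<oplus>\<^bsub>C\<^esub> lin C \<rho> k"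
          using E by (intro C.lin_add[OF \<R>] HD(1)[OF hk(1)] HD(1)[OF hk(2)]) auto
        then show "lin C \<rho> (\<lambda>b. h b \<oplus>\<^bsub>C\<^esub> k b) = \<zero>\<^bsub>C\<^esub>" using HD(2)[OF hk(1) \<rho>] HD(2)[OF hk(2) \<rho>] by simp
      qed (use HD[OF hk(1)] HD[OF hk(2)] in simp_all)
      then show "x \<oplus>\<^bsub>?Cm\<^esub> y \<in> V E" unfolding V_def hk by auto
    next
      fix s x assume s: "s \<in> carrier ?S" and "x \<in> V E"
      then obtain h where h: "h \<in> H E" "x = h b" unfolding V_def by blast
      have s': "s \<in> mod_hom R C C" using s by simp
      have "(\<lambda>b. s (h b)) \<in> H E"
      proof (rule HI)
        fix \<rho> assume \<rho>: "\<rho> \<in> E"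
        then have "s (lin C \<rho> h) = lin C \<rho> (\<lambda>b. s (h b))"
          using E by (intro lin_hom[OF C C s' \<R>] HD(1)[OF h(1)]) auto
        then show "lin C \<rho> (\<lambda>b. s (h b)) = \<zero>\<^bsub>C\<^esub>" using HD(2)[OF h(1) \<rho>] hom_zero[OF C C s'] by simp
      qed (use HD[OF h(1)] hom_closed[OF s'] hom_zero[OF C C s'] in simp_all)
      then show "s \<odot>\<^bsub>?Cm\<^esub> x \<in> V E" unfolding V_def h by auto
    qed
    define \<E> where "\<E> = {V E | E. finite E \<and> E \<subseteq> \<R>}"
    have "\<exists>Y\<in>\<E>. \<forall>Y'\<in>\<E>. Y' \<subseteq> Y \<longrightarrow> Y' = Y"
    proof (rule Cm.artinian_minimal)
      show "artinian ?S ?Cm (carrier C)" by (rule art)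
      show "\<E> \<noteq> {}" by (auto simp: \<E>_def)
      show "submodule Y ?S ?Cm \<and> Y \<subseteq> carrier C" if "Y \<in> \<E>" for Y
        using that VS submodule_subset[of Y ?S ?Cm] by (auto simp: \<E>_def)
    qed
    then obtain Y where YE: "Y \<in> \<E>" and Ymin: "\<forall>Y'\<in>\<E>. Y' \<subseteq> Y \<longrightarrow> Y' = Y" ..
    obtain E0 where E0: "finite E0" "E0 \<subseteq> \<R>" "Y = V E0" using YE unfolding \<E>_def by blast
    have Veq: "V (E \<union> E0) = V E0" if "finite E" "E \<subseteq> \<R>" for E
    proof -
      have "H (E \<union> E0) \<subseteq> H E0" by (auto simp: H_def)
      then have "V (E \<union> E0) \<subseteq> Y" unfolding E0(3) V_def by blast
      moreover have "V (E \<union> E0) \<in> \<E>" unfolding \<E>_def using that E0 by blast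
      ultimately show ?thesis using Ymin E0(3) by simp
    qed
    obtain h0 where h0: "h0 \<in> Z E0 p" using goodD[OF p(3) E0(1,2)] ..
    \<comment> \<open>The value of h0 at b works for every E. Let h1 be a solution for E \<union>
      E0. Each component of h0 b - h1 b lies in V E0 = V (E \<union> E0), so it is the value at b of
      a homogeneous solution for E \<union> E0, and these corrections are added to h1.\<close>
    have "good (insert (b, h0 b) p)"
      unfolding good_def
    proof (intro allI impI)
      fix E assume E: "finite E" "E \<subseteq> \<R>"
      have EE: "finite (E \<union> E0)" "E \<union> E0 \<subseteq> \<R>" using E E0 by auto
      obtain h1 where h1: "h1 \<in> Z (E \<union> E0) p" using goodD[OF p(3) EE] ..
      have h1c: "h1 b' \<in> carrier ?M" and h0c: "h0 b' \<in> carrier ?M" if "b' \<in> X" for b'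
        using ZD(1)[OF h1 that] ZD(1)[OF h0 that] .
      define d where "d b' = h0 b' \<oplus>\<^bsub>?M\<^esub> \<ominus>\<^bsub>?M\<^esub> h1 b'" for b'
      have dM: "d b' \<in> carrier ?M" if "b' \<in> X" for b' unfolding d_def using h0c[OF that] h1c[OF that] by simp
      have dl: "lin ?M \<rho> d = \<zero>\<^bsub>?M\<^esub>" if \<rho>: "\<rho> \<in> E0" for \<rho>
      proof -
        have r: "set \<rho> \<subseteq> carrier R \<times> X" using \<rho> E0 \<R> by blast
        have "lin ?M \<rho> d = lin ?M \<rho> h0 \<oplus>\<^bsub>?M\<^esub> lin ?M \<rho> (\<lambda>b. \<ominus>\<^bsub>?M\<^esub> h1 b)"
          unfolding d_def by (rule M.lin_add[OF r h0c]) (simp_all add: h1c)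
        also have "\<dots> = lin ?M \<rho> h0 \<oplus>\<^bsub>?M\<^esub> \<ominus>\<^bsub>?M\<^esub> lin ?M \<rho> h1" using M.lin_a_inv[OF r h1c] by simp
        also have "\<dots> = \<zero>\<^bsub>?M\<^esub>" using ZD(2)[OF h0 b \<rho>] ZD(2)[OF h1 b, of \<rho>] \<rho> by (simp add: M.M.r_neg)
        finally show ?thesis .
      qed
      have dp: "d b' = \<zero>\<^bsub>?M\<^esub>" if "(b', y) \<in> p" for b' y
      proof -
        have "b' \<in> X" using that p(1) by auto
        then show ?thesis using ZD(3)[OF h0 b that] ZD(3)[OF h1 b that] M.M.r_neg[OF h1c[of b']] by (simp add: d_def)
      qed
      have dC: "d b' i \<in> carrier C" if "b' \<in> X" "i \<in> I" for b' i
        using dM[OF that(1)] product_in_carrier[of "d b'" I "\<lambda>_. C"] that(2) by (simp add: direct_sum_carrier)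
      have "d b i \<in> V (E \<union> E0)" if i: "i \<in> I" for i
      proof -
        have "(\<lambda>b'. d b' i) \<in> H E0"
        proof (rule HI)
          show "lin C \<rho> (\<lambda>b'. d b' i) = \<zero>\<^bsub>C\<^esub>" if "\<rho> \<in> E0" for \<rho>
            using fun_cong[OF dl[OF that], of i] lin_direct_sum_apply[OF i, of C \<rho> d] i by (simp add: direct_sum_apply)
          show "d b' i = \<zero>\<^bsub>C\<^esub>" if "(b', y) \<in> p" for b' y using dp[OF that] i by (simp add: direct_sum_apply)
        qed (rule dC[OF _ i])
        then have "d b i \<in> V E0" unfolding V_def by (intro CollectI exI[of _ "\<lambda>b'. d b' i"]) simp
        then show ?thesis using Veq[OF E] by simp
      qed
      then have "\<forall>i\<in>I. \<exists>k. k \<in> H (E \<union> E0) \<and> d b i = k b" unfolding V_def by blast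
      then obtain k0 where k0: "\<forall>i\<in>I. k0 i \<in> H (E \<union> E0) \<and> d b i = k0 i b" unfolding bchoice_iff ..
      \<comment> \<open>Taking the zero solution in every component where d b vanishes keeps the
        support finite, so that k has values in the direct sum.\<close>
      define k where "k b' = (\<lambda>i\<in>I. if d b i = \<zero>\<^bsub>C\<^esub> then \<zero>\<^bsub>C\<^esub> else k0 i b')" for b'
      have k0c: "k0 i b' \<in> carrier C" if "i \<in> I" "b' \<in> X" for i b' using k0 HD(1) that by blast
      have kM: "k b' \<in> carrier ?M" if "b' \<in> X" for b'
      proof -
        have "finite {i \<in> I. d b i \<noteq> \<zero>\<^bsub>C\<^esub>}" using dM[OF b] by (simp add: direct_sum_carrier)
        then have "finite {i \<in> I. k b' i \<noteq> \<zero>\<^bsub>C\<^esub>}" by (rule rev_finite_subset) (auto simp: k_def)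
        then show ?thesis using k0c that by (simp add: direct_sum_carrier product_carrier k_def)
      qed
      have kl: "lin ?M \<rho> k = \<zero>\<^bsub>?M\<^esub>" if \<rho>: "\<rho> \<in> E \<union> E0" for \<rho>
      proof -
        have r: "set \<rho> \<subseteq> carrier R \<times> X" using \<rho> EE \<R> by blast
        have "lin ?M \<rho> k \<in> carrier ?M" by (rule M.lin_closed[OF r kM])
        then have c: "lin ?M \<rho> k \<in> carrier (product_module I (\<lambda>_. C))" by (simp add: direct_sum_carrier)
        have z: "\<zero>\<^bsub>?M\<^esub> \<in> carrier (product_module I (\<lambda>_. C))"
          using M.M.zero_closed unfolding direct_sum_carrier by blast
        show ?thesis
        proof (rule product_ext[OF c z])
          fix i assume i: "i \<in> I"
          have "lin C \<rho> (\<lambda>b. k b i) = \<zero>\<^bsub>C\<^esub>"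
          proof (cases "d b i = \<zero>\<^bsub>C\<^esub>")
            case True
            then show ?thesis using i C.lin_zero[OF r] by (simp add: k_def)
          next
            case False
            then show ?thesis using i k0 HD(2)[of "k0 i" "E \<union> E0", OF _ \<rho>] by (simp add: k_def)
          qed
          then show "lin ?M \<rho> k i = \<zero>\<^bsub>?M\<^esub> i" using lin_direct_sum_apply[OF i, of C \<rho> k] i by (simp add: direct_sum_apply)
        qed
      qed
      have kp: "k b' = \<zero>\<^bsub>?M\<^esub>" if "(b', y) \<in> p" for b' y
      proof -
        have "k0 i b' = \<zero>\<^bsub>C\<^esub>" if "i \<in> I" for i using k0 HD(3) \<open>(b', y) \<in> p\<close> that by blast
        then show ?thesis by (auto simp: k_def product_module_def direct_sum_apply intro!: restrict_ext)
      qed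
      have kb: "k b = d b"
      proof -
        have c: "k b \<in> carrier (product_module I (\<lambda>_. C))" "d b \<in> carrier (product_module I (\<lambda>_. C))"
          using kM[OF b] dM[OF b] by (simp_all add: direct_sum_carrier)
        show ?thesis by (rule product_ext[OF c]) (use k0 in \<open>simp add: k_def\<close>)
      qed
      define h where "h b' = h1 b' \<oplus>\<^bsub>?M\<^esub> k b'" for b'
      have "h b' \<in> carrier ?M" if "b' \<in> X" for b' unfolding h_def using h1c[OF that] kM[OF that] by simp
      moreover have "lin ?M \<rho> h = \<zero>\<^bsub>?M\<^esub>" if \<rho>: "\<rho> \<in> E" for \<rho>
      proof -
        have r: "set \<rho> \<subseteq> carrier R \<times> X" using \<rho> E \<R> by blast
        have "lin ?M \<rho> h = lin ?M \<rho> h1 \<oplus>\<^bsub>?M\<^esub> lin ?M \<rho> k" unfolding h_def by (rule M.lin_add[OF r h1c kM])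
        then show ?thesis using ZD(2)[OF h1 b, of \<rho>] kl[of \<rho>] \<rho> by simp
      qed
      moreover have "h b' = y" if "(b', y) \<in> p" for b' y
      proof -
        have "b' \<in> X" using that p(1) by auto
        then show ?thesis using ZD(3)[OF h1 b that] kp[OF that] h1c[of b'] by (simp add: h_def)
      qed
      moreover have hb: "h b = h0 b"
      proof -
        have "h b = h1 b \<oplus>\<^bsub>?M\<^esub> (h0 b \<oplus>\<^bsub>?M\<^esub> \<ominus>\<^bsub>?M\<^esub> h1 b)" unfolding h_def kb d_def ..
        also have "\<dots> = (h0 b \<ominus>\<^bsub>?M\<^esub> h1 b) \<oplus>\<^bsub>?M\<^esub> h1 b"
          unfolding a_minus_def by (rule M.M.a_comm) (use h0c[OF b] h1c[OF b] in simp_all)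
        also have "\<dots> = h0 b" by (rule M.add_minus_cancel(3)[OF h0c[OF b] h1c[OF b]])
        finally show ?thesis .
      qed
      ultimately have "h \<in> Z E (insert (b, h0 b) p)" by (intro ZI) auto
      then show "Z E (insert (b, h0 b) p) \<noteq> {}" by blast
    qed
    then have "insert (b, h0 b) p \<in> \<P>" using p b by (auto simp: \<P>_def)
    then have "insert (b, h0 b) p = p" using max by blast
    then show ?thesis by blast
  qed
  define h where "h b = (SOME y. (b, y) \<in> p)" for b
  have hp: "(b, h b) \<in> p" if "b \<in> X" for b using someI_ex[OF total[OF that]] by (simp add: h_def)
  have agree: "k b = h b" if "k \<in> Z E p" "b \<in> X" for k E b
    using ZD(3)[OF that(1,2) hp[OF that(2)]] .
  have "h b \<in> carrier ?M" if b: "b \<in> X" for b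
  proof -
    obtain k where k: "k \<in> Z {} p" using goodD[OF p(3), of "{}"] by auto
    show ?thesis using ZD(1)[OF k b] agree[OF k b] by simp
  qed
  moreover have "lin ?M \<rho> h = \<zero>\<^bsub>?M\<^esub>" if \<rho>: "\<rho> \<in> \<R>" for \<rho>
  proof -
    obtain k where k: "k \<in> Z {\<rho>} p" using goodD[OF p(3), of "{\<rho>}"] \<rho> by auto
    have "lin ?M \<rho> h = lin ?M \<rho> k" by (rule lin_cong[OF \<R>[OF \<rho>]]) (rule agree[OF k, symmetric])
    then show ?thesis using k by (simp add: Z_def)
  qed
  \<comment> \<open>Outside of X the values prescribed by p0 are restored. A solution for the empty
    subsystem provides them.\<close>
  moreover have "\<exists>h'. (\<forall>b\<in>X. h' b = h b) \<and> (\<forall>(b, y)\<in>p0. h' b = y)"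
  proof -
    obtain k where k: "k \<in> X \<rightarrow> carrier ?M" "\<forall>(b, y)\<in>p0. k b = y" using sol[of "{}"] by auto
    have "h b = y" if "(b, y) \<in> p0" "b \<in> X" for b y
      using fun_p[OF p(3) hp[OF that(2)]] p(2) that by blast
    then show ?thesis using k(2) by (intro exI[of _ "\<lambda>b. if b \<in> X then h b else k b"]) auto
  qed
  then obtain h' where h': "\<And>b. b \<in> X \<Longrightarrow> h' b = h b" "\<forall>(b, y)\<in>p0. h' b = y" by blast
  moreover have "lin ?M \<rho> h' = lin ?M \<rho> h" if "\<rho> \<in> \<R>" for \<rho>
    by (rule lin_cong[OF \<R>[OF that] h'(1)])
  ultimately show ?thesis by (intro bexI[of _ h']) auto
qed

text \<open>The left sides of the equations when the unknowns in Y are zero and the others are free.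
  For the regular module this is the right submodule of R^n generated by the columns of the unknowns
  outside of Y.\<close>

definition lin_values :: "('r, 'm) module \<Rightarrow> (nat \<Rightarrow> ('r \<times> 'b) list) \<Rightarrow> nat \<Rightarrow> 'b set \<Rightarrow> (nat \<Rightarrow> 'm) set" where
  "lin_values M e n Y = {(\<lambda>k\<in>{..<n}. lin M (e k) \<kappa>) | \<kappa>. (\<forall>b. \<kappa> b \<in> carrier M) \<and> (\<forall>b\<in>Y. \<kappa> b = \<zero>\<^bsub>M\<^esub>)}"

lemma lin_valuesI:
  assumes "\<And>b. \<kappa> b \<in> carrier M" "\<And>b. b \<in> Y \<Longrightarrow> \<kappa> b = \<zero>\<^bsub>M\<^esub>"
  shows "(\<lambda>k\<in>{..<n}. lin M (e k) \<kappa>) \<in> lin_values M e n Y"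
  unfolding lin_values_def using assms by blast

lemma lin_valuesE:
  assumes "t \<in> lin_values M e n Y"
  obtains \<kappa> where "t = (\<lambda>k\<in>{..<n}. lin M (e k) \<kappa>)" "\<And>b. \<kappa> b \<in> carrier M" "\<And>b. b \<in> Y \<Longrightarrow> \<kappa> b = \<zero>\<^bsub>M\<^esub>"
  using assms unfolding lin_values_def by blast

lemma lin_values_hom:
  assumes M: "left_module R M" and N: "left_module R N" and f: "f \<in> mod_hom R M N"
    and e: "\<forall>k<n. set (e k) \<subseteq> carrier R \<times> UNIV" and t: "t \<in> lin_values M e n Y"
  shows "(\<lambda>k\<in>{..<n}. f (t k)) \<in> lin_values N e n Y"
proof -
  obtain \<kappa> where t: "t = (\<lambda>k\<in>{..<n}. lin M (e k) \<kappa>)" and \<kappa>: "\<And>b. \<kappa> b \<in> carrier M" "\<And>b. b \<in> Y \<Longrightarrow> \<kappa> b = \<zero>\<^bsub>M\<^esub>"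
    by (rule lin_valuesE[OF t]) (rule that)
  have "(\<lambda>k\<in>{..<n}. f (t k)) = (\<lambda>k\<in>{..<n}. lin N (e k) (\<lambda>b. f (\<kappa> b)))"
    by (rule restrict_ext) (simp add: t lin_hom[OF M N f e[rule_format] \<kappa>(1)])
  moreover have "\<dots> \<in> lin_values N e n Y"
    by (rule lin_valuesI) (use hom_closed[OF f] \<kappa> hom_zero[OF M N f] in auto)
  ultimately show ?thesis by simp
qed

context left_module
begin

lemma lin_values_carrier:
  assumes e: "\<forall>k<n. set (e k) \<subseteq> carrier R \<times> UNIV" and t: "t \<in> lin_values M e n Y"
  shows "t \<in> carrier (product_module {..<n} (\<lambda>_. M))"
proof -
  obtain \<kappa> where t: "t = (\<lambda>k\<in>{..<n}. lin M (e k) \<kappa>)" and \<kappa>: "\<And>b. \<kappa> b \<in> carrier M"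
    by (rule lin_valuesE[OF t]) (rule that)
  show ?thesis unfolding t by (simp add: product_carrier lin_closed[OF e[rule_format] \<kappa>])
qed

lemma lin_values_zero:
  assumes e: "\<forall>k<n. set (e k) \<subseteq> carrier R \<times> UNIV"
  shows "\<zero>\<^bsub>product_module {..<n} (\<lambda>_. M)\<^esub> \<in> lin_values M e n Y"
proof -
  have "(\<lambda>k\<in>{..<n}. lin M (e k) (\<lambda>_. \<zero>\<^bsub>M\<^esub>)) \<in> lin_values M e n Y" by (rule lin_valuesI) auto
  moreover have "(\<lambda>k\<in>{..<n}. lin M (e k) (\<lambda>_. \<zero>\<^bsub>M\<^esub>)) = \<zero>\<^bsub>product_module {..<n} (\<lambda>_. M)\<^esub>"
    by (auto simp: product_module_def lin_zero[OF e[rule_format]] intro!: restrict_ext)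
  ultimately show ?thesis by simp
qed

lemma lin_values_add:
  assumes e: "\<forall>k<n. set (e k) \<subseteq> carrier R \<times> UNIV" and t: "t \<in> lin_values M e n Y" and s: "s \<in> lin_values M e n Y"
  shows "t \<oplus>\<^bsub>product_module {..<n} (\<lambda>_. M)\<^esub> s \<in> lin_values M e n Y"
proof -
  obtain \<kappa> where t: "t = (\<lambda>k\<in>{..<n}. lin M (e k) \<kappa>)" and \<kappa>: "\<And>b. \<kappa> b \<in> carrier M" "\<And>b. b \<in> Y \<Longrightarrow> \<kappa> b = \<zero>\<^bsub>M\<^esub>"
    by (rule lin_valuesE[OF t]) (rule that)
  obtain \<mu> where s: "s = (\<lambda>k\<in>{..<n}. lin M (e k) \<mu>)" and \<mu>: "\<And>b. \<mu> b \<in> carrier M" "\<And>b. b \<in> Y \<Longrightarrow> \<mu> b = \<zero>\<^bsub>M\<^esub>"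
    by (rule lin_valuesE[OF s]) (rule that)
  have "t \<oplus>\<^bsub>product_module {..<n} (\<lambda>_. M)\<^esub> s = (\<lambda>k\<in>{..<n}. lin M (e k) (\<lambda>b. \<kappa> b \<oplus>\<^bsub>M\<^esub> \<mu> b))"
    by (auto simp: product_module_def t s lin_add[OF e[rule_format] \<kappa>(1) \<mu>(1)] intro!: restrict_ext)
  moreover have "\<dots> \<in> lin_values M e n Y" by (rule lin_valuesI) (use \<kappa> \<mu> in auto)
  ultimately show ?thesis by simp
qed

lemma lin_values_a_inv:
  assumes e: "\<forall>k<n. set (e k) \<subseteq> carrier R \<times> UNIV" and t: "t \<in> lin_values M e n Y"
  shows "\<ominus>\<^bsub>product_module {..<n} (\<lambda>_. M)\<^esub> t \<in> lin_values M e n Y"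
proof -
  have M: "left_module R M" by (rule left_module_axioms)
  let ?P = "product_module {..<n} (\<lambda>_. M)"
  interpret P: left_module R ?P by (rule product_left_module[OF ring_axioms M])
  have tc: "t \<in> carrier ?P" by (rule lin_values_carrier[OF e t])
  obtain \<kappa> where tk: "t = (\<lambda>k\<in>{..<n}. lin M (e k) \<kappa>)" and \<kappa>: "\<And>b. \<kappa> b \<in> carrier M" "\<And>b. b \<in> Y \<Longrightarrow> \<kappa> b = \<zero>\<^bsub>M\<^esub>"
    by (rule lin_valuesE[OF t]) (rule that)
  have "\<ominus>\<^bsub>M\<^esub> \<zero>\<^bsub>M\<^esub> = \<zero>\<^bsub>M\<^esub>" by (rule M.minus_equality) auto
  then have v: "(\<lambda>k\<in>{..<n}. lin M (e k) (\<lambda>b. \<ominus>\<^bsub>M\<^esub> \<kappa> b)) \<in> lin_values M e n Y"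
    by (intro lin_valuesI) (use \<kappa> in auto)
  have "(\<lambda>k\<in>{..<n}. lin M (e k) (\<lambda>b. \<ominus>\<^bsub>M\<^esub> \<kappa> b)) = \<ominus>\<^bsub>?P\<^esub> t"
  proof (rule product_ext[OF lin_values_carrier[OF e v]])
    fix k assume k: "k \<in> {..<n}"
    then show "(\<lambda>k\<in>{..<n}. lin M (e k) (\<lambda>b. \<ominus>\<^bsub>M\<^esub> \<kappa> b)) k = (\<ominus>\<^bsub>?P\<^esub> t) k"
      using lin_a_inv[OF e[rule_format] \<kappa>(1), of k] product_a_inv[OF ring_axioms M tc k] by (simp add: tk)
  qed (use tc in simp_all)
  then show ?thesis using v by simp
qed

lemma lin_values_minus:
  assumes e: "\<forall>k<n. set (e k) \<subseteq> carrier R \<times> UNIV" and "t \<in> lin_values M e n Y" "s \<in> lin_values M e n Y"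
  shows "t \<ominus>\<^bsub>product_module {..<n} (\<lambda>_. M)\<^esub> s \<in> lin_values M e n Y"
  unfolding a_minus_def by (intro lin_values_add lin_values_a_inv assms)

lemma lin_values_subgroup:
  assumes e: "\<forall>k<n. set (e k) \<subseteq> carrier R \<times> UNIV"
  shows "subgroup (lin_values M e n Y) (add_monoid (product_module {..<n} (\<lambda>_. M)))"
proof -
  interpret P: left_module R "product_module {..<n} (\<lambda>_. M)" by (rule product_left_module[OF ring_axioms left_module_axioms])
  show ?thesis
  proof (rule group.subgroupI[OF P.M.a_group])
    show "lin_values M e n Y \<subseteq> carrier (add_monoid (product_module {..<n} (\<lambda>_. M)))"
      using lin_values_carrier[OF e] by auto
    show "lin_values M e n Y \<noteq> {}" using lin_values_zero[OF e] by auto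
  next
    fix t assume "t \<in> lin_values M e n Y"
    from lin_values_a_inv[OF e this]
    show "inv\<^bsub>add_monoid (product_module {..<n} (\<lambda>_. M))\<^esub> t \<in> lin_values M e n Y" by (simp add: a_inv_def)
  next
    fix t s assume "t \<in> lin_values M e n Y" "s \<in> lin_values M e n Y"
    from lin_values_add[OF e this]
    show "t \<otimes>\<^bsub>add_monoid (product_module {..<n} (\<lambda>_. M))\<^esub> s \<in> lin_values M e n Y" by simp
  qed
qed

text \<open>Evaluating the list over R at the w-th unit vector gives the total coefficient of w,
  which may occur several times in the list.\<close>

lemma lin_single:
  assumes \<rho>: "set \<rho> \<subseteq> carrier R \<times> UNIV" and y: "y \<in> carrier M"
  shows "lin M \<rho> (\<lambda>b. if b = w then y else \<zero>\<^bsub>M\<^esub>)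
    = lin (regular_module R) \<rho> (\<lambda>b. if b = w then \<one>\<^bsub>R\<^esub> else \<zero>\<^bsub>R\<^esub>) \<odot>\<^bsub>M\<^esub> y"
proof -
  have reg: "left_module R (regular_module R)" by (rule regular_left_module[OF ring_axioms])
  let ?d = "\<lambda>b. if b = w then \<one>\<^bsub>R\<^esub> else \<zero>\<^bsub>R\<^esub>"
  have d: "?d b \<in> carrier (regular_module R)" for b by simp
  have "orbit_map y (lin (regular_module R) \<rho> ?d) = lin M \<rho> (\<lambda>b. orbit_map y (?d b))"
    by (rule lin_hom[OF reg left_module_axioms orbit_map_hom[OF y] \<rho> d])
  moreover have "(\<lambda>b. orbit_map y (?d b)) = (\<lambda>b. if b = w then y else \<zero>\<^bsub>M\<^esub>)"
    using y by (simp add: orbit_map_def fun_eq_iff lsmult_one)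
  moreover have "lin (regular_module R) \<rho> ?d \<in> carrier R"
    using left_module.lin_closed[OF reg \<rho> d] by simp
  ultimately show ?thesis by (simp add: orbit_map_def)
qed

end

text \<open>Moving the coefficients to the left factor turns the sum into one over the unknowns w,
  in which d w is paired with the combination of the u_k given by column w. These combinations
  vanish by \<open>col\<close>. The induction adds one unknown of the support at a time.\<close>

lemma tensor_system:
  fixes X :: "('r, 'm) module" and B :: "('r, 'n) module"
  assumes X: "right_module R X" and B: "left_module R B"
    and e: "\<forall>k<q. set (e k) \<subseteq> carrier R \<times> UNIV" and u: "\<And>k. k < q \<Longrightarrow> u k \<in> carrier X"
    and col: "\<And>w. w \<in> W \<Longrightarrow>
      nsum X q (\<lambda>k. lin (regular_module R) (e k) (\<lambda>b. if b = w then \<one>\<^bsub>R\<^esub> else \<zero>\<^bsub>R\<^esub>) \<odot>\<^bsub>X\<^esub> u k) = \<zero>\<^bsub>X\<^esub>"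
    and D: "finite D" "D \<subseteq> W" and d: "\<And>b. d b \<in> carrier B" "\<And>b. b \<notin> D \<Longrightarrow> d b = \<zero>\<^bsub>B\<^esub>"
  shows "(\<Sum>k<q. frag_of (u k, lin B (e k) d)) \<in> tensor_relations R X B"
  using D d
proof (induction D arbitrary: d)
  case empty
  interpret B: left_module R B by (rule B)
  have "d = (\<lambda>_. \<zero>\<^bsub>B\<^esub>)" using empty by auto
  then show ?case
    using B.lin_zero[OF e[rule_format]] by (intro tensor_sum[OF X B]) (simp add: tensor_zero_right[OF X B] u)
next
  case (insert w D)
  interpret B: left_module R B by (rule B)
  interpret X: left_module "opp R" X by (rule X)
  have reg: "left_module R (regular_module R)" by (rule regular_left_module[OF B.ring_axioms])
  let ?T = "tensor_relations R X B"
  define d1 where "d1 b = (if b = w then \<zero>\<^bsub>B\<^esub> else d b)" for b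
  define d2 where "d2 b = (if b = w then d w else \<zero>\<^bsub>B\<^esub>)" for b
  define t where "t k = lin (regular_module R) (e k) (\<lambda>b. if b = w then \<one>\<^bsub>R\<^esub> else \<zero>\<^bsub>R\<^esub>)" for k
  have dc: "d b \<in> carrier B" for b by (rule insert.prems(2))
  have d1c: "d1 b \<in> carrier B" and d2c: "d2 b \<in> carrier B" for b using dc by (simp_all add: d1_def d2_def)
  have tc: "t k \<in> carrier R" if "k < q" for k
    using left_module.lin_closed[OF reg e[rule_format, OF that]] by (simp add: t_def)
  have s1: "(\<Sum>k<q. frag_of (u k, lin B (e k) d1)) \<in> ?T"
    by (rule insert.IH) (use insert.prems d1c in \<open>auto simp: d1_def\<close>)
  have "(\<Sum>k<q. frag_of (t k \<odot>\<^bsub>X\<^esub> u k, d w)) \<in> ?T"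
  proof -
    have c: "t k \<odot>\<^bsub>X\<^esub> u k \<in> carrier X" if "k < q" for k using X.lsmult_closed[of "t k" "u k"] tc u that by simp
    have n0: "nsum X q (\<lambda>k. t k \<odot>\<^bsub>X\<^esub> u k) = \<zero>\<^bsub>X\<^esub>" using col[of w] insert.prems(1) by (simp add: t_def)
    have "frag_of (\<zero>\<^bsub>X\<^esub>, d w) \<in> ?T"
      using tensor_nsum_left[OF X B dc, of 0 "\<lambda>_. \<zero>\<^bsub>X\<^esub>"] by simp
    moreover have "frag_of (\<zero>\<^bsub>X\<^esub>, d w) - (\<Sum>k<q. frag_of (t k \<odot>\<^bsub>X\<^esub> u k, d w)) \<in> ?T"
      unfolding n0[symmetric] by (rule tensor_nsum_left[OF X B dc c])
    ultimately show ?thesis using tensor_diff_cancel[OF X B] by blast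
  qed
  moreover have "(\<Sum>k<q. frag_of (t k \<odot>\<^bsub>X\<^esub> u k, d w) - frag_of (u k, t k \<odot>\<^bsub>B\<^esub> d w)) \<in> ?T"
    by (intro tensor_sum[OF X B] tensor_balanced[OF X B] u dc tc) auto
  ultimately have "(\<Sum>k<q. frag_of (u k, t k \<odot>\<^bsub>B\<^esub> d w)) \<in> ?T"
    using tensor_diff_cancel[OF X B] unfolding sum_subtractf by blast
  moreover have "lin B (e k) d2 = t k \<odot>\<^bsub>B\<^esub> d w" if "k < q" for k
    unfolding d2_def t_def by (rule B.lin_single[OF e[rule_format, OF that] dc])
  ultimately have s2: "(\<Sum>k<q. frag_of (u k, lin B (e k) d2)) \<in> ?T" by simp
  have "(\<Sum>k<q. frag_of (u k, lin B (e k) d) - frag_of (u k, lin B (e k) d1) - frag_of (u k, lin B (e k) d2)) \<in> ?T"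
  proof (rule tensor_sum[OF X B])
    fix k assume "k \<in> {..<q}"
    then have k: "k < q" by simp
    have "d = (\<lambda>b. d1 b \<oplus>\<^bsub>B\<^esub> d2 b)" using dc by (auto simp: d1_def d2_def)
    then have "lin B (e k) d = lin B (e k) d1 \<oplus>\<^bsub>B\<^esub> lin B (e k) d2"
      using B.lin_add[OF e[rule_format, OF k] d1c d2c] by simp
    then show "frag_of (u k, lin B (e k) d) - frag_of (u k, lin B (e k) d1) - frag_of (u k, lin B (e k) d2) \<in> ?T"
      using tensor_right[OF X B u[OF k] B.lin_closed[OF e[rule_format, OF k] d1c] B.lin_closed[OF e[rule_format, OF k] d2c]] by simp
  qed
  then have "(\<Sum>k<q. frag_of (u k, lin B (e k) d)) - (\<Sum>k<q. frag_of (u k, lin B (e k) d1))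
      - (\<Sum>k<q. frag_of (u k, lin B (e k) d2)) \<in> ?T"
    unfolding sum_subtractf .
  from tensor_add[OF X B tensor_add[OF X B this s2] s1] show ?case by simp
qed

text \<open>The canonical isomorphism of R^q \<otimes> A with A^q on elementary tensors.\<close>

definition act :: "('r, 'm) module \<Rightarrow> nat \<Rightarrow> (nat \<Rightarrow> 'r) \<Rightarrow> 'm \<Rightarrow> nat \<Rightarrow> 'm" where
  "act A q t a = (\<lambda>k\<in>{..<q}. t k \<odot>\<^bsub>A\<^esub> a)"

text \<open>X \<otimes> A is A^q modulo the image of Ker p \<otimes> A, and this image lies in
  \<open>lin_values A e q Y\<close>. So the map from X \<otimes> A to A^q modulo that subgroup is
  well defined, and it sends the given tensor to the class of v.\<close>

lemma tensor_vanishing: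
  fixes X :: "('r, 'm) module" and A :: "('r, 'n) module" and e :: "nat \<Rightarrow> ('r \<times> 'b) list"
  assumes X: "right_module R X" and A: "left_module R A"
    and e: "\<forall>k<q. set (e k) \<subseteq> carrier R \<times> UNIV"
    and p: "p \<in> mod_hom (opp R) (free_module (opp R) q) X" "p ` carrier (free_module (opp R) q) = carrier X"
    and K: "\<And>x y. \<lbrakk>x \<in> carrier (free_module (opp R) q); y \<in> carrier (free_module (opp R) q); p x = p y\<rbrakk> \<Longrightarrow>
      x \<ominus>\<^bsub>free_module (opp R) q\<^esub> y \<in> lin_values (regular_module R) e q Y"
    and v: "\<And>k. k < q \<Longrightarrow> v k \<in> carrier A"
    and rel: "(\<Sum>k<q. frag_of (p (ins (regular_module (opp R)) q k \<one>\<^bsub>R\<^esub>), v k)) \<in> tensor_relations R X A"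
  shows "(\<lambda>k\<in>{..<q}. v k) \<in> lin_values A e q Y"
proof -
  interpret X: left_module "opp R" X by (rule X)
  interpret A: left_module R A by (rule A)
  let ?F = "free_module (opp R) q" and ?P = "product_module {..<q} (\<lambda>_. A)" and ?D = "lin_values A e q Y"
  let ?G = "add_monoid ?P"
  have reg: "left_module R (regular_module R)" "left_module (opp R) (regular_module (opp R))"
    by (rule regular_left_module[OF A.ring_axioms], rule regular_left_module[OF X.ring_axioms])
  have Fm: "left_module (opp R) ?F" by (rule free_left_module[OF X.ring_axioms])
  interpret F: left_module "opp R" ?F by (rule Fm)
  have Pm: "left_module R ?P" by (rule product_left_module[OF A.ring_axioms A])
  interpret P: left_module R ?P by (rule Pm)
  have Fc: "t k \<in> carrier R" if "t \<in> carrier ?F" "k < q" for t k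
    using product_in_carrier[OF that(1), of k] that(2) by simp
  have ac: "act A q t a \<in> carrier ?P" if "t \<in> carrier ?F" "a \<in> carrier A" for t a
    using that Fc by (simp add: act_def product_carrier A.lsmult_closed)
  have act_add: "act A q (t \<oplus>\<^bsub>?F\<^esub> s) a = act A q t a \<oplus>\<^bsub>?P\<^esub> act A q s a"
    if "t \<in> carrier ?F" "s \<in> carrier ?F" "a \<in> carrier A" for t s a
    using that Fc by (auto simp: act_def product_module_def A.lsmult_l_distr intro!: restrict_ext)
  have act_right: "act A q t (a \<oplus>\<^bsub>A\<^esub> b) = act A q t a \<oplus>\<^bsub>?P\<^esub> act A q t b"
    if "t \<in> carrier ?F" "a \<in> carrier A" "b \<in> carrier A" for t a b
    using that Fc by (auto simp: act_def product_module_def A.lsmult_r_distr intro!: restrict_ext)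
  have act_smult: "act A q (r \<odot>\<^bsub>?F\<^esub> t) a = act A q t (r \<odot>\<^bsub>A\<^esub> a)"
    if "t \<in> carrier ?F" "r \<in> carrier R" "a \<in> carrier A" for t r a
    using that Fc by (auto simp: act_def product_module_def A.lsmult_assoc intro!: restrict_ext)
  have act_diff: "act A q t a \<ominus>\<^bsub>?P\<^esub> act A q s a \<in> ?D"
    if t: "t \<in> carrier ?F" and s: "s \<in> carrier ?F" and eq: "p t = p s" and a: "a \<in> carrier A" for t s a
  proof -
    let ?m = "t \<ominus>\<^bsub>?F\<^esub> s"
    have m: "?m \<in> carrier ?F" using t s by simp
    have "(\<lambda>k\<in>{..<q}. A.orbit_map a (?m k)) \<in> ?D"
      by (rule lin_values_hom[OF reg(1) A A.orbit_map_hom[OF a] e K[OF t s eq]])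
    moreover have "(\<lambda>k\<in>{..<q}. A.orbit_map a (?m k)) = act A q ?m a"
      unfolding act_def by (rule restrict_ext) (simp add: A.orbit_map_def Fc[OF m])
    moreover have "act A q t a \<ominus>\<^bsub>?P\<^esub> act A q s a = act A q ?m a"
    proof -
      have "act A q t a = act A q ?m a \<oplus>\<^bsub>?P\<^esub> act A q s a"
        using act_add[OF m s a] F.add_minus_cancel(3)[OF t s] by simp
      then show ?thesis using P.add_minus_cancel(1)[OF ac[OF m a] ac[OF s a]] by simp
    qed
    ultimately show ?thesis by simp
  qed
  have zD: "\<zero>\<^bsub>?P\<^esub> \<in> ?D" by (rule A.lin_values_zero[OF e])
  \<comment> \<open>A section of p, in general not linear. Its defects act into \<open>?D\<close> by
    \<open>act_diff\<close>, and \<open>tensor_universal\<close> only asks for the relations modulo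
    \<open>?D\<close>.\<close>
  define \<sigma> where "\<sigma> x = (SOME t. t \<in> carrier ?F \<and> p t = x)" for x
  have \<sigma>: "\<sigma> x \<in> carrier ?F" "p (\<sigma> x) = x" if "x \<in> carrier X" for x
  proof -
    have "x \<in> p ` carrier ?F" unfolding p(2) by (rule that)
    then have "\<exists>t. t \<in> carrier ?F \<and> p t = x" by auto
    then have "\<sigma> x \<in> carrier ?F \<and> p (\<sigma> x) = x" unfolding \<sigma>_def by (rule someI_ex)
    then show "\<sigma> x \<in> carrier ?F" "p (\<sigma> x) = x" by simp_all
  qed
  obtain h where h: "h \<in> hom (free_Abelian_group (carrier X \<times> carrier A)) ?G"
    "\<And>x y. \<lbrakk>x \<in> carrier X; y \<in> carrier A\<rbrakk> \<Longrightarrow> h (frag_of (x, y)) = act A q (\<sigma> x) y"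
    "\<And>z. z \<in> tensor_relations R X A \<Longrightarrow> h z \<in> ?D"
  proof (rule tensor_universal[OF X A P.M.a_comm_group _ A.lin_values_subgroup[OF e], of "\<lambda>x y. act A q (\<sigma> x) y"])
    fix x x' y assume x: "x \<in> carrier X" "x' \<in> carrier X" and y: "y \<in> carrier A"
    note s = \<sigma>(1)[OF x(1)] \<sigma>(1)[OF x(2)] and xx = X.M.a_closed[OF x]
    have "act A q (\<sigma> (x \<oplus>\<^bsub>X\<^esub> x')) y \<ominus>\<^bsub>?P\<^esub> act A q (\<sigma> x \<oplus>\<^bsub>?F\<^esub> \<sigma> x') y \<in> ?D"
      by (rule act_diff[OF \<sigma>(1)[OF xx] F.M.a_closed[OF s] _ y]) (simp add: \<sigma>(2) x xx hom_add[OF p(1)] s)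
    moreover have "act A q (\<sigma> (x \<oplus>\<^bsub>X\<^esub> x')) y \<ominus>\<^bsub>?P\<^esub> act A q (\<sigma> x \<oplus>\<^bsub>?F\<^esub> \<sigma> x') y
        = act A q (\<sigma> (x \<oplus>\<^bsub>X\<^esub> x')) y \<oplus>\<^bsub>?P\<^esub> \<ominus>\<^bsub>?P\<^esub> act A q (\<sigma> x) y \<oplus>\<^bsub>?P\<^esub> \<ominus>\<^bsub>?P\<^esub> act A q (\<sigma> x') y"
      unfolding act_add[OF s y] a_minus_def
      using ac[OF s(1) y] ac[OF s(2) y] ac[OF \<sigma>(1)[OF xx] y] by (simp add: P.M.minus_add P.M.a_assoc)
    ultimately show "act A q (\<sigma> (x \<oplus>\<^bsub>X\<^esub> x')) y \<otimes>\<^bsub>?G\<^esub> inv\<^bsub>?G\<^esub> act A q (\<sigma> x) y \<otimes>\<^bsub>?G\<^esub> inv\<^bsub>?G\<^esub> act A q (\<sigma> x') y \<in> ?D"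
      by (simp add: a_inv_def[symmetric])
  next
    fix x y y' assume x: "x \<in> carrier X" and y: "y \<in> carrier A" "y' \<in> carrier A"
    then show "act A q (\<sigma> x) (y \<oplus>\<^bsub>A\<^esub> y') \<otimes>\<^bsub>?G\<^esub> inv\<^bsub>?G\<^esub> act A q (\<sigma> x) y \<otimes>\<^bsub>?G\<^esub> inv\<^bsub>?G\<^esub> act A q (\<sigma> x) y' \<in> ?D"
      using zD by (simp add: a_inv_def[symmetric] act_right \<sigma>(1) P.add_minus_both ac)
  next
    fix r x y assume r: "r \<in> carrier R" and x: "x \<in> carrier X" and y: "y \<in> carrier A"
    have rx: "r \<odot>\<^bsub>X\<^esub> x \<in> carrier X" and rs: "r \<odot>\<^bsub>?F\<^esub> \<sigma> x \<in> carrier ?F"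
      using X.lsmult_closed[of r x] F.lsmult_closed[of r "\<sigma> x"] r x \<sigma>(1) by simp_all
    have "act A q (\<sigma> (r \<odot>\<^bsub>X\<^esub> x)) y \<ominus>\<^bsub>?P\<^esub> act A q (r \<odot>\<^bsub>?F\<^esub> \<sigma> x) y \<in> ?D"
      by (rule act_diff[OF \<sigma>(1)[OF rx] rs _ y]) (use r x rx \<sigma> in \<open>simp add: hom_smult[OF p(1)]\<close>)
    then show "act A q (\<sigma> (r \<odot>\<^bsub>X\<^esub> x)) y \<otimes>\<^bsub>?G\<^esub> inv\<^bsub>?G\<^esub> act A q (\<sigma> x) (r \<odot>\<^bsub>A\<^esub> y) \<in> ?D"
      using act_smult[OF \<sigma>(1)[OF x] r y] by (simp add: a_inv_def[symmetric] a_minus_def)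
  qed (auto simp: ac \<sigma>(1))
  let ?e = "\<lambda>k. ins (regular_module (opp R)) q k \<one>\<^bsub>R\<^esub>"
  have ec: "?e k \<in> carrier ?F" for k by (rule ins_carrier[OF reg(2)]) simp
  have pc: "p (?e k) \<in> carrier X" for k by (rule hom_closed[OF p(1) ec])
  have ae: "act A q (?e k) y = ins A q k y" if "y \<in> carrier A" for k y
    unfolding act_def ins_def by (rule restrict_ext) (simp add: that A.lsmult_one)
  let ?z = "\<lambda>m. \<Sum>k<m. frag_of (p (?e k), v k)"
  \<comment> \<open>Modulo \<open>?D\<close>, the image of the partial sum consists of the first m
    entries of v.\<close>
  have "h (?z m) \<ominus>\<^bsub>?P\<^esub> nsum ?P m (\<lambda>k. ins A q k (v k)) \<in> ?D \<and> h (?z m) \<in> carrier ?P" if "m \<le> q" for m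
    using that
  proof (induction m)
    case 0
    have "h 0 = \<zero>\<^bsub>?P\<^esub>"
      using hom_one[OF h(1) group_free_Abelian_group P.M.a_group] by simp
    then show ?case using zD by simp
  next
    case (Suc m)
    let ?y = "ins A q m (v m)" and ?n = "nsum ?P m (\<lambda>k. ins A q k (v k))" and ?s = "act A q (\<sigma> (p (?e m))) (v m)"
    have vm: "v k \<in> carrier A" if "k \<le> m" for k using Suc.prems v that by simp
    have yc: "ins A q k (v k) \<in> carrier ?P" if "k \<le> m" for k by (rule ins_carrier[OF A vm[OF that]])
    have nc: "?n \<in> carrier ?P" by (rule P.nsum_closed) (simp add: yc)
    have sc: "?s \<in> carrier ?P" by (rule ac[OF \<sigma>(1)[OF pc] vm]) simp
    have keys: "Poly_Mapping.keys (?z m) \<subseteq> carrier X \<times> carrier A"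
      using keys_sum[of "\<lambda>k. frag_of (p (?e k), v k)" "{..<m}"] pc vm by fastforce
    have hz: "h (?z (Suc m)) = h (?z m) \<oplus>\<^bsub>?P\<^esub> ?s"
      using hom_mult[OF h(1), of "?z m" "frag_of (p (?e m), v m)"] keys pc[of m] vm h(2)[OF pc vm, of m m] by simp
    have IH: "h (?z m) \<ominus>\<^bsub>?P\<^esub> ?n \<in> ?D" "h (?z m) \<in> carrier ?P" using Suc by simp_all
    have "?s \<ominus>\<^bsub>?P\<^esub> act A q (?e m) (v m) \<in> ?D"
      by (rule act_diff[OF \<sigma>(1)[OF pc] ec \<sigma>(2)[OF pc] vm]) simp
    then have "?s \<ominus>\<^bsub>?P\<^esub> ?y \<in> ?D" using ae[OF vm] by simp
    from A.lin_values_add[OF e IH(1) this]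
    have "(h (?z m) \<ominus>\<^bsub>?P\<^esub> ?n) \<oplus>\<^bsub>?P\<^esub> (?s \<ominus>\<^bsub>?P\<^esub> ?y) \<in> ?D" by simp
    moreover have "(h (?z m) \<ominus>\<^bsub>?P\<^esub> ?n) \<oplus>\<^bsub>?P\<^esub> (?s \<ominus>\<^bsub>?P\<^esub> ?y) = (h (?z m) \<oplus>\<^bsub>?P\<^esub> ?s) \<ominus>\<^bsub>?P\<^esub> (?n \<oplus>\<^bsub>?P\<^esub> ?y)"
      unfolding a_minus_def using IH(2) nc sc yc[of m] by (simp add: P.add_add_swap P.M.minus_add)
    ultimately show ?case using hz IH(2) sc by simp
  qed
  from this[of q] have hq: "h (?z q) \<ominus>\<^bsub>?P\<^esub> nsum ?P q (\<lambda>k. ins A q k (v k)) \<in> ?D" and hc: "h (?z q) \<in> carrier ?P"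
    by simp_all
  have vP: "(\<lambda>k\<in>{..<q}. v k) \<in> carrier ?P" using v by (simp add: product_carrier)
  have "nsum ?P q (\<lambda>k. ins A q k (v k)) = (\<lambda>k\<in>{..<q}. v k)"
    using product_decomposition[OF A vP] nsum_cong[of q "\<lambda>k. ins A q k (v k)" "\<lambda>k. ins A q k ((\<lambda>k\<in>{..<q}. v k) k)" ?P] by simp
  then have "h (?z q) \<ominus>\<^bsub>?P\<^esub> (\<lambda>k\<in>{..<q}. v k) \<in> ?D" using hq by simp
  from A.lin_values_minus[OF e h(3)[OF rel] this]
  have "h (?z q) \<ominus>\<^bsub>?P\<^esub> (h (?z q) \<ominus>\<^bsub>?P\<^esub> (\<lambda>k\<in>{..<q}. v k)) \<in> ?D" by simp
  moreover have "h (?z q) \<ominus>\<^bsub>?P\<^esub> (h (?z q) \<ominus>\<^bsub>?P\<^esub> (\<lambda>k\<in>{..<q}. v k)) = (\<lambda>k\<in>{..<q}. v k)"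
    using P.add_minus_cancel(2)[of "(\<lambda>k\<in>{..<q}. v k)" "h (?z q) \<ominus>\<^bsub>?P\<^esub> (\<lambda>k\<in>{..<q}. v k)"]
      P.add_minus_cancel(1)[of "(\<lambda>k\<in>{..<q}. v k)" "h (?z q) \<ominus>\<^bsub>?P\<^esub> (\<lambda>k\<in>{..<q}. v k)"]
      P.add_minus_cancel(3)[OF hc vP] P.M.a_comm[OF vP, of "h (?z q) \<ominus>\<^bsub>?P\<^esub> (\<lambda>k\<in>{..<q}. v k)"] hc vP
    by simp
  ultimately show ?thesis by simp
qed

lemma frag_map_sum: "frag_map f (sum g I) = (\<Sum>k\<in>I. frag_map f (g k))"
  by (induction I rule: infinite_finite_induct) simp_all

text \<open>
  Let \<open>\<rho>\<^sub>1, \<dots>, \<rho>\<^sub>q\<close> be the equations. Let \<open>X\<close> be the quotient of the right module \<open>R\<^sup>q\<close> by the columns of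
  the unknowns outside of \<open>A\<close>, and let \<open>v\<^sub>k\<close> be the constant term of \<open>\<rho>\<^sub>k\<close>. Then \<open>\<Sum> e\<^sub>k \<otimes> v\<^sub>k\<close> vanishes in \<open>X \<otimes> B\<close>, hence in \<open>X \<otimes> A\<close>.
\<close>

lemma pure_solvable:
  fixes U :: "'u itself" and R :: "('r, 'd) ring_scheme" and A B :: "('r, 'u) module"
  assumes inf: "infinite (UNIV :: 'u set)" and le: "carrier R \<lesssim> (UNIV :: 'u set)"
    and A: "left_module R A" and B: "left_module R B" and pure: "pure_mono U R A B i"
    and E: "finite E" "\<And>\<rho>. \<rho> \<in> E \<Longrightarrow> set \<rho> \<subseteq> carrier R \<times> carrier B" "\<And>\<rho>. \<rho> \<in> E \<Longrightarrow> lin B \<rho> (\<lambda>b. b) = \<zero>\<^bsub>B\<^esub>"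
  shows "\<exists>h. (\<forall>b. h b \<in> carrier A) \<and> (\<forall>a\<in>carrier A. h (i a) = a) \<and> (\<forall>\<rho>\<in>E. lin A \<rho> h = \<zero>\<^bsub>A\<^esub>)"
proof -
  interpret A: left_module R A by (rule A)
  interpret B: left_module R B by (rule B)
  have i: "i \<in> mod_hom R A B" and inj: "inj_on i (carrier A)" using pure by (auto simp: pure_mono_def)
  have opp: "ring (opp R)" by (rule ring_opp[OF A.ring_axioms])
  obtain es where es: "set es = E" using finite_list[OF E(1)] by blast
  define q where "q = length es"
  define e where "e k = es ! k" for k
  have eE: "e k \<in> E" if "k < q" for k using that es by (auto simp: q_def e_def)
  have eB: "set (e k) \<subseteq> carrier R \<times> carrier B" if "k < q" for k by (rule E(2)[OF eE[OF that]])
  have eU: "\<forall>k<q. set (e k) \<subseteq> carrier R \<times> UNIV" using eB by blast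
  define Y where "Y = i ` carrier A"
  \<comment> \<open>A first assignment: the prescribed values on the image of i, and zero elsewhere.
    Its errors v k in the equations remain to be corrected.\<close>
  define h0 where "h0 b = (if b \<in> Y then inv_into (carrier A) i b else \<zero>\<^bsub>A\<^esub>)" for b
  have h0c: "h0 b \<in> carrier A" for b by (auto simp: h0_def Y_def inv_into_into)
  have h0i: "h0 (i a) = a" if "a \<in> carrier A" for a using that inj by (simp add: h0_def Y_def)
  have ih0: "i (h0 b) = b" if "b \<in> Y" for b using that by (simp add: h0_def Y_def f_inv_into_f)
  define v where "v k = lin A (e k) h0" for k
  have vc: "v k \<in> carrier A" if "k < q" for k unfolding v_def by (rule A.lin_closed[OF eB[OF that] h0c])
  let ?F = "free_module (opp R) q" and ?K = "lin_values (regular_module R) e q Y"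
  have reg: "left_module R (regular_module R)" "left_module (opp R) (regular_module (opp R))"
    by (rule regular_left_module[OF A.ring_axioms], rule regular_left_module[OF opp])
  interpret reg: left_module R "regular_module R" by (rule reg(1))
  have Fm: "left_module (opp R) ?F" by (rule free_left_module[OF opp])
  interpret F: left_module "opp R" ?F by (rule Fm)
  have sub: "submodule ?K (opp R) ?F"
  proof (rule F.submoduleI)
    show "?K \<subseteq> carrier ?F" using reg.lin_values_carrier[OF eU] by (auto simp: product_carrier)
    show "\<zero>\<^bsub>?F\<^esub> \<in> ?K" using reg.lin_values_zero[OF eU] by (simp add: product_module_def)
  next
    fix s t assume "s \<in> ?K" "t \<in> ?K"
    from reg.lin_values_add[OF eU this] show "s \<oplus>\<^bsub>?F\<^esub> t \<in> ?K" by (simp add: product_module_def)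
  next
    fix r t assume r: "r \<in> carrier (opp R)" and t: "t \<in> ?K"
    \<comment> \<open>Right multiplication by r is left linear, which is why the columns span a
      right submodule.\<close>
    have f: "(\<lambda>x\<in>carrier R. x \<otimes>\<^bsub>R\<^esub> r) \<in> mod_hom R (regular_module R) (regular_module R)"
      using r by (intro mod_homI) (auto simp: A.l_distr A.m_assoc)
    have tc: "t k \<in> carrier R" if "k < q" for k
      using product_in_carrier[OF reg.lin_values_carrier[OF eU t], of k] that by simp
    have "r \<odot>\<^bsub>?F\<^esub> t = (\<lambda>k\<in>{..<q}. (\<lambda>x\<in>carrier R. x \<otimes>\<^bsub>R\<^esub> r) (t k))"
      using tc by (auto simp: product_module_def intro!: restrict_ext)
    then show "r \<odot>\<^bsub>?F\<^esub> t \<in> ?K" using lin_values_hom[OF reg(1) reg(1) f eU t] by simp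
  qed
  have Fle: "carrier ?F \<lesssim> (UNIV :: 'u set)"
    using lepoll_finite_power[OF le inf, of q] by (simp add: product_carrier)
  obtain X :: "('r, 'u) module" and p where X: "left_module (opp R) X" and p: "p \<in> mod_hom (opp R) ?F X"
    "p ` carrier ?F = carrier X" and K: "\<And>x y. \<lbrakk>x \<in> carrier ?F; y \<in> carrier ?F\<rbrakk> \<Longrightarrow> p x = p y \<longleftrightarrow> x \<ominus>\<^bsub>?F\<^esub> y \<in> ?K"
    by (rule quotient_in_universe[OF Fm sub Fle]) (rule that)
  let ?u = "\<lambda>k. p (ins (regular_module (opp R)) q k \<one>\<^bsub>R\<^esub>)"
  have uc: "?u k \<in> carrier X" for k by (rule hom_closed[OF p(1)], rule ins_carrier[OF reg(2)]) simp
  have pK: "p t = \<zero>\<^bsub>X\<^esub>" if t: "t \<in> ?K" for t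
  proof -
    have tF: "t \<in> carrier ?F" using submodule_in_carrier[OF sub t] .
    have "t \<ominus>\<^bsub>?F\<^esub> \<zero>\<^bsub>?F\<^esub> = t" using F.add_minus_cancel(1)[OF tF F.M.zero_closed] tF by simp
    then have "p t = p \<zero>\<^bsub>?F\<^esub>" using K[OF tF F.M.zero_closed] t by simp
    then show ?thesis using hom_zero[OF Fm X p(1)] by simp
  qed
  define W where "W = (\<Union>k\<in>{..<q}. snd ` set (e k))"
  have WB: "W \<subseteq> carrier B"
  proof
    fix b assume "b \<in> W"
    then obtain k x where "k < q" "x \<in> set (e k)" "b = snd x" by (auto simp: W_def)
    then show "b \<in> carrier B" using eB[of k] by auto
  qed
  \<comment> \<open>On W one has i (h0 b) = b + d b, and the identity solves the equations, so i
    maps v k to the value of the k-th equation at d. The restriction to W gives d finite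
    support.\<close>
  define d where "d b = (if b \<in> W - Y then \<ominus>\<^bsub>B\<^esub> b else \<zero>\<^bsub>B\<^esub>)" for b
  have dc: "d b \<in> carrier B" for b using WB by (auto simp: d_def)
  have iv: "i (v k) = lin B (e k) d" if k: "k < q" for k
  proof -
    have eW: "set (e k) \<subseteq> carrier R \<times> W" using eB[OF k] k by (force simp: W_def)
    have "i (v k) = lin B (e k) (\<lambda>b. i (h0 b))" unfolding v_def by (rule lin_hom[OF A B i eB[OF k] h0c])
    also have "\<dots> = lin B (e k) (\<lambda>b. b \<oplus>\<^bsub>B\<^esub> d b)"
    proof (rule lin_cong[OF eW])
      fix b assume b: "b \<in> W"
      show "i (h0 b) = b \<oplus>\<^bsub>B\<^esub> d b"
      proof (cases "b \<in> Y")
        case True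
        then show ?thesis using ih0 WB b by (auto simp: d_def)
      next
        case False
        then have "i (h0 b) = \<zero>\<^bsub>B\<^esub>" using hom_zero[OF A B i] by (simp add: h0_def)
        moreover have "b \<oplus>\<^bsub>B\<^esub> d b = \<zero>\<^bsub>B\<^esub>" using False b B.M.r_neg[of b] WB by (auto simp: d_def)
        ultimately show ?thesis by simp
      qed
    qed
    also have "\<dots> = lin B (e k) (\<lambda>b. b) \<oplus>\<^bsub>B\<^esub> lin B (e k) d"
      by (rule B.lin_add[OF eB[OF k] _ dc])
    also have "\<dots> = lin B (e k) d" using E(3)[OF eE[OF k]] B.lin_closed[OF eB[OF k] dc] by simp
    finally show ?thesis .
  qed
  have "(\<Sum>k<q. frag_of (?u k, lin B (e k) d)) \<in> tensor_relations R X B"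
  proof (rule tensor_system[OF X B eU uc, where W = "- Y" and D = "W - Y"])
    show "finite (W - Y)" by (simp add: W_def)
    show "d b = \<zero>\<^bsub>B\<^esub>" if "b \<notin> W - Y" for b unfolding d_def using that by (rule if_not_P)
    fix w assume w: "w \<in> - Y"
    let ?d = "\<lambda>b. if b = w then \<one>\<^bsub>R\<^esub> else \<zero>\<^bsub>R\<^esub>"
    let ?t = "\<lambda>k\<in>{..<q}. lin (regular_module R) (e k) ?d"
    have t: "?t \<in> ?K" by (rule lin_valuesI) (use w in auto)
    have "p ?t = nsum X q (\<lambda>k. ?t k \<odot>\<^bsub>X\<^esub> p (ins (regular_module (opp R)) q k \<one>\<^bsub>opp R\<^esub>))"
      by (rule hom_free_expand[OF opp X p(1) submodule_in_carrier[OF sub t]])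
    also have "\<dots> = nsum X q (\<lambda>k. lin (regular_module R) (e k) ?d \<odot>\<^bsub>X\<^esub> ?u k)"
      by (rule nsum_cong) simp
    finally show "nsum X q (\<lambda>k. lin (regular_module R) (e k) ?d \<odot>\<^bsub>X\<^esub> ?u k) = \<zero>\<^bsub>X\<^esub>" using pK[OF t] by simp
  qed (auto simp: dc)
  then have rB: "frag_map i (\<Sum>k<q. frag_of (?u k, v k)) \<in> tensor_relations R X B"
    using iv by (simp add: frag_map_sum)
  have "Poly_Mapping.keys (\<Sum>k<q. frag_of (?u k, v k)) \<subseteq> carrier X \<times> carrier A"
    using keys_sum[of "\<lambda>k. frag_of (?u k, v k)" "{..<q}"] uc vc by fastforce
  moreover have "inj_on (tensor_map R X B i) (carrier (tensor_product R X A))"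
    using pure X by (simp add: pure_mono_def)
  ultimately have rA: "(\<Sum>k<q. frag_of (?u k, v k)) \<in> tensor_relations R X A"
    using inj_on_tensor_map_iff[OF X A B i] rB by blast
  have "(\<lambda>k\<in>{..<q}. v k) \<in> lin_values A e q Y"
    by (rule tensor_vanishing[OF X A eU p _ vc rA]) (use K in blast)
  then obtain \<kappa> where \<kappa>: "(\<lambda>k\<in>{..<q}. v k) = (\<lambda>k\<in>{..<q}. lin A (e k) \<kappa>)" "\<And>b. \<kappa> b \<in> carrier A"
    "\<And>b. b \<in> Y \<Longrightarrow> \<kappa> b = \<zero>\<^bsub>A\<^esub>"
    by (rule lin_valuesE) (rule that)
  \<comment> \<open>\<kappa> produces the same errors v k and vanishes on Y, so subtracting it
    corrects h0 without changing the prescribed values.\<close>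
  define h where "h b = h0 b \<oplus>\<^bsub>A\<^esub> \<ominus>\<^bsub>A\<^esub> \<kappa> b" for b
  have "\<ominus>\<^bsub>A\<^esub> \<zero>\<^bsub>A\<^esub> = \<zero>\<^bsub>A\<^esub>" by (rule A.M.minus_equality) auto
  then have "h (i a) = a" if "a \<in> carrier A" for a using that \<kappa>(3)[of "i a"] h0i by (simp add: h_def Y_def)
  moreover have "lin A \<rho> h = \<zero>\<^bsub>A\<^esub>" if \<rho>: "\<rho> \<in> E" for \<rho>
  proof -
    obtain k where k: "k < q" "\<rho> = e k" using \<rho> es unfolding q_def e_def by (metis in_set_conv_nth)
    have "lin A \<rho> h = v k \<oplus>\<^bsub>A\<^esub> lin A (e k) (\<lambda>b. \<ominus>\<^bsub>A\<^esub> \<kappa> b)"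
      unfolding h_def v_def k(2) by (rule A.lin_add[OF eB[OF k(1)] h0c]) (simp add: \<kappa>(2))
    also have "\<dots> = v k \<oplus>\<^bsub>A\<^esub> \<ominus>\<^bsub>A\<^esub> lin A (e k) \<kappa>" by (simp add: A.lin_a_inv[OF eB[OF k(1)] \<kappa>(2)])
    also have "lin A (e k) \<kappa> = v k" using fun_cong[OF \<kappa>(1), of k] k(1) by simp
    finally show ?thesis using A.M.r_neg[OF vc[OF k(1)]] by simp
  qed
  moreover have "h b \<in> carrier A" for b using h0c \<kappa>(2) by (simp add: h_def)
  ultimately show ?thesis by (intro exI[of _ h]) blast
qed

text \<open>Take one unknown for every b in B and all linear relations among the elements of B. A
  solution is a homomorphism on B, and prescribing g a at i a makes it an extension of g. Purity
  solves finite subsystems in A, g carries these solutions to the direct sum, and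
  \<open>algebraically_compact\<close> solves the whole system.\<close>

lemma endofinite_imp_sigma_pure_injective:
  fixes U :: "'u itself" and R :: "('r, 'd) ring_scheme" and C :: "('r, 'c) module"
  assumes inf: "infinite (UNIV :: 'u set)" and le: "carrier R \<lesssim> (UNIV :: 'u set)"
    and C: "left_module R C" and fin: "endofinite R C"
  shows "sigma_pure_injective U R C"
  unfolding sigma_pure_injective_def pure_injective_def
proof (intro allI ballI impI, elim conjE)
  fix I :: "'u set" and A B :: "('r, 'u) module" and i g
  let ?M = "direct_sum_module I (\<lambda>_. C)"
  assume g: "g \<in> mod_hom R A ?M" and A: "left_module R A" and B: "left_module R B" and pure: "pure_mono U R A B i"
  interpret C: left_module R C by (rule C)
  interpret B: left_module R B by (rule B)
  have M: "left_module R ?M" by (rule direct_sum_left_module[OF C.ring_axioms C])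
  interpret M: left_module R ?M by (rule M)
  note direct_sum_apply [simp del]
  define \<R> where "\<R> = {\<rho>. set \<rho> \<subseteq> carrier R \<times> carrier B \<and> lin B \<rho> (\<lambda>b. b) = \<zero>\<^bsub>B\<^esub>}"
  have i: "i \<in> mod_hom R A B" using pure by (simp add: pure_mono_def)
  have "\<exists>h\<in>carrier B \<rightarrow> carrier ?M. (\<forall>\<rho>\<in>\<R>. lin ?M \<rho> h = \<zero>\<^bsub>?M\<^esub>) \<and> (\<forall>(b, y)\<in>(\<lambda>a. (i a, g a)) ` carrier A. h b = y)"
  proof (rule algebraically_compact[OF C endofinite_chain_conditions(2)[OF C fin]])
    show "set \<rho> \<subseteq> carrier R \<times> carrier B" if "\<rho> \<in> \<R>" for \<rho> using that by (simp add: \<R>_def)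
    fix E assume E: "finite E" "E \<subseteq> \<R>"
    have EB: "set \<rho> \<subseteq> carrier R \<times> carrier B" "lin B \<rho> (\<lambda>b. b) = \<zero>\<^bsub>B\<^esub>" if "\<rho> \<in> E" for \<rho>
      using that E(2) by (auto simp: \<R>_def)
    obtain h where h: "\<forall>b. h b \<in> carrier A" "\<forall>a\<in>carrier A. h (i a) = a" "\<forall>\<rho>\<in>E. lin A \<rho> h = \<zero>\<^bsub>A\<^esub>"
      using pure_solvable[OF inf le A B pure E(1) EB] by blast
    have "lin ?M \<rho> (\<lambda>b. g (h b)) = \<zero>\<^bsub>?M\<^esub>" if \<rho>: "\<rho> \<in> E" for \<rho>
    proof -
      have "g (lin A \<rho> h) = lin ?M \<rho> (\<lambda>b. g (h b))" by (rule lin_hom[OF A M g EB(1)[OF \<rho>]]) (use h(1) in blast)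
      then show ?thesis using h(3) \<rho> hom_zero[OF A M g] by simp
    qed
    then show "\<exists>h\<in>carrier B \<rightarrow> carrier ?M. (\<forall>\<rho>\<in>E. lin ?M \<rho> h = \<zero>\<^bsub>?M\<^esub>) \<and>
        (\<forall>(b, y)\<in>(\<lambda>a. (i a, g a)) ` carrier A. h b = y)"
      using h(1,2) hom_closed[OF g] by (intro bexI[of _ "\<lambda>b. g (h b)"]) auto
  qed
  then obtain \<theta> where \<theta>c: "\<theta> \<in> carrier B \<rightarrow> carrier ?M" and \<theta>l: "\<forall>\<rho>\<in>\<R>. lin ?M \<rho> \<theta> = \<zero>\<^bsub>?M\<^esub>"
    and \<theta>p: "\<forall>(b, y)\<in>(\<lambda>a. (i a, g a)) ` carrier A. \<theta> b = y" by blast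
  have c: "\<theta> b \<in> carrier ?M" if "b \<in> carrier B" for b using \<theta>c that by blast
  have add: "\<theta> (x \<oplus>\<^bsub>B\<^esub> y) = \<theta> x \<oplus>\<^bsub>?M\<^esub> \<theta> y" if x: "x \<in> carrier B" and y: "y \<in> carrier B" for x y
  proof -
    \<comment> \<open>Additivity is itself one of the equations: the relation (x + y) - x - y = 0 in
      B.\<close>
    let ?\<rho> = "[(\<one>\<^bsub>R\<^esub>, x \<oplus>\<^bsub>B\<^esub> y), (\<ominus>\<^bsub>R\<^esub> \<one>\<^bsub>R\<^esub>, x), (\<ominus>\<^bsub>R\<^esub> \<one>\<^bsub>R\<^esub>, y)]"
    have "?\<rho> \<in> \<R>"
      using x y B.add_minus_both[OF x y] by (simp add: \<R>_def B.minus_one_smult B.lsmult_one B.M.a_assoc)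
    then have "lin ?M ?\<rho> \<theta> = \<zero>\<^bsub>?M\<^esub>" using \<theta>l by blast
    then have "\<theta> (x \<oplus>\<^bsub>B\<^esub> y) \<oplus>\<^bsub>?M\<^esub> (\<ominus>\<^bsub>?M\<^esub> \<theta> x \<oplus>\<^bsub>?M\<^esub> \<ominus>\<^bsub>?M\<^esub> \<theta> y) = \<zero>\<^bsub>?M\<^esub>"
      using c x y by (simp add: M.minus_one_smult M.lsmult_one)
    then have "\<theta> (x \<oplus>\<^bsub>B\<^esub> y) \<ominus>\<^bsub>?M\<^esub> (\<theta> x \<oplus>\<^bsub>?M\<^esub> \<theta> y) = \<zero>\<^bsub>?M\<^esub>" using c x y by (simp add: a_minus_def M.M.minus_add)
    then show ?thesis using M.minus_eq_zero_iff[of "\<theta> (x \<oplus>\<^bsub>B\<^esub> y)" "\<theta> x \<oplus>\<^bsub>?M\<^esub> \<theta> y"] c x y by simp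
  qed
  have smult: "\<theta> (r \<odot>\<^bsub>B\<^esub> x) = r \<odot>\<^bsub>?M\<^esub> \<theta> x" if r: "r \<in> carrier R" and x: "x \<in> carrier B" for r x
  proof -
    let ?\<rho> = "[(\<one>\<^bsub>R\<^esub>, r \<odot>\<^bsub>B\<^esub> x), (\<ominus>\<^bsub>R\<^esub> r, x)]"
    have rx: "r \<odot>\<^bsub>B\<^esub> x \<in> carrier B" "r \<odot>\<^bsub>?M\<^esub> \<theta> x \<in> carrier ?M"
      by (rule B.lsmult_closed[OF r x], rule M.lsmult_closed[OF r c[OF x]])
    have "?\<rho> \<in> \<R>"
      using r x rx(1) by (simp add: \<R>_def B.smult_minus_left B.lsmult_one B.M.r_neg)
    then have "lin ?M ?\<rho> \<theta> = \<zero>\<^bsub>?M\<^esub>" using \<theta>l by blast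
    then have "\<theta> (r \<odot>\<^bsub>B\<^esub> x) \<ominus>\<^bsub>?M\<^esub> r \<odot>\<^bsub>?M\<^esub> \<theta> x = \<zero>\<^bsub>?M\<^esub>"
      using c x r rx by (simp add: M.smult_minus_left M.lsmult_one a_minus_def)
    then show ?thesis using M.minus_eq_zero_iff[OF c[OF rx(1)] rx(2)] by simp
  qed
  have "(\<lambda>b\<in>carrier B. \<theta> b) \<in> mod_hom R B ?M"
    by (rule mod_homI) (auto simp: c add smult B.lsmult_closed)
  moreover have "(\<lambda>b\<in>carrier B. \<theta> b) (i a) = g a" if "a \<in> carrier A" for a
    using that \<theta>p hom_closed[OF i that] by auto
  ultimately show "\<exists>h\<in>mod_hom R B ?M. \<forall>a\<in>carrier A. h (i a) = g a"
    by (intro bexI[of _ "\<lambda>b\<in>carrier B. \<theta> b"]) auto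
qed

theorem proposition8p15:
  fixes R :: "'r ring" and C :: "('r, 'c) module" and V :: "('c \<Rightarrow> 'c, 'v) module"
    and U :: "'u itself"
  assumes "large_universe U R C"
    and "ring R"
    and "left_module R C"
    and "finitely_presented R C"
    and "right_module (right_End R C) V"
    and "injective_module U (opp (right_End R C)) V"
    and "cogenerator U (opp (right_End R C)) V"
  defines "Cplus \<equiv> local_dual R C V"
  shows "(endofinite R C \<longleftrightarrow>
            sigma_pure_injective U R C \<and> mittag_leffler U R C Cplus) \<and>
         (endofinite R C \<longleftrightarrow>
            sigma_pure_injective U R C \<and>
            (\<forall>N. cyclic_submodule (End_ring (opp R) Cplus) (End_module Cplus) N \<longrightarrow>
                 finite_matrix_subgroup U R Cplus N))"
proof -
  have opp: "opp (right_End R C) = End_ring R C" by (simp add: right_End_def)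
  interpret dual_setup U R C V
    using assms(1,3-7) unfolding opp by (rule dual_setup.intro)
  have spi: "sigma_pure_injective U R C" if "endofinite R C"
    by (rule endofinite_imp_sigma_pure_injective[OF universe_infinite R_le C_module that])
  have ml: "mittag_leffler U R C Cplus" if "endofinite R C"
    unfolding Cplus_def by (rule endofinite_imp_mittag_leffler[OF C_module Cp_module that])
  have fms: "finite_matrix_subgroup U R Cplus N"
    if "endofinite R C" "cyclic_submodule (End_ring (opp R) Cplus) (End_module Cplus) N" for N
    using endofinite_imp_fms that unfolding Cplus_def .
  have "endofinite R C" if "sigma_pure_injective U R C" "mittag_leffler U R C Cplus"
    by (rule stable_kernels_imp_endofinite[OF that(1)])
      (rule mittag_leffler_imp_stable[OF that(2)[unfolded Cplus_def]])
  moreover have "endofinite R C" if "sigma_pure_injective U R C"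
    and "\<forall>N. cyclic_submodule (End_ring (opp R) Cplus) (End_module Cplus) N \<longrightarrow> finite_matrix_subgroup U R Cplus N"
    by (rule stable_kernels_imp_endofinite[OF that(1)])
      (rule fms_imp_stable[OF that(2)[unfolded Cplus_def, rule_format]])
  ultimately show ?thesis using spi ml fms by blast
qed

end
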